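(* Let $X$ be a manifold of $K3^{[n]}$-type for $2\le n\le5$, and let $i\in\operatorname{Aut}(X)$ be a non-symplectic involution, with invariant lattice $T\subset H^2(X,\mathbb{Z})$ and anti-invariant lattice $S=T^\perp$. If $T$ has rank two and $i^*$ acts as $-\mathrm{id}$ on $A_{H^2(X,\mathbb{Z})}$, then one of the following holds: (1) $T\cong U$ and $S\cong U^{\oplus2}\oplus E_8^{\oplus2}\oplus\langle-2(n-1)\rangle$; (2) $T\cong U(2)$ and $S\cong U\oplus U(2)\oplus E_8^{\oplus2}\oplus\langle-2(n-1)\rangle$; (3) $T\cong\langle2\rangle\oplus\langle-2\rangle$ and $S\cong U\oplus E_8^{\oplus2}\oplus\langle2\rangle\oplus\langle-2\rangle\oplus\langle-2(n-1)\rangle$; (4) $n\in\{3,5\}$, $T\cong U(2)$ and $S\cong U^{\oplus2}\oplus E_8^{\oplus2}\oplus\langle-2(n-1)\rangle$; (5) $n\in\{2,4\}$, $T\cong\langle2\rangle\oplus\langle-2\rangle$ and $S\cong U^{\oplus2}\oplus E_8^{\oplus2}\oplus\langle-2(n-1)\rangle$; (6) $n=5$, $T\cong\langle2\rangle\oplus\langle-2\rangle$ and $S\cong U\oplus E_8^{\oplus2}\oplus\begin{pmatrix}-2&1&0\\1&-2&1\\0&1&2\end{pmatrix}$.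
   Context: $U$ is the hyperbolic plane, $E_8$ the even unimodular negative definite lattice of rank $8$, $\langle t\rangle$ the rank one lattice generated by an element of square $t$, and $U(2)$ is $U$ with form multiplied by $2$; a symmetric matrix denotes the lattice with that Gram matrix. $A_N=N^\vee/N$ is the discriminant group of a lattice $N$. An IHS manifold is a simply connected compact Kähler manifold $X$ with $H^{2,0}(X)$ spanned by an everywhere non-degenerate holomorphic $2$-form; it is of $K3^{[n]}$-type if deformation equivalent to the Hilbert scheme of $n$ points on a $K3$ surface. $H^2(X,\mathbb{Z})$ is a lattice for the Beauville–Bogomolov–Fujiki form, isometric to $U^{\oplus3}\oplus E_8^{\oplus2}\oplus\langle-2(n-1)\rangle$. An involution $i$ is non-symplectic if $i^*=-1$ on $H^{2,0}(X)$. The invariant lattice is $T=\{x\mid i^*x=x\}$; the anti-invariant lattice is $S=T^\perp=\ker(\mathrm{id}+i^* )$ in $H^2(X,\mathbb{Z})$. *)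

theory Defs
  imports
    "HOL-Analysis.Analysis"
    "HOL-Homology.Homology"
    "Jordan_Normal_Form.Matrix"
begin

section \<open>Lattices\<close>

text \<open>The group of a lattice is written multiplicatively, as everywhere in HOL-Algebra.\<close>

record 'a int_lattice = "'a monoid" +
  form :: "'a \<Rightarrow> 'a \<Rightarrow> int"

definition int_vec_group :: "nat \<Rightarrow> int Matrix.vec monoid" where
  "int_vec_group r = \<lparr>carrier = carrier_vec r, monoid.mult = (+), one = 0\<^sub>v r\<rparr>"

definition gram_lattice :: "int Matrix.mat \<Rightarrow> int Matrix.vec int_lattice" where
  "gram_lattice M = \<lparr>carrier = carrier_vec (dim_row M), monoid.mult = (+), one = 0\<^sub>v (dim_row M),
     form = (\<lambda>x y. scalar_prod x (mult_mat_vec M y))\<rparr>"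

definition isometric :: "'a int_lattice \<Rightarrow> 'b int_lattice \<Rightarrow> bool" where
  "isometric L M \<longleftrightarrow> (\<exists>\<phi>\<in>iso L M. \<forall>x\<in>carrier L. \<forall>y\<in>carrier L. form M (\<phi> x) (\<phi> y) = form L x y)"

definition has_rank :: "'a int_lattice \<Rightarrow> nat \<Rightarrow> bool" where
  "has_rank L r \<longleftrightarrow> L \<cong> int_vec_group r"

definition invariant_lattice :: "'a int_lattice \<Rightarrow> ('a \<Rightarrow> 'a) \<Rightarrow> 'a int_lattice" where
  "invariant_lattice L g = L\<lparr>carrier := {x \<in> carrier L. g x = x}\<rparr>"

definition orthogonal_lattice :: "'a int_lattice \<Rightarrow> 'a int_lattice \<Rightarrow> 'a int_lattice" where
  "orthogonal_lattice L T = L\<lparr>carrier := {x \<in> carrier L. \<forall>y\<in>carrier T. form L x y = 0}\<rparr>"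

definition dual_group :: "'a int_lattice \<Rightarrow> ('a \<Rightarrow> int) monoid" where
  "dual_group L = \<lparr>carrier = hom L integer_group \<inter> extensional (carrier L),
     monoid.mult = (\<lambda>f g. \<lambda>x\<in>carrier L. f x + g x), one = (\<lambda>x\<in>carrier L. 0)\<rparr>"

definition dual_embedding :: "'a int_lattice \<Rightarrow> 'a \<Rightarrow> 'a \<Rightarrow> int" where
  "dual_embedding L x = (\<lambda>y\<in>carrier L. form L x y)"

definition discriminant_group :: "'a int_lattice \<Rightarrow> ('a \<Rightarrow> int) set monoid" where
  "discriminant_group L = dual_group L Mod (dual_embedding L ` carrier L)"

text \<open>An isometry \<open>g\<close> acts on the dual by \<open>f \<mapsto> f \<circ> g\<inverse>\<close>, which extends \<open>g\<close> along
  \<^const>\<open>dual_embedding\<close>.\<close>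

definition discriminant_action :: "'a int_lattice \<Rightarrow> ('a \<Rightarrow> 'a) \<Rightarrow> ('a \<Rightarrow> int) set \<Rightarrow> ('a \<Rightarrow> int) set"
  where
  "discriminant_action L g C = (\<lambda>f. \<lambda>x\<in>carrier L. f (inv_into (carrier L) g x)) ` C"

definition acts_as_minus_id_on_discriminant :: "'a int_lattice \<Rightarrow> ('a \<Rightarrow> 'a) \<Rightarrow> bool" where
  "acts_as_minus_id_on_discriminant L g \<longleftrightarrow>
     (\<forall>C\<in>carrier (discriminant_group L). discriminant_action L g C = inv\<^bsub>discriminant_group L\<^esub> C)"

definition U_gram :: "int Matrix.mat" where
  "U_gram = mat_of_rows_list 2 [[0, 1], [1, 0]]"

definition U2_gram :: "int Matrix.mat" where
  "U2_gram = mat_of_rows_list 2 [[0, 2], [2, 0]]"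

definition rank1_gram :: "int \<Rightarrow> int Matrix.mat" where
  "rank1_gram t = mat_of_rows_list 1 [[t]]"

text \<open>The negative of the Cartan matrix, nodes in Bourbaki's order.\<close>

definition E8_gram :: "int Matrix.mat" where
  "E8_gram = mat_of_rows_list 8
    [[-2,  0,  1,  0,  0,  0,  0,  0],
     [ 0, -2,  0,  1,  0,  0,  0,  0],
     [ 1,  0, -2,  1,  0,  0,  0,  0],
     [ 0,  1,  1, -2,  1,  0,  0,  0],
     [ 0,  0,  0,  1, -2,  1,  0,  0],
     [ 0,  0,  0,  0,  1, -2,  1,  0],
     [ 0,  0,  0,  0,  0,  1, -2,  1],
     [ 0,  0,  0,  0,  0,  0,  1, -2]]"

definition K3n_lattice :: "nat \<Rightarrow> int Matrix.vec int_lattice" where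
  "K3n_lattice n = gram_lattice (diag_block_mat
     [U_gram, U_gram, U_gram, E8_gram, E8_gram, rank1_gram (- 2 * (int n - 1))])"


section \<open>Complex manifolds\<close>

definition holo_fun :: "(complex^'m) set \<Rightarrow> (complex^'m \<Rightarrow> complex) \<Rightarrow> bool" where
  "holo_fun V f \<longleftrightarrow> (\<forall>z\<in>V. \<exists>f'. (f has_derivative f') (at z) \<and> (\<forall>c v. f' (c *s v) = c * f' v))"

definition holo_map :: "(complex^'m) set \<Rightarrow> (complex^'m \<Rightarrow> complex^'k) \<Rightarrow> bool" where
  "holo_map V f \<longleftrightarrow> (\<forall>k. holo_fun V (\<lambda>z. vec_nth (f z) k))"

primrec Ck_on :: "nat \<Rightarrow> 'e::real_normed_vector set \<Rightarrow> ('e \<Rightarrow> 'f::real_normed_vector) \<Rightarrow> bool" where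
  "Ck_on 0 V f \<longleftrightarrow> continuous_on V f"
| "Ck_on (Suc k) V f \<longleftrightarrow>
     (\<exists>f'. (\<forall>x\<in>V. (f has_derivative f' x) (at x)) \<and> (\<forall>v. Ck_on k V (\<lambda>x. f' x v)))"

definition smooth_on :: "'e::real_normed_vector set \<Rightarrow> ('e \<Rightarrow> 'f::real_normed_vector) \<Rightarrow> bool" where
  "smooth_on V f \<longleftrightarrow> (\<forall>k. Ck_on k V f)"

type_synonym ('a, 'm) chart = "'a set \<times> ('a \<Rightarrow> complex^'m)"

record ('a, 'm) cmanifold =
  mtop :: "'a topology"
  atlas :: "('a, 'm::finite) chart set"

definition points :: "('a, 'm::finite) cmanifold \<Rightarrow> 'a set" where
  "points X = topspace (mtop X)"

definition complex_manifold :: "('a, 'm::finite) cmanifold \<Rightarrow> bool" where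
  "complex_manifold X \<longleftrightarrow>
     Hausdorff_space (mtop X) \<and> second_countable (mtop X) \<and>
     (\<Union>(D, \<phi>)\<in>atlas X. D) = points X \<and>
     (\<forall>(D, \<phi>)\<in>atlas X. openin (mtop X) D \<and> open (\<phi> ` D) \<and>
        homeomorphic_map (subtopology (mtop X) D) (top_of_set (\<phi> ` D)) \<phi>) \<and>
     (\<forall>(D, \<phi>)\<in>atlas X. \<forall>(E, \<psi>)\<in>atlas X. holo_map (\<phi> ` (D \<inter> E)) (\<psi> \<circ> inv_into D \<phi>))"

definition holo_fun_on :: "('a, 'm::finite) cmanifold \<Rightarrow> 'a set \<Rightarrow> ('a \<Rightarrow> complex) \<Rightarrow> bool" where
  "holo_fun_on X W f \<longleftrightarrow> (\<forall>(D, \<phi>)\<in>atlas X. holo_fun (\<phi> ` (D \<inter> W)) (f \<circ> inv_into D \<phi>))"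

definition holo_between ::
  "('a, 'm::finite) cmanifold \<Rightarrow> ('b, 'k::finite) cmanifold \<Rightarrow> ('a \<Rightarrow> 'b) \<Rightarrow> bool" where
  "holo_between X Y f \<longleftrightarrow> continuous_map (mtop X) (mtop Y) f \<and>
     (\<forall>(D, \<phi>)\<in>atlas X. \<forall>(E, \<psi>)\<in>atlas Y.
        holo_map (\<phi> ` {x \<in> D. f x \<in> E}) (\<psi> \<circ> f \<circ> inv_into D \<phi>))"

definition biholomorphic_map ::
  "('a, 'm::finite) cmanifold \<Rightarrow> ('b, 'k::finite) cmanifold \<Rightarrow> ('a \<Rightarrow> 'b) \<Rightarrow> bool" where
  "biholomorphic_map X Y f \<longleftrightarrow> bij_betw f (points X) (points Y) \<and> holo_between X Y f \<and>
     holo_between Y X (inv_into (points X) f)"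

definition automorphism :: "('a, 'm::finite) cmanifold \<Rightarrow> ('a \<Rightarrow> 'a) \<Rightarrow> bool" where
  "automorphism X f \<longleftrightarrow> biholomorphic_map X X f"

definition simply_connected_space :: "'a topology \<Rightarrow> bool" where
  "simply_connected_space X \<longleftrightarrow> topspace X \<noteq> {} \<and> path_connected_space X \<and>
     (\<forall>g. continuous_map (top_of_set (sphere (0::complex) 1)) X g \<longrightarrow>
        (\<exists>a. homotopic_with (\<lambda>_. True) (top_of_set (sphere (0::complex) 1)) X g (\<lambda>_. a)))"


section \<open>Differential forms of degree two\<close>

text \<open>A tensor is given by its components in all charts: \<open>\<eta> (D, \<phi>) z v w\<close>, where only \<open>z \<in> \<phi> ` D\<close>
  matters. Invariance under change of charts is invariance under pullback by the identity.\<close>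

type_synonym ('a, 'm, 'v) tensor2 =
  "('a, 'm) chart \<Rightarrow> complex^'m \<Rightarrow> complex^'m \<Rightarrow> complex^'m \<Rightarrow> 'v"

definition is_pullback ::
  "('a, 'm::finite) cmanifold \<Rightarrow> ('a \<Rightarrow> 'a) \<Rightarrow> ('a, 'm, 'v) tensor2 \<Rightarrow> ('a, 'm, 'v) tensor2 \<Rightarrow> bool"
  where
  "is_pullback X f \<eta> \<theta> \<longleftrightarrow>
     (\<forall>(D, \<phi>)\<in>atlas X. \<forall>(E, \<psi>)\<in>atlas X. \<forall>x\<in>D. f x \<in> E \<longrightarrow>
        (let F = \<psi> \<circ> f \<circ> inv_into D \<phi>; F' = frechet_derivative F (at (\<phi> x)) in
         \<forall>v w. \<theta> (D, \<phi>) (\<phi> x) v w = \<eta> (E, \<psi>) (\<psi> (f x)) (F' v) (F' w)))"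

definition smooth_2form ::
  "('a, 'm::finite) cmanifold \<Rightarrow> ('a, 'm, 'v::real_normed_vector) tensor2 \<Rightarrow> bool" where
  "smooth_2form X \<eta> \<longleftrightarrow>
     (\<forall>(D, \<phi>)\<in>atlas X.
        (\<forall>z\<in>\<phi> ` D. bilinear (\<eta> (D, \<phi>) z) \<and> (\<forall>v. \<eta> (D, \<phi>) z v v = 0)) \<and>
        (\<forall>v w. smooth_on (\<phi> ` D) (\<lambda>z. \<eta> (D, \<phi>) z v w))) \<and>
     is_pullback X (\<lambda>x. x) \<eta> \<eta>"

definition closed_2form ::
  "('a, 'm::finite) cmanifold \<Rightarrow> ('a, 'm, 'v::real_normed_vector) tensor2 \<Rightarrow> bool" where
  "closed_2form X \<eta> \<longleftrightarrow>
     (\<forall>(D, \<phi>)\<in>atlas X. \<forall>z\<in>\<phi> ` D. \<forall>u v w.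
        frechet_derivative (\<lambda>z. \<eta> (D, \<phi>) z v w) (at z) u +
        frechet_derivative (\<lambda>z. \<eta> (D, \<phi>) z w u) (at z) v +
        frechet_derivative (\<lambda>z. \<eta> (D, \<phi>) z u v) (at z) w = 0)"

definition kaehler_form :: "('a, 'm::finite) cmanifold \<Rightarrow> ('a, 'm, real) tensor2 \<Rightarrow> bool" where
  "kaehler_form X \<omega> \<longleftrightarrow> smooth_2form X \<omega> \<and> closed_2form X \<omega> \<and>
     (\<forall>(D, \<phi>)\<in>atlas X. \<forall>z\<in>\<phi> ` D.
        (\<forall>v w. \<omega> (D, \<phi>) z (\<i> *s v) (\<i> *s w) = \<omega> (D, \<phi>) z v w) \<and>
        (\<forall>v. v \<noteq> 0 \<longrightarrow> 0 < \<omega> (D, \<phi>) z v (\<i> *s v)))"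

text \<open>The sections of \<open>\<Omega>\<^sup>2\<close>; on a compact Kaehler manifold they are \<open>H\<^sup>2\<^sup>,\<^sup>0(X)\<close>.\<close>

definition holomorphic_2form :: "('a, 'm::finite) cmanifold \<Rightarrow> ('a, 'm, complex) tensor2 \<Rightarrow> bool" where
  "holomorphic_2form X \<sigma> \<longleftrightarrow>
     (\<forall>(D, \<phi>)\<in>atlas X.
        (\<forall>z\<in>\<phi> ` D. bilinear (\<sigma> (D, \<phi>) z) \<and> (\<forall>v. \<sigma> (D, \<phi>) z v v = 0) \<and>
           (\<forall>v w. \<sigma> (D, \<phi>) z (\<i> *s v) w = \<i> * \<sigma> (D, \<phi>) z v w)) \<and>
        (\<forall>v w. holo_fun (\<phi> ` D) (\<lambda>z. \<sigma> (D, \<phi>) z v w))) \<and>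
     is_pullback X (\<lambda>x. x) \<sigma> \<sigma>"

definition nondegenerate_2form :: "('a, 'm::finite) cmanifold \<Rightarrow> ('a, 'm, complex) tensor2 \<Rightarrow> bool" where
  "nondegenerate_2form X \<sigma> \<longleftrightarrow>
     (\<forall>(D, \<phi>)\<in>atlas X. \<forall>z\<in>\<phi> ` D. \<forall>v. v \<noteq> 0 \<longrightarrow> (\<exists>w. \<sigma> (D, \<phi>) z v w \<noteq> 0))"

definition nonzero_2form :: "('a, 'm::finite) cmanifold \<Rightarrow> ('a, 'm, complex) tensor2 \<Rightarrow> bool" where
  "nonzero_2form X \<sigma> \<longleftrightarrow> (\<exists>(D, \<phi>)\<in>atlas X. \<exists>z\<in>\<phi> ` D. \<exists>v w. \<sigma> (D, \<phi>) z v w \<noteq> 0)"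

definition IHS_manifold :: "('a, 'm::finite) cmanifold \<Rightarrow> bool" where
  "IHS_manifold X \<longleftrightarrow> complex_manifold X \<and> compact_space (mtop X) \<and>
     simply_connected_space (mtop X) \<and> (\<exists>\<omega>. kaehler_form X \<omega>) \<and>
     (\<exists>\<sigma>. holomorphic_2form X \<sigma> \<and> nondegenerate_2form X \<sigma> \<and>
        (\<forall>\<tau>. holomorphic_2form X \<tau> \<longrightarrow>
           (\<exists>k. \<forall>(D, \<phi>)\<in>atlas X. \<forall>z\<in>\<phi> ` D. \<forall>v w. \<tau> (D, \<phi>) z v w = k * \<sigma> (D, \<phi>) z v w)))"

definition non_symplectic :: "('a, 'm::finite) cmanifold \<Rightarrow> ('a \<Rightarrow> 'a) \<Rightarrow> bool" where
  "non_symplectic X f \<longleftrightarrow>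
     (\<forall>\<sigma>. holomorphic_2form X \<sigma> \<longrightarrow> is_pullback X f \<sigma> (\<lambda>c z v w. - \<sigma> c z v w))"

definition non_symplectic_involution :: "('a, 'm::finite) cmanifold \<Rightarrow> ('a \<Rightarrow> 'a) \<Rightarrow> bool" where
  "non_symplectic_involution X f \<longleftrightarrow>
     automorphism X f \<and> (\<forall>x\<in>points X. f (f x) = x) \<and> (\<exists>x\<in>points X. f x \<noteq> x) \<and> non_symplectic X f"


section \<open>Deformations\<close>

text \<open>The base is a disc; the equivalence relation generated by such families is that of deformation
  over arbitrary connected complex spaces, since any two points of these are joined by a chain of
  holomorphic discs. A total space has cardinality at most that of the continuum, as has a nonempty
  complex manifold of positive dimension; so nothing is lost by taking it on the same type of points.\<close>

definition smooth_proper_family :: "('a, 'k::finite) cmanifold \<Rightarrow> ('a \<Rightarrow> complex) \<Rightarrow> bool" where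
  "smooth_proper_family Y \<pi> \<longleftrightarrow> complex_manifold Y \<and> \<pi> \<in> points Y \<rightarrow> ball 0 1 \<and>
     holo_fun_on Y (points Y) \<pi> \<and>
     (\<forall>(D, \<phi>)\<in>atlas Y. \<forall>z\<in>\<phi> ` D. \<exists>v. frechet_derivative (\<pi> \<circ> inv_into D \<phi>) (at z) v \<noteq> 0) \<and>
     (\<forall>K. compact K \<and> K \<subseteq> ball 0 1 \<longrightarrow> compactin (mtop Y) {y \<in> points Y. \<pi> y \<in> K})"

definition fibre_of ::
  "('a, 'k::finite) cmanifold \<Rightarrow> ('a \<Rightarrow> complex) \<Rightarrow> complex \<Rightarrow> ('a, 'm::finite) cmanifold \<Rightarrow> bool" where
  "fibre_of Y \<pi> t X \<longleftrightarrow> (\<exists>j. holo_between X Y j \<and> inj_on j (points X) \<and>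
     j ` points X = {y \<in> points Y. \<pi> y = t} \<and>
     (\<forall>(D, \<phi>)\<in>atlas X. \<forall>(E, \<psi>)\<in>atlas Y. \<forall>x\<in>D. j x \<in> E \<longrightarrow>
        inj (frechet_derivative (\<psi> \<circ> j \<circ> inv_into D \<phi>) (at (\<phi> x)))))"

text \<open>If \<open>'m\<close> has \<open>d\<close> elements, then \<open>'m option\<close> has \<open>d + 1\<close>, the dimension of the total space.\<close>

definition in_common_family :: "('a, 'm::finite) cmanifold \<Rightarrow> ('a, 'm) cmanifold \<Rightarrow> bool" where
  "in_common_family X X' \<longleftrightarrow> complex_manifold X \<and> complex_manifold X' \<and>
     (\<exists>(Y :: ('a, 'm option) cmanifold) \<pi>. smooth_proper_family Y \<pi> \<and>
        (\<exists>t\<in>ball 0 1. fibre_of Y \<pi> t X) \<and> (\<exists>t\<in>ball 0 1. fibre_of Y \<pi> t X'))"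

definition deformation_equivalent :: "('a, 'm::finite) cmanifold \<Rightarrow> ('a, 'm) cmanifold \<Rightarrow> bool" where
  "deformation_equivalent = rtranclp in_common_family"


section \<open>Hilbert schemes of points\<close>

definition holo_near :: "('a, 'm::finite) cmanifold \<Rightarrow> 'a set \<Rightarrow> ('a \<Rightarrow> complex) \<Rightarrow> bool" where
  "holo_near S A f \<longleftrightarrow> (\<exists>W. openin (mtop S) W \<and> A \<subseteq> W \<and> holo_fun_on S W f)"

text \<open>An ideal of every local ring \<open>\<O>\<^sub>S\<^sub>,\<^sub>p\<close>. Germs are represented by functions; that functions
  vanishing near \<open>p\<close> belong to \<open>I p\<close> makes membership depend on the germ only.\<close>

definition stalk_ideals :: "('a, 'm::finite) cmanifold \<Rightarrow> ('a \<Rightarrow> ('a \<Rightarrow> complex) set) \<Rightarrow> bool" where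
  "stalk_ideals S I \<longleftrightarrow> (\<forall>p. p \<notin> points S \<longrightarrow> I p = {}) \<and>
     (\<forall>p\<in>points S.
        (\<forall>f\<in>I p. holo_near S {p} f) \<and>
        (\<forall>f W. openin (mtop S) W \<and> p \<in> W \<and> (\<forall>x\<in>W. f x = 0) \<longrightarrow> f \<in> I p) \<and>
        (\<forall>f\<in>I p. \<forall>g\<in>I p. (\<lambda>x. f x + g x) \<in> I p) \<and>
        (\<forall>f\<in>I p. \<forall>h. holo_near S {p} h \<longrightarrow> (\<lambda>x. h x * f x) \<in> I p))"

definition ideal_support :: "('a, 'm::finite) cmanifold \<Rightarrow> ('a \<Rightarrow> ('a \<Rightarrow> complex) set) \<Rightarrow> 'a set" where
  "ideal_support S I = {p \<in> points S. (\<lambda>_. 1) \<notin> I p}"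

definition congruent_mod ::
  "('a, 'm::finite) cmanifold \<Rightarrow> ('a \<Rightarrow> ('a \<Rightarrow> complex) set) \<Rightarrow> ('a \<Rightarrow> complex) \<Rightarrow> ('a \<Rightarrow> complex) \<Rightarrow> bool"
  where
  "congruent_mod S I f g \<longleftrightarrow> (\<forall>p\<in>ideal_support S I. (\<lambda>x. f x - g x) \<in> I p)"

definition quotient_basis ::
  "('a, 'm::finite) cmanifold \<Rightarrow> nat \<Rightarrow> ('a \<Rightarrow> ('a \<Rightarrow> complex) set) \<Rightarrow> (nat \<Rightarrow> 'a \<Rightarrow> complex) \<Rightarrow> bool"
  where
  "quotient_basis S n I g \<longleftrightarrow> (\<forall>j<n. holo_near S (ideal_support S I) (g j)) \<and>
     (\<forall>h. holo_near S (ideal_support S I) h \<longrightarrow>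
        (\<exists>!c. (\<forall>j\<ge>n. c j = 0) \<and> congruent_mod S I h (\<lambda>x. \<Sum>j<n. c j * g j x)))"

text \<open>The closed analytic subspaces of length \<open>n\<close>. A system of stalk ideals with finite support is
  automatically a sheaf of ideals, coherent if the stalks have finite colength.\<close>

definition length_subschemes ::
  "('a, 'm::finite) cmanifold \<Rightarrow> nat \<Rightarrow> ('a \<Rightarrow> ('a \<Rightarrow> complex) set) set" where
  "length_subschemes S n =
     {I. stalk_ideals S I \<and> finite (ideal_support S I) \<and> (\<exists>g. quotient_basis S n I g)}"

text \<open>Flat families of length \<open>n\<close> subspaces over an open set \<open>V\<close>: the pushforward to \<open>V\<close> of the
  structure sheaf is locally free with a basis \<open>g\<close>, with respect to which functions on \<open>S\<close> have
  holomorphic coefficients.\<close>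

definition flat_family ::
  "('a, 'm::finite) cmanifold \<Rightarrow> nat \<Rightarrow> (complex^'k) set \<Rightarrow>
     (complex^'k \<Rightarrow> 'a \<Rightarrow> ('a \<Rightarrow> complex) set) \<Rightarrow> bool" where
  "flat_family S n V I \<longleftrightarrow> (\<forall>b\<in>V. I b \<in> length_subschemes S n) \<and>
     (\<forall>b0\<in>V. \<exists>g V0. open V0 \<and> b0 \<in> V0 \<and> V0 \<subseteq> V \<and> (\<forall>b\<in>V0. quotient_basis S n (I b) g) \<and>
        (\<forall>W h. openin (mtop S) W \<and> ideal_support S (I b0) \<subseteq> W \<and> holo_fun_on S W h \<longrightarrow>
           (\<exists>V1 c. open V1 \<and> b0 \<in> V1 \<and> V1 \<subseteq> V0 \<and> (\<forall>j<n. holo_fun V1 (c j)) \<and>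
              (\<forall>b\<in>V1. ideal_support S (I b) \<subseteq> W \<and>
                 congruent_mod S (I b) h (\<lambda>x. \<Sum>j<n. c j b * g j x)))))"

definition holo_into :: "('a, 'm::finite) cmanifold \<Rightarrow> (complex^'k) set \<Rightarrow> (complex^'k \<Rightarrow> 'a) \<Rightarrow> bool" where
  "holo_into X V f \<longleftrightarrow> continuous_map (top_of_set V) (mtop X) f \<and>
     (\<forall>(D, \<phi>)\<in>atlas X. holo_map {z \<in> V. f z \<in> D} (\<phi> \<circ> f))"

text \<open>\<open>H\<close> represents the functor of flat families. Test spaces of the dimension of \<open>H\<close> suffice to
  determine the manifold \<open>H\<close> up to biholomorphism.\<close>

definition hilbert_scheme ::
  "('a, 2) cmanifold \<Rightarrow> nat \<Rightarrow> ('a, 'm::finite) cmanifold \<Rightarrow> bool" where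
  "hilbert_scheme S n H \<longleftrightarrow> complex_manifold H \<and>
     (\<exists>u. bij_betw u (points H) (length_subschemes S n) \<and>
        (\<forall>(V :: (complex^'m) set) f. open V \<and> f \<in> V \<rightarrow> points H \<longrightarrow>
           (holo_into H V f \<longleftrightarrow> flat_family S n V (u \<circ> f))))"

text \<open>K3 surfaces are the IHS manifolds of dimension two.\<close>

definition K3n_type :: "nat \<Rightarrow> ('a, 'm::finite) cmanifold \<Rightarrow> bool" where
  "K3n_type n X \<longleftrightarrow> CARD('m) = 2 * n \<and> IHS_manifold X \<and>
     (\<exists>(S :: ('a, 2) cmanifold) H. IHS_manifold S \<and> hilbert_scheme S n H \<and> deformation_equivalent X H)"


section \<open>Second integral cohomology\<close>

type_synonym ('a, 'r) cochain = "((nat \<Rightarrow> real) \<Rightarrow> 'a) \<Rightarrow> 'r"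

type_synonym 'a cohomology_class = "('a, int) cochain set"

definition cochain_eval :: "('a, 'r::ring_1) cochain \<Rightarrow> 'a chain \<Rightarrow> 'r" where
  "cochain_eval a z = (\<Sum>\<sigma>\<in>Poly_Mapping.keys z. of_int (Poly_Mapping.lookup z \<sigma>) * a \<sigma>)"

definition coboundary :: "nat \<Rightarrow> 'a topology \<Rightarrow> ('a, int) cochain \<Rightarrow> ('a, int) cochain" where
  "coboundary p X a = (\<lambda>\<sigma>. if singular_simplex (Suc p) X \<sigma>
     then cochain_eval a (chain_boundary (Suc p) (frag_of \<sigma>)) else 0)"

definition cochains :: "nat \<Rightarrow> 'a topology \<Rightarrow> ('a, int) cochain set" where
  "cochains p X = {a. \<forall>\<sigma>. \<not> singular_simplex p X \<sigma> \<longrightarrow> a \<sigma> = 0}"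

definition cocycle_group :: "nat \<Rightarrow> 'a topology \<Rightarrow> ('a, int) cochain monoid" where
  "cocycle_group p X = \<lparr>carrier = {a \<in> cochains p X. coboundary p X a = (\<lambda>_. 0)},
     monoid.mult = (\<lambda>a b \<sigma>. a \<sigma> + b \<sigma>), one = (\<lambda>_. 0)\<rparr>"

definition H2 :: "'a topology \<Rightarrow> 'a cohomology_class monoid" where
  "H2 X = cocycle_group 2 X Mod (coboundary 1 X ` cochains 1 X)"

definition coh_class :: "'a topology \<Rightarrow> ('a, int) cochain \<Rightarrow> 'a cohomology_class" where
  "coh_class X a = (coboundary 1 X ` cochains 1 X) #>\<^bsub>cocycle_group 2 X\<^esub> a"

definition cochain_pullback :: "nat \<Rightarrow> 'a topology \<Rightarrow> ('a \<Rightarrow> 'a) \<Rightarrow> ('a, int) cochain \<Rightarrow> ('a, int) cochain"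
  where
  "cochain_pullback p X f a = (\<lambda>\<sigma>. if singular_simplex p X \<sigma> then a (simplex_map p f \<sigma>) else 0)"

definition H2_pullback :: "'a topology \<Rightarrow> ('a \<Rightarrow> 'a) \<Rightarrow> 'a cohomology_class \<Rightarrow> 'a cohomology_class" where
  "H2_pullback X f A = (\<Union>a\<in>A. coh_class X (cochain_pullback 2 X f a))"

definition H2_pairing :: "'a cohomology_class \<Rightarrow> 'a chain \<Rightarrow> int" where
  "H2_pairing A z = cochain_eval (SOME a. a \<in> A) z"

text \<open>The face with vertices \<open>i, i + 1, i + 2\<close>, and the cup power \<open>a \<union> \<dots> \<union> a\<close> (\<open>k\<close> factors) of a
  cochain of degree two.\<close>

definition middle_face :: "nat \<Rightarrow> ((nat \<Rightarrow> real) \<Rightarrow> 'a) \<Rightarrow> (nat \<Rightarrow> real) \<Rightarrow> 'a" where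
  "middle_face i \<sigma> = restrict (\<lambda>x. \<sigma> (\<lambda>m. if i \<le> m then x (m - i) else 0)) (standard_simplex 2)"

definition cup_power :: "nat \<Rightarrow> ('a, int) cochain \<Rightarrow> ('a, int) cochain" where
  "cup_power k a = (\<lambda>\<sigma>. \<Prod>j<k. a (middle_face (2 * j) \<sigma>))"

text \<open>A cycle whose class generates the top homology of a closed connected orientable \<open>p\<close>-manifold.\<close>

definition fundamental_cycle :: "nat \<Rightarrow> 'a topology \<Rightarrow> 'a chain \<Rightarrow> bool" where
  "fundamental_cycle p X z \<longleftrightarrow> singular_relcycle p X {} z \<and>
     (\<forall>w. singular_relcycle p X {} w \<longrightarrow> (\<exists>k. homologous_rel p X {} w (frag_cmul k z)))"


section \<open>Classes of closed forms\<close>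

definition bary :: "real \<times> real \<Rightarrow> nat \<Rightarrow> real" where
  "bary p = (\<lambda>k. if k = 0 then 1 - fst p - snd p else if k = 1 then fst p
     else if k = 2 then snd p else 0)"

definition smooth_simplex :: "('a, 'm::finite) cmanifold \<Rightarrow> ((nat \<Rightarrow> real) \<Rightarrow> 'a) \<Rightarrow> bool" where
  "smooth_simplex X \<sigma> \<longleftrightarrow> singular_simplex 2 (mtop X) \<sigma> \<and>
     (\<exists>W g. open W \<and> {(s, t). 0 \<le> s \<and> 0 \<le> t \<and> s + t \<le> 1} \<subseteq> W \<and> g ` W \<subseteq> points X \<and>
        (\<forall>s t. 0 \<le> s \<and> 0 \<le> t \<and> s + t \<le> 1 \<longrightarrow> g (s, t) = \<sigma> (bary (s, t))) \<and>
        (\<forall>(D, \<phi>)\<in>atlas X. open {p \<in> W. g p \<in> D} \<and> smooth_on {p \<in> W. g p \<in> D} (\<phi> \<circ> g)))"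

text \<open>The integrand does not depend on the chart chosen.\<close>

definition simplex_integral ::
  "('a, 'm::finite) cmanifold \<Rightarrow> ('a, 'm, real) tensor2 \<Rightarrow> ((nat \<Rightarrow> real) \<Rightarrow> 'a) \<Rightarrow> real" where
  "simplex_integral X \<eta> \<sigma> = integral {(s, t). 0 < s \<and> 0 < t \<and> s + t < 1}
     (\<lambda>p. let c = (SOME c. c \<in> atlas X \<and> \<sigma> (bary p) \<in> fst c);
              \<gamma> = snd c \<circ> \<sigma> \<circ> bary;
              \<gamma>' = frechet_derivative \<gamma> (at p)
          in \<eta> c (\<gamma> p) (\<gamma>' (1, 0)) (\<gamma>' (0, 1)))"

text \<open>\<open>H\<^sup>2(X, \<real>) = H\<^sup>2(X, \<int>) \<otimes> \<real>\<close>: a real class is a formal real combination \<open>r\<close> of integral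
  classes. It is the class of \<open>\<eta>\<close> if it has the same periods on smooth singular cycles.\<close>

definition represents_form ::
  "('a, 'm::finite) cmanifold \<Rightarrow> ('a, 'm, real) tensor2 \<Rightarrow> ('a cohomology_class \<Rightarrow> real) \<Rightarrow> bool" where
  "represents_form X \<eta> r \<longleftrightarrow> finite {A. r A \<noteq> 0} \<and> {A. r A \<noteq> 0} \<subseteq> carrier (H2 (mtop X)) \<and>
     (\<forall>z. singular_relcycle 2 (mtop X) {} z \<and> (\<forall>\<sigma>\<in>Poly_Mapping.keys z. smooth_simplex X \<sigma>) \<longrightarrow>
        (\<Sum>A | r A \<noteq> 0. r A * of_int (H2_pairing A z)) = cochain_eval (simplex_integral X \<eta>) z)"

definition real_square ::
  "('a cohomology_class \<Rightarrow> 'a cohomology_class \<Rightarrow> int) \<Rightarrow> ('a cohomology_class \<Rightarrow> real) \<Rightarrow> real" where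
  "real_square q r = (\<Sum>A | r A \<noteq> 0. \<Sum>B | r B \<noteq> 0. r A * r B * of_int (q A B))"

definition has_positive_class ::
  "('a, 'm::finite) cmanifold \<Rightarrow> ('a cohomology_class \<Rightarrow> 'a cohomology_class \<Rightarrow> int) \<Rightarrow>
     ('a, 'm, real) tensor2 \<Rightarrow> bool" where
  "has_positive_class X q \<eta> \<longleftrightarrow> (\<exists>r. represents_form X \<eta> r) \<and>
     (\<forall>r. represents_form X \<eta> r \<longrightarrow> 0 < real_square q r)"


section \<open>The Beauville--Bogomolov--Fujiki form\<close>

text \<open>It is the primitive integral symmetric bilinear form on \<open>H\<^sup>2(X, \<int>)\<close> such that
  \<open>\<integral> \<alpha>\<^sup>2\<^sup>n = c q(\<alpha>)\<^sup>n\<close> with a constant \<open>c > 0\<close> (where \<open>dim X = 2n\<close>), normalised to be positive on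
  Kaehler classes and on \<open>\<sigma> + \<sigma>\<^sup>-\<close>, for \<open>\<sigma> \<noteq> 0\<close> in \<open>H\<^sup>2\<^sup>,\<^sup>0(X)\<close>. These conditions determine it;
  in them the fundamental cycle is forced to be the one given by the complex orientation.\<close>

definition BBF_form ::
  "('a, 'm::finite) cmanifold \<Rightarrow> ('a cohomology_class \<Rightarrow> 'a cohomology_class \<Rightarrow> int) \<Rightarrow> bool" where
  "BBF_form X q \<longleftrightarrow>
     (\<forall>A\<in>carrier (H2 (mtop X)). \<forall>B\<in>carrier (H2 (mtop X)). q A B = q B A) \<and>
     (\<forall>A\<in>carrier (H2 (mtop X)). \<forall>B\<in>carrier (H2 (mtop X)). \<forall>C\<in>carrier (H2 (mtop X)).
        q (A \<otimes>\<^bsub>H2 (mtop X)\<^esub> B) C = q A C + q B C) \<and>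
     (\<forall>d. (\<forall>A\<in>carrier (H2 (mtop X)). \<forall>B\<in>carrier (H2 (mtop X)). d dvd q A B) \<longrightarrow> \<bar>d\<bar> = 1) \<and>
     (\<exists>z c. fundamental_cycle (2 * CARD('m)) (mtop X) z \<and> (0::real) < c \<and>
        (\<forall>a\<in>carrier (cocycle_group 2 (mtop X)).
           of_int (cochain_eval (cup_power CARD('m) a) z) =
           c * of_int (q (coh_class (mtop X) a) (coh_class (mtop X) a)) ^ (CARD('m) div 2))) \<and>
     (\<forall>\<omega>. kaehler_form X \<omega> \<longrightarrow> has_positive_class X q \<omega>) \<and>
     (\<forall>\<sigma>. holomorphic_2form X \<sigma> \<and> nonzero_2form X \<sigma> \<longrightarrow>
        has_positive_class X q (\<lambda>c z v w. Re (\<sigma> c z v w)))"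

definition H2_lattice ::
  "('a, 'm::finite) cmanifold \<Rightarrow> ('a cohomology_class \<Rightarrow> 'a cohomology_class \<Rightarrow> int) \<Rightarrow>
     'a cohomology_class int_lattice" where
  "H2_lattice X q = \<lparr>carrier = carrier (H2 (mtop X)), monoid.mult = monoid.mult (H2 (mtop X)),
     one = one (H2 (mtop X)), form = q\<rparr>"

end

theory Submission
  imports Defs "HOL-Complex_Analysis.Cauchy_Integral_Formula"
begin

text \<open>Let \<open>g = i\<^sup>*\<close>. Since \<open>\<integral> \<alpha>\<^sup>2\<^sup>n = c q(\<alpha>)\<^sup>n\<close> and \<open>i\<close> maps a fundamental cycle to a multiple of itself, \<open>g\<close>
  preserves \<open>q\<close> up to a sign, and the sign is \<open>1\<close> because \<open>i\<^sup>*\<omega>\<close> is a Kaehler form if \<open>\<omega>\<close> is. The class of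
  \<open>\<omega> + i\<^sup>*\<omega>\<close> is invariant of positive square, and the real parts of the multiples of \<open>\<sigma>\<close> give a positive
  plane of anti-invariant classes. As \<open>H\<^sup>2(X, \<int>)\<close> has only three positive squares, \<open>T\<close> is indefinite.

  A functional on \<open>T\<close> extends to \<open>H\<^sup>2(X, \<int>)\<close>; as \<open>g\<close> is \<open>-1\<close> on the discriminant group, twice the
  functional is the product with an element of \<open>T\<close>. So the Gram matrix of \<open>T\<close> divides \<open>2\<close>, which
  leaves \<open>U\<close>, \<open>U(2)\<close> and \<open>\<langle>2\<rangle> \<oplus> \<langle>-2\<rangle>\<close>. In each of them there is a primitive isotropic vector \<open>e\<close>.
  Eichler's criterion brings \<open>e\<close>, and then a second basis vector, to a normal form from which \<open>S\<close> can be
  read off. The several cases come from the divisibility of \<open>e\<close> in \<open>H\<^sup>2(X, \<int>)\<close>, which is \<open>1\<close> or \<open>2\<close>, and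
  from the residue modulo 2 of the second vector.\<close>

section \<open>Even lattices on additive groups\<close>

text \<open>Fujiki's relation sees \<open>q\<close> only through an n-th power, so it yields |q(gA)|
  = |q(A)| class by class. That one sign serves all classes follows by comparing the quadratic
  polynomials t -> q(gA + t gB) and t -> q(A + tB), whose squares agree. A Gram matrix dividing 2
  has determinant dividing 4, and evenness leaves -1, -4 and 4. The value 4 belongs to definite T;
  the other two are minus squares, which is what produces the isotropic vector. An isotropic vector
  of divisibility 2 is, modulo 2, the generator of <-2m> with m = n - 1; isotropy then makes m a
  multiple of 4. For n at most 5 this leaves n = 5, the origin of the sixth case. On the analytic
  side, holomorphic maps are only known to be differentiable with complex linear derivative, while
  the pullback of a Kaehler form must again be smooth and closed. Smoothness and the symmetry of
  second derivatives are both drawn from Cauchy's formula on complex lines.\<close>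

definition zmul :: "int \<Rightarrow> 'a::ab_group_add \<Rightarrow> 'a" where
  "zmul k x = (if 0 \<le> k then ((+) x ^^ nat k) 0 else - ((+) x ^^ nat (- k)) 0)"

lemma zmul_0_left [simp]: "zmul 0 x = 0"
  by (simp add: zmul_def)

lemma zmul_Suc_left: "zmul (k + 1) x = x + zmul k x"
proof (cases "0 \<le> k")
  case True
  then show ?thesis
    by (simp add: zmul_def nat_add_distrib)
next
  case False
  define j where "j = nat (- k - 1)"
  have k: "k = - int (Suc j)" using False by (simp add: j_def)
  show ?thesis
    by (cases "j = 0") (simp_all add: k zmul_def nat_add_distrib)
qed

lemma zmul_pred_left: "zmul (k - 1) x = zmul k x - x"
  using zmul_Suc_left[of "k - 1" x] by (simp add: algebra_simps)

lemma zmul_add_left: "zmul (k + l) x = zmul k x + zmul l x"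
proof (induction k rule: int_induct[where k = 0])
  case (step1 i)
  have "i + 1 + l = i + l + 1" by simp
  then have "zmul (i + 1 + l) x = x + zmul (i + l) x"
    by (metis zmul_Suc_left)
  then show ?case
    using step1 by (simp add: zmul_Suc_left add.assoc)
next
  case (step2 i)
  have "i - 1 + l = i + l - 1" by simp
  then have "zmul (i - 1 + l) x = zmul (i + l) x - x"
    by (metis zmul_pred_left)
  then show ?case
    using step2 by (simp add: zmul_pred_left algebra_simps)
qed simp

lemma zmul_1_left [simp]: "zmul 1 x = x"
  using zmul_Suc_left[of 0 x] by simp

lemma zmul_minus_left: "zmul (- k) x = - zmul k x"
  using zmul_add_left[of k "- k" x] by (simp add: eq_neg_iff_add_eq_0 add.commute)

lemma zmul_diff_left: "zmul (k - l) x = zmul k x - zmul l x"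
  using zmul_add_left[of k "- l" x] by (simp add: zmul_minus_left)

lemma additive_zmul:
  assumes "Modules.additive f"
  shows "f (zmul k x) = zmul k (f x)"
proof (induction k rule: int_induct[where k = 0])
  case base
  then show ?case using additive.zero[OF assms] by simp
next
  case (step1 i)
  then show ?case using additive.add[OF assms] by (simp add: zmul_Suc_left)
next
  case (step2 i)
  then show ?case using additive.diff[OF assms] by (simp add: zmul_pred_left)
qed

lemma zmul_int [simp]: "zmul k (x::int) = k * x"
  by (induction k rule: int_induct[where k = 0]) (simp_all add: zmul_Suc_left zmul_pred_left algebra_simps)

lemma zmul_Pair [simp]: "zmul k (x, y) = (zmul k x, zmul k y)"
  by (induction k rule: int_induct[where k = 0])
    (simp_all add: zmul_Suc_left zmul_pred_left zero_prod_def)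

lemma zmul_0_right [simp]: "zmul k 0 = 0"
  by (induction k rule: int_induct[where k = 0]) (simp_all add: zmul_Suc_left zmul_pred_left)

lemma zmul_add_right: "zmul k (x + y) = zmul k x + zmul k y"
  by (induction k rule: int_induct[where k = 0])
    (simp_all add: zmul_Suc_left zmul_pred_left algebra_simps)

lemma zmul_minus_right: "zmul k (- x) = - zmul k x"
  using zmul_add_right[of k x "- x"] by (simp add: eq_neg_iff_add_eq_0 add.commute)

lemma zmul_zmul: "zmul k (zmul l x) = zmul (k * l) x"
  by (induction k rule: int_induct[where k = 0])
    (simp_all add: zmul_Suc_left zmul_pred_left zmul_add_left zmul_diff_left algebra_simps)

text \<open>A lattice is a whole type here, in practice an iterated product with \<open>int\<close>,
  so that computations need no carrier sets. Sublattices appear only later, as the first argument of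
  \<open>lat\<close>.\<close>

locale even_form =
  fixes b :: "'a::ab_group_add \<Rightarrow> 'a \<Rightarrow> int"
  assumes add_left: "b (x + y) z = b x z + b y z"
    and sym: "b x y = b y x"
    and even: "even (b x x)"
begin

lemma add_right: "b z (x + y) = b z x + b z y"
  using add_left sym by metis

lemma additive_left: "Modules.additive (\<lambda>x. b x z)"
  by (simp add: Modules.additive_def add_left)

lemma additive_right: "Modules.additive (b z)"
  by (simp add: Modules.additive_def add_right)

lemma zero_left [simp]: "b 0 z = 0"
  using additive.zero[OF additive_left] .

lemma zero_right [simp]: "b z 0 = 0"
  using additive.zero[OF additive_right] .

lemma minus_left: "b (- x) z = - b x z"
  using additive.minus[OF additive_left] .

lemma minus_right: "b z (- x) = - b z x"
  using additive.minus[OF additive_right] .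

lemma diff_left: "b (x - y) z = b x z - b y z"
  using additive.diff[OF additive_left] .

lemma diff_right: "b z (x - y) = b z x - b z y"
  using additive.diff[OF additive_right] .

lemma zmul_left: "b (zmul k x) z = k * b x z"
  using additive_zmul[OF additive_left] by simp

lemma zmul_right: "b z (zmul k x) = k * b z x"
  using additive_zmul[OF additive_right] by simp

lemmas bilin = add_left add_right minus_left minus_right diff_left diff_right zmul_left zmul_right

end

text \<open>So the norm modulo 4 depends only on the vector modulo 2. This is the invariant that
  separates the cases of the classification.\<close>

lemma (in even_form) norm_add_zmul_2: "b (u + zmul 2 y) (u + zmul 2 y) = b u u + 4 * (b u y + b y y)"
  using sym[of y u] by (simp add: add_left add_right zmul_left zmul_right)

section \<open>Isometries and Eichler transvections\<close>

definition isom :: "('a::ab_group_add \<Rightarrow> 'a \<Rightarrow> int) \<Rightarrow> ('b::ab_group_add \<Rightarrow> 'b \<Rightarrow> int) \<Rightarrow> ('a \<Rightarrow> 'b) \<Rightarrow> bool"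
  where "isom b c f \<longleftrightarrow> Modules.additive f \<and> bij f \<and> (\<forall>x y. c (f x) (f y) = b x y)"

lemma isomI:
  assumes "\<And>x y. f (x + y) = f x + f y" "\<And>x. g (f x) = x" "\<And>y. f (g y) = y"
    and "\<And>x y. c (f x) (f y) = b x y"
  shows "isom b c f"
  using assms unfolding isom_def Modules.additive_def by (metis bij_betw_def injI surjI)

lemma isom_id: "isom b b (\<lambda>x. x)"
  by (rule isomI[where g = "\<lambda>x. x"]) auto

lemma isom_comp: "isom b c f \<Longrightarrow> isom c d g \<Longrightarrow> isom b d (\<lambda>x. g (f x))"
  unfolding isom_def Modules.additive_def using bij_comp[of f g] by (simp add: comp_def)

lemma isom_form: "isom b c f \<Longrightarrow> c (f x) (f y) = b x y"
  and isom_additive: "isom b c f \<Longrightarrow> Modules.additive f"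
  and isom_bij: "isom b c f \<Longrightarrow> bij f"
  by (auto simp: isom_def)

lemma isom_add: "isom b c f \<Longrightarrow> f (x + y) = f x + f y"
  and isom_zmul: "isom b c f \<Longrightarrow> f (zmul k x) = zmul k (f x)"
  by (simp_all add: isom_def additive.add additive_zmul)

text \<open>The Eichler transvection attached to an isotropic \<open>e\<close> and a vector
  \<open>x\<close> orthogonal to it. The division by 2 is exact because the form is even.\<close>

definition transvection ::
  "('a::ab_group_add \<Rightarrow> 'a \<Rightarrow> int) \<Rightarrow> 'a \<Rightarrow> 'a \<Rightarrow> 'a \<Rightarrow> 'a" where
  "transvection b e x v =
     v - zmul (b x v) e + zmul (b e v) x - zmul ((b x x div 2) * b e v) e"

text \<open>Up to multiples of \<open>e\<close>, the transvection just adds \<open>b e v\<close>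
  times \<open>x\<close>. This is the useful view when only the complement of \<open>e\<close> and
  the image matters, since that is insensitive to multiples of \<open>e\<close>.\<close>

lemma transvection_alt:
  "transvection b e x v = v + zmul (b e v) x + zmul (- b x v - (b x x div 2) * b e v) e"
  by (simp add: transvection_def zmul_diff_left zmul_minus_left)

text \<open>The inverse is the transvection by \<open>- x\<close>: the product with \<open>e\<close>
  does not change, and the product with \<open>x\<close> grows by 2q(e,v), which is exactly what the
  quadratic term compensates.\<close>

lemma (in even_form) isom_transvection:
  assumes e: "b e e = 0" and x: "b e x = 0"
  shows "isom b b (transvection b e x)"
proof -
  obtain q where q: "b x x = 2 * q" using even by (meson dvdE)
  \<comment> \<open>Stated for \<open>x\<close> and \<open>- x\<close> together, to serve the map as
    well as its inverse.\<close>
  have T: "transvection b e y v = v - zmul (b y v + q * b e v) e + zmul (b e v) y"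
    if "y = x \<or> y = - x" for y v
    using that q by (auto simp: transvection_def bilin zmul_add_left algebra_simps)
  have inv: "transvection b e (- y) (transvection b e y v) = v"
    if y: "y = x \<or> y = - x" for y v
  proof -
    have y': "- y = x \<or> - y = - x" and ey: "b e y = 0" and ye: "b y e = 0" and yy: "b y y = 2 * q"
      using y x q sym[of e x] by (auto simp: bilin)
    have 1: "b e (transvection b e y v) = b e v"
      by (simp add: T[OF y] bilin e ey)
    have 2: "b (- y) (transvection b e y v) = - b y v - 2 * q * b e v"
      by (simp add: T[OF y] bilin ye yy)
    have "transvection b e (- y) (transvection b e y v) =
       transvection b e y v + zmul (b y v + q * b e v) e - zmul (b e v) y"
      by (simp add: T[OF y', of "transvection b e y v"] 1 2 zmul_minus_right zmul_minus_left
          zmul_diff_left zmul_add_left mult.assoc flip: zmul_zmul)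
    also have "\<dots> = v" by (simp add: T[OF y])
    finally show ?thesis .
  qed
  have pres: "b (transvection b e x u) (transvection b e x v) = b u v" for u v
  proof -
    have s: "b u e = b e u" "b u x = b x u" "b x e = 0" using sym[of u] sym[of x e] x by auto
    have "b (u - zmul k e + zmul l x) (v - zmul k' e + zmul l' x) =
       b u v - k' * b e u + l' * b x u - k * b e v + l * b x v + 2 * q * l * l'" for k k' l l'
      by (simp add: bilin e x q s distrib_left)
    then show ?thesis
      by (simp add: T) (simp add: algebra_simps)
  qed
  show ?thesis
  proof (rule isomI[where g = "transvection b e (- x)"])
    show "transvection b e x (u + v) = transvection b e x u + transvection b e x v" for u v
      by (simp add: T add_right zmul_add_left distrib_left)
    show "transvection b e (- x) (transvection b e x v) = v" for v
      using inv by blast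
    show "transvection b e x (transvection b e (- x) v) = v" for v
      using inv[of "- x" v] by simp
  qed (rule pres)
qed

text \<open>The orthogonal sum of U and the given lattice. The two coordinates of the plane are put
  in front of a flat tuple, so that iteration gives tuples (a1, a2, c1, c2, x).\<close>

definition hyp :: "('a::ab_group_add \<Rightarrow> 'a \<Rightarrow> int) \<Rightarrow> int \<times> int \<times> 'a \<Rightarrow> int \<times> int \<times> 'a \<Rightarrow> int" where
  "hyp b = (\<lambda>(a1, a2, x) (c1, c2, y). a1 * c2 + a2 * c1 + b x y)"

lemma hyp_simp [simp]: "hyp b (a1, a2, x) (c1, c2, y) = a1 * c2 + a2 * c1 + b x y"
  by (simp add: hyp_def)

lemma even_form_hyp:
  assumes "even_form b"
  shows "even_form (hyp b)"
proof -
  interpret even_form b by fact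
  show ?thesis
  proof
    show "hyp b (x + y) z = hyp b x z + hyp b y z" for x y z
      by (cases x; cases y; cases z) (simp add: bilin algebra_simps)
    show "hyp b x y = hyp b y x" for x y
      using sym by (cases x; cases y) simp
    show "2 dvd hyp b x x" for x
      using even by (cases x) simp
  qed
qed

lemma isom_hyp_swap: "isom (hyp b) (hyp b) (\<lambda>(a1, a2, x). (a2, a1, x))"
  by (rule isomI[where g = "\<lambda>(a1, a2, x). (a2, a1, x)"]) auto

lemma isom_hyp_swap_planes:
  "isom (hyp (hyp b)) (hyp (hyp b)) (\<lambda>(a1, a2, c1, c2, x). (c1, c2, a1, a2, x))"
  by (rule isomI[where g = "\<lambda>(a1, a2, c1, c2, x). (c1, c2, a1, a2, x)"]) auto

lemma (in even_form) isom_uminus: "isom b b uminus"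
  by (rule isomI[where g = uminus]) (simp_all add: minus_left minus_right)

text \<open>The first coordinate of the normal form is the least positive first coordinate in the orbit.\<close>

lemma eichler_divisor:
  fixes b :: "'a::ab_group_add \<Rightarrow> 'a \<Rightarrow> int"
  assumes "even_form b"
  shows "\<exists>f a a' x. isom (hyp (hyp b)) (hyp (hyp b)) f \<and> f v = (a, a', 0, 0, x) \<and> 0 \<le> a \<and>
    a dvd a' \<and> (\<forall>y. a dvd b x y)"
proof -
  interpret b: even_form b by fact
  interpret h: even_form "hyp b" by (rule even_form_hyp) fact
  interpret hh: even_form "hyp (hyp b)" by (rule even_form_hyp) (rule h.even_form_axioms)
  let ?B = "hyp (hyp b)"
  define Orb where "Orb = {f v |f. isom ?B ?B f}"
  have move: "g w \<in> Orb" if "isom ?B ?B g" "w \<in> Orb" for g w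
  proof -
    obtain f where f: "isom ?B ?B f" "w = f v" using \<open>w \<in> Orb\<close> unfolding Orb_def by auto
    have "isom ?B ?B (\<lambda>x. g (f x))" by (rule isom_comp) fact+
    then show ?thesis unfolding Orb_def f(2) mem_Collect_eq by (intro exI conjI) (rule refl)
  qed
  have v_Orb: "v \<in> Orb"
    unfolding Orb_def mem_Collect_eq by (intro exI[of _ "\<lambda>x. x"] conjI refl isom_id)
  have sw1: "(a2, a1, r) \<in> Orb" if "(a1, a2, r) \<in> Orb" for a1 a2 r
    using move[OF isom_hyp_swap that] by simp
  have sw12: "(c1, c2, a1, a2, x) \<in> Orb" if "(a1, a2, c1, c2, x) \<in> Orb" for a1 a2 c1 c2 x
    using move[OF isom_hyp_swap_planes that] by simp
  have sw2: "(a1, a2, c2, c1, x) \<in> Orb" if "(a1, a2, c1, c2, x) \<in> Orb" for a1 a2 c1 c2 x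
    using that sw1 sw12 by blast
  have neg: "(- a1, - a2, - c1, - c2, - x) \<in> Orb" if "(a1, a2, c1, c2, x) \<in> Orb" for a1 a2 c1 c2 x
    using move[OF hh.isom_uminus that] by simp
  \<comment> \<open>The Euclidean step: a transvection by k times a basis vector of the second plane
    adds a multiple of a2 to c1.\<close>
  have t1: "(a1 - k * c2, a2, c1 + k * a2, c2, x) \<in> Orb"
    if "(a1, a2, c1, c2, x) \<in> Orb" for a1 a2 c1 c2 x k
    using move[OF hh.isom_transvection[of "(1, 0, 0)" "(0, 0, k, 0, 0)"] that]
    by (simp add: transvection_def zero_prod_def mult.commute)
  have t2: "(a1 - b y x - (b y y div 2) * a2, a2, c1, c2, x + zmul a2 y) \<in> Orb"
    if "(a1, a2, c1, c2, x) \<in> Orb" for a1 a2 c1 c2 x y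
    using move[OF hh.isom_transvection[of "(1, 0, 0)" "(0, 0, 0, 0, y)"] that]
    by (simp add: transvection_def zero_prod_def)
  show ?thesis
  proof (cases "\<exists>a r. (a, r) \<in> Orb \<and> a \<noteq> 0")
    \<comment> \<open>All plane coordinates of v vanish, as each can be moved to the front, and
      \<open>t2\<close> would move a nonzero product with x there too. The divisor is then
      0.\<close>
    case False
    obtain a1 a2 c1 c2 x where v: "v = (a1, a2, c1, c2, x)" by (metis prod_cases5)
    have z: "a1 = 0" "a2 = 0" "c1 = 0" "c2 = 0"
      using False v_Orb sw1 sw12 sw2 unfolding v by blast+
    have "(- b y x, 0, 0, 0, x) \<in> Orb" for y
      using t2[of a1 a2 c1 c2 x y] v_Orb unfolding v z by simp
    then have "- b y x = 0" for y
      using False by blast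
    then have "b y x = 0" for y
      by simp
    then have "\<forall>y. 0 dvd b x y" by (simp add: b.sym[of x])
    then show ?thesis using v z
      by (intro exI[of _ "\<lambda>x. x"] exI[of _ 0] exI[of _ x] conjI isom_id) simp_all
  next
    case True
    then obtain a r where ar: "(a, r) \<in> Orb" "a \<noteq> 0" by blast
    have pos: "\<exists>r. (int (nat \<bar>a\<bar>), r) \<in> Orb" if "(a, r) \<in> Orb" for a r
    proof (cases "0 \<le> a")
      case True then show ?thesis using that by (intro exI[of _ r]) simp
    next
      case False
      obtain a2 c1 c2 x where r: "r = (a2, c1, c2, x)" by (cases r rule: prod_cases4)
      have "(- a, - a2, - c1, - c2, - x) \<in> Orb" using neg that unfolding r .
      then show ?thesis
        using False by (intro exI[of _ "(- a2, - c1, - c2, - x)"]) simp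
    qed
    define P where "P j \<longleftrightarrow> 0 < j \<and> (\<exists>r. (int j, r) \<in> Orb)" for j
    define a0 where "a0 = (LEAST j. P j)"
    have "P (nat \<bar>a\<bar>)" using pos[OF ar(1)] ar(2) unfolding P_def by simp
    then have P0: "P a0" and min: "\<And>j. P j \<Longrightarrow> a0 \<le> j"
      unfolding a0_def by (auto intro: LeastI Least_le)
    have a0: "0 < a0" using P0 by (simp add: P_def)
    have small: "k = 0" if "(k, r) \<in> Orb" "0 \<le> k" "k < int a0" for k r
    proof (rule ccontr)
      assume "k \<noteq> 0"
      then have "P (nat k)" using that unfolding P_def by (intro conjI exI[of _ r]) simp_all
      then show False using min that by fastforce
    qed
    \<comment> \<open>After exchanging the first two coordinates, \<open>t1\<close> reduces c1
      modulo a0. The remainder can be moved to the front, so it is 0 by minimality of a0.\<close>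
    have red: "int a0 dvd c1 \<and> (\<exists>a2'. (int a0, a2', 0, c2, x) \<in> Orb \<and> (c2 = 0 \<longrightarrow> a2' = a2))"
      if "(int a0, a2, c1, c2, x) \<in> Orb" for a2 c1 c2 x
    proof -
      define k where "k = - (c1 div int a0)"
      have w: "(a2 - k * c2, int a0, c1 + k * int a0, c2, x) \<in> Orb"
        using t1[OF sw1[OF that]] .
      have c: "c1 + k * int a0 = c1 mod int a0"
        by (simp add: k_def minus_mult_div_eq_mod mult.commute)
      have "c1 mod int a0 = 0"
        using small[OF sw12[OF w]] a0 unfolding c by simp
      then show ?thesis using sw1[OF w] c by auto
    qed
    obtain a2 c1 c2 x where w0: "(int a0, a2, c1, c2, x) \<in> Orb"
    proof -
      obtain r where "(int a0, r) \<in> Orb" using P0 unfolding P_def by auto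
      then show ?thesis using that by (cases r rule: prod_cases4) simp
    qed
    obtain a2' where "(int a0, a2', 0, c2, x) \<in> Orb" using red[OF w0] by blast
    then have "(int a0, a2', c2, 0, x) \<in> Orb" by (rule sw2)
    then obtain a2'' where w: "(int a0, a2'', 0, 0, x) \<in> Orb" using red by blast
    \<comment> \<open>With k = 1, \<open>t1\<close> copies the second coordinate into c1, where
      \<open>red\<close> yields the divisibility.\<close>
    have d1: "int a0 dvd a2''"
      using t1[OF w, of 1] red[of a2'' a2'' 0 x] by simp
    \<comment> \<open>A transvection by y, performed between two exchanges of the planes, writes
      minus the product of y and x into c1.\<close>
    have d2: "int a0 dvd b x y" for y
    proof -
      have "(int a0, a2'', - b y x, 0, x) \<in> Orb"
        using sw12[OF t2[OF sw12[OF w], of y]] by simp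
      then have "int a0 dvd b y x" using red[of a2'' "- b y x" 0 x] by simp
      then show ?thesis using b.sym by metis
    qed
    obtain f where "isom ?B ?B f" "f v = (int a0, a2'', 0, 0, x)"
      using w unfolding Orb_def by force
    then show ?thesis using d1 d2 of_nat_0_le_iff by blast
  qed
qed

text \<open>The divisor of the previous normal form divides every product with the vector, so it is
  1 here. One more transvection clears the last component, and the norm determines the remaining
  coordinate: such vectors are classified by their norm.\<close>

lemma eichler:
  fixes b :: "'a::ab_group_add \<Rightarrow> 'a \<Rightarrow> int"
  assumes "even_form b" and vz: "hyp (hyp b) v z = 1"
  shows "\<exists>f. isom (hyp (hyp b)) (hyp (hyp b)) f \<and> f v = (1, hyp (hyp b) v v div 2, 0, 0, 0)"
proof -
  interpret b: even_form b by fact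
  interpret h: even_form "hyp b" by (rule even_form_hyp) fact
  interpret hh: even_form "hyp (hyp b)" by (rule even_form_hyp) (rule h.even_form_axioms)
  let ?B = "hyp (hyp b)"
  obtain f a a' x where f: "isom ?B ?B f" "f v = (a, a', 0, 0, x)" "0 \<le> a" "a dvd a'"
    "\<And>y. a dvd b x y" using eichler_divisor[OF assms(1), of v] by blast
  have "1 = ?B (f v) (f z)" using isom_form[OF f(1)] vz by metis
  moreover have "a dvd ?B (f v) w" for w using f by (cases w) simp
  ultimately have "a dvd 1" by metis
  then have a: "a = 1" using f(3) by simp
  define g where "g = transvection ?B (0, 1, 0) (0, 0, 0, 0, - x)"
  have g: "isom ?B ?B g" unfolding g_def
    by (rule hh.isom_transvection) (simp_all add: zero_prod_def)
  have gf: "isom ?B ?B (\<lambda>v. g (f v))" using isom_comp[OF f(1) g] .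
  have "\<exists>c. g (f v) = (1, c, 0, 0, 0)"
    by (simp add: g_def f(2) a transvection_def zero_prod_def)
  then obtain c where c: "g (f v) = (1, c, 0, 0, 0)" by blast
  have "?B v v = ?B (g (f v)) (g (f v))" using isom_form[OF gf] by metis
  then have "c = ?B v v div 2" by (simp add: c)
  then show ?thesis using gf c by blast
qed

text \<open>Modulo 2 such a vector agrees with a primitive one, to which Eichler's criterion applies.\<close>

lemma isom_normal_form_mod_2:
  fixes b :: "'a::ab_group_add \<Rightarrow> 'a \<Rightarrow> int"
  assumes "even_form b" and odd: "odd (hyp (hyp b) w z)"
  shows "\<exists>f s y. isom (hyp (hyp b)) (hyp (hyp b)) f \<and> f w = (1, s, 0) + zmul 2 y \<and> s \<in> {0, 1} \<and>
    (even s \<longleftrightarrow> 4 dvd hyp (hyp b) w w)"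
proof -
  interpret b: even_form b by fact
  interpret h: even_form "hyp b" by (rule even_form_hyp) fact
  interpret hh: even_form "hyp (hyp b)" by (rule even_form_hyp) (rule h.even_form_axioms)
  let ?B = "hyp (hyp b)"
  obtain a1 a2 c1 c2 x where w: "w = (a1, a2, c1, c2, x)" by (metis prod_cases5)
  obtain z1 z2 z3 z4 z5 where z: "z = (z1, z2, z3, z4, z5)" by (metis prod_cases5)
  have half: "\<exists>k. a + 2 * k = c" if "even (a - c)" for a c :: int
    using that by presburger
  \<comment> \<open>An odd product has an odd ingredient. If it is a plane coordinate of w, an even
    change turns it into 1; otherwise the product of x and z5 is odd, and a1 is changed so that
    their sum is 1.\<close>
  have "\<exists>y z. ?B (w + zmul 2 y) z = 1"
  proof -
    consider "odd a1" | "odd a2" | "odd c1" | "odd c2" | "even a1" "odd (b x z5)"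
      using odd that unfolding w z by (cases "odd a1"; cases "odd a2"; cases "odd c1"; cases "odd c2") simp_all
    then show ?thesis
    proof cases
      case 1
      then obtain k where "a1 + 2 * k = 1" using half[of a1 1] by auto
      then have "?B (w + zmul 2 (k, 0, 0, 0, 0)) (0, 1, 0, 0, 0) = 1" by (simp add: w)
      then show ?thesis by blast
    next
      case 2
      then obtain k where "a2 + 2 * k = 1" using half[of a2 1] by auto
      then have "?B (w + zmul 2 (0, k, 0, 0, 0)) (1, 0, 0, 0, 0) = 1" by (simp add: w)
      then show ?thesis by blast
    next
      case 3
      then obtain k where "c1 + 2 * k = 1" using half[of c1 1] by auto
      then have "?B (w + zmul 2 (0, 0, k, 0, 0)) (0, 0, 0, 1, 0) = 1" by (simp add: w)
      then show ?thesis by blast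
    next
      case 4
      then obtain k where "c2 + 2 * k = 1" using half[of c2 1] by auto
      then have "?B (w + zmul 2 (0, 0, 0, k, 0)) (0, 0, 1, 0, 0) = 1" by (simp add: w)
      then show ?thesis by blast
    next
      case 5
      then obtain k where "a1 + 2 * k = 1 - b x z5" using half[of a1 "1 - b x z5"] by auto
      then have "?B (w + zmul 2 (k, 0, 0, 0, 0)) (0, 1, 0, 0, z5) = 1" by (simp add: w)
      then show ?thesis by blast
    qed
  qed
  then obtain y z' where y: "?B (w + zmul 2 y) z' = 1" by blast
  define t where "t = ?B (w + zmul 2 y) (w + zmul 2 y) div 2"
  obtain f where f: "isom ?B ?B f" "f (w + zmul 2 y) = (1, t, 0, 0, 0)"
    using eichler[OF assms(1) y] unfolding t_def by blast
  \<comment> \<open>The even part of t is absorbed into \<open>y'\<close>; what remains, 2s, is the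
    norm modulo 4.\<close>
  define s where "s = t mod 2"
  define y' where "y' = (0, t div 2, 0) - f y"
  have "f w = (1, t, 0) - zmul 2 (f y)"
    using f(2) isom_add[OF f(1), of w "zmul 2 y"] isom_zmul[OF f(1), of 2 y]
    by (simp add: zero_prod_def algebra_simps)
  also have "\<dots> = (1, s, 0) + zmul 2 y'"
  proof -
    have 1: "(1, t, 0) = (1, s, 0) + zmul 2 (0, t div 2, 0 :: int \<times> int \<times> 'a)"
      by (simp add: s_def)
    show ?thesis
      unfolding y'_def diff_conv_add_uminus zmul_add_right zmul_minus_right
      by (subst 1) (rule add.assoc)
  qed
  finally have fw: "f w = (1, s, 0) + zmul 2 y'" .
  have "?B w w = ?B ((1, s, 0) + zmul 2 y') ((1, s, 0) + zmul 2 y')"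
    using isom_form[OF f(1), of w w] fw by metis
  then have "?B w w = ?B (1, s, 0) (1, s, 0) + 4 * (?B (1, s, 0) y' + ?B y' y')"
    unfolding hh.norm_add_zmul_2 .
  moreover have "?B (1, s, 0) (1, s, 0) = 2 * s" by (simp add: zero_prod_def)
  ultimately obtain r where r: "?B w w = 2 * s + 4 * r" by metis
  have "even s \<longleftrightarrow> 4 dvd ?B w w" unfolding r by presburger
  moreover have "s \<in> {0, 1}" by (auto simp: s_def)
  ultimately show ?thesis using f(1) fw by blast
qed

section \<open>Gram matrices and coordinates\<close>

definition lat :: "'a::ab_group_add set \<Rightarrow> ('a \<Rightarrow> 'a \<Rightarrow> int) \<Rightarrow> 'a int_lattice" where
  "lat C b = \<lparr>carrier = C, monoid.mult = (+), one = 0, form = b\<rparr>"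

lemma lat_simps [simp]:
  "carrier (lat C b) = C" "monoid.mult (lat C b) = (+)" "one (lat C b) = 0" "form (lat C b) = b"
  by (simp_all add: lat_def)

lemma isometricI:
  assumes "bij_betw f (carrier L) (carrier M)"
    and "\<And>x y. x \<in> carrier L \<Longrightarrow> y \<in> carrier L \<Longrightarrow> f (x \<otimes>\<^bsub>L\<^esub> y) = f x \<otimes>\<^bsub>M\<^esub> f y"
    and "\<And>x y. x \<in> carrier L \<Longrightarrow> y \<in> carrier L \<Longrightarrow> form M (f x) (f y) = form L x y"
  shows "isometric L M"
  using assms bij_betwE[OF assms(1)] unfolding isometric_def iso_def hom_def by blast

lemma isometric_trans:
  assumes "isometric L M" "isometric M N"
  shows "isometric L N"
proof -
  obtain f g where f: "f \<in> iso L M" "\<And>x y. x \<in> carrier L \<Longrightarrow> y \<in> carrier L \<Longrightarrow> form M (f x) (f y) = form L x y"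
    and g: "g \<in> iso M N" "\<And>x y. x \<in> carrier M \<Longrightarrow> y \<in> carrier M \<Longrightarrow> form N (g x) (g y) = form M x y"
    using assms unfolding isometric_def by blast
  have b: "bij_betw f (carrier L) (carrier M)" "bij_betw g (carrier M) (carrier N)"
    using f(1) g(1) by (auto simp: iso_def)
  have fc: "f x \<in> carrier M" if "x \<in> carrier L" for x
    using b(1) that bij_betwE by blast
  show ?thesis
  proof (rule isometricI[where f = "g \<circ> f"])
    show "bij_betw (g \<circ> f) (carrier L) (carrier N)"
      using bij_betw_trans[OF b] .
    show "(g \<circ> f) (x \<otimes>\<^bsub>L\<^esub> y) = (g \<circ> f) x \<otimes>\<^bsub>N\<^esub> (g \<circ> f) y"
      if "x \<in> carrier L" "y \<in> carrier L" for x y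
      using f(1) g(1) that fc by (simp add: iso_def hom_def)
    show "form N ((g \<circ> f) x) ((g \<circ> f) y) = form L x y"
      if "x \<in> carrier L" "y \<in> carrier L" for x y
      using f(2) g(2) that fc by simp
  qed
qed

lemma isometric_isom:
  assumes f: "isom b c f" and CD: "\<And>x. f x \<in> D \<longleftrightarrow> x \<in> C"
  shows "isometric (lat C b) (lat D c)"
proof (rule isometricI[where f = f])
  have "f ` C = D"
  proof
    show "D \<subseteq> f ` C"
    proof
      fix y assume "y \<in> D"
      moreover obtain x where "y = f x" using isom_bij[OF f] by (metis bij_pointE)
      ultimately show "y \<in> f ` C" using CD by auto
    qed
  qed (use CD in auto)
  then show "bij_betw f (carrier (lat C b)) (carrier (lat D c))"
    using isom_bij[OF f] by (simp add: bij_betw_def inj_on_def)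
qed (simp_all add: isom_form[OF f] isom_add[OF f])

definition orth_sum :: "('a \<Rightarrow> 'a \<Rightarrow> int) \<Rightarrow> ('b \<Rightarrow> 'b \<Rightarrow> int) \<Rightarrow> 'a \<times> 'b \<Rightarrow> 'a \<times> 'b \<Rightarrow> int" where
  "orth_sum b c = (\<lambda>(x, y) (x', y'). b x x' + c y y')"

lemma orth_sum_simp [simp]: "orth_sum b c (x, y) (x', y') = b x x' + c y y'"
  by (simp add: orth_sum_def)

lemma even_form_orth_sum:
  assumes "even_form b" "even_form c"
  shows "even_form (orth_sum b c)"
proof -
  interpret b: even_form b by fact
  interpret c: even_form c by fact
  show ?thesis
  proof
    show "orth_sum b c (x + y) z = orth_sum b c x z + orth_sum b c y z" for x y z
      by (cases x; cases y; cases z) (simp add: b.add_left c.add_left)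
    show "orth_sum b c x y = orth_sum b c y x" for x y
      using b.sym c.sym by (cases x; cases y) simp
    show "2 dvd orth_sum b c x x" for x
      using b.even c.even by (cases x) simp
  qed
qed

text \<open>The link between tuples and matrices. All arguments run on forms of tuples, and Gram
  matrices return only when an isometry class has to be named.\<close>

definition has_gram :: "('a::ab_group_add \<Rightarrow> 'a \<Rightarrow> int) \<Rightarrow> int Matrix.mat \<Rightarrow> bool" where
  "has_gram b A \<longleftrightarrow> square_mat A \<and> (\<exists>f. bij_betw f UNIV (carrier_vec (dim_row A)) \<and>
     (\<forall>x y. f (x + y) = f x + f y) \<and> (\<forall>x y. f x \<bullet> (A *\<^sub>v f y) = b x y))"

lemma has_gram_isometric:
  assumes "has_gram b A"
  shows "isometric (lat UNIV b) (gram_lattice A)" and "isometric (gram_lattice A) (lat UNIV b)"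
proof -
  obtain f where f: "bij_betw f UNIV (carrier_vec (dim_row A))"
    "\<And>x y. f (x + y) = f x + f y" "\<And>x y. f x \<bullet> (A *\<^sub>v f y) = b x y"
    using assms unfolding has_gram_def by blast
  show "isometric (lat UNIV b) (gram_lattice A)"
    by (rule isometricI[where f = f]) (use f in \<open>simp_all add: gram_lattice_def\<close>)
  let ?g = "inv_into UNIV f"
  have fg: "f (?g x) = x" if "x \<in> carrier_vec (dim_row A)" for x
    using f(1) that by (simp add: bij_betw_def f_inv_into_f)
  have gf: "?g (f x) = x" for x
    using f(1) by (simp add: bij_betw_def)
  show "isometric (gram_lattice A) (lat UNIV b)"
  proof (rule isometricI[where f = ?g])
    show "bij_betw ?g (carrier (gram_lattice A)) (carrier (lat UNIV b))"
      using bij_betw_inv_into[OF f(1)] by (simp add: gram_lattice_def)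
    show "?g (x \<otimes>\<^bsub>gram_lattice A\<^esub> y) = ?g x \<otimes>\<^bsub>lat UNIV b\<^esub> ?g y"
      if "x \<in> carrier (gram_lattice A)" "y \<in> carrier (gram_lattice A)" for x y
      using that f(2)[of "?g x" "?g y"] gf[of "?g x + ?g y"] by (simp add: gram_lattice_def fg)
    show "form (lat UNIV b) (?g x) (?g y) = form (gram_lattice A) x y"
      if "x \<in> carrier (gram_lattice A)" "y \<in> carrier (gram_lattice A)" for x y
      using that f(3)[of "?g x" "?g y"] by (simp add: gram_lattice_def fg)
  qed
qed

lemma has_gram_block:
  assumes "has_gram b A" "has_gram c (diag_block_mat As)"
  shows "has_gram (orth_sum b c) (diag_block_mat (A # As))"
proof -
  let ?D = "diag_block_mat As"
  let ?n = "dim_row A" and ?m = "dim_row ?D"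
  obtain f where f: "bij_betw f UNIV (carrier_vec ?n)"
    "\<And>x y. f (x + y) = f x + f y" "\<And>x y. f x \<bullet> (A *\<^sub>v f y) = b x y"
    using assms(1) unfolding has_gram_def by blast
  obtain g where g: "bij_betw g UNIV (carrier_vec ?m)"
    "\<And>x y. g (x + y) = g x + g y" "\<And>x y. g x \<bullet> (?D *\<^sub>v g y) = c x y"
    using assms(2) unfolding has_gram_def by blast
  have A: "A \<in> carrier_mat ?n ?n" and D: "?D \<in> carrier_mat ?m ?m"
    using assms unfolding has_gram_def by auto
  have eq: "diag_block_mat (A # As) = four_block_mat A (0\<^sub>m ?n ?m) (0\<^sub>m ?m ?n) ?D"
    unfolding diag_block_mat.simps Let_def carrier_matD(2)[OF A] carrier_matD(2)[OF D] ..
  have fc: "f x \<in> carrier_vec ?n" for x using f(1) by (auto simp: bij_betw_def)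
  have gc: "g x \<in> carrier_vec ?m" for x using g(1) by (auto simp: bij_betw_def)
  let ?h = "\<lambda>(x, y). f x @\<^sub>v g y"
  have "bij_betw ?h UNIV (carrier_vec (?n + ?m))"
  proof (rule bij_betw_imageI)
    show "inj ?h"
    proof (rule injI, clarify)
      fix x y x' y' assume "f x @\<^sub>v g y = f x' @\<^sub>v g y'"
      then have "f x = f x'" "g y = g y'"
        using append_vec_eq[OF fc fc] by blast+
      then show "x = x' \<and> y = y'"
        using f(1) g(1) by (auto simp: bij_betw_def dest: injD)
    qed
    show "range ?h = carrier_vec (?n + ?m)"
    proof
      show "carrier_vec (?n + ?m) \<subseteq> range ?h"
      proof
        fix v :: "int Matrix.vec" assume v: "v \<in> carrier_vec (?n + ?m)"
        have "vec_first v ?n \<in> range f" "vec_last v ?m \<in> range g"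
          using f(1) g(1) by (simp_all add: bij_betw_def)
        then obtain x y where "vec_first v ?n = f x" "vec_last v ?m = g y" by auto
        then have "v = ?h (x, y)" using vec_first_last_append[OF v] by simp
        then show "v \<in> range ?h" by (rule range_eqI)
      qed
    qed (use fc gc in \<open>auto intro!: append_carrier_vec\<close>)
  qed
  moreover have "?h (x + y) = ?h x + ?h y" for x y
    by (cases x; cases y) (simp add: f(2) g(2) append_vec_add[OF fc fc gc gc])
  moreover have "?h x \<bullet> (diag_block_mat (A # As) *\<^sub>v ?h y) = orth_sum b c x y" for x y
  proof (cases x; cases y)
    fix x1 x2 y1 y2 assume xy: "x = (x1, x2)" "y = (y1, y2)"
    have "diag_block_mat (A # As) *\<^sub>v ?h y = (A *\<^sub>v f y1) @\<^sub>v (?D *\<^sub>v g y2)"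
      unfolding eq xy using mult_mat_vec_split[OF A D fc gc] by simp
    then show ?thesis
      unfolding xy using scalar_prod_append[OF fc gc, of "A *\<^sub>v f y1" "?D *\<^sub>v g y2"]
        mult_mat_vec_carrier[OF A fc] mult_mat_vec_carrier[OF D gc]
      by (simp add: f(3) g(3))
  qed
  moreover have "square_mat (diag_block_mat (A # As))" "dim_row (diag_block_mat (A # As)) = ?n + ?m"
    unfolding eq square_mat.simps index_mat_four_block carrier_matD(2)[OF A] carrier_matD(2)[OF D] by (rule refl)+
  ultimately show ?thesis
    unfolding has_gram_def by (intro conjI exI[of _ ?h]) auto
qed

lemma has_gram_list:
  assumes "\<And>x. length (l x) = n" and "\<And>xs. length xs = n \<Longrightarrow> \<exists>x. l x = xs" "inj l"
    and "\<And>x y. l (x + y) = map2 (+) (l x) (l y)"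
    and "A \<in> carrier_mat n n"
    and "\<And>x y. (\<Sum>i<n. \<Sum>j<n. l x ! i * A $$ (i, j) * l y ! j) = b x y"
  shows "has_gram b A"
proof -
  have "bij_betw (\<lambda>x. vec_of_list (l x)) UNIV (carrier_vec n)"
  proof (rule bij_betw_imageI)
    show "inj (\<lambda>x. vec_of_list (l x))"
    proof (rule injI)
      fix x y assume "vec_of_list (l x) = vec_of_list (l y)"
      then have "l x = l y" by (metis list_vec)
      then show "x = y" using assms(3) by (rule injD[rotated])
    qed
    show "range (\<lambda>x. vec_of_list (l x)) = carrier_vec n"
    proof
      show "range (\<lambda>x. vec_of_list (l x)) \<subseteq> carrier_vec n"
        by (rule image_subsetI) (simp add: carrier_dim_vec assms(1))
      show "carrier_vec n \<subseteq> range (\<lambda>x. vec_of_list (l x))"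
      proof
        fix v :: "int Matrix.vec" assume "v \<in> carrier_vec n"
        then have "length (list_of_vec v) = n" by simp
        then obtain x where "l x = list_of_vec v" using assms(2)[of "list_of_vec v"] by auto
        then show "v \<in> range (\<lambda>x. vec_of_list (l x))" by (metis range_eqI vec_list)
      qed
    qed
  qed
  moreover have "vec_of_list (l (x + y)) = vec_of_list (l x) + vec_of_list (l y)" for x y
    unfolding assms(4) by (rule eq_vecI) (simp_all add: assms(1) vec_of_list_index)
  moreover have "vec_of_list (l x) \<bullet> (A *\<^sub>v vec_of_list (l y)) = b x y" for x y
    unfolding assms(6)[symmetric] using assms(5)
    by (simp add: scalar_prod_def assms(1) vec_of_list_index sum_distrib_left atLeast0LessThan mult.assoc)
  ultimately show ?thesis
    unfolding has_gram_def using assms(5) by auto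
qed

text \<open>Products of explicit rows replace the double sum over matrix entries, so that the 8 by 8
  case can be evaluated by rewriting.\<close>

lemma has_gram_rows:
  assumes "\<And>x. length (l x) = n" and "\<And>xs. length xs = n \<Longrightarrow> \<exists>x. l x = xs" "inj l"
    and "\<And>x y. l (x + y) = map2 (+) (l x) (l y)"
    and rs: "length rs = n" "\<And>r. r \<in> set rs \<Longrightarrow> length r = n"
    and b: "\<And>x y. sum_list (map2 (\<lambda>a r. a * sum_list (map2 (*) r (l y))) (l x) rs) = b x y"
  shows "has_gram b (mat_of_rows_list n rs)"
proof (rule has_gram_list[OF assms(1-4)])
  show "mat_of_rows_list n rs \<in> carrier_mat n n"
    using rs(1) by (simp add: mat_of_rows_list_def)
  show "(\<Sum>i<n. \<Sum>j<n. l x ! i * mat_of_rows_list n rs $$ (i, j) * l y ! j) = b x y" for x y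
    unfolding b[symmetric] using assms(1) rs
    by (simp add: sum_list_sum_nth mat_of_rows_list_def atLeast0LessThan sum_distrib_left mult.assoc)
qed

lemma has_gram_isom:
  assumes "has_gram c A" "isom b c f"
  shows "has_gram b A"
proof -
  obtain g where g: "bij_betw g UNIV (carrier_vec (dim_row A))"
    "\<And>x y. g (x + y) = g x + g y" "\<And>x y. g x \<bullet> (A *\<^sub>v g y) = c x y"
    using assms(1) unfolding has_gram_def by blast
  have "bij_betw (g \<circ> f) UNIV (carrier_vec (dim_row A))"
    using bij_betw_trans[OF isom_bij[OF assms(2)] g(1)] .
  then show ?thesis
    using assms(1) g isom_add[OF assms(2)] isom_form[OF assms(2)] unfolding has_gram_def
    by (intro conjI exI[of _ "g \<circ> f"]) auto
qed

section \<open>The concrete forms and their Gram matrices\<close>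

type_synonym e8 = "int \<times> int \<times> int \<times> int \<times> int \<times> int \<times> int \<times> int"

definition E8_form :: "e8 \<Rightarrow> e8 \<Rightarrow> int" where
  "E8_form = (\<lambda>(x1, x2, x3, x4, x5, x6, x7, x8) (y1, y2, y3, y4, y5, y6, y7, y8).
     x1 * (y3 - 2 * y1) + x2 * (y4 - 2 * y2) + x3 * (y1 + y4 - 2 * y3) + x4 * (y2 + y3 + y5 - 2 * y4) +
     x5 * (y4 + y6 - 2 * y5) + x6 * (y5 + y7 - 2 * y6) + x7 * (y6 + y8 - 2 * y7) + x8 * (y7 - 2 * y8))"

definition rank1_form :: "int \<Rightarrow> int \<Rightarrow> int \<Rightarrow> int" where
  "rank1_form t x y = t * x * y"

lemma rank1_form_0 [simp]: "rank1_form t x 0 = 0" "rank1_form t 0 y = 0"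
  by (simp_all add: rank1_form_def)

text \<open>For t = 1 this is U and for t = 2 it is U(2).\<close>

definition plane_form :: "int \<Rightarrow> int \<times> int \<Rightarrow> int \<times> int \<Rightarrow> int" where
  "plane_form t = (\<lambda>(x1, x2) (y1, y2). t * (x1 * y2 + x2 * y1))"

lemma has_gram_rank1: "has_gram (rank1_form t) (rank1_gram t)"
proof (rule has_gram_list[where n = 1 and l = "\<lambda>x. [x]"])
  show "\<exists>x. [x] = xs" if "length xs = 1" for xs :: "int list"
    using that by (cases xs) auto
qed (auto intro!: injI simp: rank1_gram_def rank1_form_def mat_of_rows_list_def)

lemma has_gram_U: "has_gram (plane_form 1) U_gram"
proof (rule has_gram_list[where n = 2 and l = "\<lambda>(x1, x2). [x1, x2]"])
  show "\<exists>x. (case x of (x1, x2) \<Rightarrow> [x1, x2]) = xs" if "length xs = 2" for xs :: "int list"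
    using that by (auto simp: numeral_2_eq_2 length_Suc_conv)
qed (auto intro!: injI simp: U_gram_def plane_form_def mat_of_rows_list_def numeral_2_eq_2)

lemma has_gram_U2: "has_gram (plane_form 2) U2_gram"
proof (rule has_gram_list[where n = 2 and l = "\<lambda>(x1, x2). [x1, x2]"])
  show "\<exists>x. (case x of (x1, x2) \<Rightarrow> [x1, x2]) = xs" if "length xs = 2" for xs :: "int list"
    using that by (auto simp: numeral_2_eq_2 length_Suc_conv)
qed (auto intro!: injI simp: U2_gram_def plane_form_def mat_of_rows_list_def numeral_2_eq_2)

lemma has_gram_3:
  "has_gram (\<lambda>(x1, x2, x3) (y1, y2, y3). x1 * (y2 - 2 * y1) + x2 * (y1 - 2 * y2 + y3) + x3 * (y2 + 2 * y3))
     (mat_of_rows_list 3 [[- 2, 1, 0], [1, - 2, 1], [0, 1, 2]])"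
proof (rule has_gram_list[where n = 3 and l = "\<lambda>(x1, x2, x3). [x1, x2, x3]"])
  show "\<exists>x. (case x of (x1, x2, x3) \<Rightarrow> [x1, x2, x3]) = xs" if "length xs = 3" for xs :: "int list"
    using that by (auto simp: numeral_3_eq_3 length_Suc_conv)
qed (auto intro!: injI simp: mat_of_rows_list_def numeral_3_eq_3 algebra_simps)

lemma has_gram_E8: "has_gram E8_form E8_gram"
  unfolding E8_gram_def
proof (rule has_gram_rows[where l = "\<lambda>(x1, x2, x3, x4, x5, x6, x7, x8). [x1, x2, x3, x4, x5, x6, x7, x8]"])
  show "\<exists>x. (case x of (x1, x2, x3, x4, x5, x6, x7, x8) \<Rightarrow> [x1, x2, x3, x4, x5, x6, x7, x8]) = xs"
    if "length xs = 8" for xs :: "int list"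
    using that by (auto simp: eval_nat_numeral length_Suc_conv)
qed (auto intro!: injI simp: E8_form_def add_diff_eq add.assoc)

section \<open>Orthogonal complements of isotropic planes\<close>

abbreviation perp2 :: "('a \<Rightarrow> 'a \<Rightarrow> int) \<Rightarrow> 'a \<Rightarrow> 'a \<Rightarrow> 'a set" where
  "perp2 b e f \<equiv> {x. b x e = 0 \<and> b x f = 0}"

lemma isometric_perp2:
  assumes "isom b c g"
  shows "isometric (lat (perp2 b e f) b) (lat (perp2 c (g e) (g f)) c)"
  by (rule isometric_isom[OF assms]) (simp add: isom_form[OF assms])

text \<open>Orthogonality to the first vector means x2 = 0, and orthogonality to the second
  determines x1 from x1 d = - b(y, w). So the complement projects onto those y for which this
  equation is solvable, and isometrically, because x1 enters the form only through its product with
  x2.\<close>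

lemma perp2_hyp:
  assumes "even_form b" and d: "d \<noteq> 0"
  shows "isometric (lat (perp2 (hyp b) (1, 0, 0) (p, d, w)) (hyp b)) (lat {y. d dvd b y w} b)"
proof -
  interpret even_form b by fact
  let ?P = "perp2 (hyp b) (1, 0, 0) (p, d, w)"
  have P: "(x1, x2, y) \<in> ?P \<longleftrightarrow> x2 = 0 \<and> x1 * d + b y w = 0" for x1 x2 y
    by auto
  show ?thesis
  proof (rule isometricI[where f = "\<lambda>(x1, x2, y). y"])
    have "inj_on (\<lambda>(x1, x2, y). y) ?P"
    proof (rule inj_onI)
      fix u v :: "int \<times> int \<times> 'a" assume "u \<in> ?P" "v \<in> ?P" "(\<lambda>(x1, x2, y). y) u = (\<lambda>(x1, x2, y). y) v"
      then obtain x1 x2 x1' x2' y where uv: "u = (x1, x2, y)" "v = (x1', x2', y)"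
        by (cases u; cases v) auto
      have "x2 = 0" "x2' = 0" "x1 * d = x1' * d"
        using \<open>u \<in> ?P\<close> \<open>v \<in> ?P\<close> unfolding uv P by linarith+
      then show "u = v" using d unfolding uv by simp
    qed
    moreover have "(\<lambda>(x1, x2, y). y) ` ?P = {y. d dvd b y w}"
    proof
      show "(\<lambda>(x1, x2, y). y) ` ?P \<subseteq> {y. d dvd b y w}"
      proof clarify
        fix x1 x2 y assume "hyp b (x1, x2, y) (1, 0, 0) = 0" "hyp b (x1, x2, y) (p, d, w) = 0"
        then have "b y w = d * (- x1)" by (auto simp: algebra_simps)
        then show "d dvd b y w" by (rule dvdI)
      qed
      show "{y. d dvd b y w} \<subseteq> (\<lambda>(x1, x2, y). y) ` ?P"
      proof clarify
        fix y assume "d dvd b y w"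
        then obtain k where "b y w = d * k" by (rule dvdE)
        then have "(- k, 0, y) \<in> ?P" unfolding P by (simp add: mult.commute)
        then show "y \<in> (\<lambda>(x1, x2, y). y) ` ?P" by (rule rev_image_eqI) simp
      qed
    qed
    ultimately show "bij_betw (\<lambda>(x1, x2, y). y) (carrier (lat ?P (hyp b))) (carrier (lat {y. d dvd b y w} b))"
      by (simp add: bij_betw_def)
    show "(\<lambda>(x1, x2, y). y) (u \<otimes>\<^bsub>lat ?P (hyp b)\<^esub> v) =
        (\<lambda>(x1, x2, y). y) u \<otimes>\<^bsub>lat {y. d dvd b y w} b\<^esub> (\<lambda>(x1, x2, y). y) v" for u v
      by (cases u; cases v) simp
    show "form (lat {y. d dvd b y w} b) ((\<lambda>(x1, x2, y). y) u) ((\<lambda>(x1, x2, y). y) v) =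
        form (lat ?P (hyp b)) u v" if "u \<in> carrier (lat ?P (hyp b))" "v \<in> carrier (lat ?P (hyp b))" for u v
      using that by (cases u; cases v) auto
  qed
qed

section \<open>The lattice of a manifold of K3n-type and complements in it\<close>

type_synonym 'n k3n_space = "int \<times> int \<times> int \<times> int \<times> int \<times> int \<times> 'n \<times> int"

text \<open>Here \<open>nf\<close> stands for \<open>E\<^sub>8 \<oplus> E\<^sub>8\<close>, of whose unimodularity only the consequence modulo 2 is
  used, and \<open>m = n - 1\<close>; so \<open>lf\<close> is the form of \<open>H\<^sup>2(X, \<int>)\<close>, and \<open>kf\<close> that of the complement of a
  hyperbolic plane in it.\<close>

locale K3n_form = N: even_form nf for nf :: "'n::ab_group_add \<Rightarrow> 'n \<Rightarrow> int" +
  fixes m :: int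
  assumes halve: "(\<And>y. even (nf x y)) \<Longrightarrow> \<exists>y. x = zmul 2 y"
    and m: "1 \<le> m" "m \<le> 4"
begin

abbreviation mf :: "'n \<times> int \<Rightarrow> 'n \<times> int \<Rightarrow> int" where
  "mf \<equiv> orth_sum nf (rank1_form (- (2 * m)))"

abbreviation kf :: "int \<times> int \<times> int \<times> int \<times> 'n \<times> int \<Rightarrow> int \<times> int \<times> int \<times> int \<times> 'n \<times> int \<Rightarrow> int" where
  "kf \<equiv> hyp (hyp mf)"

abbreviation lf :: "'n k3n_space \<Rightarrow> 'n k3n_space \<Rightarrow> int" where
  "lf \<equiv> hyp kf"

lemma even_form_mf: "even_form mf"
proof (rule even_form_orth_sum[OF N.even_form_axioms])
  show "even_form (rank1_form (- (2 * m)))"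
    by unfold_locales (simp_all add: rank1_form_def algebra_simps)
qed

sublocale M: even_form mf by (rule even_form_mf)
sublocale H: even_form "hyp mf" by (rule even_form_hyp) (rule even_form_mf)
sublocale K: even_form kf by (rule even_form_hyp) (rule H.even_form_axioms)
sublocale L: even_form lf by (rule even_form_hyp) (rule K.even_form_axioms)

lemma isotropic_normal_form:
  assumes "lf e e = 0" "lf e z = 1"
  shows "\<exists>g. isom lf lf g \<and> g e = (1, 0, 0)"
  using eichler[OF H.even_form_axioms assms(2)] assms(1) by (simp add: zero_prod_def)

text \<open>The coordinate d of \<open>perp2_hyp\<close> is the product of e and f, here 1. The
  divisibility condition is void and the complement is all of \<open>kf\<close>.\<close>

lemma perp_of_U:
  assumes e: "lf e e = 0" and ef: "lf e f = 1"
  shows "isometric (lat (perp2 lf e f) lf) (lat UNIV kf)"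
proof -
  obtain g where g: "isom lf lf g" "g e = (1, 0, 0)"
    using isotropic_normal_form[OF e ef] by blast
  obtain p d w where gf: "g f = (p, d, w)" by (cases "g f") auto
  have "lf (g e) (g f) = 1" using isom_form[OF g(1)] ef by metis
  then have d: "d = 1" by (simp add: g(2) gf)
  show ?thesis
    using isometric_trans[OF isometric_perp2[OF g(1), of e f]] perp2_hyp[OF K.even_form_axioms, of 1 p w]
    by (simp add: g(2) gf d)
qed

text \<open>Modulo 2 the planes and \<open>nf\<close> are unimodular, while <-2m> vanishes. So its
  generator, the last unit vector, spans the radical modulo 2.\<close>

lemma kf_even:
  assumes "\<And>y. even (kf y w)"
  shows "\<exists>k u. w = zmul k (0, 0, 0, 0, 0, 1) + zmul 2 u"
proof -
  obtain a1 a2 c1 c2 x k where w: "w = (a1, a2, c1, c2, x, k)" by (metis prod_cases6)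
  have "even a1" "even a2" "even c1" "even c2"
    using assms[of "(0, 1, 0)"] assms[of "(1, 0, 0)"] assms[of "(0, 0, 0, 1, 0)"]
      assms[of "(0, 0, 1, 0, 0)"] by (simp_all add: w)
  moreover have "even (nf x y)" for y
    using assms[of "(0, 0, 0, 0, y, 0)"] N.sym[of y x] by (simp add: w rank1_form_def)
  then obtain x' where "x = zmul 2 x'" using halve by blast
  ultimately have "w = zmul k (0, 0, 0, 0, 0, 1) + zmul 2 (a1 div 2, a2 div 2, c1 div 2, c2 div 2, x', 0)"
    by (simp add: w)
  then show ?thesis by blast
qed

text \<open>With e brought to (1, 0, 0), the complement consists of the y whose product with the
  component w of f is even. Either w is even on everything: then the complement is all of
  \<open>kf\<close>, and w is congruent modulo 2 to the generator of <-2m>, which ties the parity of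
  m to the norm of f. Or w has the normal form (1, s, 0) modulo 2.\<close>

lemma perp_div_1:
  assumes e: "lf e e = 0" and ef: "lf e f = 2" and z: "odd (lf e z)"
    and pure: "\<And>k y. f \<noteq> zmul k e + zmul 2 y"
  shows "(\<exists>s\<in>{0, 1}. (even s \<longleftrightarrow> 4 dvd lf f f) \<and>
      isometric (lat (perp2 lf e f) lf) (lat {y. even (kf y (1, s, 0))} kf)) \<or>
    (even m \<longleftrightarrow> 4 dvd lf f f) \<and> isometric (lat (perp2 lf e f) lf) (lat UNIV kf)"
proof -
  obtain k where k: "lf e z = 2 * k + 1" using z by (rule oddE)
  \<comment> \<open>The odd product of e and z is corrected to 1 by multiples of f, whose product
    with e is 2.\<close>
  have "lf e (z - zmul k f) = 1" by (simp add: L.diff_right L.zmul_right k ef)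
  then obtain g where g: "isom lf lf g" "g e = (1, 0, 0)"
    using isotropic_normal_form[OF e] by blast
  obtain p d w where gf: "g f = (p, d, w)" by (cases "g f") auto
  have "lf (g e) (g f) = 2" using isom_form[OF g(1)] ef by metis
  then have d: "d = 2" by (simp add: g(2) gf)
  have iso: "isometric (lat (perp2 lf e f) lf) (lat {y. even (kf y w)} kf)"
    using isometric_trans[OF isometric_perp2[OF g(1), of e f]] perp2_hyp[OF K.even_form_axioms, of 2 p w]
    by (simp add: g(2) gf d)
  have "lf f f = lf (g f) (g f)" using isom_form[OF g(1)] by metis
  then have ff: "lf f f = 4 * p + kf w w" by (simp add: gf d)
  show ?thesis
  proof (cases "\<forall>y. even (kf y w)")
    case True
    then obtain k u where w: "w = zmul k (0, 0, 0, 0, 0, 1) + zmul 2 u" using kf_even by blast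
    \<comment> \<open>Otherwise w is twice a vector and f is a multiple of e plus twice a vector,
      contrary to \<open>pure\<close>.\<close>
    have "odd k"
    proof
      assume "even k"
      then obtain k' where k': "k = 2 * k'" by (rule evenE)
      have w2: "w = zmul 2 (zmul k' (0, 0, 0, 0, 0, 1) + u)"
        unfolding w k' by (simp only: zmul_add_right zmul_zmul)
      obtain y where y: "g y = (0, 1, zmul k' (0, 0, 0, 0, 0, 1) + u)"
        using isom_bij[OF g(1)] by (metis bij_pointE)
      have "g f = g (zmul p e + zmul 2 y)"
        unfolding isom_add[OF g(1)] isom_zmul[OF g(1)] g(2) gf d y w2
        by (simp add: zmul_add_right)
      then have "f = zmul p e + zmul 2 y"
        using isom_bij[OF g(1)] by (metis bij_pointE)
      then show False using pure by blast
    qed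
    have "kf w w = kf (zmul k (0, 0, 0, 0, 0, 1)) (zmul k (0, 0, 0, 0, 0, 1)) +
        4 * (kf (zmul k (0, 0, 0, 0, 0, 1)) u + kf u u)"
      unfolding w by (rule K.norm_add_zmul_2)
    moreover have "kf (zmul k (0, 0, 0, 0, 0, 1)) (zmul k (0, 0, 0, 0, 0, 1)) = - (2 * m * (k * k))"
      by (simp add: rank1_form_def)
    ultimately obtain r where "kf w w = - (2 * m * (k * k)) + 4 * r" by metis
    moreover obtain j where "k = 2 * j + 1" using \<open>odd k\<close> by (rule oddE)
    ultimately have "lf f f = 4 * (p + r - 2 * m * j * j - 2 * m * j) - 2 * m"
      unfolding ff by (simp add: algebra_simps)
    moreover have "even m \<longleftrightarrow> 4 dvd 4 * x - 2 * m" for x by presburger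
    ultimately have "even m \<longleftrightarrow> 4 dvd lf f f" by metis
    moreover have "{y. even (kf y w)} = UNIV" using True by auto
    ultimately show ?thesis using iso by simp
  next
    case False
    then obtain y where "odd (kf y w)" by blast
    then have "odd (kf w y)" using K.sym by metis
    then obtain h s u where h: "isom kf kf h" "h w = (1, s, 0) + zmul 2 u" "s \<in> {0, 1}"
      "even s \<longleftrightarrow> 4 dvd kf w w"
      using isom_normal_form_mod_2[OF even_form_mf] by blast
    have "even (kf (h y) (1, s, 0)) \<longleftrightarrow> even (kf y w)" for y
    proof -
      have "kf y w = kf (h y) (h w)" using isom_form[OF h(1)] by simp
      also have "\<dots> = kf (h y) (1, s, 0) + 2 * kf (h y) u"
        unfolding h(2) K.add_right K.zmul_right ..
      finally show ?thesis by simp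
    qed
    then have "isometric (lat {y. even (kf y w)} kf) (lat {y. even (kf y (1, s, 0))} kf)"
      by (intro isometric_isom[OF h(1)]) simp
    then have "isometric (lat (perp2 lf e f) lf) (lat {y. even (kf y (1, s, 0))} kf)"
      using isometric_trans[OF iso] by blast
    moreover have "even s \<longleftrightarrow> 4 dvd lf f f"
      unfolding h(4) ff by (simp add: dvd_add_right_iff)
    ultimately show ?thesis using h(3) by blast
  qed
qed

end

text \<open>Additivity and the form are checked for the inverse g only. In the applications g is
  polynomial in the coordinates, whereas f may contain divisions that are exact only on C.\<close>

lemma isometric_lat_inverseI:
  assumes "\<And>x. x \<in> C \<Longrightarrow> f x \<in> D" "\<And>y. y \<in> D \<Longrightarrow> g y \<in> C"
    and "\<And>x. x \<in> C \<Longrightarrow> g (f x) = x" "\<And>y. y \<in> D \<Longrightarrow> f (g y) = y"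
    and g: "\<And>x y. g (x + y) = g x + g y" "\<And>x y. b (g x) (g y) = c x y"
    and D: "\<And>x y. x \<in> D \<Longrightarrow> y \<in> D \<Longrightarrow> x + y \<in> D"
  shows "isometric (lat C b) (lat D c)"
proof (rule isometricI[where f = f])
  show "bij_betw f (carrier (lat C b)) (carrier (lat D c))"
    using assms(1-4) by (intro bij_betwI[where g = g]) auto
  show "f (x \<otimes>\<^bsub>lat C b\<^esub> y) = f x \<otimes>\<^bsub>lat D c\<^esub> f y"
    if "x \<in> carrier (lat C b)" "y \<in> carrier (lat C b)" for x y
    using that assms(1,3,4) g(1)[of "f x" "f y"] D[of "f x" "f y"] assms(4)[of "f x + f y"] by simp
  show "form (lat D c) (f x) (f y) = form (lat C b) x y"
    if "x \<in> carrier (lat C b)" "y \<in> carrier (lat C b)" for x y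
    using that assms(3) g(2)[of "f x" "f y"] by simp
qed

lemma isom_orth_sum:
  assumes "isom b b' f" "isom c c' g"
  shows "isom (orth_sum b c) (orth_sum b' c') (\<lambda>(x, y). (f x, g y))"
proof (rule isomI[where g = "\<lambda>(x, y). (inv_into UNIV f x, inv_into UNIV g y)"])
  have "inv_into UNIV f (f x) = x" "f (inv_into UNIV f y) = y" for x y
    using isom_bij[OF assms(1)] by (simp_all add: bij_is_inj bij_is_surj surj_f_inv_f)
  moreover have "inv_into UNIV g (g x) = x" "g (inv_into UNIV g y) = y" for x y
    using isom_bij[OF assms(2)] by (simp_all add: bij_is_inj bij_is_surj surj_f_inv_f)
  ultimately show "(case case x of (x, y) \<Rightarrow> (f x, g y) of (x, y) \<Rightarrow> (inv_into UNIV f x, inv_into UNIV g y)) = x"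
    "(case case y of (x, y) \<Rightarrow> (inv_into UNIV f x, inv_into UNIV g y) of (x, y) \<Rightarrow> (f x, g y)) = y" for x y
    by (simp_all split: prod.split)
qed (auto simp: isom_add[OF assms(1)] isom_add[OF assms(2)] isom_form[OF assms(1)] isom_form[OF assms(2)])

section \<open>The possible complements and isotropic vectors of divisibility two\<close>

context K3n_form
begin

abbreviation S2 where "S2 \<equiv> orth_sum (plane_form 1) (orth_sum (plane_form 2) mf)"

abbreviation S3 where
  "S3 \<equiv> orth_sum (plane_form 1) (orth_sum nf (orth_sum (rank1_form 2)
     (orth_sum (rank1_form (- 2)) (rank1_form (- (2 * m))))))"

definition form3 :: "int \<times> int \<times> int \<Rightarrow> int \<times> int \<times> int \<Rightarrow> int" where
  "form3 = (\<lambda>(x1, x2, x3) (y1, y2, y3). x1 * (y2 - 2 * y1) + x2 * (y1 - 2 * y2 + y3) + x3 * (y2 + 2 * y3))"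

abbreviation S6 where "S6 \<equiv> orth_sum (plane_form 1) (orth_sum nf form3)"

text \<open>The condition says that a2 is even; halving it turns the first plane into U(2).\<close>

lemma isometric_S2: "isometric (lat {y. even (kf y (1, 0, 0))} kf) (lat UNIV S2)"
  by (rule isometric_lat_inverseI[where f = "\<lambda>(a1, a2, c1, c2, x). ((c1, c2), (a1, a2 div 2), x)"
        and g = "\<lambda>((c1, c2), (a1, a2), x). (a1, 2 * a2, c1, c2, x)"])
    (auto simp: plane_form_def zero_prod_def algebra_simps)

text \<open>The condition says that a1 and a2 have the same parity. In terms of their half sum p and
  half difference q, the norm 2 a1 a2 of the plane becomes 2p^2 - 2q^2.\<close>

lemma isometric_S3: "isometric (lat {y. even (kf y (1, 1, 0))} kf) (lat UNIV S3)"
proof -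
  have "(a1 + a2) div 2 + (a1 - a2) div 2 = a1" "(a1 + a2) div 2 - (a1 - a2) div 2 = a2"
    if "even a1 \<longleftrightarrow> even a2" for a1 a2 :: int
    using that by presburger+
  then show ?thesis
    by (intro isometric_lat_inverseI[where
      f = "\<lambda>(a1, a2, c1, c2, x, k). ((c1, c2), x, (a1 + a2) div 2, (a1 - a2) div 2, k)"
      and g = "\<lambda>((c1, c2), x, p, q, k). (p + q, p - q, c1, c2, x, k)"])
      (auto simp: plane_form_def rank1_form_def zero_prod_def algebra_simps)
qed

text \<open>The divisor of e must be 2, so the component v is twice a vector plus k times the
  generator of <-2m>, with k odd because e is not twice a vector. A transvection reduces v to that
  generator and e to (2, t, 0, ..., 1). Isotropy reads 4t = 2m, and t is a product with e, hence
  even. As m is at most 4, this leaves m = 4 and t = 2.\<close>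

lemma div_2_normal_form:
  assumes e: "lf e e = 0" and ef: "lf e f = 2" and ev: "\<And>z. even (lf e z)"
    and pure: "\<And>y. e \<noteq> zmul 2 y"
  shows "m = 4 \<and> (\<exists>g. isom lf lf g \<and> g e = (2, 2, 0, 0, 0, 0, 0, 1))"
proof -
  obtain g a a' v where g: "isom lf lf g" "g e = (a, a', 0, 0, v)" "0 \<le> a" "a dvd a'"
    and av: "\<And>y. a dvd hyp mf v y"
    using eichler_divisor[OF H.even_form_axioms, of e] by blast
  have lfg: "lf (g x) (g y) = lf x y" for x y using isom_form[OF g(1)] .
  have ev': "even (lf (g e) z)" for z
  proof -
    obtain y where "g y = z" using isom_bij[OF g(1)] by (metis bij_pointE)
    then show ?thesis using ev[of y] lfg[of e y] by simp
  qed
  have "a dvd lf (g e) z" for z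
  proof -
    obtain z1 z2 c1 c2 u where z: "z = (z1, z2, c1, c2, u)" by (metis prod_cases5)
    have "lf (g e) z = a * z2 + a' * z1 + hyp mf v u" by (simp add: g(2) z)
    then show ?thesis using g(4) av[of u] by simp
  qed
  then have "a dvd 2" using lfg[of e f] ef by metis
  moreover have "even a"
    using ev'[of "(0, 1, 0, 0, 0)"] by (simp add: g(2))
  ultimately have a: "a = 2"
    using g(3) zdvd_imp_le[of a 2] by (cases "a = 0 \<or> a = 1") auto
  obtain x1 x2 x k where v: "v = (x1, x2, x, k)" by (metis prod_cases4)
  have "even x1" "even x2"
    using av[of "(0, 1, 0, 0)"] av[of "(1, 0, 0, 0)"] by (simp_all add: a v)
  moreover have "even (nf x y)" for y
    using av[of "(0, 0, y, 0)"] by (simp add: a v)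
  then obtain x' where x: "x = zmul 2 x'" using halve by blast
  ultimately have v': "v = zmul 2 (x1 div 2, x2 div 2, x', 0) + (0, 0, 0, k)"
    by (simp add: v)
  have "odd k"
  proof
    assume "even k"
    obtain y where y: "g y = (1, a' div 2, 0, 0, x1 div 2, x2 div 2, x', k div 2)"
      using isom_bij[OF g(1)] by (metis bij_pointE)
    have "even a'" using g(4) a by simp
    have "g e = g (zmul 2 y)"
      unfolding isom_zmul[OF g(1)] y g(2) v x
      using \<open>even k\<close> \<open>even a'\<close> \<open>even x1\<close> \<open>even x2\<close> by (simp add: a)
    then have "e = zmul 2 y"
      using isom_bij[OF g(1)] by (metis bij_pointE)
    then show False using pure by blast
  qed
  define w where "w = (x1 div 2, x2 div 2, x', k div 2)"
  have vw: "v - zmul 2 w = (0, 0, 0, 1)"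
    using \<open>odd k\<close> \<open>even x1\<close> \<open>even x2\<close> by (simp add: v x w_def minus_mod_eq_mult_div [symmetric] odd_iff_mod_2_eq_one)
  have [simp]: "hyp mf (0, 0, 0, 0) u = 0" for u
    using H.zero_left[of u] unfolding zero_prod_def .
  have [simp]: "x - (0, 0, 0, 0) = x" for x :: "int \<times> int \<times> 'n \<times> int"
    by (cases x rule: prod_cases4) simp
  \<comment> \<open>The vector (0, 1, 0) has product a = 2 with \<open>g e\<close>, so this
    transvection subtracts 2w from v.\<close>
  define h where "h = transvection lf (0, 1, 0) (0, 0, 0, 0, - w)"
  have h: "isom lf lf h"
    unfolding h_def by (rule L.isom_transvection) (simp_all add: zero_prod_def)
  obtain t where t: "h (g e) = (2, t, 0, 0, 0, 0, 0, 1)"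
    using vw by (simp add: h_def g(2) a transvection_def zero_prod_def zmul_minus_right)
  have "lf (h (g e)) (h (g e)) = 0"
    using e lfg isom_form[OF h] by simp
  then have m2: "m = 2 * t"
    by (simp add: t rank1_form_def)
  have "even t"
  proof -
    obtain y where y: "h y = (1, 0, 0)" using isom_bij[OF h] by (metis bij_pointE)
    have "even (lf (h (g e)) (h y))" using ev'[of y] isom_form[OF h] by simp
    then show ?thesis by (simp add: t y zero_prod_def rank1_form_def)
  qed
  then have "m = 4" "t = 2" using m2 m by presburger+
  then show ?thesis
    using t isom_comp[OF g(1) h] by (metis (no_types, lifting))
qed

end

text \<open>U plus <-8>: the first plane together with <-2m> for m = 4. The normal form (2, 2, 1) of
  a vector of divisibility 2 lies in it.\<close>

definition tri :: "int \<times> int \<times> int \<Rightarrow> int \<times> int \<times> int \<Rightarrow> int" where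
  "tri = (\<lambda>(a, b, k) (a', b', k'). a * b' + b * a' - 8 * k * k')"

lemma tri_simp [simp]: "tri (a, b, k) (a', b', k') = a * b' + b * a' - 8 * k * k'"
  by (simp add: tri_def)

lemma even_form_tri: "even_form tri"
proof
  show "tri (x + y) z = tri x z + tri y z" for x y z
    by (cases x rule: prod_cases3; cases y rule: prod_cases3; cases z rule: prod_cases3)
      (simp add: algebra_simps)
  show "tri x y = tri y x" for x y
    by (cases x rule: prod_cases3; cases y rule: prod_cases3) simp
  show "even (tri x x)" for x
    by (cases x rule: prod_cases3) simp
qed

context K3n_form
begin

abbreviation pf where "pf \<equiv> hyp (hyp nf)"

abbreviation qf where "qf \<equiv> orth_sum tri pf"

sublocale P: even_form pf
  by (rule even_form_hyp) (rule even_form_hyp, rule N.even_form_axioms)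

sublocale Q: even_form qf
  by (rule even_form_orth_sum[OF even_form_tri P.even_form_axioms])

text \<open>Without the summand <-2m> the form is unimodular modulo 2, so such a w is twice a
  vector.\<close>

lemma pf_even:
  assumes "\<And>y. even (pf w y)"
  shows "4 dvd pf w w"
proof -
  obtain a1 a2 c1 c2 x where w: "w = (a1, a2, c1, c2, x)" by (metis prod_cases5)
  have "even a1" "even a2" "even c1" "even c2"
    using assms[of "(0, 1, 0, 0, 0)"] assms[of "(1, 0, 0, 0, 0)"] assms[of "(0, 0, 0, 1, 0)"]
      assms[of "(0, 0, 1, 0, 0)"] by (simp_all add: w)
  moreover have "even (nf x y)" for y
    using assms[of "(0, 0, 0, 0, y)"] by (simp add: w)
  then obtain x' where "x = zmul 2 x'" using halve by blast
  ultimately have "w = 0 + zmul 2 (a1 div 2, a2 div 2, c1 div 2, c2 div 2, x')"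
    by (simp add: w)
  then show ?thesis using P.norm_add_zmul_2[of 0] by fastforce
qed

text \<open>Orthogonality means a + b = 4k and a + c + d = 0, so c, d and k are free and determine a
  and b. The coordinates r, s, t on this rank three part are those in which the form becomes
  \<open>form3\<close>.\<close>

lemma perp2_qf:
  "isometric (lat (perp2 qf ((2, 2, 1), 0) ((0, 1, 0), (1, 1, 0))) qf) (lat UNIV S6)"
  by (rule isometric_lat_inverseI[where
    f = "\<lambda>((a, b, k), c, d, z1, z2, x). ((z1, z2), x, c + k, - d - 2 * k, - k)" and
    g = "\<lambda>((z1, z2), x, r, s, t). ((s - r - 3 * t, r - s - t, - t), r + t, 2 * t - s, z1, z2, x)"])
    (auto simp: zero_prod_def plane_form_def form3_def algebra_simps)

lemma isom_lf_qf:
  assumes "m = 4"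
  shows "isom lf qf (\<lambda>(a, b, c1, c2, d1, d2, x, k). ((a, b, k), c1, c2, d1, d2, x))"
  by (rule isomI[where g = "\<lambda>((a, b, k), c1, c2, d1, d2, x). (a, b, c1, c2, d1, d2, x, k)"])
    (auto simp: rank1_form_def assms)

text \<open>The complement depends on f only modulo e. So a multiple of e is removed from f, the
  part w outside \<open>tri\<close> is brought to (1, 1, 0) modulo 2, and even remainders are
  cleared by a transvection fixing e. What is left is one parity, and its two values are exchanged
  by a symmetry fixing e.\<close>

lemma perp_div_2_odd:
  assumes e: "lf e e = 0" and ef: "lf e f = 2" and ev: "\<And>z. even (lf e z)"
    and pure: "\<And>y. e \<noteq> zmul 2 y" and ff: "\<not> 4 dvd lf f f"
  shows "m = 4 \<and> isometric (lat (perp2 lf e f) lf) (lat UNIV S6)"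
proof -
  let ?e = "((2, 2, 1), 0) :: (int \<times> int \<times> int) \<times> int \<times> int \<times> int \<times> int \<times> 'n"
  obtain g0 where m4: "m = 4" and g0: "isom lf lf g0" "g0 e = (2, 2, 0, 0, 0, 0, 0, 1)"
    using div_2_normal_form[OF e ef ev pure] by blast
  obtain g where g: "isom lf qf g" "g e = ?e"
    using isom_comp[OF g0(1) isom_lf_qf[OF m4]] g0(2) by (auto simp: zero_prod_def)
  obtain f1 f2 f3 w where gf: "g f = ((f1, f2, f3), w)" by (metis prod_cases3)
  have "qf (g e) (g f) = 2" using isom_form[OF g(1)] ef by metis
  then have f2: "f2 = 1 - f1 + 4 * f3" by (simp add: g(2) gf)
  define f' where "f' = ((f1 - 2 * f3, 1 - f1 + 2 * f3, 0 :: int), w)"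
  have gf': "g f = f' + zmul f3 ?e"
    by (simp add: gf f'_def f2)
  have qe: "qf ?e ?e = 0" and qef: "qf ?e f' = 2" by (simp_all add: f'_def)
  have P1: "perp2 qf (g e) (g f) = perp2 qf ?e f'"
    unfolding gf' g(2) Q.add_right Q.zmul_right by auto
  have "lf f f = qf (g f) (g f)" using isom_form[OF g(1)] by metis
  also have "\<dots> = qf f' f' + 4 * f3"
    unfolding gf' using qe qef Q.sym[of f' ?e] by (simp only: Q.add_left Q.add_right Q.zmul_left Q.zmul_right) simp
  finally have "\<not> 4 dvd qf f' f'" using ff by (simp add: dvd_add_left_iff)
  moreover have "qf f' f' = 2 * ((f1 - 2 * f3) * (1 - (f1 - 2 * f3))) + pf w w"
    by (simp add: f'_def algebra_simps)
  \<comment> \<open>Hence the \<open>tri\<close> part of f' has norm divisible by 4, and the norm of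
    w inherits from f that it is not.\<close>
  moreover have "even (j * (1 - j))" for j :: int by simp
  then obtain r where "(f1 - 2 * f3) * (1 - (f1 - 2 * f3)) = 2 * r" by (meson dvdE)
  ultimately have ww: "\<not> 4 dvd pf w w" by (simp add: dvd_add_right_iff)
  then obtain y where "odd (pf w y)" using pf_even by blast
  then obtain h s u where h: "isom pf pf h" "h w = (1, s, 0) + zmul 2 u" "s \<in> {0, 1}"
    "even s \<longleftrightarrow> 4 dvd pf w w"
    using isom_normal_form_mod_2[OF N.even_form_axioms] by blast
  have s: "s = 1" using h(3,4) ww by auto
  define H where "H = (\<lambda>(x :: int \<times> int \<times> int, y). (x, h y))"
  have H: "isom qf qf H"
    unfolding H_def using isom_orth_sum[OF isom_id h(1)] .
  define j where "j = f1 - 2 * f3"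
  \<comment> \<open>Chosen orthogonal to (2, 2, 1). Adding 2(d, - u) replaces j by its remainder
    modulo 2 and cancels 2u; the factor 2 is the product of e and \<open>H f'\<close>.\<close>
  define d where "d = (- (j div 2), j div 2, 0 :: int)"
  define T where "T = transvection qf ?e (d, - u)"
  have T: "isom qf qf T"
    unfolding T_def by (rule Q.isom_transvection) (use qe in \<open>simp_all add: d_def\<close>)
  have qed': "qf (d, - u) ?e = 0" "qf ?e (d, - u) = 0" by (simp_all add: d_def)
  have He: "H ?e = ?e"
    using additive.zero[OF isom_additive[OF h(1)]] by (simp add: H_def)
  have Te: "T ?e = ?e"
    unfolding T_def transvection_def qed' qe by simp
  have "H f' = ((j, 1 - j, 0), (1, 1, 0) + zmul 2 u)"
    by (simp add: H_def f'_def h(2) s j_def)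
  moreover have "qf ?e (H f') = 2" using isom_form[OF H, of ?e f'] qef He by simp
  moreover obtain t where "T (H f') = H f' + zmul (qf ?e (H f')) (d, - u) + zmul t ?e"
    unfolding T_def transvection_alt by blast
  ultimately have "T (H f') = ((j, 1 - j, 0), (1, 1, 0) + zmul 2 u) + zmul 2 (d, - u) + zmul t ?e"
    by simp
  moreover have "((j, 1 - j, 0), (1, 1, 0) + zmul 2 u) + zmul 2 (d, - u) = ((j mod 2, 1 - j mod 2, 0), (1, 1, 0))"
    by (simp add: d_def zmul_minus_right minus_mult_div_eq_mod[symmetric])
  ultimately have THf: "T (H f') = ((j mod 2, 1 - j mod 2, 0), (1, 1, 0)) + zmul t ?e" by simp
  have P2: "perp2 qf (T (H ?e)) (T (H f')) = perp2 qf ?e ((j mod 2, 1 - j mod 2, 0), (1, 1, 0))"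
    unfolding THf He Te Q.add_right Q.zmul_right by auto
  have i1: "isometric (lat (perp2 lf e f) lf) (lat (perp2 qf ?e f') qf)"
    using isometric_perp2[OF g(1), of e f] unfolding P1 .
  have i2: "isometric (lat (perp2 qf ?e f') qf) (lat (perp2 qf ?e ((j mod 2, 1 - j mod 2, 0), (1, 1, 0))) qf)"
    using isometric_perp2[OF isom_comp[OF H T], of ?e f'] unfolding P2 .
  have i3: "isometric (lat (perp2 qf ?e ((j mod 2, 1 - j mod 2, 0), (1, 1, 0))) qf) (lat UNIV S6)"
  proof (cases "even j")
    case True
    then have "j mod 2 = 0" by simp
    then show ?thesis using perp2_qf by simp
  next
    case False
    then have j: "j mod 2 = 1" by presburger
    \<comment> \<open>Exchanging a and b fixes (2, 2, 1) and interchanges the two parities of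
      j.\<close>
    have sw: "isom qf qf (\<lambda>((a, b, k), x). ((b, a, k), x))"
      by (rule isomI[where g = "\<lambda>((a, b, k), x). ((b, a, k), x)"]) auto
    show ?thesis
      using isometric_trans[OF isometric_perp2[OF sw, of ?e "((1, 0, 0), (1, 1, 0))"]] perp2_qf j by simp
  qed
  show ?thesis using m4 isometric_trans[OF i1 isometric_trans[OF i2 i3]] by blast
qed

text \<open>In the normal form of e, the equation (e, f) = 2 reads b1 + b2 - 4k = 1, so the
  coordinates b1 and b2 of f cannot both be even. Thus a pair spanning U(2) always contains a vector
  with an odd product, and divisibility 2 gives nothing new for U(2).\<close>

lemma other_isotropic_odd:
  assumes e: "lf e e = 0" and f: "lf f f = 0" and ef: "lf e f = 2" and ev: "\<And>z. even (lf e z)"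
    and pure: "\<And>y. e \<noteq> zmul 2 y"
  shows "\<exists>z. odd (lf f z)"
proof (rule ccontr)
  assume "\<not> ?thesis"
  then have evf: "even (lf f z)" for z by blast
  obtain g where m4: "m = 4" and g: "isom lf lf g" "g e = (2, 2, 0, 0, 0, 0, 0, 1)"
    using div_2_normal_form[OF e ef ev pure] by blast
  obtain b1 b2 c1 c2 d1 d2 x k where gf: "g f = (b1, b2, c1, c2, d1, d2, x, k)"
    by (metis prod_cases6 prod_cases3)
  have ev': "even (lf (g f) z)" for z
  proof -
    obtain y where "g y = z" using isom_bij[OF g(1)] by (metis bij_pointE)
    then show ?thesis using evf[of y] isom_form[OF g(1), of f y] by simp
  qed
  have "even b1" "even b2"
    using ev'[of "(0, 1, 0, 0, 0, 0, 0, 0)"] ev'[of "(1, 0, 0, 0, 0, 0, 0, 0)"] by (simp_all add: gf)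
  moreover have "lf (g e) (g f) = 2" using isom_form[OF g(1)] ef by metis
  then have "2 * b1 + 2 * b2 - 8 * k = 2" by (simp add: g(2) gf m4 rank1_form_def)
  ultimately show False by presburger
qed

end

section \<open>Lattices of rank two with a basis, and their classification\<close>

definition basis2 :: "'a::ab_group_add set \<Rightarrow> 'a \<Rightarrow> 'a \<Rightarrow> bool" where
  "basis2 T e f \<longleftrightarrow> bij_betw (\<lambda>(i, j). zmul i e + zmul j f) UNIV T"

lemma basis2_change:
  assumes T: "basis2 T e f" and det: "\<bar>p * s - q * r\<bar> = 1"
  shows "basis2 T (zmul p e + zmul q f) (zmul r e + zmul s f)"
proof -
  define d where "d = p * s - q * r"
  have d: "d * d = 1" using det unfolding d_def[symmetric] by (auto simp: abs_if split: if_splits)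
  have "bij (\<lambda>(i, j). (i * p + j * r, i * q + j * s))"
  \<comment> \<open>The determinant d is its own inverse, so the inverse matrix is d times the
    adjugate.\<close>
  proof (rule o_bij[where g = "\<lambda>(k, l). (d * (s * k - r * l), d * (p * l - q * k))"])
    have 1: "d * (s * (i * p + j * r) - r * (i * q + j * s)) = i * (d * (p * s - q * r))"
      "d * (p * (i * q + j * s) - q * (i * p + j * r)) = j * (d * (p * s - q * r))"
      "d * (s * i - r * j) * p + d * (p * j - q * i) * r = i * (d * (p * s - q * r))"
      "d * (s * i - r * j) * q + d * (p * j - q * i) * s = j * (d * (p * s - q * r))" for i j
      by (simp_all add: algebra_simps)
    show "(\<lambda>(k, l). (d * (s * k - r * l), d * (p * l - q * k))) \<circ> (\<lambda>(i, j). (i * p + j * r, i * q + j * s)) = id"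
      unfolding fun_eq_iff by (simp only: split_paired_All comp_apply prod.case 1 d_def[symmetric] d) simp
    show "(\<lambda>(i, j). (i * p + j * r, i * q + j * s)) \<circ> (\<lambda>(k, l). (d * (s * k - r * l), d * (p * l - q * k))) = id"
      unfolding fun_eq_iff by (simp only: split_paired_All comp_apply prod.case 1 d_def[symmetric] d) simp
  qed
  then have "bij_betw ((\<lambda>(i, j). zmul i e + zmul j f) \<circ> (\<lambda>(i, j). (i * p + j * r, i * q + j * s))) UNIV T"
    using T unfolding basis2_def by (rule bij_betw_trans)
  moreover have "(\<lambda>(i, j). zmul i e + zmul j f) \<circ> (\<lambda>(i, j). (i * p + j * r, i * q + j * s)) =
      (\<lambda>(i, j). zmul i (zmul p e + zmul q f) + zmul j (zmul r e + zmul s f))"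
    by (simp add: fun_eq_iff zmul_add_left zmul_add_right zmul_zmul ac_simps)
  ultimately show ?thesis unfolding basis2_def by simp
qed

lemma basis2_add: "basis2 T e f \<Longrightarrow> basis2 T e (zmul k e + f)"
  using basis2_change[of T e f 1 1 0 k] by simp

lemma basis2_isometric:
  assumes "even_form b" and T: "basis2 T e f"
    and c: "\<And>i j k l. c (i, j) (k, l) = i * k * b e e + (i * l + j * k) * b e f + j * l * b f f"
  shows "isometric (lat T b) (lat UNIV c)"
proof -
  interpret even_form b by fact
  let ?g = "\<lambda>(i, j). zmul i e + zmul j f"
  have g: "bij_betw ?g UNIV T" using T unfolding basis2_def .
  then have inj: "inj ?g" and im: "range ?g = T" by (auto simp: bij_betw_def)
  show ?thesis
  proof (rule isometric_lat_inverseI[where f = "inv_into UNIV ?g" and g = ?g])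
    show "?g y \<in> T" for y using im by blast
    show "?g (inv_into UNIV ?g x) = x" if "x \<in> T" for x using that im by (simp add: f_inv_into_f)
    show "inv_into UNIV ?g (?g y) = y" for y using inj by simp
    show "?g (x + y) = ?g x + ?g y" for x y
      by (cases x; cases y) (simp add: zmul_add_left)
    show "b (?g x) (?g y) = c x y" for x y
      using sym[of f e] by (cases x; cases y) (simp add: c bilin distrib_right distrib_left mult.assoc)
  qed simp_all
qed

text \<open>The quadratic formula: for discriminant r^2 a zero is (r - b : 2a), made primitive by
  dividing out the gcd.\<close>

lemma coprime_isotropic:
  fixes a b c r :: int
  assumes "b\<^sup>2 - 4 * a * c = r\<^sup>2"
  shows "\<exists>x y. coprime x y \<and> a * x\<^sup>2 + b * x * y + c * y\<^sup>2 = 0"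
proof (cases "a = 0")
  case True
  then show ?thesis by (intro exI[of _ 1] exI[of _ 0]) simp
next
  case False
  define g where "g = gcd (r - b) (2 * a)"
  have g0: "g \<noteq> 0" using False by (simp add: g_def)
  obtain x y where x: "r - b = x * g" "2 * a = y * g" "coprime x y"
    using gcd_coprime_exists[of "r - b" "2 * a"] g0 unfolding g_def by auto
  have "(a * x\<^sup>2 + b * x * y + c * y\<^sup>2) * g\<^sup>2 = a * (x * g)\<^sup>2 + b * (x * g) * (y * g) + c * (y * g)\<^sup>2"
    by (simp add: algebra_simps power2_eq_square)
  also have "\<dots> = a * (r\<^sup>2 - (b\<^sup>2 - 4 * a * c))"
    unfolding x(1,2)[symmetric] by (simp add: algebra_simps power2_eq_square)
  also have "\<dots> = 0" using assms by simp
  finally show ?thesis using x(3) g0 by auto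
qed

text \<open>Bezout completes a primitive zero e to a basis e, f. The Gram determinant is preserved,
  and it equals minus the square of the product of e and f since e is isotropic; the sign is
  adjusted by replacing f with - f.\<close>

lemma basis2_isotropic:
  assumes "even_form b" and T: "basis2 T t1 t2"
    and det: "b t1 t1 * b t2 t2 - (b t1 t2)\<^sup>2 = - (r\<^sup>2)" and r: "0 < r"
  shows "\<exists>e f. basis2 T e f \<and> b e e = 0 \<and> b e f = r"
proof -
  interpret even_form b by fact
  obtain a where a: "b t1 t1 = 2 * a" using even by (meson dvdE)
  obtain c where c: "b t2 t2 = 2 * c" using even by (meson dvdE)
  have "(b t1 t2)\<^sup>2 - 4 * a * c = r\<^sup>2" using det by (simp add: a c)
  then obtain x y where xy: "coprime x y" "a * x\<^sup>2 + b t1 t2 * x * y + c * y\<^sup>2 = 0"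
    using coprime_isotropic by blast
  obtain u v where uv: "u * x + v * y = 1"
    using bezout_int[of x y] xy(1) by (metis coprime_iff_gcd_eq_1)
  define e f where "e = zmul x t1 + zmul y t2" and "f = zmul (- v) t1 + zmul u t2"
  have ef: "basis2 T e f"
    unfolding e_def f_def by (rule basis2_change[OF T]) (use uv in \<open>simp add: algebra_simps\<close>)
  have b21: "b t2 t1 = b t1 t2" by (rule sym)
  have ee: "b e e = 0"
  proof -
    have "b e e = 2 * (a * x\<^sup>2 + b t1 t2 * x * y + c * y\<^sup>2)"
      by (simp add: e_def bilin a c b21 power2_eq_square algebra_simps)
    then show ?thesis using xy by simp
  qed
  have "b e e * b f f - (b e f)\<^sup>2 = (b t1 t1 * b t2 t2 - (b t1 t2)\<^sup>2) * (u * x + v * y)\<^sup>2"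
    unfolding e_def f_def by (simp add: bilin b21 power2_eq_square) (simp add: algebra_simps)
  then have "(b e f)\<^sup>2 = r\<^sup>2" using det ee uv by simp
  then have "b e f = r \<or> b e f = - r" by (rule power2_eq_iff[THEN iffD1])
  then show ?thesis
  proof
    assume "b e f = - r"
    moreover have "basis2 T e (- f)"
      using basis2_change[OF ef, of 1 "- 1" 0 0] by (simp add: zmul_minus_left)
    ultimately show ?thesis using ee by (intro exI[of _ e] exI[of _ "- f"]) (simp add: bilin)
  qed (use ef ee in blast)
qed

lemma basis2_pure:
  assumes T: "basis2 T e f" and pure: "\<And>x. zmul 2 x \<in> T \<Longrightarrow> x \<in> T"
    and ij: "zmul i e + zmul j f = zmul 2 y"
  shows "even i \<and> even j"
proof -
  have b: "bij_betw (\<lambda>(i, j). zmul i e + zmul j f) UNIV T" using T unfolding basis2_def .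
  have "zmul 2 y \<in> T"
    unfolding ij[symmetric] using b by (auto simp: bij_betw_def)
  then have "y \<in> T" by (rule pure)
  then obtain k l where y: "y = zmul k e + zmul l f"
    using b by (auto simp: bij_betw_def)
  have "(\<lambda>(i, j). zmul i e + zmul j f) (i, j) = (\<lambda>(i, j). zmul i e + zmul j f) (2 * k, 2 * l)"
    using ij by (simp add: y zmul_add_right zmul_zmul)
  then have "(i, j) = (2 * k, 2 * l)"
    using b unfolding bij_betw_def by (meson UNIV_I inj_onD)
  then show ?thesis by simp
qed

context K3n_form
begin

text \<open>Adding ke to f changes its norm by 2kr. For r = 1 this makes f isotropic and gives U.
  For r = 2 the parity of half the norm survives and distinguishes U(2) from <2> + <-2>. The
  complement then depends on whether e has an odd product with some vector.\<close>

theorem rank_2_classification: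
  assumes T: "basis2 T t1 t2" and pure: "\<And>x. zmul 2 x \<in> T \<Longrightarrow> x \<in> T"
    and det: "lf t1 t1 * lf t2 t2 - (lf t1 t2)\<^sup>2 \<in> {- 1, - 4}"
    and S: "S = {x. \<forall>y\<in>T. lf x y = 0}"
  shows "isometric (lat T lf) (lat UNIV (plane_form 1)) \<and> isometric (lat S lf) (lat UNIV kf)
    \<or> isometric (lat T lf) (lat UNIV (plane_form 2)) \<and> isometric (lat S lf) (lat UNIV S2)
    \<or> isometric (lat T lf) (lat UNIV (orth_sum (rank1_form 2) (rank1_form (- 2)))) \<and>
        isometric (lat S lf) (lat UNIV S3)
    \<or> even m \<and> isometric (lat T lf) (lat UNIV (plane_form 2)) \<and> isometric (lat S lf) (lat UNIV kf)
    \<or> odd m \<and> isometric (lat T lf) (lat UNIV (orth_sum (rank1_form 2) (rank1_form (- 2)))) \<and>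
        isometric (lat S lf) (lat UNIV kf)
    \<or> m = 4 \<and> isometric (lat T lf) (lat UNIV (orth_sum (rank1_form 2) (rank1_form (- 2)))) \<and>
        isometric (lat S lf) (lat UNIV S6)"
proof -
  have S': "S = perp2 lf e f" if "basis2 T e f" for e f
  proof -
    have im: "T = range (\<lambda>(i, j). zmul i e + zmul j f)" using that by (simp add: basis2_def bij_betw_def)
    have "e \<in> T" "f \<in> T"
      unfolding im by (rule range_eqI[of _ _ "(1, 0)"], simp) (rule range_eqI[of _ _ "(0, 1)"], simp)
    moreover have "lf x y = 0" if "lf x e = 0" "lf x f = 0" "y \<in> T" for x y
      using that(3) unfolding im by (auto simp: L.add_right L.zmul_right that(1,2))
    ultimately show ?thesis unfolding S by blast
  qed
  have "\<exists>r\<in>{1, 2}. lf t1 t1 * lf t2 t2 - (lf t1 t2)\<^sup>2 = - (r\<^sup>2)" using det by auto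
  then obtain r where r: "r = 1 \<or> r = 2" "lf t1 t1 * lf t2 t2 - (lf t1 t2)\<^sup>2 = - (r\<^sup>2)" by blast
  moreover have "0 < r" using r(1) by auto
  ultimately obtain e f where ef: "basis2 T e f" "lf e e = 0" "lf e f = r"
    using basis2_isotropic[OF L.even_form_axioms T] by blast
  obtain s where s: "lf f f = 2 * s" using L.even by (meson dvdE)
  have shift: "lf (zmul k e + f) (zmul k e + f) = 2 * (k * r + s)" "lf e (zmul k e + f) = r" for k
    using ef s L.sym[of f e] by (simp_all add: L.add_left L.add_right L.zmul_left L.zmul_right)
  show ?thesis
  proof (cases "r = 1")
    case True
    have "lf (zmul (- s) e + f) (zmul (- s) e + f) = 0" "lf e (zmul (- s) e + f) = 1"
      unfolding shift True by simp_all
    then have "isometric (lat T lf) (lat UNIV (plane_form 1))"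
      using basis2_isometric[OF L.even_form_axioms basis2_add[OF ef(1), of "- s"], of "plane_form 1"] ef(2)
      by (simp add: plane_form_def)
    moreover have "isometric (lat S lf) (lat UNIV kf)"
      unfolding S'[OF ef(1)] using perp_of_U[OF ef(2)] ef(3) True by simp
    ultimately show ?thesis by blast
  next
    case False
    then have r: "r = 2" using r by simp
    show ?thesis
    proof (cases "even s")
      case True
      define f' where "f' = zmul (- (s div 2)) e + f"
      have f': "basis2 T e f'" unfolding f'_def by (rule basis2_add[OF ef(1)])
      have ff': "lf f' f' = 0" and ef': "lf e f' = 2"
        unfolding f'_def shift r using True by auto
      have T2: "isometric (lat T lf) (lat UNIV (plane_form 2))"
        using basis2_isometric[OF L.even_form_axioms f', of "plane_form 2"] ef(2)
        by (simp add: plane_form_def ff' ef')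
      \<comment> \<open>Stated for any isotropic pair, because e and f' trade places below if e has
        only even products. As f0 has norm 0, \<open>perp_div_1\<close> leaves s = 0 or m
        even.\<close>
      have fin: ?thesis if "lf e0 e0 = 0" "lf f0 f0 = 0" "lf e0 f0 = 2" "odd (lf e0 z)"
        "\<And>k y. f0 \<noteq> zmul k e0 + zmul 2 y" "S = perp2 lf e0 f0" for e0 f0 z
        using perp_div_1[OF that(1,3,4,5)] that(2) T2 isometric_trans[OF _ isometric_S2]
        unfolding that(6)[symmetric] by auto
      show ?thesis
      proof (cases "\<exists>z. odd (lf e z)")
        case True
        then obtain z where z: "odd (lf e z)" by blast
        have "f' \<noteq> zmul k e + zmul 2 y" for k y
        proof
          assume "f' = zmul k e + zmul 2 y"
          then have "zmul (- k) e + zmul 1 f' = zmul 2 y" by (simp add: zmul_minus_left)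
          then show False using basis2_pure[OF f' pure] by fastforce
        qed
        then show ?thesis using fin[OF ef(2) ff' ef' z _ S'[OF f']] by blast
      next
        case False
        then have ev: "even (lf e z)" for z by blast
        have "e \<noteq> zmul 2 y" for y
          using basis2_pure[OF f' pure, of 1 0 y] by auto
        then obtain z where z: "odd (lf f' z)"
          using other_isotropic_odd[OF ef(2) ff' ef' ev] by blast
        have "e \<noteq> zmul k f' + zmul 2 y" for k y
        proof
          assume "e = zmul k f' + zmul 2 y"
          then have "zmul 1 e + zmul (- k) f' = zmul 2 y" by (simp add: zmul_minus_left)
          then show False using basis2_pure[OF f' pure] by fastforce
        qed
        moreover have "S = perp2 lf f' e" using S'[OF f'] by auto
        moreover have "lf f' e = 2" using ef' L.sym by metis
        ultimately show ?thesis using fin[OF ff' ef(2) _ z] by blast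
      qed
    next
      case False
      define k where "k = - (s div 2)"
      define f' where "f' = zmul k e + f"
      have f': "basis2 T e f'" unfolding f'_def by (rule basis2_add[OF ef(1)])
      have ks: "k * 2 + s = 1" using False unfolding k_def by presburger
      have ff': "lf f' f' = 2" and ef': "lf e f' = 2"
        unfolding f'_def shift r by (simp_all add: ks)
      have T3: "isometric (lat T lf) (lat UNIV (orth_sum (rank1_form 2) (rank1_form (- 2))))"
      proof (rule basis2_isometric[OF L.even_form_axioms])
        \<comment> \<open>The vectors f' and f' - e are orthogonal, of norms 2 and 2 - 4 =
          -2.\<close>
        show "basis2 T f' (- e + f')"
          using basis2_change[OF f', of 0 1 1 "- 1"] by (simp add: zmul_minus_left)
      next
        fix i j k l
        have "lf f' e = 2" using ef' L.sym by metis
        then show "orth_sum (rank1_form 2) (rank1_form (- 2)) (i, j) (k, l) =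
          i * k * lf f' f' + (i * l + j * k) * lf f' (- e + f') + j * l * lf (- e + f') (- e + f')"
          using ef(2) by (simp add: rank1_form_def L.add_left L.add_right L.minus_left L.minus_right L.diff_left L.diff_right ff' ef')
      qed
      show ?thesis
      proof (cases "\<exists>z. odd (lf e z)")
        case True
        then obtain z where z: "odd (lf e z)" by blast
        have "f' \<noteq> zmul k e + zmul 2 y" for k y
        proof
          assume "f' = zmul k e + zmul 2 y"
          then have "zmul (- k) e + zmul 1 f' = zmul 2 y" by (simp add: zmul_minus_left)
          then show False using basis2_pure[OF f' pure] by fastforce
        qed
        note D = perp_div_1[OF ef(2) ef' z this, folded S'[OF f'], unfolded ff']
        \<comment> \<open>The norm 2 of f' forces s = 1 in the first alternative and m odd in the
          second.\<close>
        have "\<not> 4 dvd (2 :: int)" by simp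
        with D consider "isometric (lat S lf) (lat {y. even (kf y (1, 1, 0))} kf)"
          | "odd m" "isometric (lat S lf) (lat UNIV kf)"
          by auto
        then show ?thesis
        proof cases
          case 1
          then show ?thesis using isometric_trans[OF 1 isometric_S3] T3 by blast
        next
          case 2
          then show ?thesis using T3 by blast
        qed
      next
        case False
        then have ev: "even (lf e z)" for z by blast
        have "e \<noteq> zmul 2 y" for y
          using basis2_pure[OF f' pure, of 1 0 y] by auto
        then have "m = 4 \<and> isometric (lat S lf) (lat UNIV S6)"
          unfolding S'[OF f'] by (rule perp_div_2_odd[OF ef(2) ef' ev]) (simp add: ff')
        then show ?thesis using T3 by blast
      qed
    qed
  qed
qed

end

section \<open>The form E8 and signatures\<close>

lemma E8_form_simp:
  "E8_form (x1, x2, x3, x4, x5, x6, x7, x8) (y1, y2, y3, y4, y5, y6, y7, y8) =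
     x1 * (y3 - 2 * y1) + x2 * (y4 - 2 * y2) + x3 * (y1 + y4 - 2 * y3) + x4 * (y2 + y3 + y5 - 2 * y4) +
     x5 * (y4 + y6 - 2 * y5) + x6 * (y5 + y7 - 2 * y6) + x7 * (y6 + y8 - 2 * y7) + x8 * (y7 - 2 * y8)"
  by (simp add: E8_form_def)

lemma e8_cases: obtains x1 x2 x3 x4 x5 x6 x7 x8 :: int where "x = (x1, x2, x3, x4, x5, x6, x7, x8)"
  by (cases x) auto

lemma even_form_E8: "even_form E8_form"
proof
  show "E8_form (x + y) z = E8_form x z + E8_form y z" for x y z
    by (cases x rule: e8_cases; cases y rule: e8_cases; cases z rule: e8_cases)
      (simp add: E8_form_simp distrib_right)
  show "E8_form x y = E8_form y x" for x y
    by (cases x rule: e8_cases; cases y rule: e8_cases)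
      (simp add: E8_form_simp algebra_simps)
  show "even (E8_form x x)" for x
  proof (cases x rule: e8_cases)
    case (1 x1 x2 x3 x4 x5 x6 x7 x8)
    have "E8_form x x = 2 * (x1 * x3 + x2 * x4 + x3 * x4 + x4 * x5 + x5 * x6 + x6 * x7 + x7 * x8 -
      x1 * x1 - x2 * x2 - x3 * x3 - x4 * x4 - x5 * x5 - x6 * x6 - x7 * x7 - x8 * x8)"
      unfolding 1 by (simp add: E8_form_simp algebra_simps)
    then show ?thesis by simp
  qed
qed

lemma E8_form_unit_vectors:
  "E8_form (x1, x2, x3, x4, x5, x6, x7, x8) (1, 0, 0, 0, 0, 0, 0, 0) = x3 - 2 * x1"
  "E8_form (x1, x2, x3, x4, x5, x6, x7, x8) (0, 1, 0, 0, 0, 0, 0, 0) = x4 - 2 * x2"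
  "E8_form (x1, x2, x3, x4, x5, x6, x7, x8) (0, 0, 1, 0, 0, 0, 0, 0) = x1 + x4 - 2 * x3"
  "E8_form (x1, x2, x3, x4, x5, x6, x7, x8) (0, 0, 0, 1, 0, 0, 0, 0) = x2 + x3 + x5 - 2 * x4"
  "E8_form (x1, x2, x3, x4, x5, x6, x7, x8) (0, 0, 0, 0, 1, 0, 0, 0) = x4 + x6 - 2 * x5"
  "E8_form (x1, x2, x3, x4, x5, x6, x7, x8) (0, 0, 0, 0, 0, 1, 0, 0) = x5 + x7 - 2 * x6"
  "E8_form (x1, x2, x3, x4, x5, x6, x7, x8) (0, 0, 0, 0, 0, 0, 1, 0) = x6 + x8 - 2 * x7"
  "E8_form (x1, x2, x3, x4, x5, x6, x7, x8) (0, 0, 0, 0, 0, 0, 0, 1) = x7 - 2 * x8"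
  by (simp_all add: E8_form_simp)

text \<open>Unimodularity modulo 2. The products with the unit vectors, read modulo 2, make one
  coordinate after the other even, starting from the leaves of the Dynkin diagram.\<close>

lemma E8_form_halve:
  assumes "\<And>y. even (E8_form x y)"
  shows "\<exists>y. x = zmul 2 y"
proof (cases x rule: e8_cases)
  case (1 x1 x2 x3 x4 x5 x6 x7 x8)
  have "even (x3 - 2 * x1)" "even (x4 - 2 * x2)" "even (x1 + x4 - 2 * x3)"
    "even (x2 + x3 + x5 - 2 * x4)" "even (x4 + x6 - 2 * x5)" "even (x5 + x7 - 2 * x6)"
    "even (x6 + x8 - 2 * x7)" "even (x7 - 2 * x8)"
    using assms unfolding 1 by (metis E8_form_unit_vectors)+
  then have "even x1" "even x2" "even x3" "even x4" "even x5" "even x6" "even x7" "even x8"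
    by auto
  then have "x = zmul 2 (x1 div 2, x2 div 2, x3 div 2, x4 div 2, x5 div 2, x6 div 2, x7 div 2, x8 div 2)"
    by (simp add: 1)
  then show ?thesis by blast
qed

lemma E8_form_nondegenerate:
  assumes "\<And>y. E8_form x y = 0"
  shows "x = 0"
proof (cases x rule: e8_cases)
  case (1 x1 x2 x3 x4 x5 x6 x7 x8)
  have "x3 - 2 * x1 = 0" "x4 - 2 * x2 = 0" "x1 + x4 - 2 * x3 = 0"
    "x2 + x3 + x5 - 2 * x4 = 0" "x4 + x6 - 2 * x5 = 0" "x5 + x7 - 2 * x6 = 0"
    "x6 + x8 - 2 * x7 = 0" "x7 - 2 * x8 = 0"
    using assms unfolding 1 by (metis E8_form_unit_vectors)+
  then have "x1 = 0" "x2 = 0" "x3 = 0" "x4 = 0" "x5 = 0" "x6 = 0" "x7 = 0" "x8 = 0"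
    by linarith+
  then show ?thesis by (simp add: 1 zero_prod_def)
qed

text \<open>The positive index of inertia is at most \<open>k\<close>, as witnessed by a real diagonalisation.\<close>

definition pos_index_le :: "nat \<Rightarrow> ('a \<Rightarrow> 'a \<Rightarrow> int) \<Rightarrow> bool" where
  "pos_index_le k b \<longleftrightarrow> (\<exists>(p :: nat \<Rightarrow> 'a \<Rightarrow> real) u (n :: nat \<Rightarrow> 'a \<Rightarrow> real) w N.
     (\<forall>j. 0 \<le> w j) \<and> (\<forall>x y. of_int (b x y) =
       (\<Sum>i<k. u i * p i x * p i y) - (\<Sum>j<N::nat. w j * n j x * n j y)))"

lemma pos_index_le_rank1:
  assumes "t \<le> 0"
  shows "pos_index_le 0 (rank1_form t)"
  unfolding pos_index_le_def rank1_form_def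
  by (intro exI[of _ "\<lambda>_. of_int"] exI[of _ "\<lambda>_. - of_int t"] exI[of _ 1]) (use assms in auto)

lemma pos_index_le_orth_sum:
  assumes "pos_index_le k b" "pos_index_le l c"
  shows "pos_index_le (k + l) (orth_sum b c)"
proof -
  obtain p u n w N where b: "\<forall>j. 0 \<le> w j" "\<And>x y. of_int (b x y) =
       (\<Sum>i<k. u i * p i x * p i y) - (\<Sum>j<N::nat. w j * n j x * n j y :: real)"
    using assms(1) unfolding pos_index_le_def by blast
  obtain p' u' n' w' N' where c: "\<forall>j. 0 \<le> w' j" "\<And>x y. of_int (c x y) =
       (\<Sum>i<l. u' i * p' i x * p' i y) - (\<Sum>j<N'::nat. w' j * n' j x * n' j y :: real)"
    using assms(2) unfolding pos_index_le_def by blast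
  have split: "(\<Sum>i<K + M. h i) = (\<Sum>i<K. h i) + (\<Sum>i<M. h (K + i))" for K M :: nat and h :: "nat \<Rightarrow> real"
    by (induction M) simp_all
  show ?thesis unfolding pos_index_le_def
  proof (intro exI conjI allI)
    show "0 \<le> (if j < N then w j else w' (j - N))" for j using b(1) c(1) by simp
    show "of_int (orth_sum b c x y) =
      (\<Sum>i<k + l. (if i < k then u i else u' (i - k)) * (if i < k then p i (fst x) else p' (i - k) (snd x)) *
        (if i < k then p i (fst y) else p' (i - k) (snd y))) -
      (\<Sum>j<N + N'. (if j < N then w j else w' (j - N)) * (if j < N then n j (fst x) else n' (j - N) (snd x)) *
        (if j < N then n j (fst y) else n' (j - N) (snd y)))" for x y
      by (cases x; cases y) (simp add: split b(2) c(2))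
  qed
qed

lemma pos_index_le_plane: "pos_index_le 1 (plane_form 1)"
  unfolding pos_index_le_def
  by (intro exI[of _ "\<lambda>_ x. of_int (fst x + snd x)"] exI[of _ "\<lambda>_. 1 / 2"]
      exI[of _ "\<lambda>_ x. of_int (fst x - snd x)"] exI[of _ 1]) (auto simp: plane_form_def field_simps)

text \<open>Squares are completed along the three arms of the diagram towards the branch node x4,
  with terms (2x - y)^2, (3x - 2y)^2, (4x - 3y)^2, (5x - 4y)^2 of weight 1/2, 1/6, 1/12, 1/20. At x4
  there remains 2 - 1/2 - 2/3 - 4/5 = 1/30, and 60 clears the denominators.\<close>

lemma E8_form_diagonal:
  "60 * E8_form (x1, x2, x3, x4, x5, x6, x7, x8) (y1, y2, y3, y4, y5, y6, y7, y8) =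
    - (30 * ((2 * x2 - x4) * (2 * y2 - y4)) + 30 * ((2 * x1 - x3) * (2 * y1 - y3)) +
       10 * ((3 * x3 - 2 * x4) * (3 * y3 - 2 * y4)) + 30 * ((2 * x8 - x7) * (2 * y8 - y7)) +
       10 * ((3 * x7 - 2 * x6) * (3 * y7 - 2 * y6)) + 5 * ((4 * x6 - 3 * x5) * (4 * y6 - 3 * y5)) +
       3 * ((5 * x5 - 4 * x4) * (5 * y5 - 4 * y4)) + 2 * (x4 * y4))"
  unfolding E8_form_simp by (simp add: algebra_simps)

lemma pos_index_le_E8: "pos_index_le 0 E8_form"
  unfolding pos_index_le_def
proof (intro exI conjI allI)
  let ?c = "\<lambda>j. if j < 8 then [30, 30, 10, 30, 10, 5, 3, 2] ! j else (0::int)"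
  let ?n = "\<lambda>j (x1, x2, x3, x4, x5, x6, x7, x8). [2 * x2 - x4, 2 * x1 - x3, 3 * x3 - 2 * x4,
    2 * x8 - x7, 3 * x7 - 2 * x6, 4 * x6 - 3 * x5, 5 * x5 - 4 * x4, x4 :: int] ! j"
  let ?w = "\<lambda>j. real_of_int (?c j) / 60"
  show "0 \<le> ?w j" for j
  proof -
    have "j \<in> {0, 1, 2, 3, 4, 5, 6, 7} \<or> \<not> j < 8" by auto
    then show ?thesis by auto
  qed
  show "of_int (E8_form x y) = (\<Sum>i<0. (\<lambda>_. 0) i * (\<lambda>_ _. 0) i x * (\<lambda>_ _. 0) i y) -
    (\<Sum>j<8. ?w j * real_of_int (?n j x) * real_of_int (?n j y))" for x y
  proof -
    have "60 * E8_form x y = - (\<Sum>j<8. ?c j * (?n j x * ?n j y))"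
      by (cases x rule: e8_cases; cases y rule: e8_cases)
        (simp only: E8_form_diagonal, simp add: eval_nat_numeral)
    then have "real_of_int (60 * E8_form x y) = real_of_int (- (\<Sum>j<8. ?c j * (?n j x * ?n j y)))"
      by (simp only:)
    then show ?thesis
      by (simp add: sum_divide_distrib[symmetric] mult.assoc)
  qed
qed

lemma pos_index_le_isom:
  assumes "pos_index_le k c" "isom b c f"
  shows "pos_index_le k b"
proof -
  obtain p u n w N where c: "\<forall>j. 0 \<le> w j" "\<And>x y. of_int (c x y) =
       (\<Sum>i<k. u i * p i x * p i y) - (\<Sum>j<N::nat. w j * n j x * n j y :: real)"
    using assms(1) unfolding pos_index_le_def by blast
  show ?thesis unfolding pos_index_le_def
    by (intro exI[of _ "\<lambda>i x. p i (f x)"] exI[of _ u] exI[of _ "\<lambda>i x. n i (f x)"] exI[of _ w] exI[of _ N] conjI c(1))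
      (simp add: isom_form[OF assms(2), symmetric] c(2))
qed

lemma isom_hyp_orth_sum: "isom (hyp b) (orth_sum (plane_form 1) b) (\<lambda>(x1, x2, y). ((x1, x2), y))"
  by (rule isomI[where g = "\<lambda>((x1, x2), y). (x1, x2, y)"]) (auto simp: plane_form_def)

lemma isom_orth_sum_assoc:
  "isom (orth_sum (orth_sum a b) c) (orth_sum a (orth_sum b c)) (\<lambda>((x, y), z). (x, y, z))"
  by (rule isomI[where g = "\<lambda>(x, y, z). ((x, y), z)"]) auto

lemma pos_index_le_hyp: "pos_index_le k b \<Longrightarrow> pos_index_le (Suc k) (hyp b)"
  using pos_index_le_isom[OF pos_index_le_orth_sum[OF pos_index_le_plane] isom_hyp_orth_sum] by force

abbreviation "E8E8_form \<equiv> orth_sum E8_form E8_form"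

lemma K3n_form_E8E8:
  assumes "1 \<le> m" "m \<le> 4"
  shows "K3n_form E8E8_form m"
proof -
  interpret E: even_form E8_form by (rule even_form_E8)
  interpret EE: even_form E8E8_form by (rule even_form_orth_sum) (rule even_form_E8)+
  show ?thesis
  proof
    fix x :: "e8 \<times> e8" assume ev: "\<And>y. even (E8E8_form x y)"
    obtain x1 x2 where x: "x = (x1, x2)" by (cases x)
    have "even (E8_form x1 y)" "even (E8_form x2 y)" for y
      using ev[of "(y, 0)"] ev[of "(0, y)"] by (simp_all add: x)
    then obtain y1 y2 where "x1 = zmul 2 y1" "x2 = zmul 2 y2" using E8_form_halve by metis
    then have "x = zmul 2 (y1, y2)" by (simp add: x)
    then show "\<exists>y. x = zmul 2 y" by blast
  qed (use assms in auto)
qed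

lemma E8E8_form_nondegenerate:
  assumes "\<And>y. E8E8_form x y = 0"
  shows "x = 0"
proof -
  interpret E: even_form E8_form by (rule even_form_E8)
  obtain x1 x2 where x: "x = (x1, x2)" by (cases x)
  have "E8_form x1 y = 0" "E8_form x2 y = 0" for y
    using assms[of "(y, 0)"] assms[of "(0, y)"] by (simp_all add: x)
  then have "x1 = 0" "x2 = 0" using E8_form_nondegenerate by blast+
  then show ?thesis by (simp add: x zero_prod_def)
qed

section \<open>Gram matrices, nondegeneracy and signature of the K3n lattice\<close>

lemma has_gram_hyp: "has_gram b (diag_block_mat As) \<Longrightarrow> has_gram (hyp b) (diag_block_mat (U_gram # As))"
  using has_gram_isom[OF has_gram_block[OF has_gram_U] isom_hyp_orth_sum] .

lemma has_gram_E8E8: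
  assumes "has_gram b (diag_block_mat As)"
  shows "has_gram (orth_sum E8E8_form b) (diag_block_mat (E8_gram # E8_gram # As))"
  using has_gram_isom[OF has_gram_block[OF has_gram_E8 has_gram_block[OF has_gram_E8 assms]] isom_orth_sum_assoc] .

lemma has_gram_singleton: "has_gram b A \<Longrightarrow> has_gram b (diag_block_mat [A])"
  by (simp only: diag_block_mat_singleton)

context K3n_form
begin

lemma lf_nondegenerate:
  assumes nf: "\<And>x. (\<And>y. nf x y = 0) \<Longrightarrow> x = 0" and "\<And>y. lf x y = 0"
  shows "x = 0"
proof -
  obtain a1 a2 c1 c2 d1 d2 z k where x: "x = (a1, a2, c1, c2, d1, d2, z, k)"
    by (metis prod_cases6 prod_cases3)
  have "a1 = 0" "a2 = 0" "c1 = 0" "c2 = 0" "d1 = 0" "d2 = 0" "- (2 * m) * k = 0"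
    using assms(2)[of "(0, 1, 0, 0, 0, 0, 0, 0)"] assms(2)[of "(1, 0, 0, 0, 0, 0, 0, 0)"]
      assms(2)[of "(0, 0, 0, 1, 0, 0, 0, 0)"] assms(2)[of "(0, 0, 1, 0, 0, 0, 0, 0)"]
      assms(2)[of "(0, 0, 0, 0, 0, 1, 0, 0)"] assms(2)[of "(0, 0, 0, 0, 1, 0, 0, 0)"]
      assms(2)[of "(0, 0, 0, 0, 0, 0, 0, 1)"]
    by (simp_all add: x rank1_form_def)
  moreover have "nf z y = 0" for y
    using assms(2)[of "(0, 0, 0, 0, 0, 0, y, 0)"] by (simp add: x)
  then have "z = 0" by (rule nf)
  ultimately show ?thesis using m by (simp add: x zero_prod_def)
qed

lemma pos_index_le_lf:
  assumes "pos_index_le 0 nf"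
  shows "pos_index_le 3 lf"
proof -
  have "pos_index_le (0 + 0) mf"
    by (rule pos_index_le_orth_sum[OF assms pos_index_le_rank1]) (use m in simp)
  then show ?thesis
    using pos_index_le_hyp[OF pos_index_le_hyp[OF pos_index_le_hyp]] by (simp add: eval_nat_numeral)
qed

end

section \<open>Involutions\<close>

text \<open>Holds for every free group of finite rank: coordinates are functionals.\<close>

definition enough_functionals :: "'a::ab_group_add itself \<Rightarrow> bool" where
  "enough_functionals _ \<longleftrightarrow> (\<forall>(x :: 'a) d. (\<forall>f :: 'a \<Rightarrow> int. Modules.additive f \<longrightarrow> d dvd f x) \<longrightarrow>
     (\<exists>y. x = zmul d y))"

lemma enough_functionals_int: "enough_functionals TYPE(int)"
proof -
  have "Modules.additive (\<lambda>x :: int. x)" by (simp add: Modules.additive_def)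
  then show ?thesis unfolding enough_functionals_def by (auto simp: dvd_def)
qed

lemma enough_functionals_prod:
  assumes "enough_functionals TYPE('a::ab_group_add)" "enough_functionals TYPE('b::ab_group_add)"
  shows "enough_functionals TYPE('a \<times> 'b)"
  unfolding enough_functionals_def
proof (intro allI impI)
  fix x :: "'a \<times> 'b" and d
  assume d: "\<forall>f :: 'a \<times> 'b \<Rightarrow> int. Modules.additive f \<longrightarrow> d dvd f x"
  have "d dvd f (fst x)" if "Modules.additive f" for f
  proof -
    have "Modules.additive (\<lambda>x :: 'a \<times> 'b. f (fst x))"
      using that by (simp add: Modules.additive_def)
    then show ?thesis using d by blast
  qed
  then obtain y where y: "fst x = zmul d y" using assms(1) unfolding enough_functionals_def by blast
  have "d dvd f (snd x)" if "Modules.additive f" for f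
  proof -
    have "Modules.additive (\<lambda>x :: 'a \<times> 'b. f (snd x))"
      using that by (simp add: Modules.additive_def)
    then show ?thesis using d by blast
  qed
  then obtain z where z: "snd x = zmul d z" using assms(2) unfolding enough_functionals_def by blast
  have "x = zmul d (y, z)" using y z by (simp add: prod_eq_iff)
  then show "\<exists>y. x = zmul d y" by blast
qed

lemma additive_combine:
  fixes f h :: "'a::ab_group_add \<Rightarrow> int"
  assumes "Modules.additive f" "Modules.additive h"
  shows "Modules.additive (\<lambda>x. f x - k * h x)"
  using assms by (simp add: Modules.additive_def algebra_simps)

text \<open>The number d is the content of x: by division with remainder, the least positive value
  of functionals at x divides all other values, hence x itself.\<close>

lemma functional_divisor:
  assumes "enough_functionals TYPE('a::ab_group_add)"
  shows "\<exists>f d (y :: 'a). Modules.additive f \<and> f x = d \<and> x = zmul d y"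
proof (cases "\<forall>f :: 'a \<Rightarrow> int. Modules.additive f \<longrightarrow> f x = 0")
  case True
  then have "\<forall>f :: 'a \<Rightarrow> int. Modules.additive f \<longrightarrow> 0 dvd f x" by simp
  then have "\<exists>y. x = zmul 0 y" using assms unfolding enough_functionals_def by blast
  then have "x = zmul 0 0" by simp
  moreover have "Modules.additive (\<lambda>x :: 'a. 0 :: int)" by (simp add: Modules.additive_def)
  ultimately show ?thesis by blast
next
  case False
  define P where "P j \<longleftrightarrow> 0 < j \<and> (\<exists>f :: 'a \<Rightarrow> int. Modules.additive f \<and> f x = int j)" for j
  obtain f :: "'a \<Rightarrow> int" where f: "Modules.additive f" "f x \<noteq> 0" using False by blast
  have "P (nat \<bar>f x\<bar>)"
  proof (cases "0 < f x")
    case True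
    then show ?thesis using f unfolding P_def by auto
  next
    case False
    have "Modules.additive (\<lambda>x. - f x)" using f(1) by (simp add: Modules.additive_def)
    then show ?thesis using f(2) False unfolding P_def by (intro conjI exI[of _ "\<lambda>x. - f x"]) auto
  qed
  define d where "d = (LEAST j. P j)"
  have "P d" and min: "\<And>j. P j \<Longrightarrow> d \<le> j"
    using \<open>P (nat \<bar>f x\<bar>)\<close> unfolding d_def by (auto intro: LeastI Least_le)
  then obtain h :: "'a \<Rightarrow> int" where d: "0 < d" and h: "Modules.additive h" "h x = int d"
    unfolding P_def by blast
  have "int d dvd k x" if "Modules.additive k" for k :: "'a \<Rightarrow> int"
  proof (rule ccontr)
    assume "\<not> int d dvd k x"
    then have "k x mod int d \<noteq> 0" by (simp add: mod_eq_0_iff_dvd)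
    then have pos: "0 < k x mod int d" "k x mod int d < int d"
      using d pos_mod_sign[of "int d" "k x"] pos_mod_bound[of "int d" "k x"] by linarith+
    have "k x - k x div int d * h x = k x mod int d" by (simp add: h(2) minus_div_mult_eq_mod)
    then have "P (nat (k x mod int d))"
      using additive_combine[OF that h(1), of "k x div int d"] pos unfolding P_def
      by (intro conjI exI[of _ "\<lambda>z. k z - k x div int d * h z"]) auto
    then show False using min pos by fastforce
  qed
  then obtain y where "x = zmul (int d) y" using assms unfolding enough_functionals_def by blast
  then show ?thesis using h by blast
qed

lemma basis2_multiple:
  assumes T: "basis2 T e f" and pure: "\<And>k x. k \<noteq> 0 \<Longrightarrow> zmul k x \<in> T \<Longrightarrow> x \<in> T"
    and x: "zmul i e + zmul j f = zmul d y" "i \<noteq> 0 \<or> j \<noteq> 0"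
  shows "d dvd i \<and> d dvd j"
proof -
  have b: "bij_betw (\<lambda>(i, j). zmul i e + zmul j f) UNIV T" using T unfolding basis2_def .
  then have inj: "inj (\<lambda>(i, j). zmul i e + zmul j f)" by (rule bij_betw_imp_inj_on)
  have eq: "i = k \<and> j = l" if "zmul i e + zmul j f = zmul k e + zmul l f" for i j k l
    using injD[OF inj, of "(i, j)" "(k, l)"] that by simp
  have "zmul d y \<in> T"
    unfolding x(1)[symmetric] using b by (auto simp: bij_betw_def)
  moreover have "d \<noteq> 0" using x eq[of i j 0 0] by auto
  ultimately have "y \<in> T" using pure by blast
  then obtain k l where y: "y = zmul k e + zmul l f"
    using b by (auto simp: bij_betw_def)
  then have "i = d * k \<and> j = d * l" using x(1) by (intro eq) (simp add: zmul_add_right zmul_zmul)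
  then show ?thesis by simp
qed

text \<open>A basis of a pure subgroup extends, so its dual basis extends to functionals.\<close>

lemma dual_basis:
  assumes enough: "enough_functionals TYPE('a::ab_group_add)"
    and T: "basis2 T e (f :: 'a)" and pure: "\<And>k x. k \<noteq> 0 \<Longrightarrow> zmul k x \<in> T \<Longrightarrow> x \<in> T"
  shows "\<exists>(p :: 'a \<Rightarrow> int) (q :: 'a \<Rightarrow> int). Modules.additive p \<and> Modules.additive q \<and>
    p e = 1 \<and> p f = 0 \<and> q e = 0 \<and> q f = 1"
proof -
  \<comment> \<open>By purity the content d of ie + jf divides i and j, so it is a unit; multiplying
    by d corrects the value to 1.\<close>
  have func: "\<exists>p :: 'a \<Rightarrow> int. Modules.additive p \<and> p (zmul i e + zmul j f) = 1"
    if ij: "coprime i j" for i j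
  proof -
    obtain p :: "'a \<Rightarrow> int" and d y where p: "Modules.additive p" "p (zmul i e + zmul j f) = d"
      "zmul i e + zmul j f = zmul d y"
      using functional_divisor[OF enough] by blast
    have "i \<noteq> 0 \<or> j \<noteq> 0" using ij by (cases "i = 0") simp_all
    have "d dvd i \<and> d dvd j"
      by (rule basis2_multiple[OF T _ p(3)]) (rule pure, assumption+, fact)
    then have "is_unit d" using coprime_common_divisor[OF ij] by blast
    then have "d * d = 1" by (auto simp: abs_if split: if_splits)
    moreover have "Modules.additive (\<lambda>x. d * p x)"
      using p(1) by (simp add: Modules.additive_def distrib_left)
    ultimately show ?thesis using p(2) by (intro exI[of _ "\<lambda>x. d * p x"]) simp
  qed
  obtain p :: "'a \<Rightarrow> int" where p: "Modules.additive p" "p e = 1" using func[of 1 0] by auto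
  \<comment> \<open>The vector f - p(f) e lies in the kernel of p. This makes the correction of p
    and q to a dual basis triangular.\<close>
  obtain q :: "'a \<Rightarrow> int" where q: "Modules.additive q" "q (zmul (- p f) e + zmul 1 f) = 1"
    using func[of "- p f" 1] by auto
  define q' where "q' = (\<lambda>x. q x - q e * p x)"
  have q': "Modules.additive q'" unfolding q'_def by (rule additive_combine[OF q(1) p(1)])
  have qf: "- p f * q e + q f = 1"
    using q(2) additive.add[OF q(1)] additive_zmul[OF q(1)] by simp
  have q'v: "q' e = 0" "q' f = 1" using p(2) qf by (simp_all add: q'_def algebra_simps)
  show ?thesis
  proof (rule exI[of _ "\<lambda>x. p x - p f * q' x"], rule exI[of _ q'], intro conjI)
    show "Modules.additive (\<lambda>x. p x - p f * q' x)" by (rule additive_combine[OF p(1) q'])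
    show "p e - p f * q' e = 1" "p f - p f * q' f = 0" by (simp_all add: p q'v)
  qed (fact q' q'v)+
qed

text \<open>Once all positive coordinates vanish on a real vector, only the terms with weights - w_j
  remain in its square. Real vectors are formal combinations of lattice vectors, the form in which
  classes of differential forms are given.\<close>

lemma pos_index_le_sum:
  fixes c :: "'i \<Rightarrow> real"
  assumes b: "\<And>x y. of_int (b x y) = (\<Sum>i<k::nat. u i * p i x * p i y) - (\<Sum>j<N::nat. w j * n j x * n j y :: real)"
    and w: "\<And>j. 0 \<le> w j" and p: "\<And>i. i < k \<Longrightarrow> (\<Sum>s\<in>I. c s * p i (v s)) = 0"
  shows "(\<Sum>s\<in>I. \<Sum>t\<in>I. c s * c t * of_int (b (v s) (v t))) \<le> 0"
proof -
  have sq: "(\<Sum>s\<in>I. \<Sum>t\<in>I. c s * c t * (\<Sum>i\<in>J. a i * h i (v s) * h i (v t))) =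
      (\<Sum>i\<in>J. a i * (\<Sum>s\<in>I. c s * h i (v s))\<^sup>2)" for J :: "nat set" and a h
  proof -
    have "(\<Sum>s\<in>I. \<Sum>t\<in>I. c s * c t * (\<Sum>i\<in>J. a i * h i (v s) * h i (v t))) =
       (\<Sum>s\<in>I. \<Sum>t\<in>I. \<Sum>i\<in>J. a i * ((c s * h i (v s)) * (c t * h i (v t))))"
      by (simp add: sum_distrib_left mult_ac)
    also have "\<dots> = (\<Sum>s\<in>I. \<Sum>i\<in>J. \<Sum>t\<in>I. a i * ((c s * h i (v s)) * (c t * h i (v t))))"
      by (intro sum.cong refl sum.swap)
    also have "\<dots> = (\<Sum>i\<in>J. \<Sum>s\<in>I. \<Sum>t\<in>I. a i * ((c s * h i (v s)) * (c t * h i (v t))))"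
      by (rule sum.swap)
    also have "\<dots> = (\<Sum>i\<in>J. a i * (\<Sum>s\<in>I. c s * h i (v s))\<^sup>2)"
      by (simp only: power2_eq_square sum_product) (simp only: sum_distrib_left)
    finally show ?thesis .
  qed
  have "(\<Sum>s\<in>I. \<Sum>t\<in>I. c s * c t * of_int (b (v s) (v t))) =
      (\<Sum>s\<in>I. \<Sum>t\<in>I. c s * c t * (\<Sum>i<k. u i * p i (v s) * p i (v t))) -
      (\<Sum>s\<in>I. \<Sum>t\<in>I. c s * c t * (\<Sum>j<N. w j * n j (v s) * n j (v t)))"
    by (simp add: b right_diff_distrib sum_subtractf)
  also have "\<dots> = - (\<Sum>j<N. w j * (\<Sum>s\<in>I. c s * n j (v s))\<^sup>2)"
    unfolding sq[of u p "{..<k}"] sq[of w n "{..<N}"] using p by simp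
  also have "\<dots> \<le> 0" using w by (simp add: sum_nonneg)
  finally show ?thesis .
qed

lemma four_unknowns:
  fixes p1 p2 p3 p4 :: "nat \<Rightarrow> real"
  shows "\<exists>a1 a2 a3 a4. (a1, a2, a3, a4) \<noteq> (0, 0, 0, 0) \<and>
    (\<forall>i<3. a1 * p1 i + a2 * p2 i + a3 * p3 i + a4 * p4 i = 0)"
proof -
  let ?f = "\<lambda>(a1, a2, a3, a4). (a1 * p1 0 + a2 * p2 0 + a3 * p3 0 + a4 * p4 0,
     a1 * p1 1 + a2 * p2 1 + a3 * p3 1 + a4 * p4 1, a1 * p1 2 + a2 * p2 2 + a3 * p3 2 + a4 * p4 2)"
  have lin: "linear ?f"
    by (rule linearI) (auto simp: algebra_simps)
  have "\<not> inj ?f"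
  proof
    assume "inj ?f"
    then have "dim (range ?f) = dim (UNIV :: (real \<times> real \<times> real \<times> real) set)"
      by (intro dim_image_eq[OF lin]) auto
    moreover have "dim (range ?f) \<le> DIM(real \<times> real \<times> real)" by (rule dim_subset_UNIV)
    ultimately show False by simp
  qed
  then obtain a where a: "?f a = 0" "a \<noteq> 0"
    unfolding linear_injective_0[OF lin] by blast
  obtain a1 a2 a3 a4 where a': "a = (a1, a2, a3, a4)" by (cases a) auto
  have "a1 * p1 i + a2 * p2 i + a3 * p3 i + a4 * p4 i = 0" if "i < 3" for i
  proof -
    have "i = 0 \<or> i = 1 \<or> i = 2" using that by auto
    then show ?thesis using a(1) by (auto simp: a' zero_prod_def)
  qed
  then show ?thesis using a(2) by (auto simp: a' zero_prod_def)
qed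

text \<open>The hypotheses say that some integral matrix times the Gram matrix is twice the
  identity. Taking determinants, 4ac - b^2 divides 4; it is also 0 or 3 modulo 4, because b^2 is a
  square.\<close>

lemma discriminant_values:
  fixes a b c :: int
  assumes "x11 * (2 * a) + x12 * b = 2" "x11 * b + x12 * (2 * c) = 0"
    "x21 * (2 * a) + x22 * b = 0" "x21 * b + x22 * (2 * c) = 2"
  shows "4 * a * c - b\<^sup>2 \<in> {- 1, - 4, 4}"
proof -
  let ?d = "4 * a * c - b\<^sup>2"
  have "(x11 * x22 - x12 * x21) * ?d =
    (x11 * (2 * a) + x12 * b) * (x21 * b + x22 * (2 * c)) -
    (x11 * b + x12 * (2 * c)) * (x21 * (2 * a) + x22 * b)"
    by (simp add: power2_eq_square algebra_simps)
  then have "(x11 * x22 - x12 * x21) * ?d = 4" unfolding assms by simp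
  then have "?d dvd 4" by (metis dvd_triv_right)
  then have "\<bar>?d\<bar> \<le> 4" using zdvd_imp_le[of "\<bar>?d\<bar>" 4] by simp
  then have "?d \<in> {- 4, - 3, - 2, - 1, 0, 1, 2, 3, 4}" by auto
  moreover have "b\<^sup>2 mod 4 = 0 \<or> b\<^sup>2 mod 4 = 1"
  proof (cases "even b")
    case True
    then obtain k where "b = 2 * k" by (rule evenE)
    then show ?thesis by (simp add: power2_eq_square)
  next
    case False
    then obtain k where "b = 2 * k + 1" by (rule oddE)
    then have "b\<^sup>2 = 4 * (k * k + k) + 1" by (simp add: power2_eq_square algebra_simps)
    then show ?thesis by presburger
  qed
  then have "?d mod 4 = 0 \<or> ?d mod 4 = 3"
  proof -
    obtain s where s: "b\<^sup>2 = s" by blast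
    obtain t where t: "a * c = t" by blast
    have "s mod 4 = 0 \<or> s mod 4 = 1" using \<open>b\<^sup>2 mod 4 = 0 \<or> b\<^sup>2 mod 4 = 1\<close> s by simp
    then have "(4 * t - s) mod 4 = 0 \<or> (4 * t - s) mod 4 = 3" by presburger
    then show ?thesis using s t by (simp add: mult.assoc)
  qed
  moreover have "?d \<noteq> 0" using \<open>_ * ?d = 4\<close> by auto
  moreover have "?d \<noteq> 3" "?d \<noteq> - 3" using \<open>?d dvd 4\<close> by auto
  ultimately show ?thesis by auto
qed

lemma binary_form_nonneg:
  fixes a b c x y :: real
  assumes "0 < a" "b\<^sup>2 \<le> a * c"
  shows "0 \<le> a * x\<^sup>2 + 2 * b * x * y + c * y\<^sup>2"
proof -
  have "a * (a * x\<^sup>2 + 2 * b * x * y + c * y\<^sup>2) = (a * x + b * y)\<^sup>2 + (a * c - b\<^sup>2) * y\<^sup>2"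
    by (simp add: power2_eq_square algebra_simps)
  also have "\<dots> \<ge> 0" using assms(2) by simp
  finally show ?thesis using assms(1) by (simp add: zero_le_mult_iff)
qed

lemma binary_form_pos:
  fixes a b c x y :: real
  assumes "0 < a" "b\<^sup>2 < a * c" "(x, y) \<noteq> (0, 0)"
  shows "0 < a * x\<^sup>2 + 2 * b * x * y + c * y\<^sup>2"
proof -
  have "a * (a * x\<^sup>2 + 2 * b * x * y + c * y\<^sup>2) = (a * x + b * y)\<^sup>2 + (a * c - b\<^sup>2) * y\<^sup>2"
    by (simp add: power2_eq_square algebra_simps)
  also have "\<dots> > 0"
  proof (cases "y = 0")
    case True
    then show ?thesis using assms(1,3) by simp
  next
    case False
    then show ?thesis using assms(2) by (simp add: add_nonneg_pos)
  qed
  finally show ?thesis using assms(1) by (simp add: zero_less_mult_iff)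
qed

section \<open>Squares of real combinations, and positive planes\<close>

context even_form
begin

lemma sum_basis2:
  fixes r :: "'i \<Rightarrow> real" and v :: "'i \<Rightarrow> 'a" and X Y :: real
  assumes F: "finite F" and v: "\<And>A. A \<in> F \<Longrightarrow> v A = zmul (i A) t1 + zmul (j A) t2"
  defines "X \<equiv> \<Sum>A\<in>F. r A * real_of_int (i A)" and "Y \<equiv> \<Sum>A\<in>F. r A * real_of_int (j A)"
  shows "(\<Sum>A\<in>F. \<Sum>B\<in>F. r A * r B * of_int (b (v A) (v B))) =
    b t1 t1 * X\<^sup>2 + 2 * b t1 t2 * X * Y + b t2 t2 * Y\<^sup>2"
proof -
  have prods: "(\<Sum>A\<in>F. \<Sum>B\<in>F. r A * r B * (k * of_int (p A) * of_int (q B))) =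
      k * (\<Sum>A\<in>F. r A * of_int (p A)) * (\<Sum>B\<in>F. r B * of_int (q B))" for p q :: "_ \<Rightarrow> int" and k :: real
    by (simp add: sum_product sum_distrib_left mult_ac)
  have "r A * r B * of_int (b (v A) (v B)) =
      r A * r B * (of_int (b t1 t1) * of_int (i A) * of_int (i B)) +
      r A * r B * (of_int (b t1 t2) * of_int (i A) * of_int (j B)) +
      r A * r B * (of_int (b t1 t2) * of_int (j A) * of_int (i B)) +
      r A * r B * (of_int (b t2 t2) * of_int (j A) * of_int (j B))" if "A \<in> F" "B \<in> F" for A B
    using v[OF that(1)] v[OF that(2)] sym[of t2 t1]
    by (simp add: add_left add_right zmul_left zmul_right algebra_simps)
  then have "(\<Sum>A\<in>F. \<Sum>B\<in>F. r A * r B * of_int (b (v A) (v B))) =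
      of_int (b t1 t1) * X * X + of_int (b t1 t2) * X * Y + of_int (b t1 t2) * Y * X + of_int (b t2 t2) * Y * Y"
    unfolding X_def Y_def by (simp add: sum.distrib prods)
  then show ?thesis by (simp add: power2_eq_square algebra_simps)
qed

text \<open>Two orthogonal positive planes span a positive space of dimension four. Three linear
  conditions have a nonzero solution there, and its square would be at most 0 by
  \<open>pos_index_le_sum\<close>.\<close>

lemma no_positive_4_space:
  fixes r1 r2 :: "'i \<Rightarrow> real" and v :: "'i \<Rightarrow> 'a"
  assumes idx: "pos_index_le 3 b" and F: "finite F"
    and t: "0 < b t1 t1" "(b t1 t2)\<^sup>2 < b t1 t1 * b t2 t2"
    and s: "\<And>a c. (a, c) \<noteq> (0, 0) \<Longrightarrow> 0 < (\<Sum>A\<in>F. \<Sum>B\<in>F.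
      (a * r1 A + c * r2 A) * (a * r1 B + c * r2 B) * of_int (b (v A) (v B)))"
    and orth: "\<And>A. A \<in> F \<Longrightarrow> b t1 (v A) = 0" "\<And>A. A \<in> F \<Longrightarrow> b t2 (v A) = 0"
  shows False
proof -
  obtain p u n w N where b: "\<forall>j. 0 \<le> w j" "\<And>x y. of_int (b x y) =
       (\<Sum>i<3::nat. u i * p i x * p i y) - (\<Sum>j<N::nat. w j * n j x * n j y :: real)"
    using idx unfolding pos_index_le_def by blast
  obtain a1 a2 a3 a4 where a: "(a1, a2, a3, a4) \<noteq> (0, 0, 0, 0)"
    and ker: "\<forall>i<3. a1 * p i t1 + a2 * p i t2 + a3 * (\<Sum>A\<in>F. r1 A * p i (v A)) +
      a4 * (\<Sum>A\<in>F. r2 A * p i (v A)) = 0"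
    using four_unknowns[of "\<lambda>i. p i t1" "\<lambda>i. p i t2" "\<lambda>i. \<Sum>A\<in>F. r1 A * p i (v A)"
        "\<lambda>i. \<Sum>A\<in>F. r2 A * p i (v A)"] by blast
  \<comment> \<open>The two lattice vectors and the two formal combinations are merged into one
    combination, indexed by F together with two extra points.\<close>
  define I where "I = F <+> (UNIV :: bool set)"
  define c where "c = case_sum (\<lambda>A. a3 * r1 A + a4 * r2 A) (\<lambda>i. if i then a1 else a2)"
  define vv where "vv = case_sum v (\<lambda>i. if i then t1 else t2)"
  have split: "(\<Sum>s\<in>I. h s) = (\<Sum>A\<in>F. h (Inl A)) + h (Inr True) + h (Inr False)" for h :: "_ \<Rightarrow> real"
    unfolding I_def using F by (simp add: sum.Plus UNIV_bool)
  have "(\<Sum>s\<in>I. c s * p i (vv s)) = 0" if "i < 3" for i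
    using ker[rule_format, OF that] unfolding split
    by (simp add: c_def vv_def distrib_right sum.distrib sum_distrib_left mult.assoc)
  then have le: "(\<Sum>s\<in>I. \<Sum>t\<in>I. c s * c t * of_int (b (vv s) (vv t))) \<le> 0"
    by (rule pos_index_le_sum[where v = vv and c = c and I = I, OF b(2) b(1)[rule_format]])
  have orth': "b (v A) t1 = 0" "b (v A) t2 = 0" if "A \<in> F" for A using orth[OF that] sym by metis+
  have "(\<Sum>s\<in>I. \<Sum>t\<in>I. c s * c t * of_int (b (vv s) (vv t))) =
    (\<Sum>A\<in>F. \<Sum>B\<in>F. (a3 * r1 A + a4 * r2 A) * (a3 * r1 B + a4 * r2 B) * of_int (b (v A) (v B))) +
    (b t1 t1 * a1\<^sup>2 + 2 * b t1 t2 * a1 * a2 + b t2 t2 * a2\<^sup>2)"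
    unfolding split using sym[of t2 t1]
    by (simp add: c_def vv_def orth orth' power2_eq_square sum.distrib algebra_simps)
  moreover have "0 \<le> (b t1 t1 * a1\<^sup>2 + 2 * b t1 t2 * a1 * a2 + b t2 t2 * a2\<^sup>2)"
    using binary_form_nonneg[of "b t1 t1" "b t1 t2" "b t2 t2" a1 a2] t
    by (simp flip: of_int_mult of_int_power)
  moreover have "0 < (b t1 t1 * a1\<^sup>2 + 2 * b t1 t2 * a1 * a2 + b t2 t2 * a2\<^sup>2)" if "(a1, a2) \<noteq> (0, 0)"
    using binary_form_pos[of "b t1 t1" "b t1 t2" "b t2 t2" a1 a2] t that
    by (simp flip: of_int_mult of_int_power)
  moreover have "0 < (\<Sum>A\<in>F. \<Sum>B\<in>F. (a3 * r1 A + a4 * r2 A) * (a3 * r1 B + a4 * r2 B) * of_int (b (v A) (v B)))"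
    if "(a3, a4) \<noteq> (0, 0)" using s[OF that] .
  moreover have "(\<Sum>A\<in>F. \<Sum>B\<in>F. (a3 * r1 A + a4 * r2 A) * (a3 * r1 B + a4 * r2 B) * of_int (b (v A) (v B))) \<ge> 0"
    using s[of a3 a4] by (cases "(a3, a4) = (0, 0)") auto
  ultimately show False using le a by fastforce
qed

end

context K3n_form
begin

text \<open>The hypothesis \<open>disc\<close> is the action by -1 on the discriminant group,
  expressed by functionals. The sums in \<open>pos\<close> and \<open>pos2\<close> will come from a
  Kaehler class and from the plane of the symplectic form.\<close>

theorem involution_classification:
  fixes r r1 r2 :: "'n k3n_space \<Rightarrow> real"
  assumes enough: "enough_functionals TYPE('n)"
    and nondeg: "\<forall>x. (\<forall>y. nf x y = 0) \<longrightarrow> x = 0"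
    and idx: "pos_index_le 0 nf"
    and g: "Modules.additive g" "\<And>x. g (g x) = x" "\<And>x y. lf (g x) (g y) = lf x y"
    and T: "T = {x. g x = x}" and S: "S = {x. \<forall>y\<in>T. lf x y = 0}"
    and basis: "basis2 T t1 t2"
    and disc: "\<forall>f :: _ \<Rightarrow> int. Modules.additive f \<longrightarrow> (\<exists>x. \<forall>y. f (g y) + f y = lf x y)"
    and F: "finite F" and F': "finite F'"
    and pos: "0 < (\<Sum>A\<in>F. \<Sum>B\<in>F. r A * r B * of_int (lf (A + g A) (B + g B)))"
    and pos2: "\<forall>a c. (a, c) \<noteq> (0, 0) \<longrightarrow> 0 < (\<Sum>A\<in>F'. \<Sum>B\<in>F'.
      (a * r1 A + c * r2 A) * (a * r1 B + c * r2 B) * of_int (lf (A - g A) (B - g B)))"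
  shows "isometric (lat T lf) (lat UNIV (plane_form 1)) \<and> isometric (lat S lf) (lat UNIV kf)
    \<or> isometric (lat T lf) (lat UNIV (plane_form 2)) \<and> isometric (lat S lf) (lat UNIV S2)
    \<or> isometric (lat T lf) (lat UNIV (orth_sum (rank1_form 2) (rank1_form (- 2)))) \<and>
        isometric (lat S lf) (lat UNIV S3)
    \<or> even m \<and> isometric (lat T lf) (lat UNIV (plane_form 2)) \<and> isometric (lat S lf) (lat UNIV kf)
    \<or> odd m \<and> isometric (lat T lf) (lat UNIV (orth_sum (rank1_form 2) (rank1_form (- 2)))) \<and>
        isometric (lat S lf) (lat UNIV kf)
    \<or> m = 4 \<and> isometric (lat T lf) (lat UNIV (orth_sum (rank1_form 2) (rank1_form (- 2)))) \<and>
        isometric (lat S lf) (lat UNIV S6)"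
proof (rule rank_2_classification[OF basis _ _ S])
  have torsion_free: "x = 0" if "zmul k x = 0" "k \<noteq> 0" for k and x :: "'n k3n_space"
  proof (rule lf_nondegenerate[OF nondeg[rule_format]])
    fix y
    have "k * lf x y = lf (zmul k x) y" by (simp only: L.zmul_left)
    then show "lf x y = 0" using that by simp
  qed
  have pure: "x \<in> T" if "k \<noteq> 0" "zmul k x \<in> T" for k x
  proof -
    have "zmul k (g x) = zmul k x"
      using that(2) additive_zmul[OF g(1), of k x] unfolding T by simp
    then have "zmul k (g x - x) = 0"
      using zmul_add_right[of k "g x" "- x"] by (simp add: zmul_minus_right)
    then have "g x - x = 0" using that(1) by (rule torsion_free)
    then show ?thesis unfolding T by simp
  qed
  show "x \<in> T" if "zmul 2 x \<in> T" for x using pure[OF _ that] by simp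
  have enoughL: "enough_functionals TYPE('n k3n_space)"
    by (intro enough_functionals_prod enough_functionals_int enough)
  obtain p q :: "'n k3n_space \<Rightarrow> int"
    where p: "Modules.additive p" "p t1 = 1" "p t2 = 0" and q: "Modules.additive q" "q t1 = 0" "q t2 = 1"
    using dual_basis[OF enoughL basis] pure by blast
  have bT: "bij_betw (\<lambda>(i, j). zmul i t1 + zmul j t2) UNIV T" using basis unfolding basis2_def .
  have mem: "zmul i t1 + zmul j t2 \<in> T" for i j using bT by (auto simp: bij_betw_def)
  have t: "g t1 = t1" "g t2 = t2" using mem[of 1 0] mem[of 0 1] unfolding T by simp_all
  have coords: "\<exists>i j. x = zmul i t1 + zmul j t2" if "g x = x" for x
  proof -
    have "x \<in> T" using that unfolding T by simp
    then show ?thesis using bT by (auto simp: bij_betw_def)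
  qed
  \<comment> \<open>The functional \<open>f (g y) + f y\<close> is invariant under g, hence so is
    the x representing it, by nondegeneracy. So 2f on T is the product with an element of T; for the
    dual basis this gives the rows of a matrix whose product with the Gram matrix is 2.\<close>
  have rep: "\<exists>i j. 2 * f t1 = i * lf t1 t1 + j * lf t1 t2 \<and> 2 * f t2 = i * lf t1 t2 + j * lf t2 t2"
    if f: "Modules.additive f" for f :: "'n k3n_space \<Rightarrow> int"
  proof -
    obtain x where x: "\<And>y. f (g y) + f y = lf x y" using disc[rule_format, OF f] by blast
    have "g x - x = 0"
    proof (rule lf_nondegenerate[OF nondeg[rule_format]])
      fix y
      have "lf (g x) y = lf x (g y)" using g(3)[of x "g y"] by (simp add: g(2))
      then have "lf (g x) y = lf x y" using x[of y] x[of "g y"] by (simp add: g(2))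
      then show "lf (g x - x) y = 0" by (simp only: L.diff_left)
    qed
    then have "g x = x" by simp
    then obtain i j where ij: "x = zmul i t1 + zmul j t2" using coords by blast
    have "2 * f t1 = lf x t1" "2 * f t2 = lf x t2" using x[of t1] x[of t2] t by simp_all
    then have "2 * f t1 = i * lf t1 t1 + j * lf t1 t2 \<and> 2 * f t2 = i * lf t1 t2 + j * lf t2 t2"
      unfolding ij using L.sym[of t2 t1] by (simp only: L.add_left L.zmul_left simp_thms)
    then show ?thesis by blast
  qed
  obtain a where a: "lf t1 t1 = 2 * a" using L.even by (meson dvdE)
  obtain c where c: "lf t2 t2 = 2 * c" using L.even by (meson dvdE)
  obtain x11 x12 where x1: "2 = x11 * (2 * a) + x12 * lf t1 t2" "0 = x11 * lf t1 t2 + x12 * (2 * c)"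
    using rep[OF p(1)] by (auto simp: p a c)
  obtain x21 x22 where x2: "0 = x21 * (2 * a) + x22 * lf t1 t2" "2 = x21 * lf t1 t2 + x22 * (2 * c)"
    using rep[OF q(1)] by (auto simp: q a c)
  have d: "4 * a * c - (lf t1 t2)\<^sup>2 \<in> {- 1, - 4, 4}"
    by (rule discriminant_values[of x11 a x12 _ c x21 x22]) (use x1 x2 in simp_all)
  \<comment> \<open>Determinant 4 makes T definite. If T is negative, \<open>pos\<close> fails,
    since all A + gA lie in T. If T is positive, it forms a positive 4-space with the plane of
    \<open>pos2\<close>, whose vectors A - gA are orthogonal to T.\<close>
  have False if d4: "4 * a * c - (lf t1 t2)\<^sup>2 = 4"
  proof -
    have lt: "(lf t1 t2)\<^sup>2 < lf t1 t1 * lf t2 t2" using d4 by (simp add: a c)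
    have "lf t1 t1 \<noteq> 0" using lt by auto
    moreover have "\<not> lf t1 t1 < 0"
    proof
      assume neg: "lf t1 t1 < 0"
      have "\<exists>i j. A + g A = zmul i t1 + zmul j t2" for A
        by (rule coords) (simp add: additive.add[OF g(1)] g(2) add.commute)
      then obtain i j where ij: "\<And>A. A + g A = zmul (i A) t1 + zmul (j A) t2" by metis
      define X where "X = (\<Sum>A\<in>F. r A * real_of_int (i A))"
      define Y where "Y = (\<Sum>A\<in>F. r A * real_of_int (j A))"
      have "0 < lf t1 t1 * X\<^sup>2 + 2 * lf t1 t2 * X * Y + lf t2 t2 * Y\<^sup>2"
        using pos L.sum_basis2[OF F, of "\<lambda>A. A + g A" i t1 j t2 r] ij unfolding X_def Y_def by simp
      moreover have "0 \<le> (- lf t1 t1) * X\<^sup>2 + 2 * (- lf t1 t2) * X * Y + (- lf t2 t2) * Y\<^sup>2"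
        using binary_form_nonneg[of "- lf t1 t1" "- lf t1 t2" "- lf t2 t2" X Y] neg lt
        by (simp flip: of_int_mult of_int_power)
      ultimately show False by simp
    qed
    moreover have "\<not> 0 < lf t1 t1"
    proof
      assume "0 < lf t1 t1"
      have orth: "lf x (A - g A) = 0" if "g x = x" for x A
      proof -
        have "lf x (g A) = lf x A" using g(3)[of x A] that by simp
        then show ?thesis by (simp only: L.diff_right)
      qed
      show False
        by (rule L.no_positive_4_space[OF pos_index_le_lf[OF idx] F' \<open>0 < lf t1 t1\<close> lt pos2[rule_format] orth orth])
          (use t in auto)
    qed
    ultimately show False by linarith
  qed
  then have "4 * a * c - (lf t1 t2)\<^sup>2 \<in> {- 1, - 4}" using d by blast
  then show "lf t1 t1 * lf t2 t2 - (lf t1 t2)\<^sup>2 \<in> {- 1, - 4}" by (simp add: a c mult.assoc)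
qed

end

section \<open>The discriminant group\<close>

lemma comm_group_dual_group:
  assumes "Group.group L"
  shows "comm_group (dual_group L)"
    and "f \<in> carrier (dual_group L) \<Longrightarrow> inv\<^bsub>dual_group L\<^esub> f = (\<lambda>x\<in>carrier L. - f x)"
proof -
  interpret Group.group L by fact
  have hom: "f \<in> carrier (dual_group L) \<longleftrightarrow> f \<in> extensional (carrier L) \<and>
      (\<forall>x\<in>carrier L. \<forall>y\<in>carrier L. f (x \<otimes>\<^bsub>L\<^esub> y) = f x + f y)" for f :: "'a \<Rightarrow> int"
    by (auto simp: dual_group_def hom_def integer_group_def)
  have minus: "(\<lambda>x\<in>carrier L. - f x) \<in> carrier (dual_group L)" if "f \<in> carrier (dual_group L)" for f :: "'a \<Rightarrow> int"
    using that unfolding hom by (simp add: extensional_restrict)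
  have minus_mult: "(\<lambda>x\<in>carrier L. - f x) \<otimes>\<^bsub>dual_group L\<^esub> f = \<one>\<^bsub>dual_group L\<^esub>" for f
    by (simp add: dual_group_def fun_eq_iff restrict_def)
  show comm: "comm_group (dual_group L)"
  proof (rule comm_groupI)
    show "x \<otimes>\<^bsub>dual_group L\<^esub> y \<in> carrier (dual_group L)"
      if "x \<in> carrier (dual_group L)" "y \<in> carrier (dual_group L)" for x y
      using that unfolding hom by (simp add: dual_group_def)
    show "\<one>\<^bsub>dual_group L\<^esub> \<in> carrier (dual_group L)"
      unfolding hom by (simp add: dual_group_def)
    show "x \<otimes>\<^bsub>dual_group L\<^esub> y \<otimes>\<^bsub>dual_group L\<^esub> z = x \<otimes>\<^bsub>dual_group L\<^esub> (y \<otimes>\<^bsub>dual_group L\<^esub> z)" for x y z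
      by (simp add: dual_group_def fun_eq_iff restrict_def)
    show "x \<otimes>\<^bsub>dual_group L\<^esub> y = y \<otimes>\<^bsub>dual_group L\<^esub> x" for x y
      by (simp add: dual_group_def fun_eq_iff restrict_def)
    show "\<one>\<^bsub>dual_group L\<^esub> \<otimes>\<^bsub>dual_group L\<^esub> x = x" if "x \<in> carrier (dual_group L)" for x
      using that unfolding hom by (auto simp: dual_group_def fun_eq_iff restrict_def extensional_def)
    show "\<exists>y\<in>carrier (dual_group L). y \<otimes>\<^bsub>dual_group L\<^esub> x = \<one>\<^bsub>dual_group L\<^esub>"
      if "x \<in> carrier (dual_group L)" for x
      using minus[OF that] minus_mult by blast
  qed
  interpret D: comm_group "dual_group L" by (rule comm)
  show "inv\<^bsub>dual_group L\<^esub> f = (\<lambda>x\<in>carrier L. - f x)" if "f \<in> carrier (dual_group L)"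
    using D.inv_equality[OF minus_mult that minus[OF that]] .
qed

text \<open>The coset of f is sent to its inverse, which consists of the negatives of its members.
  So the image of f, that is f composed with the involution g, is - f up to the product with a
  lattice vector.\<close>

lemma acts_as_minus_idD:
  assumes L: "Group.group L"
    and add: "\<And>x y z. x \<in> carrier L \<Longrightarrow> y \<in> carrier L \<Longrightarrow> z \<in> carrier L \<Longrightarrow>
      form L (x \<otimes>\<^bsub>L\<^esub> y) z = form L x z + form L y z"
    and sym: "\<And>x y. x \<in> carrier L \<Longrightarrow> y \<in> carrier L \<Longrightarrow> form L x y = form L y x"
    and g: "\<And>x. x \<in> carrier L \<Longrightarrow> g x \<in> carrier L" "\<And>x. x \<in> carrier L \<Longrightarrow> g (g x) = x"
    and disc: "acts_as_minus_id_on_discriminant L g"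
    and f: "\<And>x y. x \<in> carrier L \<Longrightarrow> y \<in> carrier L \<Longrightarrow> f (x \<otimes>\<^bsub>L\<^esub> y) = f x + f y"
  shows "\<exists>z\<in>carrier L. \<forall>y\<in>carrier L. f (g y) + f y = - form L z y"
proof -
  interpret Group.group L by fact
  interpret D: comm_group "dual_group L" by (rule comm_group_dual_group) fact
  let ?D = "dual_group L" and ?N = "dual_embedding L ` carrier L"
  have add2: "form L z (x \<otimes>\<^bsub>L\<^esub> y) = form L z x + form L z y"
    if "x \<in> carrier L" "y \<in> carrier L" "z \<in> carrier L" for x y z
    using add[OF that] sym[of z "x \<otimes>\<^bsub>L\<^esub> y"] sym[of z x] sym[of z y] that by simp
  have one: "form L \<one>\<^bsub>L\<^esub> y = 0" if "y \<in> carrier L" for y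
    using add[of "\<one>\<^bsub>L\<^esub>" "\<one>\<^bsub>L\<^esub>" y] that by simp
  have inv: "form L (inv\<^bsub>L\<^esub> x) y = - form L x y" if "x \<in> carrier L" "y \<in> carrier L" for x y
    using add[of "inv\<^bsub>L\<^esub> x" x y] one[of y] that by simp
  have emb: "dual_embedding L x \<in> carrier ?D" if "x \<in> carrier L" for x
    using that add2 by (auto simp: dual_group_def dual_embedding_def hom_def integer_group_def)
  have sub: "subgroup ?N ?D"
  proof (rule D.subgroupI)
    show "?N \<noteq> {}" using one_closed by blast
    show "?N \<subseteq> carrier ?D" using emb by (rule image_subsetI)
    show "inv\<^bsub>?D\<^esub> a \<in> ?N" if a: "a \<in> ?N" for a
    proof -
      obtain x where x: "x \<in> carrier L" "a = dual_embedding L x" using a unfolding image_iff by (elim bexE)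
      have "inv\<^bsub>?D\<^esub> a = dual_embedding L (inv\<^bsub>L\<^esub> x)"
        unfolding x(2) comm_group_dual_group(2)[OF L emb[OF x(1)]]
        using x(1) by (auto simp: dual_embedding_def inv)
      then show ?thesis using x(1) by simp
    qed
    show "a \<otimes>\<^bsub>?D\<^esub> b \<in> ?N" if ab: "a \<in> ?N" "b \<in> ?N" for a b
    proof -
      obtain x where x: "x \<in> carrier L" "a = dual_embedding L x" using ab(1) unfolding image_iff by (elim bexE)
      obtain y where y: "y \<in> carrier L" "b = dual_embedding L y" using ab(2) unfolding image_iff by (elim bexE)
      have "a \<otimes>\<^bsub>?D\<^esub> b = dual_embedding L (x \<otimes>\<^bsub>L\<^esub> y)"
        unfolding x(2) y(2) using x(1) y(1) by (auto simp: dual_embedding_def dual_group_def add)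
      then show ?thesis using x(1) y(1) by simp
    qed
  qed
  have normal: "?N \<lhd> ?D" using sub by (simp only: D.normal_iff_subgroup)
  define f0 where "f0 = restrict f (carrier L)"
  have f0: "f0 \<in> carrier ?D"
    using f by (auto simp: f0_def dual_group_def hom_def integer_group_def)
  define C where "C = ?N #>\<^bsub>?D\<^esub> f0"
  have C: "C \<in> carrier (?D Mod ?N)"
    unfolding C_def FactGroup_def RCOSETS_def using f0 by auto
  have "f0 \<in> C" unfolding C_def using D.rcos_self[OF f0 sub] .
  have "discriminant_action L g C = inv\<^bsub>discriminant_group L\<^esub> C"
    using disc C unfolding acts_as_minus_id_on_discriminant_def discriminant_group_def by blast
  also have "\<dots> = set_inv\<^bsub>?D\<^esub> C"
    unfolding discriminant_group_def using normal.inv_FactGroup[OF normal C] .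
  finally have "(\<lambda>x\<in>carrier L. f0 (inv_into (carrier L) g x)) \<in> set_inv\<^bsub>?D\<^esub> C"
    using \<open>f0 \<in> C\<close> unfolding discriminant_action_def by blast
  then obtain c where c: "c \<in> C" "(\<lambda>x\<in>carrier L. f0 (inv_into (carrier L) g x)) = inv\<^bsub>?D\<^esub> c"
    unfolding SET_INV_def by auto
  then obtain z where z: "z \<in> carrier L" "c = dual_embedding L z \<otimes>\<^bsub>?D\<^esub> f0"
    unfolding C_def r_coset_def by auto
  have cD: "c \<in> carrier ?D" unfolding z(2) using emb[OF z(1)] f0 by simp
  have inj: "inj_on g (carrier L)" using g(2) by (metis inj_onI)
  have "f (g y) + f y = - form L z y" if y: "y \<in> carrier L" for y
  proof -
    have "inv_into (carrier L) g y = g y"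
      using inv_into_f_f[OF inj, of "g y"] g y by simp
    then have "f (g y) = (\<lambda>x\<in>carrier L. f0 (inv_into (carrier L) g x)) y"
      using g(1)[OF y] y by (simp add: f0_def)
    also have "\<dots> = - c y"
      unfolding c(2) comm_group_dual_group(2)[OF L cD] using y by simp
    also have "c y = form L z y + f y"
      unfolding z(2) using y by (simp add: dual_group_def dual_embedding_def f0_def)
    finally show ?thesis by simp
  qed
  then show ?thesis using z(1) by blast
qed

lemma isometric_gram:
  assumes "isometric L M" "isometric M (lat UNIV b)" "has_gram b A"
  shows "isometric L (gram_lattice A)"
  using isometric_trans[OF assms(1) isometric_trans[OF assms(2) has_gram_isometric(1)[OF assms(3)]]] .

section \<open>Involutions of the lattice of a manifold of K3n-type\<close>

text \<open>Everything is transported along an isometry from the given lattice to the type of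
  tuples; the coefficients of the real combinations are composed with its inverse
  \<open>\<psi>\<close>.\<close>

theorem lattice_involution_classification:
  fixes L :: "'c int_lattice"
  assumes n: "2 \<le> n" "n \<le> 5" and L: "Group.group L" and L_iso: "isometric L (K3n_lattice n)"
    and g: "\<And>x. x \<in> carrier L \<Longrightarrow> g x \<in> carrier L" "\<And>x. x \<in> carrier L \<Longrightarrow> g (g x) = x"
      "\<And>x y. x \<in> carrier L \<Longrightarrow> y \<in> carrier L \<Longrightarrow> g (x \<otimes>\<^bsub>L\<^esub> y) = g x \<otimes>\<^bsub>L\<^esub> g y"
      "\<And>x y. x \<in> carrier L \<Longrightarrow> y \<in> carrier L \<Longrightarrow> form L (g x) (g y) = form L x y"
    and T: "T = invariant_lattice L g" and S: "S = orthogonal_lattice L T"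
    and rank_T: "has_rank T 2" and disc: "acts_as_minus_id_on_discriminant L g"
    and F: "finite F" "F \<subseteq> carrier L" and F': "finite F'" "F' \<subseteq> carrier L"
    and pos: "0 < (\<Sum>A\<in>F. \<Sum>B\<in>F. r A * r B * real_of_int (form L (A \<otimes>\<^bsub>L\<^esub> g A) (B \<otimes>\<^bsub>L\<^esub> g B)))"
    and pos2: "\<And>a c. (a, c) \<noteq> (0, 0) \<Longrightarrow> 0 < (\<Sum>A\<in>F'. \<Sum>B\<in>F'.
      (a * r1 A + c * r2 A) * (a * r1 B + c * r2 B) *
      real_of_int (form L (A \<otimes>\<^bsub>L\<^esub> inv\<^bsub>L\<^esub> g A) (B \<otimes>\<^bsub>L\<^esub> inv\<^bsub>L\<^esub> g B)))"
  shows
    "(isometric T (gram_lattice U_gram) \<and>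
      isometric S (gram_lattice (diag_block_mat
        [U_gram, U_gram, E8_gram, E8_gram, rank1_gram (- 2 * (int n - 1))])))
   \<or> (isometric T (gram_lattice U2_gram) \<and>
      isometric S (gram_lattice (diag_block_mat
        [U_gram, U2_gram, E8_gram, E8_gram, rank1_gram (- 2 * (int n - 1))])))
   \<or> (isometric T (gram_lattice (diag_block_mat [rank1_gram 2, rank1_gram (- 2)])) \<and>
      isometric S (gram_lattice (diag_block_mat
        [U_gram, E8_gram, E8_gram, rank1_gram 2, rank1_gram (- 2), rank1_gram (- 2 * (int n - 1))])))
   \<or> (n \<in> {3, 5} \<and>
      isometric T (gram_lattice U2_gram) \<and>
      isometric S (gram_lattice (diag_block_mat
        [U_gram, U_gram, E8_gram, E8_gram, rank1_gram (- 2 * (int n - 1))])))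
   \<or> (n \<in> {2, 4} \<and>
      isometric T (gram_lattice (diag_block_mat [rank1_gram 2, rank1_gram (- 2)])) \<and>
      isometric S (gram_lattice (diag_block_mat
        [U_gram, U_gram, E8_gram, E8_gram, rank1_gram (- 2 * (int n - 1))])))
   \<or> (n = 5 \<and>
      isometric T (gram_lattice (diag_block_mat [rank1_gram 2, rank1_gram (- 2)])) \<and>
      isometric S (gram_lattice (diag_block_mat
        [U_gram, E8_gram, E8_gram,
         mat_of_rows_list 3 [[- 2, 1, 0], [1, - 2, 1], [0, 1, 2]]])))"
proof -
  interpret L: Group.group L by fact
  define m where "m = int n - 1"
  have m: "1 \<le> m" "m \<le> 4" using n by (simp_all add: m_def)
  interpret K: K3n_form E8E8_form m by (rule K3n_form_E8E8) (rule m)+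
  have r1: "rank1_gram (- 2 * (int n - 1)) = rank1_gram (- (2 * m))" by (simp add: m_def)
  have gram_m: "has_gram (rank1_form (- (2 * m))) (diag_block_mat [rank1_gram (- 2 * (int n - 1))])"
    unfolding r1 by (rule has_gram_singleton[OF has_gram_rank1])
  note gram_mf = has_gram_E8E8[OF gram_m]
  note gram_kf = has_gram_hyp[OF has_gram_hyp[OF gram_mf]]
  have "has_gram K.lf (diag_block_mat [U_gram, U_gram, U_gram, E8_gram, E8_gram, rank1_gram (- 2 * (int n - 1))])"
    by (rule has_gram_hyp[OF gram_kf])
  then have "isometric L (lat UNIV K.lf)"
    by (rule isometric_trans[OF L_iso[unfolded K3n_lattice_def] has_gram_isometric(2)])
  then obtain \<phi> where \<phi>: "\<phi> \<in> iso L (lat UNIV K.lf)"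
    and pres: "\<And>x y. x \<in> carrier L \<Longrightarrow> y \<in> carrier L \<Longrightarrow> K.lf (\<phi> x) (\<phi> y) = form L x y"
    unfolding isometric_def by auto
  have bij: "bij_betw \<phi> (carrier L) UNIV"
    and add: "\<And>x y. x \<in> carrier L \<Longrightarrow> y \<in> carrier L \<Longrightarrow> \<phi> (x \<otimes>\<^bsub>L\<^esub> y) = \<phi> x + \<phi> y"
    using \<phi> by (auto simp: iso_def hom_def)
  define \<psi> where "\<psi> = inv_into (carrier L) \<phi>"
  have \<psi>: "\<psi> y \<in> carrier L" "\<phi> (\<psi> y) = y" for y
  proof -
    have "y \<in> \<phi> ` carrier L" using bij by (simp add: bij_betw_def)
    then show "\<psi> y \<in> carrier L" "\<phi> (\<psi> y) = y"
      unfolding \<psi>_def by (rule inv_into_into, rule f_inv_into_f)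
  qed
  have \<psi>\<phi>: "\<psi> (\<phi> x) = x" if "x \<in> carrier L" for x
    using bij that unfolding \<psi>_def bij_betw_def by (simp add: inv_into_f_f)
  have \<psi>_add: "\<psi> (x + y) = \<psi> x \<otimes>\<^bsub>L\<^esub> \<psi> y" for x y
    using \<psi>\<phi>[of "\<psi> x \<otimes>\<^bsub>L\<^esub> \<psi> y"] by (simp add: add \<psi>)
  have inv: "\<phi> (inv\<^bsub>L\<^esub> x) = - \<phi> x" if "x \<in> carrier L" for x
  proof -
    have "\<phi> \<one>\<^bsub>L\<^esub> = 0" using add[of "\<one>\<^bsub>L\<^esub>" "\<one>\<^bsub>L\<^esub>"] by simp
    then show ?thesis using add[of "inv\<^bsub>L\<^esub> x" x] that by (simp add: eq_neg_iff_add_eq_0)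
  qed
  define g' where "g' = (\<lambda>x. \<phi> (g (\<psi> x)))"
  have g'\<phi>: "g' (\<phi> x) = \<phi> (g x)" if "x \<in> carrier L" for x
    using that by (simp add: g'_def \<psi>\<phi>)
  have g': "Modules.additive g'" "g' (g' x) = x" "K.lf (g' x) (g' y) = K.lf x y" for x y
    using pres[of "\<psi> x" "\<psi> y"] by (simp_all add: g'_def Modules.additive_def \<psi>_add g \<psi> add \<psi>\<phi> pres)
  define T' where "T' = {x. g' x = x}"
  define S' where "S' = {x. \<forall>y\<in>T'. K.lf x y = 0}"
  have carT: "carrier T = {x \<in> carrier L. g x = x}" and multT: "monoid.mult T = monoid.mult L"
    and formT: "form T = form L" by (simp_all add: T invariant_lattice_def)
  have T'\<phi>: "\<phi> x \<in> T' \<longleftrightarrow> x \<in> carrier T" if "x \<in> carrier L" for x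
  proof -
    have "\<phi> (g x) = \<phi> x \<longleftrightarrow> g x = x"
      using \<psi>\<phi>[OF that] \<psi>\<phi>[OF g(1)[OF that]] by auto
    then show ?thesis using that by (simp add: T'_def carT g'\<phi>)
  qed
  have bijT: "bij_betw \<phi> (carrier T) T'"
  proof (rule bij_betwI[where g = \<psi>])
    show "\<phi> \<in> carrier T \<rightarrow> T'" using T'\<phi> by (auto simp: carT)
    show "\<psi> \<in> T' \<rightarrow> carrier T" using T'\<phi>[OF \<psi>(1)] \<psi>(2) by auto
  qed (use \<psi> \<psi>\<phi> in \<open>auto simp: carT\<close>)
  have isoT: "isometric T (lat T' K.lf)"
    by (rule isometricI[where f = \<phi>]) (use bijT in \<open>simp_all add: carT multT formT add pres\<close>)
  have carS: "carrier S = {x \<in> carrier L. \<forall>y\<in>carrier T. form L x y = 0}"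
    and multS: "monoid.mult S = monoid.mult L"
    and formS: "form S = form L" by (simp_all add: S orthogonal_lattice_def)
  have S'\<phi>: "\<phi> x \<in> S' \<longleftrightarrow> x \<in> carrier S" if x: "x \<in> carrier L" for x
  proof
    assume "\<phi> x \<in> S'"
    then have "form L x y = 0" if "y \<in> carrier T" for y
      using that T'\<phi>[of y] pres[OF x, of y] by (simp add: S'_def carT)
    then show "x \<in> carrier S" using x by (simp add: carS)
  next
    assume "x \<in> carrier S"
    then have "K.lf (\<phi> x) y = 0" if "y \<in> T'" for y
      using that T'\<phi>[OF \<psi>(1), of y] pres[OF x \<psi>(1), of y] by (simp add: \<psi> carS)
    then show "\<phi> x \<in> S'" by (simp add: S'_def)
  qed
  have bijS: "bij_betw \<phi> (carrier S) S'"
  proof (rule bij_betwI[where g = \<psi>])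
    show "\<phi> \<in> carrier S \<rightarrow> S'" using S'\<phi> by (auto simp: carS)
    show "\<psi> \<in> S' \<rightarrow> carrier S" using S'\<phi>[OF \<psi>(1)] \<psi>(2) by auto
  qed (use \<psi> \<psi>\<phi> in \<open>auto simp: carS\<close>)
  have isoS: "isometric S (lat S' K.lf)"
    by (rule isometricI[where f = \<phi>]) (use bijS in \<open>simp_all add: carS multS formS add pres\<close>)
  obtain h where "h \<in> iso T (int_vec_group 2)"
    using rank_T unfolding has_rank_def is_iso_def by blast
  then have h: "bij_betw h (carrier T) (carrier_vec 2)"
    and h_add: "\<And>x y. x \<in> carrier T \<Longrightarrow> y \<in> carrier T \<Longrightarrow> h (x \<otimes>\<^bsub>L\<^esub> y) = h x + h y"
    by (auto simp: iso_def hom_def int_vec_group_def multT)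
  have v2: "bij_betw (\<lambda>(i, j). vec_of_list [i, j :: int]) UNIV (carrier_vec 2)"
  proof (rule bij_betwI[where g = "\<lambda>v. (vec_index v 0, vec_index v 1)"])
    show "(\<lambda>(i, j). vec_of_list [i, j]) \<in> UNIV \<rightarrow> carrier_vec 2"
      by (auto intro!: carrier_vecI)
    show "(case (vec_index v 0, vec_index v 1) of (i, j) \<Rightarrow> vec_of_list [i, j]) = v" if "v \<in> carrier_vec 2" for v :: "int Matrix.vec"
      using that by (intro eq_vecI) (auto simp: less_2_cases_iff vec_of_list_index)
  qed (auto simp: vec_of_list_index)
  define hi where "hi = inv_into (carrier T) h"
  have hi: "bij_betw hi (carrier_vec 2) (carrier T)"
    unfolding hi_def using bij_betw_inv_into[OF h] .
  have h_hi: "h (hi v) = v" if "v \<in> carrier_vec 2" for v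
    using h that unfolding hi_def by (simp add: bij_betw_def f_inv_into_f)
  have hi_h: "hi (h x) = x" if "x \<in> carrier T" for x
    using h that unfolding hi_def by (simp add: bij_betw_def)
  have hi_T: "hi v \<in> carrier T" if "v \<in> carrier_vec 2" for v
    using bij_betwE[OF hi] that by blast
  have hi_add: "hi (u + v) = hi u \<otimes>\<^bsub>L\<^esub> hi v" if uv: "u \<in> carrier_vec 2" "v \<in> carrier_vec 2" for u v
  proof -
    have "hi u \<otimes>\<^bsub>L\<^esub> hi v \<in> carrier T"
      using hi_T[OF uv(1)] hi_T[OF uv(2)] by (simp add: carT g(3))
    then show ?thesis
      using hi_h[of "hi u \<otimes>\<^bsub>L\<^esub> hi v"] h_add[OF hi_T[OF uv(1)] hi_T[OF uv(2)]] h_hi uv by simp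
  qed
  \<comment> \<open>The rank of T is given by an isomorphism with integer vectors of length two.
    Composed with \<open>\<phi>\<close> it provides the basis k(1, 0), k(0, 1) of the transported
    lattice.\<close>
  define k where "k = (\<lambda>(i, j). \<phi> (hi (vec_of_list [i, j :: int])))"
  have "bij_betw (\<phi> \<circ> (hi \<circ> (\<lambda>(i, j). vec_of_list [i, j :: int]))) UNIV T'"
    by (rule bij_betw_trans[OF bij_betw_trans[OF v2 hi] bijT])
  moreover have "\<phi> \<circ> (hi \<circ> (\<lambda>(i, j). vec_of_list [i, j :: int])) = k"
    by (auto simp: k_def)
  ultimately have k_bij: "bij_betw k UNIV T'" by (simp only:)
  have k_add: "k (x + y) = k x + k y" for x y
  proof -
    obtain x1 x2 y1 y2 where xy: "x = (x1, x2)" "y = (y1, y2)" by (cases x; cases y)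
    have c: "vec_of_list [i, j] \<in> carrier_vec 2" for i j :: int
      by (rule carrier_vecI) simp
    have "vec_of_list [x1 + y1, x2 + y2] = vec_of_list [x1, x2] + vec_of_list [y1, y2]"
      by (rule eq_vecI) (auto simp: less_Suc_eq_0_disj vec_of_list_index simp del: vec_of_list_Cons)
    then have "k (x + y) = \<phi> (hi (vec_of_list [x1, x2]) \<otimes>\<^bsub>L\<^esub> hi (vec_of_list [y1, y2]))"
      unfolding xy k_def using hi_add[OF c c, of x1 x2 y1 y2] by simp
    also have "\<dots> = k x + k y"
      using hi_T[OF c, of x1 x2] hi_T[OF c, of y1 y2] unfolding xy k_def by (simp add: add carT)
    finally show ?thesis .
  qed
  then have k_additive: "Modules.additive k" by (simp add: Modules.additive_def)
  have "k = (\<lambda>(i, j). zmul i (k (1, 0)) + zmul j (k (0, 1)))"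
  proof
    fix x :: "int \<times> int"
    obtain i j where x: "x = (i, j)" by (cases x)
    have "k x = k (zmul i (1, 0) + zmul j (0, 1))" by (simp add: x)
    then show "k x = (case x of (i, j) \<Rightarrow> zmul i (k (1, 0)) + zmul j (k (0, 1)))"
      unfolding k_add additive_zmul[OF k_additive] by (simp add: x)
  qed
  then have basis: "basis2 T' (k (1, 0)) (k (0, 1))"
    using k_bij unfolding basis2_def by (simp only:)
  have symL: "form L x y = form L y x" if "x \<in> carrier L" "y \<in> carrier L" for x y
    using pres that K.L.sym by metis
  have addL: "form L (x \<otimes>\<^bsub>L\<^esub> y) z = form L x z + form L y z"
    if "x \<in> carrier L" "y \<in> carrier L" "z \<in> carrier L" for x y z
    using pres[of "x \<otimes>\<^bsub>L\<^esub> y" z] pres[of x z] pres[of y z] that by (simp add: add K.L.add_left)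
  have disc': "\<exists>x. \<forall>y. f (g' y) + f y = K.lf x y" if f: "Modules.additive f" for f
  proof -
    have "\<exists>z\<in>carrier L. \<forall>y\<in>carrier L. f (\<phi> (g y)) + f (\<phi> y) = - form L z y"
      by (rule acts_as_minus_idD[OF L addL symL g(1,2) disc]) (simp_all add: add additive.add[OF f])
    then obtain z where z: "z \<in> carrier L" "\<And>y. y \<in> carrier L \<Longrightarrow> f (\<phi> (g y)) + f (\<phi> y) = - form L z y"
      by blast
    have "f (g' y) + f y = K.lf (- \<phi> z) y" for y
      using z(2)[OF \<psi>(1), of y] pres[OF z(1) \<psi>(1), of y] by (simp add: g'_def \<psi> K.L.minus_left)
    then show ?thesis by blast
  qed
  have inj: "inj_on \<phi> A" if "A \<subseteq> carrier L" for A
    using bij that by (auto simp: bij_betw_def intro: inj_on_subset)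
  have pos': "0 < (\<Sum>A\<in>\<phi> ` F. \<Sum>B\<in>\<phi> ` F. r (\<psi> A) * r (\<psi> B) * of_int (K.lf (A + g' A) (B + g' B)))"
  proof -
    have "K.lf (\<phi> A + g' (\<phi> A)) (\<phi> B + g' (\<phi> B)) = form L (A \<otimes>\<^bsub>L\<^esub> g A) (B \<otimes>\<^bsub>L\<^esub> g B)"
      if "A \<in> F" "B \<in> F" for A B
      using pres[of "A \<otimes>\<^bsub>L\<^esub> g A" "B \<otimes>\<^bsub>L\<^esub> g B"] that F g(1) by (simp add: subset_iff g'\<phi> add)
    then have "(\<Sum>A\<in>\<phi> ` F. \<Sum>B\<in>\<phi> ` F. r (\<psi> A) * r (\<psi> B) * of_int (K.lf (A + g' A) (B + g' B))) =
      (\<Sum>A\<in>F. \<Sum>B\<in>F. r A * r B * real_of_int (form L (A \<otimes>\<^bsub>L\<^esub> g A) (B \<otimes>\<^bsub>L\<^esub> g B)))"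
      using F(2) by (simp add: sum.reindex[OF inj[OF F(2)]] \<psi>\<phi> subset_iff cong: sum.cong)
    then show ?thesis using pos by (simp only:)
  qed
  have pos2': "0 < (\<Sum>A\<in>\<phi> ` F'. \<Sum>B\<in>\<phi> ` F'.
      (a * r1 (\<psi> A) + c * r2 (\<psi> A)) * (a * r1 (\<psi> B) + c * r2 (\<psi> B)) * of_int (K.lf (A - g' A) (B - g' B)))"
    if ac: "(a, c) \<noteq> (0, 0)" for a c
  proof -
    have "K.lf (\<phi> A - g' (\<phi> A)) (\<phi> B - g' (\<phi> B)) =
        form L (A \<otimes>\<^bsub>L\<^esub> inv\<^bsub>L\<^esub> g A) (B \<otimes>\<^bsub>L\<^esub> inv\<^bsub>L\<^esub> g B)"
      if "A \<in> F'" "B \<in> F'" for A B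
      using pres[of "A \<otimes>\<^bsub>L\<^esub> inv\<^bsub>L\<^esub> g A" "B \<otimes>\<^bsub>L\<^esub> inv\<^bsub>L\<^esub> g B"] that F' g(1)
      by (simp add: subset_iff g'\<phi> add inv)
    then have "(\<Sum>A\<in>\<phi> ` F'. \<Sum>B\<in>\<phi> ` F'.
        (a * r1 (\<psi> A) + c * r2 (\<psi> A)) * (a * r1 (\<psi> B) + c * r2 (\<psi> B)) * of_int (K.lf (A - g' A) (B - g' B))) =
      (\<Sum>A\<in>F'. \<Sum>B\<in>F'. (a * r1 A + c * r2 A) * (a * r1 B + c * r2 B) *
        real_of_int (form L (A \<otimes>\<^bsub>L\<^esub> inv\<^bsub>L\<^esub> g A) (B \<otimes>\<^bsub>L\<^esub> inv\<^bsub>L\<^esub> g B)))"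
      using F'(2) by (simp add: sum.reindex[OF inj[OF F'(2)]] \<psi>\<phi> subset_iff cong: sum.cong)
    then show ?thesis using pos2[OF ac] by (simp only:)
  qed
  have enough: "enough_functionals TYPE(e8 \<times> e8)"
    by (intro enough_functionals_prod enough_functionals_int)
  have idx: "pos_index_le 0 E8E8_form"
    using pos_index_le_orth_sum[OF pos_index_le_E8 pos_index_le_E8] by simp
  have nondeg: "\<forall>x. (\<forall>y. E8E8_form x y = 0) \<longrightarrow> x = 0"
    using E8E8_form_nondegenerate by blast
  have disc'': "\<forall>f. Modules.additive f \<longrightarrow> (\<exists>x. \<forall>y. f (g' y) + f y = K.lf x y)"
    using disc' by blast
  have pos2'': "\<forall>a c. (a, c) \<noteq> (0, 0) \<longrightarrow> 0 < (\<Sum>A\<in>\<phi> ` F'. \<Sum>B\<in>\<phi> ` F'.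
      (a * r1 (\<psi> A) + c * r2 (\<psi> A)) * (a * r1 (\<psi> B) + c * r2 (\<psi> B)) * of_int (K.lf (A - g' A) (B - g' B)))"
    using pos2' by blast
  note classification = K.involution_classification[OF enough nondeg idx g' T'_def S'_def
    basis disc'' finite_imageI[OF F(1)] finite_imageI[OF F'(1)] pos' pos2'']
  have m_even: "even m \<longleftrightarrow> n \<in> {3, 5}" and n_odd: "n \<notin> {3, 5} \<longleftrightarrow> n \<in> {2, 4}" and m4: "m = 4 \<longleftrightarrow> n = 5"
  proof -
    have "n = 2 \<or> n = 3 \<or> n = 4 \<or> n = 5" using n by auto
    then show "even m \<longleftrightarrow> n \<in> {3, 5}" "n \<notin> {3, 5} \<longleftrightarrow> n \<in> {2, 4}" "m = 4 \<longleftrightarrow> n = 5"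
      by (auto simp: m_def)
  qed
  note T1 = isometric_gram[OF isoT _ has_gram_U] and T2 = isometric_gram[OF isoT _ has_gram_U2]
    and T3 = isometric_gram[OF isoT _ has_gram_block[OF has_gram_rank1 has_gram_singleton[OF has_gram_rank1]]]
  note S1 = isometric_gram[OF isoS _ gram_kf]
    and S2 = isometric_gram[OF isoS _ has_gram_block[OF has_gram_U has_gram_block[OF has_gram_U2 gram_mf]]]
    and S3 = isometric_gram[OF isoS _ has_gram_block[OF has_gram_U has_gram_E8E8[OF
        has_gram_block[OF has_gram_rank1 has_gram_block[OF has_gram_rank1 gram_m]]]]]
    and S6 = isometric_gram[OF isoS _ has_gram_block[OF has_gram_U has_gram_E8E8[OF
        has_gram_singleton[OF has_gram_3[folded K.form3_def]]]]]
  from classification show ?thesis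
    unfolding m_even n_odd m4
    apply (elim disjE conjE)
         apply (intro disjI1 conjI T1 S1; assumption)
        apply (intro disjI2[OF disjI1] conjI T2 S2; assumption)
       apply (rule disjI2, rule disjI2, rule disjI1, intro conjI T3 S3; assumption)
      apply (rule disjI2, rule disjI2, rule disjI2, rule disjI1, intro conjI T2 S1; assumption)
     apply (rule disjI2, rule disjI2, rule disjI2, rule disjI2, rule disjI1, intro conjI T3 S1; assumption)
    apply (rule disjI2, rule disjI2, rule disjI2, rule disjI2, rule disjI2, intro conjI T3 S6; assumption)
    done
qed

section \<open>Cochains and cohomology in degree two\<close>

lemma cochain_eval_superset:
  assumes "finite F" "Poly_Mapping.keys z \<subseteq> F"
  shows "cochain_eval a z = (\<Sum>\<sigma>\<in>F. of_int (Poly_Mapping.lookup z \<sigma>) * a \<sigma>)"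
  unfolding cochain_eval_def
  by (rule sum.mono_neutral_left) (use assms in \<open>auto simp: in_keys_iff\<close>)

lemma cochain_eval_0 [simp]: "cochain_eval a 0 = 0"
  by (simp add: cochain_eval_def)

lemma cochain_eval_of [simp]: "cochain_eval a (frag_of \<sigma>) = a \<sigma>"
  by (simp add: cochain_eval_def)

lemma cochain_eval_add: "cochain_eval a (x + y) = cochain_eval a x + cochain_eval a y"
proof -
  let ?F = "Poly_Mapping.keys x \<union> Poly_Mapping.keys y"
  have "finite ?F" "Poly_Mapping.keys (x + y) \<subseteq> ?F" by (simp_all add: Poly_Mapping.keys_add)
  then show ?thesis
    using cochain_eval_superset[of ?F x a] cochain_eval_superset[of ?F y a]
      cochain_eval_superset[of ?F "x + y" a]
    by (simp add: lookup_add distrib_right sum.distrib)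
qed

lemma cochain_eval_cmul: "cochain_eval a (frag_cmul k x) = of_int k * cochain_eval a x"
proof -
  have "Poly_Mapping.keys (frag_cmul k x) \<subseteq> Poly_Mapping.keys x"
    by (rule keys_cmul)
  then show ?thesis
    using cochain_eval_superset[of "Poly_Mapping.keys x" "frag_cmul k x" a]
    by (simp add: cochain_eval_def sum_distrib_left mult.assoc)
qed

lemma cochain_eval_diff: "cochain_eval a (x - y) = cochain_eval a x - cochain_eval a y"
  using cochain_eval_add[of a "x - y" y] by simp

lemma cochain_eval_sum: "finite I \<Longrightarrow> cochain_eval a (\<Sum>i\<in>I. z i) = (\<Sum>i\<in>I. cochain_eval a (z i))"
  by (induction I rule: finite_induct) (simp_all add: cochain_eval_add)

lemma cochain_eval_extend:
  "cochain_eval a (frag_extend b x) = cochain_eval (\<lambda>\<sigma>. cochain_eval a (b \<sigma>)) x"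
  by (simp add: frag_extend_def cochain_eval_sum cochain_eval_cmul cochain_eval_def[of _ x])

lemma cochain_eval_cong:
  "(\<And>\<sigma>. \<sigma> \<in> Poly_Mapping.keys z \<Longrightarrow> a \<sigma> = b \<sigma>) \<Longrightarrow> cochain_eval a z = cochain_eval b z"
  by (simp add: cochain_eval_def)

lemma cochain_eval_plus: "cochain_eval (\<lambda>\<sigma>. a \<sigma> + b \<sigma>) z = cochain_eval a z + cochain_eval b z"
  by (simp add: cochain_eval_def distrib_left sum.distrib)

lemma cochain_eval_minus: "cochain_eval (\<lambda>\<sigma>. - a \<sigma>) z = - cochain_eval a z"
  by (simp add: cochain_eval_def sum_negf)

lemma cochain_eval_zero: "(\<And>\<sigma>. \<sigma> \<in> Poly_Mapping.keys z \<Longrightarrow> a \<sigma> = 0) \<Longrightarrow> cochain_eval a z = 0"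
  by (simp add: cochain_eval_def)

lemma cochain_eval_chain_map:
  "cochain_eval a (chain_map p f z) = cochain_eval (\<lambda>\<sigma>. a (simplex_map p f \<sigma>)) z"
  by (simp add: chain_map_def cochain_eval_extend comp_def)

lemma cochain_eval_boundary:
  "cochain_eval a (chain_boundary p z) =
     cochain_eval (\<lambda>\<sigma>. cochain_eval a (chain_boundary p (frag_of \<sigma>))) z"
proof (cases "p = 0 \<or> z = 0")
  case True
  then show ?thesis by (auto simp: chain_boundary_def cochain_eval_def)
next
  case False
  then have "cochain_eval a (chain_boundary p z) = cochain_eval (\<lambda>f. cochain_eval a
      (\<Sum>k\<le>p. frag_cmul ((-1) ^ k) (frag_of (singular_face p k f)))) z"
    by (simp add: chain_boundary_def cochain_eval_extend)
  then show ?thesis using False by (simp add: chain_boundary_of)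
qed

lemma keys_singular_chain:
  "singular_chain p X z \<Longrightarrow> \<sigma> \<in> Poly_Mapping.keys z \<Longrightarrow> singular_simplex p X \<sigma>"
  by (auto simp: singular_chain_def)

lemma cochain_eval_coboundary:
  assumes "singular_chain (Suc p) X z"
  shows "cochain_eval (coboundary p X a) z = cochain_eval a (chain_boundary (Suc p) z)"
  unfolding cochain_eval_boundary[of a "Suc p" z]
  by (rule cochain_eval_cong) (simp add: coboundary_def keys_singular_chain[OF assms])

lemma coboundary_coboundary: "coboundary (Suc p) X (coboundary p X a) = (\<lambda>_. 0)"
proof
  fix \<sigma>
  show "coboundary (Suc p) X (coboundary p X a) \<sigma> = 0"
  proof (cases "singular_simplex (Suc (Suc p)) X \<sigma>")
    case True
    then have c: "singular_chain (Suc (Suc p)) X (frag_of \<sigma>)" by (simp add: singular_chain_of)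
    have "singular_chain (Suc p) X (chain_boundary (Suc (Suc p)) (frag_of \<sigma>))"
      using singular_chain_boundary_alt[OF c] .
    then show ?thesis
      using True chain_boundary_boundary_alt[OF c] by (simp add: coboundary_def[of "Suc p"] cochain_eval_coboundary)
  qed (simp add: coboundary_def)
qed

lemma coboundary_add: "coboundary p X (\<lambda>\<sigma>. a \<sigma> + b \<sigma>) = (\<lambda>\<sigma>. coboundary p X a \<sigma> + coboundary p X b \<sigma>)"
  by (auto simp: coboundary_def cochain_eval_plus)

lemma coboundary_minus: "coboundary p X (\<lambda>\<sigma>. - a \<sigma>) = (\<lambda>\<sigma>. - coboundary p X a \<sigma>)"
  by (auto simp: coboundary_def cochain_eval_minus)

lemma coboundary_cochains: "coboundary p X a \<in> cochains (Suc p) X"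
  by (simp add: coboundary_def cochains_def)

section \<open>The group of classes of degree two\<close>

definition cocycles2 :: "'a topology \<Rightarrow> ('a, int) cochain set" where
  "cocycles2 X = carrier (cocycle_group 2 X)"

lemma cocycles2_iff: "a \<in> cocycles2 X \<longleftrightarrow> a \<in> cochains 2 X \<and> coboundary 2 X a = (\<lambda>_. 0)"
  by (simp add: cocycles2_def cocycle_group_def)

lemma cocycle_group_mult: "a \<otimes>\<^bsub>cocycle_group p X\<^esub> b = (\<lambda>\<sigma>. a \<sigma> + b \<sigma>)"
  by (simp add: cocycle_group_def)

lemma cocycles2_add: "a \<in> cocycles2 X \<Longrightarrow> b \<in> cocycles2 X \<Longrightarrow> (\<lambda>\<sigma>. a \<sigma> + b \<sigma>) \<in> cocycles2 X"
  by (auto simp: cocycles2_iff cochains_def coboundary_add)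

lemma cocycles2_minus: "a \<in> cocycles2 X \<Longrightarrow> (\<lambda>\<sigma>. - a \<sigma>) \<in> cocycles2 X"
  by (auto simp: cocycles2_iff cochains_def coboundary_minus)

lemma cocycles2_coboundary: "coboundary 1 X c \<in> cocycles2 X"
  using coboundary_coboundary[of 1 X c] coboundary_cochains[of 1 X c]
  by (simp add: cocycles2_iff numeral_2_eq_2)

lemma comm_group_cocycle: "comm_group (cocycle_group 2 X)"
proof (rule comm_groupI)
  show "\<exists>y\<in>carrier (cocycle_group 2 X). y \<otimes>\<^bsub>cocycle_group 2 X\<^esub> a = \<one>\<^bsub>cocycle_group 2 X\<^esub>"
    if "a \<in> carrier (cocycle_group 2 X)" for a
    using cocycles2_minus[of a X] that unfolding cocycles2_def
    by (intro bexI[of _ "\<lambda>\<sigma>. - a \<sigma>"]) (simp_all add: cocycle_group_def)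
  show "\<one>\<^bsub>cocycle_group 2 X\<^esub> \<in> carrier (cocycle_group 2 X)"
    by (simp add: cocycle_group_def cochains_def coboundary_def cochain_eval_def fun_eq_iff)
  show "a \<otimes>\<^bsub>cocycle_group 2 X\<^esub> b \<in> carrier (cocycle_group 2 X)"
    if "a \<in> carrier (cocycle_group 2 X)" "b \<in> carrier (cocycle_group 2 X)" for a b
    using cocycles2_add[of a X b] that unfolding cocycles2_def by (simp add: cocycle_group_mult)
qed (auto simp: cocycle_group_def ac_simps)

abbreviation coboundaries2 :: "'a topology \<Rightarrow> ('a, int) cochain set" where
  "coboundaries2 X \<equiv> coboundary 1 X ` cochains 1 X"

lemma subgroup_coboundaries: "subgroup (coboundaries2 X) (cocycle_group 2 X)"
proof -
  interpret comm_group "cocycle_group 2 X" by (rule comm_group_cocycle)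
  have inv: "inv\<^bsub>cocycle_group 2 X\<^esub> a = (\<lambda>\<sigma>. - a \<sigma>)" if "a \<in> cocycles2 X" for a
    using that cocycles2_minus[OF that] unfolding cocycles2_def
    by (intro inv_equality) (simp_all add: cocycle_group_def)
  show ?thesis
  proof (rule subgroupI)
    show "coboundaries2 X \<subseteq> carrier (cocycle_group 2 X)"
      using cocycles2_coboundary unfolding cocycles2_def by (rule image_subsetI)
    have "(\<lambda>_. 0) \<in> cochains 1 X" by (simp add: cochains_def)
    then show "coboundaries2 X \<noteq> {}" by (rule_tac notI) (simp add: image_is_empty)
    show "inv\<^bsub>cocycle_group 2 X\<^esub> a \<in> coboundaries2 X" if a: "a \<in> coboundaries2 X" for a
    proof -
      obtain c where c: "c \<in> cochains 1 X" "a = coboundary 1 X c" using a by (auto simp only: image_iff)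
      have "inv\<^bsub>cocycle_group 2 X\<^esub> a = coboundary 1 X (\<lambda>\<sigma>. - c \<sigma>)"
        unfolding c(2) inv[OF cocycles2_coboundary] coboundary_minus ..
      moreover have "(\<lambda>\<sigma>. - c \<sigma>) \<in> cochains 1 X" using c(1) by (simp add: cochains_def)
      ultimately show ?thesis by simp
    qed
    show "a \<otimes>\<^bsub>cocycle_group 2 X\<^esub> b \<in> coboundaries2 X"
      if ab: "a \<in> coboundaries2 X" "b \<in> coboundaries2 X" for a b
    proof -
      obtain c where c: "c \<in> cochains 1 X" "a = coboundary 1 X c" using ab(1) by (auto simp only: image_iff)
      obtain d where d: "d \<in> cochains 1 X" "b = coboundary 1 X d" using ab(2) by (auto simp only: image_iff)
      have "a \<otimes>\<^bsub>cocycle_group 2 X\<^esub> b = coboundary 1 X (\<lambda>\<sigma>. c \<sigma> + d \<sigma>)"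
        unfolding c(2) d(2) cocycle_group_mult coboundary_add ..
      moreover have "(\<lambda>\<sigma>. c \<sigma> + d \<sigma>) \<in> cochains 1 X" using c(1) d(1) by (simp add: cochains_def)
      ultimately show ?thesis by simp
    qed
  qed
qed

lemma normal_coboundaries: "coboundaries2 X \<lhd> cocycle_group 2 X"
  using subgroup_coboundaries comm_group.normal_iff_subgroup[OF comm_group_cocycle] by blast

lemma comm_group_H2: "comm_group (H2 X)"
  unfolding H2_def using comm_group.abelian_FactGroup[OF comm_group_cocycle subgroup_coboundaries] .

lemma H2_carrier: "A \<in> carrier (H2 X) \<longleftrightarrow> (\<exists>a\<in>cocycles2 X. A = coh_class X a)"
  unfolding H2_def FactGroup_def RCOSETS_def coh_class_def cocycles2_def by auto

lemma coh_class_mult: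
  assumes "a \<in> cocycles2 X" "b \<in> cocycles2 X"
  shows "coh_class X a \<otimes>\<^bsub>H2 X\<^esub> coh_class X b = coh_class X (\<lambda>\<sigma>. a \<sigma> + b \<sigma>)"
  using normal.rcos_sum[OF normal_coboundaries] assms
  unfolding H2_def FactGroup_def coh_class_def cocycles2_def by (simp add: cocycle_group_mult)

lemma in_coh_class: "b \<in> coh_class X a \<longleftrightarrow> (\<exists>c\<in>cochains 1 X. b = (\<lambda>\<sigma>. coboundary 1 X c \<sigma> + a \<sigma>))"
  unfolding coh_class_def r_coset_def by (auto simp: cocycle_group_mult)

lemma coh_class_self: "a \<in> cocycles2 X \<Longrightarrow> a \<in> coh_class X a"
  unfolding coh_class_def cocycles2_def
  using group.rcos_self[OF comm_group.axioms(2)[OF comm_group_cocycle] _ subgroup_coboundaries] by blast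

lemma coh_class_eqI:
  assumes "a \<in> cocycles2 X" "b \<in> coh_class X a"
  shows "coh_class X b = coh_class X a"
  using group.repr_independence[OF comm_group.axioms(2)[OF comm_group_cocycle] _ _ subgroup_coboundaries, of b X a] assms
  unfolding coh_class_def cocycles2_def by simp

section \<open>Pullback of classes along a continuous map\<close>

lemma cochain_pullback_cochains: "cochain_pullback p X f a \<in> cochains p X"
  by (simp add: cochain_pullback_def cochains_def)

lemma singular_chain_frag_of: "singular_simplex p X \<sigma> \<Longrightarrow> singular_chain p X (frag_of \<sigma>)"
  by (simp add: singular_chain_of)

lemma cochain_eval_pullback:
  assumes "singular_chain p X z"
  shows "cochain_eval (cochain_pullback p X f a) z = cochain_eval a (chain_map p f z)"
  unfolding cochain_eval_chain_map
  by (rule cochain_eval_cong) (simp add: cochain_pullback_def keys_singular_chain[OF assms])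

lemma coboundary_pullback:
  assumes f: "continuous_map X X f"
  shows "coboundary p X (cochain_pullback p X f a) = cochain_pullback (Suc p) X f (coboundary p X a)"
proof
  fix \<sigma>
  show "coboundary p X (cochain_pullback p X f a) \<sigma> = cochain_pullback (Suc p) X f (coboundary p X a) \<sigma>"
  proof (cases "singular_simplex (Suc p) X \<sigma>")
    case True
    then have c: "singular_chain (Suc p) X (frag_of \<sigma>)" by (rule singular_chain_frag_of)
    have "cochain_eval (cochain_pullback p X f a) (chain_boundary (Suc p) (frag_of \<sigma>)) =
        cochain_eval a (chain_map p f (chain_boundary (Suc p) (frag_of \<sigma>)))"
      by (rule cochain_eval_pullback) (rule singular_chain_boundary_alt[OF c])
    also have "chain_map p f (chain_boundary (Suc p) (frag_of \<sigma>)) =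
        chain_boundary (Suc p) (frag_of (simplex_map (Suc p) f \<sigma>))"
      using chain_boundary_chain_map[OF c, of f] by simp
    finally show ?thesis
      using True singular_simplex_simplex_map[OF True f] by (simp add: coboundary_def cochain_pullback_def)
  qed (simp add: coboundary_def cochain_pullback_def)
qed

lemma cochain_pullback_add:
  "cochain_pullback p X f (\<lambda>\<sigma>. a \<sigma> + b \<sigma>) = (\<lambda>\<sigma>. cochain_pullback p X f a \<sigma> + cochain_pullback p X f b \<sigma>)"
  by (auto simp: cochain_pullback_def)

lemma cocycles2_pullback:
  assumes f: "continuous_map X X f" and a: "a \<in> cocycles2 X"
  shows "cochain_pullback 2 X f a \<in> cocycles2 X"
proof -
  have "coboundary 2 X (cochain_pullback 2 X f a) = cochain_pullback 3 X f (\<lambda>_. 0)"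
    using coboundary_pullback[OF f, of 2 a] a by (simp add: cocycles2_iff)
  also have "\<dots> = (\<lambda>_. 0)" by (auto simp: cochain_pullback_def)
  finally show ?thesis by (simp add: cocycles2_iff cochain_pullback_cochains)
qed

text \<open>\<open>H2_pullback\<close> is a union over all representatives. Pullback commutes with
  the coboundary, so all cosets in that union coincide.\<close>

lemma H2_pullback_coh_class:
  assumes f: "continuous_map X X f" and a: "a \<in> cocycles2 X"
  shows "H2_pullback X f (coh_class X a) = coh_class X (cochain_pullback 2 X f a)"
proof -
  have eq: "coh_class X (cochain_pullback 2 X f b) = coh_class X (cochain_pullback 2 X f a)"
    if b: "b \<in> coh_class X a" for b
  proof -
    obtain c where c: "c \<in> cochains 1 X" "b = (\<lambda>\<sigma>. coboundary 1 X c \<sigma> + a \<sigma>)"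
      using b unfolding in_coh_class by (elim bexE)
    have "cochain_pullback 2 X f b = (\<lambda>\<sigma>. coboundary 1 X (cochain_pullback 1 X f c) \<sigma> + cochain_pullback 2 X f a \<sigma>)"
      unfolding c(2) cochain_pullback_add
      using coboundary_pullback[OF f, of 1 c] by (simp add: numeral_2_eq_2)
    then have "cochain_pullback 2 X f b \<in> coh_class X (cochain_pullback 2 X f a)"
      unfolding in_coh_class by (rule bexI[OF _ cochain_pullback_cochains])
    then show ?thesis by (rule coh_class_eqI[OF cocycles2_pullback[OF f a]])
  qed
  have "H2_pullback X f (coh_class X a) =
      (\<Union>b\<in>coh_class X a. coh_class X (cochain_pullback 2 X f a))"
    unfolding H2_pullback_def by (rule SUP_cong[OF refl]) (rule eq)
  moreover have "coh_class X a \<noteq> {}" using coh_class_self[OF a] by (rule ex_in_conv[THEN iffD1, OF exI])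
  ultimately show ?thesis by (simp only: UN_constant if_False)
qed

lemma cochain_pullback_involution:
  assumes f: "continuous_map X X f" "\<And>x. x \<in> topspace X \<Longrightarrow> f (f x) = x" and a: "a \<in> cochains p X"
  shows "cochain_pullback p X f (cochain_pullback p X f a) = a"
proof
  fix \<sigma>
  show "cochain_pullback p X f (cochain_pullback p X f a) \<sigma> = a \<sigma>"
  proof (cases "singular_simplex p X \<sigma>")
    case True
    have "simplex_map p f (simplex_map p f \<sigma>) = \<sigma>"
      using simplex_map_id_gen[OF True, of "f \<circ> f"] f(2) by (simp add: simplex_map_compose)
    then show ?thesis
      using True singular_simplex_simplex_map[OF True f(1)] by (simp add: cochain_pullback_def)
  qed (use a in \<open>simp add: cochain_pullback_def cochains_def\<close>)
qed

lemma H2_pullback_involution: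
  assumes f: "continuous_map X X f" "\<And>x. x \<in> topspace X \<Longrightarrow> f (f x) = x"
  shows "A \<in> carrier (H2 X) \<Longrightarrow> H2_pullback X f A \<in> carrier (H2 X)"
    and "A \<in> carrier (H2 X) \<Longrightarrow> H2_pullback X f (H2_pullback X f A) = A"
    and "A \<in> carrier (H2 X) \<Longrightarrow> B \<in> carrier (H2 X) \<Longrightarrow>
      H2_pullback X f (A \<otimes>\<^bsub>H2 X\<^esub> B) = H2_pullback X f A \<otimes>\<^bsub>H2 X\<^esub> H2_pullback X f B"
proof -
  show "H2_pullback X f A \<in> carrier (H2 X)" if A: "A \<in> carrier (H2 X)" for A
  proof -
    obtain a where a: "a \<in> cocycles2 X" "A = coh_class X a" using A unfolding H2_carrier by (elim bexE)
    show ?thesis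
      unfolding a(2) H2_pullback_coh_class[OF f(1) a(1)] H2_carrier
      by (rule bexI[OF refl cocycles2_pullback[OF f(1) a(1)]])
  qed
  show "H2_pullback X f (H2_pullback X f A) = A" if A: "A \<in> carrier (H2 X)" for A
  proof -
    obtain a where a: "a \<in> cocycles2 X" "A = coh_class X a" using A unfolding H2_carrier by (elim bexE)
    have "a \<in> cochains 2 X" using a(1) by (simp add: cocycles2_iff)
    then show ?thesis
      unfolding a(2) H2_pullback_coh_class[OF f(1) a(1)]
        H2_pullback_coh_class[OF f(1) cocycles2_pullback[OF f(1) a(1)]]
      using cochain_pullback_involution[OF f] by simp
  qed
  show "H2_pullback X f (A \<otimes>\<^bsub>H2 X\<^esub> B) = H2_pullback X f A \<otimes>\<^bsub>H2 X\<^esub> H2_pullback X f B"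
    if A: "A \<in> carrier (H2 X)" and B: "B \<in> carrier (H2 X)" for A B
  proof -
    obtain a where a: "a \<in> cocycles2 X" "A = coh_class X a" using A unfolding H2_carrier by (elim bexE)
    obtain b where b: "b \<in> cocycles2 X" "B = coh_class X b" using B unfolding H2_carrier by (elim bexE)
    show ?thesis
      unfolding a(2) b(2) coh_class_mult[OF a(1) b(1)] H2_pullback_coh_class[OF f(1) a(1)]
        H2_pullback_coh_class[OF f(1) b(1)] H2_pullback_coh_class[OF f(1) cocycles2_add[OF a(1) b(1)]]
        coh_class_mult[OF cocycles2_pullback[OF f(1) a(1)] cocycles2_pullback[OF f(1) b(1)]]
        cochain_pullback_add ..
  qed
qed

text \<open>The representative chosen in \<open>H2_pairing\<close> differs from a by a coboundary,
  which evaluates to 0 on a cycle.\<close>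

lemma H2_pairing_coh_class:
  assumes a: "a \<in> cocycles2 X" and z: "singular_relcycle 2 X {} z"
  shows "H2_pairing (coh_class X a) z = cochain_eval a z"
proof -
  have "(SOME b. b \<in> coh_class X a) \<in> coh_class X a"
    using coh_class_self[OF a] by (rule someI[where P = "\<lambda>b. b \<in> coh_class X a"])
  then obtain c where c: "(SOME b. b \<in> coh_class X a) = (\<lambda>\<sigma>. coboundary 1 X c \<sigma> + a \<sigma>)"
    unfolding in_coh_class by (elim bexE)
  have z': "singular_chain (Suc 1) X z" "chain_boundary (Suc 1) z = 0"
    using z by (simp_all add: singular_cycle numeral_2_eq_2)
  show ?thesis
    unfolding H2_pairing_def c cochain_eval_plus cochain_eval_coboundary[OF z'(1)] z'(2) by simp
qed

lemma H2_pairing_pullback: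
  assumes f: "continuous_map X X f" and A: "A \<in> carrier (H2 X)" and z: "singular_relcycle 2 X {} z"
  shows "H2_pairing (H2_pullback X f A) z = H2_pairing A (chain_map 2 f z)"
proof -
  obtain a where a: "a \<in> cocycles2 X" "A = coh_class X a" using A unfolding H2_carrier by (elim bexE)
  have z': "singular_relcycle 2 X {} (chain_map 2 f z)"
    by (rule singular_relcycle_chain_map[OF z f]) simp
  have "singular_chain 2 X z" using z by (simp add: singular_cycle)
  then show ?thesis
    unfolding a(2) H2_pullback_coh_class[OF f a(1)] H2_pairing_coh_class[OF a(1) z']
      H2_pairing_coh_class[OF cocycles2_pullback[OF f a(1)] z]
    by (rule cochain_eval_pullback)
qed

section \<open>Cup powers\<close>

definition simplex_shift :: "nat \<Rightarrow> (nat \<Rightarrow> real) \<Rightarrow> nat \<Rightarrow> real" where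
  "simplex_shift s x = (\<lambda>m. if s \<le> m then x (m - s) else 0)"

text \<open>\<open>middle_face\<close> in arbitrary dimension d. The Leibniz rule needs d = 3
  besides d = 2: the omitted vertex may fall inside a factor.\<close>

definition inner_face :: "nat \<Rightarrow> nat \<Rightarrow> ((nat \<Rightarrow> real) \<Rightarrow> 'a) \<Rightarrow> (nat \<Rightarrow> real) \<Rightarrow> 'a" where
  "inner_face d s \<sigma> = restrict (\<lambda>x. \<sigma> (simplex_shift s x)) (standard_simplex d)"

lemma middle_face_inner_face: "middle_face s \<sigma> = inner_face 2 s \<sigma>"
  by (simp add: middle_face_def inner_face_def simplex_shift_def)

lemma simplex_shift_in_simplex:
  assumes "x \<in> standard_simplex d" "s + d \<le> p"
  shows "simplex_shift s x \<in> standard_simplex p"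
proof -
  have x: "\<And>i. 0 \<le> x i" "\<And>i. x i \<le> 1" "\<And>i. d < i \<Longrightarrow> x i = 0" "(\<Sum>i\<le>d. x i) = 1"
    using assms(1) by (auto simp: standard_simplex_def)
  have "(\<Sum>i\<le>p. simplex_shift s x i) = (\<Sum>i\<in>{s..s + d}. simplex_shift s x i)"
    by (rule sum.mono_neutral_right) (use assms(2) x(3) in \<open>auto simp: simplex_shift_def\<close>)
  also have "\<dots> = (\<Sum>i\<in>{0..d}. simplex_shift s x (i + s))"
    using sum.shift_bounds_cl_nat_ivl[of "simplex_shift s x" 0 s d] by (simp add: add.commute)
  also have "\<dots> = 1" using x(4) by (simp add: simplex_shift_def atMost_atLeast0)
  finally show ?thesis
    using x assms(2) by (auto simp: standard_simplex_def simplex_shift_def)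
qed

lemma singular_simplex_inner_face:
  assumes \<sigma>: "singular_simplex p X \<sigma>" and sd: "s + d \<le> p"
  shows "singular_simplex d X (inner_face d s \<sigma>)"
proof -
  let ?PT = "powertop_real UNIV :: (nat \<Rightarrow> real) topology"
  have 1: "continuous_map (subtopology ?PT (standard_simplex d)) (subtopology ?PT (standard_simplex p))
      (simplex_shift s)"
  proof (clarsimp simp add: continuous_map_in_subtopology continuous_map_componentwise)
    show "(\<forall>i. continuous_map (subtopology ?PT (standard_simplex d)) euclideanreal (\<lambda>x. simplex_shift s x i)) \<and>
        simplex_shift s \<in> standard_simplex d \<rightarrow> standard_simplex p"
      using simplex_shift_in_simplex[OF _ sd]
      by (auto simp: simplex_shift_def intro!: continuous_map_from_subtopology continuous_map_product_projection)
  qed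
  have 2: "continuous_map (subtopology ?PT (standard_simplex p)) X \<sigma>"
    using \<sigma> by (simp add: singular_simplex_def)
  show ?thesis
    using continuous_map_compose[OF 1 2] by (simp add: singular_simplex_def inner_face_def comp_def)
qed

lemma inner_face_simplex_map:
  assumes "s + d \<le> p"
  shows "inner_face d s (simplex_map p f \<sigma>) = simplex_map d f (inner_face d s \<sigma>)"
  using simplex_shift_in_simplex[OF _ assms] by (auto simp: inner_face_def simplex_map_def fun_eq_iff)

text \<open>This lemma and the next two follow a block of consecutive vertices through the omission
  of vertex i. If i comes before the block, the block shifts by one; if i falls within, the block is
  a face of the block one dimension larger; if i comes after it, nothing changes.\<close>

lemma inner_face_singular_face_low:
  assumes "i \<le> s" "s + d < p"
  shows "inner_face d s (singular_face p i \<tau>) = inner_face d (Suc s) \<tau>"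
proof -
  have "simplical_face i (simplex_shift s x) = simplex_shift (Suc s) x" for x
    using assms(1) by (auto simp: fun_eq_iff simplical_face_def simplex_shift_def)
  then show ?thesis
    using simplex_shift_in_simplex[of _ d s "p - Suc 0"] assms
    unfolding inner_face_def singular_face_def by (intro restrict_ext) simp
qed

lemma inner_face_singular_face_mid:
  assumes "t \<le> Suc d" "s + d < p"
  shows "inner_face d s (singular_face p (s + t) \<tau>) = singular_face (Suc d) t (inner_face (Suc d) s \<tau>)"
proof -
  have "simplical_face (s + t) (simplex_shift s x) = simplex_shift s (simplical_face t x)" for x
    by (auto simp: fun_eq_iff simplical_face_def simplex_shift_def)
  then show ?thesis
    using simplex_shift_in_simplex[of _ d s "p - Suc 0"] simplical_face_in_standard_simplex[of "Suc d" t] assms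
    unfolding inner_face_def singular_face_def diff_Suc_Suc diff_zero by (intro restrict_ext) simp
qed

lemma inner_face_singular_face_high:
  assumes "s + d < i" "s + d < p"
  shows "inner_face d s (singular_face p i \<tau>) = inner_face d s \<tau>"
proof -
  have "simplical_face i (simplex_shift s x) = simplex_shift s x" if "x \<in> standard_simplex d" for x
    using that assms(1) by (auto simp: fun_eq_iff simplical_face_def simplex_shift_def standard_simplex_def)
  then show ?thesis
    using simplex_shift_in_simplex[of _ d s "p - Suc 0"] assms
    unfolding inner_face_def singular_face_def by (intro restrict_ext) simp
qed

text \<open>The Leibniz rule: with \<open>A\<^sub>j\<close>, \<open>D\<^sub>j\<close>, \<open>C\<^sub>j\<close>, \<open>B\<^sub>j\<close> the values on the faces of the \<open>j\<close>-th
  3-dimensional block, the sum telescopes.\<close>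

lemma alternating_product_sum:
  fixes A B C D :: "nat \<Rightarrow> int"
  assumes "\<And>j. j < k \<Longrightarrow> B j - C j + D j - A j = 0"
  defines "V \<equiv> \<lambda>j i. if i \<le> 2 * j then B j else if i = 2 * j + 1 then C j else if i = 2 * j + 2 then D j else A j"
  shows "(\<Sum>i\<le>2 * k + 1. (-1) ^ i * (\<Prod>j<k. V j i)) = 0"
  using assms(1)
proof (induction k)
  case 0
  then show ?case by simp
next
  case (Suc k)
  let ?PA = "\<Prod>j<k. A j"
  have high: "(\<Prod>j<k. V j i) = ?PA" if "2 * k + 1 \<le> i" for i
    by (rule prod.cong) (use that in \<open>auto simp: V_def\<close>)
  have low: "(\<Sum>i\<le>2 * k. (-1) ^ i * (\<Prod>j<Suc k. V j i)) = (\<Sum>i\<le>2 * k. (-1) ^ i * (\<Prod>j<k. V j i)) * B k"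
    unfolding sum_distrib_right by (rule sum.cong) (auto simp: V_def mult.assoc)
  have IH: "(\<Sum>i\<le>2 * k. (-1) ^ i * (\<Prod>j<k. V j i)) = ?PA"
    using Suc.IH Suc.prems high[of "2 * k + 1"] by simp
  have "(\<Sum>i\<le>2 * Suc k + 1. (-1) ^ i * (\<Prod>j<Suc k. V j i)) = ?PA * (B k - C k + D k - A k)"
    using low IH high[of "2 * k + 1"] high[of "2 * k + 2"] high[of "2 * k + 3"]
    by (simp add: V_def algebra_simps)
  then show ?case using Suc.prems[of k] by simp
qed

text \<open>Each factor of the cup power on a face of tau is a face of the 3-dimensional block of
  tau that starts at the even vertex 2j. The cocycle condition on these blocks is the hypothesis of
  \<open>alternating_product_sum\<close>.\<close>

lemma cup_power_cocycle:
  assumes a: "a \<in> cocycles2 X" and z: "singular_chain (Suc (2 * k)) X z"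
  shows "cochain_eval (cup_power k a) (chain_boundary (Suc (2 * k)) z) = 0"
  unfolding cochain_eval_boundary[of _ _ z]
proof (rule cochain_eval_zero)
  fix \<tau> assume "\<tau> \<in> Poly_Mapping.keys z"
  then have \<tau>: "singular_simplex (Suc (2 * k)) X \<tau>" by (rule keys_singular_chain[OF z])
  define \<rho> where "\<rho> j = inner_face 3 (2 * j) \<tau>" for j
  define V where "V t j = a (singular_face 3 t (\<rho> j))" for t j
  have zero: "V 0 j - V 1 j + V 2 j - V 3 j = 0" if "j < k" for j
  proof -
    have \<rho>: "singular_simplex (Suc 2) X (\<rho> j)"
      unfolding \<rho>_def using singular_simplex_inner_face[OF \<tau>, of "2 * j" 3] that by simp
    have "0 = coboundary 2 X a (\<rho> j)" using a by (simp add: cocycles2_iff)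
    also have "\<dots> = cochain_eval a (chain_boundary (Suc 2) (frag_of (\<rho> j)))"
      using \<rho> by (simp add: coboundary_def)
    also have "\<dots> = (\<Sum>i\<le>3. (-1) ^ i * V i j)"
      by (simp add: chain_boundary_of cochain_eval_add cochain_eval_diff V_def eval_nat_numeral)
    also have "\<dots> = V 0 j - V 1 j + V 2 j - V 3 j"
      by (simp add: numeral_3_eq_3 numeral_2_eq_2)
    finally show ?thesis by simp
  qed
  have face: "a (middle_face (2 * j) (singular_face (Suc (2 * k)) i \<tau>)) =
      (if i \<le> 2 * j then V 0 j else if i = 2 * j + 1 then V 1 j else if i = 2 * j + 2 then V 2 j else V 3 j)"
    if "j < k" for i j
  proof -
    have p: "2 * j + 2 < Suc (2 * k)" using that by simp
    \<comment> \<open>All omissions up to 2j give the same block as i = 2j, where the omitted vertex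
      is the first one of the 3-dimensional block.\<close>
    have low: "i \<le> 2 * j \<Longrightarrow> inner_face 2 (2 * j) (singular_face (Suc (2 * k)) i \<tau>) = singular_face 3 0 (\<rho> j)"
      using inner_face_singular_face_low[OF _ p, of i \<tau>] inner_face_singular_face_low[OF _ p, of "2 * j" \<tau>]
        inner_face_singular_face_mid[of 0 2 "2 * j" "Suc (2 * k)" \<tau>] p by (simp add: \<rho>_def eval_nat_numeral)
    have high: "2 * j + 2 < i \<Longrightarrow> inner_face 2 (2 * j) (singular_face (Suc (2 * k)) i \<tau>) = singular_face 3 3 (\<rho> j)"
      using inner_face_singular_face_high[OF _ p, of i \<tau>] inner_face_singular_face_high[OF _ p, of "2 * j + 3" \<tau>]
        inner_face_singular_face_mid[of 3 2 "2 * j" "Suc (2 * k)" \<tau>] p by (simp add: \<rho>_def eval_nat_numeral)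
    have mid: "inner_face 2 (2 * j) (singular_face (Suc (2 * k)) (2 * j + t) \<tau>) = singular_face 3 t (\<rho> j)" if "t \<le> 3" for t
      using inner_face_singular_face_mid[of t 2 "2 * j" "Suc (2 * k)" \<tau>] p that by (simp add: \<rho>_def eval_nat_numeral)
    consider "i \<le> 2 * j" | "i = 2 * j + 1" | "i = 2 * j + 2" | "2 * j + 2 < i" by linarith
    then show ?thesis
      by cases (simp_all add: middle_face_inner_face V_def low high mid[of 1, simplified] mid[of 2, simplified])
  qed
  have "cochain_eval (cup_power k a) (chain_boundary (Suc (2 * k)) (frag_of \<tau>)) =
      (\<Sum>i\<le>2 * k + 1. (-1) ^ i * (\<Prod>j<k. a (middle_face (2 * j) (singular_face (Suc (2 * k)) i \<tau>))))"
    by (simp add: chain_boundary_of cochain_eval_sum cochain_eval_cmul cochain_eval_diff cup_power_def)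
  also have "\<dots> = (\<Sum>i\<le>2 * k + 1. (-1) ^ i * (\<Prod>j<k. if i \<le> 2 * j then V 0 j else
      if i = 2 * j + 1 then V 1 j else if i = 2 * j + 2 then V 2 j else V 3 j))"
    by (intro sum.cong arg_cong2[where f = "(*)"] prod.cong refl) (simp add: face)
  also have "\<dots> = 0"
    by (rule alternating_product_sum) (rule zero)
  finally show "cochain_eval (cup_power k a) (chain_boundary (Suc (2 * k)) (frag_of \<tau>)) = 0" .
qed

text \<open>Taking faces commutes with composing by f, so the cup power is natural already for
  cochains.\<close>

lemma cup_power_pullback:
  assumes f: "continuous_map X X f" and z: "singular_chain (2 * k) X z"
  shows "cochain_eval (cup_power k (cochain_pullback 2 X f a)) z = cochain_eval (cup_power k a) (chain_map (2 * k) f z)"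
  unfolding cochain_eval_chain_map
proof (rule cochain_eval_cong)
  fix \<sigma> assume "\<sigma> \<in> Poly_Mapping.keys z"
  then have \<sigma>: "singular_simplex (2 * k) X \<sigma>" by (rule keys_singular_chain[OF z])
  show "cup_power k (cochain_pullback 2 X f a) \<sigma> = cup_power k a (simplex_map (2 * k) f \<sigma>)"
    unfolding cup_power_def
  proof (rule prod.cong[OF refl])
    fix j assume "j \<in> {..<k}"
    then have j: "2 * j + 2 \<le> 2 * k" by simp
    show "cochain_pullback 2 X f a (middle_face (2 * j) \<sigma>) = a (middle_face (2 * j) (simplex_map (2 * k) f \<sigma>))"
      using singular_simplex_inner_face[OF \<sigma> j] inner_face_simplex_map[OF j, of f \<sigma>]
      by (simp add: cochain_pullback_def middle_face_inner_face)
  qed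
qed

section \<open>The Beauville--Bogomolov--Fujiki form under an involution\<close>

lemma poly_eq_0_on_nat:
  fixes p :: "int poly"
  assumes "\<And>t :: nat. poly p (int t) = 0"
  shows "p = 0"
proof (rule ccontr)
  assume "p \<noteq> 0"
  then have "finite {x. poly p x = 0}" by (rule poly_roots_finite)
  moreover have "range int \<subseteq> {x. poly p x = 0}" using assms by (rule_tac image_subsetI) simp
  ultimately have "finite (range int)" by (rule rev_finite_subset)
  then show False using finite_imageD[of int UNIV] by simp
qed

text \<open>Polynomials over the integers form a domain, so equal squares at all natural numbers
  make the two polynomials equal up to one sign, common to all coefficients. This is where a uniform
  sign comes from.\<close>

lemma quadratic_square_eq:
  fixes a0 a1 a2 b0 b1 b2 :: int
  assumes "\<And>t :: nat. (a0 + a1 * int t + a2 * (int t)\<^sup>2)\<^sup>2 = (b0 + b1 * int t + b2 * (int t)\<^sup>2)\<^sup>2"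
  shows "a0 = b0 \<and> a2 = b2 \<or> a0 = - b0 \<and> a2 = - b2"
proof -
  let ?p = "[:a0, a1, a2:]" and ?r = "[:b0, b1, b2:]"
  have "poly ((?p - ?r) * (?p + ?r)) (int t) = 0" for t :: nat
  proof -
    have "poly ((?p - ?r) * (?p + ?r)) (int t) =
        (a0 + a1 * int t + a2 * (int t)\<^sup>2)\<^sup>2 - (b0 + b1 * int t + b2 * (int t)\<^sup>2)\<^sup>2"
      by (simp add: power2_eq_square algebra_simps)
    then show ?thesis using assms[of t] by simp
  qed
  then have "(?p - ?r) * (?p + ?r) = 0" by (rule poly_eq_0_on_nat)
  then have "?p - ?r = 0 \<or> ?p + ?r = 0" by (simp only: mult_eq_0_iff)
  then show ?thesis by auto
qed

lemma homologous_rel_empty: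
  assumes "homologous_rel p X {} a b"
  shows "\<exists>w. singular_chain (Suc p) X w \<and> chain_boundary (Suc p) w = a - b"
  using assms unfolding homologous_rel_def singular_boundary .

text \<open>Up to a boundary, f multiplies the fundamental cycle by some k, hence q(gB)^n = k q(B)^n
  for every class B. Taking A and gA for B gives k^2 = 1 unless q(A) = 0.\<close>

lemma BBF_abs_pullback:
  fixes X :: "('a, 'm::finite) cmanifold"
  assumes q: "BBF_form X q" and card: "CARD('m) = 2 * n" "0 < n"
    and f: "continuous_map (mtop X) (mtop X) f" "\<And>x. x \<in> topspace (mtop X) \<Longrightarrow> f (f x) = x"
    and A: "A \<in> carrier (H2 (mtop X))"
  shows "\<bar>q (H2_pullback (mtop X) f A) (H2_pullback (mtop X) f A)\<bar> = \<bar>q A A\<bar>"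
proof -
  let ?g = "H2_pullback (mtop X) f"
  let ?d = "CARD('m)"
  obtain z c where z: "fundamental_cycle (2 * ?d) (mtop X) z" and c: "(0::real) < c"
    and fuj: "\<And>a. a \<in> carrier (cocycle_group 2 (mtop X)) \<Longrightarrow>
           of_int (cochain_eval (cup_power ?d a) z) =
           c * of_int (q (coh_class (mtop X) a) (coh_class (mtop X) a)) ^ (?d div 2)"
    using q unfolding BBF_form_def by blast
  have z1: "singular_relcycle (2 * ?d) (mtop X) {} z" using z unfolding fundamental_cycle_def by blast
  then have zc: "singular_chain (2 * ?d) (mtop X) z" by (simp add: singular_cycle)
  have "singular_relcycle (2 * ?d) (mtop X) {} (chain_map (2 * ?d) f z)"
    by (rule singular_relcycle_chain_map[OF z1 f(1)]) simp
  then obtain k where "homologous_rel (2 * ?d) (mtop X) {} (chain_map (2 * ?d) f z) (frag_cmul k z)"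
    using z unfolding fundamental_cycle_def by blast
  then obtain w where w: "singular_chain (Suc (2 * ?d)) (mtop X) w"
    "chain_boundary (Suc (2 * ?d)) w = chain_map (2 * ?d) f z - frag_cmul k z"
    using homologous_rel_empty by blast
  have key: "q (?g B) (?g B) ^ n = k * q B B ^ n" if B: "B \<in> carrier (H2 (mtop X))" for B
  proof -
    obtain a where a: "a \<in> cocycles2 (mtop X)" "B = coh_class (mtop X) a"
      using B unfolding H2_carrier by (elim bexE)
    let ?P = "cochain_pullback 2 (mtop X) f a"
    have P: "?P \<in> cocycles2 (mtop X)" by (rule cocycles2_pullback[OF f(1) a(1)])
    have gB: "?g B = coh_class (mtop X) ?P" unfolding a(2) by (rule H2_pullback_coh_class[OF f(1) a(1)])
    have "cochain_eval (cup_power ?d ?P) z = cochain_eval (cup_power ?d a) (chain_map (2 * ?d) f z)"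
      by (rule cup_power_pullback[OF f(1) zc])
    also have "\<dots> = k * cochain_eval (cup_power ?d a) z"
      using cup_power_cocycle[OF a(1) w(1)] unfolding w(2) cochain_eval_diff cochain_eval_cmul by simp
    finally have "real_of_int (cochain_eval (cup_power ?d ?P) z) = of_int k * of_int (cochain_eval (cup_power ?d a) z)"
      by simp
    moreover have "real_of_int (cochain_eval (cup_power ?d ?P) z) = c * of_int (q (?g B) (?g B)) ^ n"
      using fuj[of ?P] P card(1) unfolding gB cocycles2_def by simp
    moreover have "real_of_int (cochain_eval (cup_power ?d a) z) = c * of_int (q B B) ^ n"
      using fuj[of a] a(1) card(1) unfolding a(2) cocycles2_def by simp
    ultimately have "c * of_int (q (?g B) (?g B)) ^ n = of_int k * (c * of_int (q B B) ^ n)"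
      by (simp only:)
    then have "real_of_int (q (?g B) (?g B) ^ n) = of_int (k * q B B ^ n)"
      using c by simp
    then show ?thesis by (simp only: of_int_eq_iff)
  qed
  have gA: "?g A \<in> carrier (H2 (mtop X))" "?g (?g A) = A"
    using H2_pullback_involution[OF f] A by simp_all
  have k1: "q (?g A) (?g A) ^ n = k * q A A ^ n" and k2: "q A A ^ n = k * q (?g A) (?g A) ^ n"
    using key[OF A] key[OF gA(1)] gA(2) by simp_all
  have "\<bar>q (?g A) (?g A)\<bar> ^ n = \<bar>q A A\<bar> ^ n"
  proof (cases "q A A = 0")
    case True
    then show ?thesis using k1 card(2) by (simp add: power_0_left)
  next
    case False
    have "q A A ^ n * 1 = q A A ^ n * (k * k)" using k1 k2 by (simp add: mult.left_commute mult.commute)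
    then have "k * k = 1" using False by simp
    then have "\<bar>k\<bar> = 1" by (auto simp: zmult_eq_1_iff)
    then show ?thesis using k1 by (simp add: power_abs[symmetric] abs_mult)
  qed
  then show ?thesis by (rule power_eq_imp_eq_base) (use card(2) in simp_all)
qed

text \<open>The squares of q(gA + t gB) and q(A + tB) agree for all t, so A and B carry the same
  sign. If a single class A0 changes its square, comparison with A0 gives the sign -1 to every
  class. Polarisation passes from squares to products.\<close>

lemma BBF_pullback_up_to_sign:
  fixes X :: "('a, 'm::finite) cmanifold"
  assumes q: "BBF_form X q" and card: "CARD('m) = 2 * n" "0 < n"
    and f: "continuous_map (mtop X) (mtop X) f" "\<And>x. x \<in> topspace (mtop X) \<Longrightarrow> f (f x) = x"
  defines "g \<equiv> H2_pullback (mtop X) f"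
  shows "(\<forall>A\<in>carrier (H2 (mtop X)). \<forall>B\<in>carrier (H2 (mtop X)). q (g A) (g B) = q A B) \<or>
    (\<forall>A\<in>carrier (H2 (mtop X)). \<forall>B\<in>carrier (H2 (mtop X)). q (g A) (g B) = - q A B)"
proof -
  let ?H = "H2 (mtop X)"
  interpret H: comm_group ?H by (rule comm_group_H2)
  have sym: "q A B = q B A" if "A \<in> carrier ?H" "B \<in> carrier ?H" for A B
    using q that unfolding BBF_form_def by blast
  have addl: "q (A \<otimes>\<^bsub>?H\<^esub> B) C = q A C + q B C"
    if "A \<in> carrier ?H" "B \<in> carrier ?H" "C \<in> carrier ?H" for A B C
    using q that unfolding BBF_form_def by blast
  have addr: "q C (A \<otimes>\<^bsub>?H\<^esub> B) = q C A + q C B"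
    if "A \<in> carrier ?H" "B \<in> carrier ?H" "C \<in> carrier ?H" for A B C
    using addl[OF that] sym[of C "A \<otimes>\<^bsub>?H\<^esub> B"] sym[of C A] sym[of C B] that by simp
  have g: "A \<in> carrier ?H \<Longrightarrow> g A \<in> carrier ?H"
    "A \<in> carrier ?H \<Longrightarrow> B \<in> carrier ?H \<Longrightarrow> g (A \<otimes>\<^bsub>?H\<^esub> B) = g A \<otimes>\<^bsub>?H\<^esub> g B" for A B
    unfolding g_def using H2_pullback_involution[OF f] by simp_all
  have gone: "g \<one>\<^bsub>?H\<^esub> = \<one>\<^bsub>?H\<^esub>"
    using g(2)[OF H.one_closed H.one_closed] g(1)[OF H.one_closed] by simp
  have qone: "q \<one>\<^bsub>?H\<^esub> C = 0" "q C \<one>\<^bsub>?H\<^esub> = 0" if "C \<in> carrier ?H" for C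
    using addl[OF H.one_closed H.one_closed that] addr[OF H.one_closed H.one_closed that] by simp_all
  have pow: "q (B [^]\<^bsub>?H\<^esub> (t::nat)) C = int t * q B C" "q C (B [^]\<^bsub>?H\<^esub> t) = int t * q C B"
    if "B \<in> carrier ?H" "C \<in> carrier ?H" for B C t
    using that by (induction t) (simp_all add: qone addl addr algebra_simps)
  have gpow: "g (B [^]\<^bsub>?H\<^esub> (t::nat)) = g B [^]\<^bsub>?H\<^esub> t" if "B \<in> carrier ?H" for B t
    using that by (induction t) (simp_all add: gone g)
  have quad: "q (A \<otimes>\<^bsub>?H\<^esub> B [^]\<^bsub>?H\<^esub> (t::nat)) (A \<otimes>\<^bsub>?H\<^esub> B [^]\<^bsub>?H\<^esub> t) =
      q A A + (2 * q A B) * int t + q B B * (int t)\<^sup>2" if "A \<in> carrier ?H" "B \<in> carrier ?H" for A B t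
    using that sym[of B A] by (simp add: addl addr pow power2_eq_square algebra_simps)
  have pair: "q (g A) (g A) = q A A \<and> q (g B) (g B) = q B B \<or>
      q (g A) (g A) = - q A A \<and> q (g B) (g B) = - q B B" if AB: "A \<in> carrier ?H" "B \<in> carrier ?H" for A B
  proof (rule quadratic_square_eq)
    fix t :: nat
    let ?C = "A \<otimes>\<^bsub>?H\<^esub> B [^]\<^bsub>?H\<^esub> t"
    have C: "?C \<in> carrier ?H" using AB by simp
    have "g ?C = g A \<otimes>\<^bsub>?H\<^esub> g B [^]\<^bsub>?H\<^esub> t" using AB by (simp add: g gpow)
    moreover have "(q (g ?C) (g ?C))\<^sup>2 = (q ?C ?C)\<^sup>2"
      using BBF_abs_pullback[OF q card f C, folded g_def] by (simp only: power2_eq_iff abs_eq_iff)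
    ultimately show "(q (g A) (g A) + (2 * q (g A) (g B)) * int t + q (g B) (g B) * (int t)\<^sup>2)\<^sup>2 =
       (q A A + (2 * q A B) * int t + q B B * (int t)\<^sup>2)\<^sup>2"
      using quad[OF AB, of t] quad[OF g(1)[OF AB(1)] g(1)[OF AB(2)], of t] by simp
  qed
  have polar: "2 * q A B = q (A \<otimes>\<^bsub>?H\<^esub> B) (A \<otimes>\<^bsub>?H\<^esub> B) - q A A - q B B" if "A \<in> carrier ?H" "B \<in> carrier ?H" for A B
    using quad[OF that, of 1] that by simp
  show ?thesis
  proof (cases "\<forall>A\<in>carrier ?H. q (g A) (g A) = q A A")
    case True
    have "q (g A) (g B) = q A B" if "A \<in> carrier ?H" "B \<in> carrier ?H" for A B
      using polar[OF that] polar[OF g(1)[OF that(1)] g(1)[OF that(2)]] that True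
        True[rule_format, of "A \<otimes>\<^bsub>?H\<^esub> B"] by (simp add: g)
    then show ?thesis by simp
  next
    case False
    then obtain A0 where A0: "A0 \<in> carrier ?H" "q (g A0) (g A0) \<noteq> q A0 A0" by blast
    have neg: "q (g A) (g A) = - q A A" if "A \<in> carrier ?H" for A
      using pair[OF A0(1) that] A0(2) by simp
    have "q (g A) (g B) = - q A B" if "A \<in> carrier ?H" "B \<in> carrier ?H" for A B
      using polar[OF that] polar[OF g(1)[OF that(1)] g(1)[OF that(2)]] that
        neg[of "A \<otimes>\<^bsub>?H\<^esub> B"] neg[of A] neg[of B] by (simp add: g)
    then show ?thesis by simp
  qed
qed

section \<open>Smooth functions\<close>

lemma Ck_on_cong:
  assumes "open V" "\<And>x. x \<in> V \<Longrightarrow> f x = g x" "Ck_on k V f"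
  shows "Ck_on k V g"
proof (cases k)
  case 0
  then show ?thesis using assms by (simp cong: continuous_on_cong)
next
  case (Suc j)
  then obtain f' where f': "\<And>x. x \<in> V \<Longrightarrow> (f has_derivative f' x) (at x)" "\<And>v. Ck_on j V (\<lambda>x. f' x v)"
    using assms(3) by auto
  have "(g has_derivative f' x) (at x)" if "x \<in> V" for x
    using has_derivative_transform_within_open[OF f'(1)[OF that] assms(1) that assms(2)] by simp
  then show ?thesis using f'(2) Suc by auto
qed

lemma Ck_on_subset: "Ck_on k V f \<Longrightarrow> U \<subseteq> V \<Longrightarrow> Ck_on k U f"
proof (induction k arbitrary: f)
  case 0
  then show ?case using continuous_on_subset by auto
next
  case (Suc k)
  then obtain f' where "\<And>x. x \<in> V \<Longrightarrow> (f has_derivative f' x) (at x)" "\<And>v. Ck_on k V (\<lambda>x. f' x v)"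
    by auto
  then show ?case using Suc.IH Suc.prems(2) unfolding Ck_on.simps by (intro exI[of _ f']) auto
qed

text \<open>The derivative in \<open>Ck_on\<close> is only asserted to exist. On an open set it is
  the Frechet derivative, which is the same for all neighbourhoods of a point and so lets local
  statements be glued.\<close>

lemma Ck_on_Suc_frechet:
  assumes "open V"
  shows "Ck_on (Suc k) V f \<longleftrightarrow>
    (\<forall>x\<in>V. f differentiable (at x)) \<and> (\<forall>v. Ck_on k V (\<lambda>x. frechet_derivative f (at x) v))"
proof
  assume "Ck_on (Suc k) V f"
  then obtain f' where f': "\<And>x. x \<in> V \<Longrightarrow> (f has_derivative f' x) (at x)" "\<And>v. Ck_on k V (\<lambda>x. f' x v)"
    by auto
  have eq: "f' x = frechet_derivative f (at x)" if "x \<in> V" for x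
    using frechet_derivative_at[OF f'(1)[OF that]] .
  have "Ck_on k V (\<lambda>x. frechet_derivative f (at x) v)" for v
    by (rule Ck_on_cong[OF assms _ f'(2)[of v]]) (simp add: eq)
  moreover have "f differentiable (at x)" if "x \<in> V" for x
    using f'(1)[OF that] by (rule differentiableI)
  ultimately show "(\<forall>x\<in>V. f differentiable (at x)) \<and> (\<forall>v. Ck_on k V (\<lambda>x. frechet_derivative f (at x) v))"
    by blast
next
  assume "(\<forall>x\<in>V. f differentiable (at x)) \<and> (\<forall>v. Ck_on k V (\<lambda>x. frechet_derivative f (at x) v))"
  then show "Ck_on (Suc k) V f"
    by (auto simp: frechet_derivative_works intro!: exI[of _ "\<lambda>x. frechet_derivative f (at x)"])
qed

lemma Ck_on_local:
  assumes "open V" "\<And>x. x \<in> V \<Longrightarrow> \<exists>U. open U \<and> x \<in> U \<and> U \<subseteq> V \<and> Ck_on k U f"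
  shows "Ck_on k V f"
  using assms(2)
proof (induction k arbitrary: f)
  case 0
  have "isCont f x" if x: "x \<in> V" for x
  proof -
    obtain U where "open U" "x \<in> U" "continuous_on U f" using 0[OF x] by auto
    then show ?thesis by (simp add: continuous_on_eq_continuous_at)
  qed
  then show ?case by (simp add: continuous_at_imp_continuous_on)
next
  case (Suc k)
  have loc: "\<exists>U. open U \<and> x \<in> U \<and> U \<subseteq> V \<and> f differentiable (at x) \<and>
      (\<forall>v. Ck_on k U (\<lambda>x. frechet_derivative f (at x) v))" if x: "x \<in> V" for x
  proof -
    obtain U where U: "open U" "x \<in> U" "U \<subseteq> V" "Ck_on (Suc k) U f" using Suc.prems[OF x] by blast
    then show ?thesis using Ck_on_Suc_frechet[OF U(1), of k f] by blast
  qed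
  have "Ck_on k V (\<lambda>x. frechet_derivative f (at x) v)" for v
    by (rule Suc.IH) (use loc in blast)
  then show ?case using loc Ck_on_Suc_frechet[OF assms(1), of k f] by blast
qed

lemma Ck_on_SucD: "Ck_on (Suc k) V f \<Longrightarrow> Ck_on k V f"
proof (induction k arbitrary: f)
  case 0
  then obtain f' where "\<And>x. x \<in> V \<Longrightarrow> (f has_derivative f' x) (at x)" by auto
  then show ?case by (auto intro: continuous_at_imp_continuous_on has_derivative_continuous)
next
  case (Suc k)
  then obtain f' where f': "\<forall>x\<in>V. (f has_derivative f' x) (at x)" "\<forall>v. Ck_on (Suc k) V (\<lambda>x. f' x v)"
    unfolding Ck_on.simps(2)[of "Suc k"] by blast
  then have "\<forall>v. Ck_on k V (\<lambda>x. f' x v)" using Suc.IH by blast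
  then show ?case unfolding Ck_on.simps(2)[of k] using f'(1) by blast
qed

lemma Ck_on_const: "Ck_on k V (\<lambda>_. c)"
proof (induction k arbitrary: c)
  case (Suc k)
  then show ?case by (auto intro!: exI[of _ "\<lambda>_ _. 0"])
qed simp

lemma Ck_on_add: "Ck_on k V f \<Longrightarrow> Ck_on k V g \<Longrightarrow> Ck_on k V (\<lambda>x. f x + g x)"
proof (induction k arbitrary: f g)
  case 0
  then show ?case by (simp add: continuous_on_add)
next
  case (Suc k)
  obtain f' where f': "\<And>x. x \<in> V \<Longrightarrow> (f has_derivative f' x) (at x)" "\<And>v. Ck_on k V (\<lambda>x. f' x v)"
    using Suc.prems(1) by auto
  obtain g' where g': "\<And>x. x \<in> V \<Longrightarrow> (g has_derivative g' x) (at x)" "\<And>v. Ck_on k V (\<lambda>x. g' x v)"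
    using Suc.prems(2) by auto
  show ?case unfolding Ck_on.simps
    using f' g' Suc.IH by (intro exI[of _ "\<lambda>x v. f' x v + g' x v"]) (auto intro: has_derivative_add)
qed

lemma Ck_on_sum: "(\<And>i. i \<in> I \<Longrightarrow> Ck_on k V (f i)) \<Longrightarrow> Ck_on k V (\<lambda>x. \<Sum>i\<in>I. f i x)"
proof (induction I rule: infinite_finite_induct)
  case (insert i I)
  then show ?case using Ck_on_add[of k V "f i" "\<lambda>x. \<Sum>i\<in>I. f i x"] by simp
qed (simp_all add: Ck_on_const)

lemma Ck_on_bilinear:
  assumes "bounded_bilinear p"
  shows "Ck_on k V f \<Longrightarrow> Ck_on k V g \<Longrightarrow> Ck_on k V (\<lambda>x. p (f x) (g x))"
proof (induction k arbitrary: f g)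
  case 0
  then show ?case by (simp add: bounded_bilinear.continuous_on[OF assms])
next
  case (Suc k)
  obtain f' where f': "\<And>x. x \<in> V \<Longrightarrow> (f has_derivative f' x) (at x)" "\<And>v. Ck_on k V (\<lambda>x. f' x v)"
    using Suc.prems(1) by auto
  obtain g' where g': "\<And>x. x \<in> V \<Longrightarrow> (g has_derivative g' x) (at x)" "\<And>v. Ck_on k V (\<lambda>x. g' x v)"
    using Suc.prems(2) by auto
  have fg: "Ck_on k V f" "Ck_on k V g" using Suc.prems Ck_on_SucD by blast+
  show ?case unfolding Ck_on.simps
    by (intro exI[of _ "\<lambda>x v. p (f x) (g' x v) + p (f' x v) (g x)"] conjI ballI allI
        bounded_bilinear.FDERIV[OF assms] f' g' Ck_on_add Suc.IH fg)
qed

lemma Ck_on_linear_comp: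
  assumes "bounded_linear L"
  shows "Ck_on k V f \<Longrightarrow> Ck_on k V (\<lambda>x. L (f x))"
proof (induction k arbitrary: f)
  case 0
  then show ?case by (simp add: bounded_linear.continuous_on[OF assms])
next
  case (Suc k)
  obtain f' where f': "\<And>x. x \<in> V \<Longrightarrow> (f has_derivative f' x) (at x)" "\<And>v. Ck_on k V (\<lambda>x. f' x v)"
    using Suc.prems by auto
  show ?case unfolding Ck_on.simps
    by (intro exI[of _ "\<lambda>x v. L (f' x v)"] conjI ballI allI bounded_linear.has_derivative[OF assms] f' Suc.IH)
qed

lemma linear_euclidean_sum:
  assumes "linear L"
  shows "L v = (\<Sum>b\<in>Basis. (v \<bullet> b) *\<^sub>R L b)"
proof -
  have "L v = L (\<Sum>b\<in>Basis. (v \<bullet> b) *\<^sub>R b)" by (simp only: euclidean_representation)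
  then show ?thesis by (simp only: linear_sum[OF assms] linear_cmul[OF assms])
qed

text \<open>\<open>Ck_on\<close> speaks of derivatives in fixed directions, but in the chain rule
  the direction f' x v varies with x. Expanding it in a basis leaves sums of products to which the
  induction hypothesis applies.\<close>

lemma Ck_on_compose:
  fixes g :: "'b::euclidean_space \<Rightarrow> 'c::real_normed_vector"
  shows "Ck_on k V f \<Longrightarrow> Ck_on k W g \<Longrightarrow> (\<And>x. x \<in> V \<Longrightarrow> f x \<in> W) \<Longrightarrow> Ck_on k V (\<lambda>x. g (f x))"
proof (induction k arbitrary: g)
  case 0
  then have "f ` V \<subseteq> W" by (intro image_subsetI)
  then show ?case using 0 by (simp add: continuous_on_compose2[of W g V f])
next
  case (Suc k)
  obtain f' where f': "\<And>x. x \<in> V \<Longrightarrow> (f has_derivative f' x) (at x)" "\<And>v. Ck_on k V (\<lambda>x. f' x v)"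
    using Suc.prems(1) by auto
  obtain g' where g': "\<And>x. x \<in> W \<Longrightarrow> (g has_derivative g' x) (at x)" "\<And>v. Ck_on k W (\<lambda>x. g' x v)"
    using Suc.prems(2) by auto
  have f: "Ck_on k V f" using Suc.prems(1) Ck_on_SucD by blast
  have lin: "linear (g' y)" if "y \<in> W" for y using has_derivative_linear[OF g'(1)[OF that]] .
  have D: "((\<lambda>x. g (f x)) has_derivative (\<lambda>v. g' (f x) (f' x v))) (at x)" if "x \<in> V" for x
    using has_derivative_compose[OF f'(1)[OF that], of g "g' (f x)"] g'(1)[OF Suc.prems(3)[OF that]] by simp
  have D': "((\<lambda>x. g (f x)) has_derivative (\<lambda>v. \<Sum>b\<in>Basis. (f' x v \<bullet> b) *\<^sub>R g' (f x) b)) (at x)" if "x \<in> V" for x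
  proof -
    have "(\<lambda>v. g' (f x) (f' x v)) = (\<lambda>v. \<Sum>b\<in>Basis. (f' x v \<bullet> b) *\<^sub>R g' (f x) b)"
      by (rule ext) (rule linear_euclidean_sum[OF lin[OF Suc.prems(3)[OF that]]])
    then show ?thesis using D[OF that] by (simp only:)
  qed
  have C: "Ck_on k V (\<lambda>x. \<Sum>b\<in>Basis. (f' x v \<bullet> b) *\<^sub>R g' (f x) b)" for v
    by (intro Ck_on_sum Ck_on_bilinear[OF bounded_bilinear_scaleR]
        Ck_on_linear_comp[OF bounded_linear_inner_left] f' Suc.IH[OF f] g' Suc.prems(3))
  show ?case unfolding Ck_on.simps
    by (intro exI[of _ "\<lambda>x v. \<Sum>b\<in>Basis. (f' x v \<bullet> b) *\<^sub>R g' (f x) b"] conjI ballI allI D' C)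
qed

lemma Ck_on_euclidean_componentwise:
  fixes f :: "'a::real_normed_vector \<Rightarrow> 'b::euclidean_space"
  assumes "\<And>b. b \<in> Basis \<Longrightarrow> Ck_on k V (\<lambda>x. f x \<bullet> b)"
  shows "Ck_on k V f"
proof -
  have "Ck_on k V (\<lambda>x. \<Sum>b\<in>Basis. (f x \<bullet> b) *\<^sub>R b)"
    by (intro Ck_on_sum Ck_on_linear_comp[OF bounded_linear_scaleR_left] assms)
  then show ?thesis by (simp only: euclidean_representation)
qed

section \<open>Holomorphic functions of several variables\<close>

lemma bounded_linear_line: "bounded_linear (\<lambda>\<zeta> :: complex. \<zeta> *s (v :: complex^'m))"
proof -
  have "linear (\<lambda>\<zeta> :: complex. \<zeta> *s v)"
    by (rule linearI) (simp_all add: Finite_Cartesian_Product.vec_eq_iff distrib_right)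
  then show ?thesis by (simp add: linear_conv_bounded_linear)
qed

lemma holo_fun_derivative:
  assumes "holo_fun V f" "z \<in> V"
  shows "(f has_derivative frechet_derivative f (at z)) (at z)"
    and "frechet_derivative f (at z) (c *s v) = c * frechet_derivative f (at z) v"
proof -
  obtain f' where f': "(f has_derivative f') (at z)" "\<And>c v. f' (c *s v) = c * f' v"
    using assms unfolding holo_fun_def by blast
  then have eq: "f' = frechet_derivative f (at z)" using frechet_derivative_at by blast
  show "(f has_derivative frechet_derivative f (at z)) (at z)" using f'(1) unfolding eq .
  show "frechet_derivative f (at z) (c *s v) = c * frechet_derivative f (at z) v"
    using f'(2) unfolding eq .
qed

lemma holo_fun_continuous: "holo_fun V f \<Longrightarrow> continuous_on V f"
  using holo_fun_derivative(1) by (blast intro: continuous_at_imp_continuous_on has_derivative_continuous)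

definition circ :: "real \<Rightarrow> real \<Rightarrow> complex" where
  "circ r t = circlepath 0 r t"

lemma circ_nonzero: "0 < r \<Longrightarrow> circ r t \<noteq> 0"
  by (simp add: circ_def circlepath)

lemma norm_circ: "0 < r \<Longrightarrow> norm (circ r t) = r"
  by (simp add: circ_def circlepath norm_mult)

lemma continuous_on_circ: "continuous_on S (circ r)"
  unfolding circ_def circlepath by (intro continuous_intros)

text \<open>Cauchy's formula for the derivative at 0 of the restriction of f to the line through z
  in direction v. On the circle du = 2 pi i u dt, which cancels the constant and one factor of u^2.
  The right-hand side contains only values of f, so derivatives inherit the regularity of f.\<close>

lemma cauchy_line:
  assumes f: "holo_fun V f" and r: "0 < r" and line: "\<And>\<zeta>. norm \<zeta> \<le> r \<Longrightarrow> z + \<zeta> *s v \<in> V"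
  shows "frechet_derivative f (at z) v = integral {0..1} (\<lambda>t. f (z + circ r t *s v) / circ r t)"
proof -
  let ?\<phi> = "\<lambda>\<zeta>. f (z + \<zeta> *s v)"
  have D: "(?\<phi> has_field_derivative frechet_derivative f (at (z + \<zeta> *s v)) v) (at \<zeta>)" if "norm \<zeta> \<le> r" for \<zeta>
  proof -
    have 1: "((\<lambda>\<zeta>. z + \<zeta> *s v) has_derivative (\<lambda>h. h *s v)) (at \<zeta>)"
      using has_derivative_add[OF has_derivative_const bounded_linear_imp_has_derivative[OF bounded_linear_line]]
      by simp
    have "(?\<phi> has_derivative (\<lambda>h. frechet_derivative f (at (z + \<zeta> *s v)) (h *s v))) (at \<zeta>)"
      using has_derivative_compose[OF 1 holo_fun_derivative(1)[OF f line[OF that]]] .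
    then show ?thesis
      unfolding has_field_derivative_def holo_fun_derivative(2)[OF f line[OF that]]
      by (simp add: mult.commute[of _ "frechet_derivative f (at (z + \<zeta> *s v)) v"])
  qed
  have "continuous_on (cball 0 r) ?\<phi>"
  proof (rule DERIV_continuous_on)
    show "(?\<phi> has_field_derivative frechet_derivative f (at (z + \<zeta> *s v)) v) (at \<zeta> within cball 0 r)"
      if "\<zeta> \<in> cball 0 r" for \<zeta>
      by (rule has_field_derivative_at_within[OF D]) (use that in simp)
  qed
  moreover have "?\<phi> holomorphic_on ball 0 r"
    unfolding holomorphic_on_def field_differentiable_def
  proof
    fix \<zeta> :: complex assume "\<zeta> \<in> ball 0 r"
    then have "norm \<zeta> \<le> r" by simp
    from has_field_derivative_at_within[OF D[OF this]]
    show "\<exists>d. (?\<phi> has_field_derivative d) (at \<zeta> within ball 0 r)" by (rule exI)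
  qed
  moreover have "0 \<in> ball 0 r" using r by simp
  ultimately have C: "(?\<phi> has_field_derivative (1 / (2 * of_real pi * \<i>) *
      contour_integral (circlepath 0 r) (\<lambda>u. ?\<phi> u / (u - 0)^2))) (at 0)"
    by (rule Cauchy_derivative_integral_circlepath(2))
  have "frechet_derivative f (at z) v = 1 / (2 * of_real pi * \<i>) *
      contour_integral (circlepath 0 r) (\<lambda>u. ?\<phi> u / (u - 0)^2)"
    using DERIV_unique[OF D C] r by simp
  also have "\<dots> = integral {0..1} (\<lambda>t. 1 / (2 * of_real pi * \<i>) *
      (?\<phi> (circ r t) / (circ r t - 0)\<^sup>2 * (2 * of_real pi * \<i> * circ r t)))"
  proof -
    have "vector_derivative (circlepath 0 r) (at t) = 2 * of_real pi * \<i> * circ r t" for t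
      by (simp add: circ_def vector_derivative_circlepath) (simp add: circlepath)
    then show ?thesis unfolding contour_integral_integral integral_mult_right by (simp only: circ_def)
  qed
  also have "\<dots> = integral {0..1} (\<lambda>t. ?\<phi> (circ r t) / circ r t)"
    using circ_nonzero[OF r] by (intro integral_cong) (simp add: power2_eq_square)
  finally show ?thesis .
qed

text \<open>The radius is uniform for z near z0, so that the integral in \<open>cauchy_line\<close>
  can be studied as a function of z.\<close>

lemma line_in_open:
  fixes V :: "(complex^'m) set"
  assumes "open V" "z0 \<in> V"
  shows "\<exists>\<rho> r. 0 < \<rho> \<and> 0 < r \<and> ball z0 \<rho> \<subseteq> V \<and> (\<forall>z\<in>ball z0 \<rho>. \<forall>\<zeta>. norm \<zeta> \<le> r \<longrightarrow> z + \<zeta> *s v \<in> V)"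
proof -
  obtain e where e: "0 < e" "ball z0 e \<subseteq> V" using assms by (meson open_contains_ball)
  obtain K where K: "0 < K" "\<And>\<zeta> :: complex. norm (\<zeta> *s v) \<le> norm \<zeta> * K"
    using bounded_linear.pos_bounded[OF bounded_linear_line[of v]] by blast
  \<comment> \<open>With this radius the displacement along the line is at most e/2, and z ranges
    over the ball of radius e/2.\<close>
  define r where "r = e / (2 * K)"
  have r: "0 < r" "r * K = e / 2" using e(1) K(1) by (simp_all add: r_def)
  have "z + \<zeta> *s v \<in> V" if z: "z \<in> ball z0 (e / 2)" and \<zeta>: "norm \<zeta> \<le> r" for z \<zeta>
  proof -
    have "norm (\<zeta> *s v) \<le> e / 2"
      using K(2)[of \<zeta>] mult_right_mono[OF \<zeta>, of K] K(1) r(2) by linarith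
    moreover have "dist z0 (z + \<zeta> *s v) \<le> dist z0 z + norm (\<zeta> *s v)"
      using norm_triangle_ineq4[of "z0 - z" "\<zeta> *s v"] by (simp add: dist_norm algebra_simps)
    ultimately have "z + \<zeta> *s v \<in> ball z0 e" using z by simp
    then show ?thesis using e(2) by blast
  qed
  moreover have "ball z0 (e / 2) \<subseteq> V" using e by (intro order_trans[OF subset_ball e(2)]) simp
  ultimately show ?thesis using e(1) r(1) by (intro exI[of _ "e / 2"] exI[of _ r]) auto
qed

lemma continuous_on_line_integrand:
  fixes g :: "complex^'m \<Rightarrow> 'b::topological_space"
  assumes "continuous_on V g" "0 < r" "\<And>z \<zeta>. z \<in> U \<Longrightarrow> norm \<zeta> \<le> r \<Longrightarrow> z + \<zeta> *s v \<in> V"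
  shows "continuous_on (U \<times> cbox 0 (1::real)) (\<lambda>(z, t). g (z + circ r t *s v))"
proof -
  have "continuous_on (U \<times> cbox 0 (1::real)) (\<lambda>p. fst p + circ r (snd p) *s v)"
    by (intro continuous_intros bounded_linear.continuous_on[OF bounded_linear_line]
        continuous_on_compose2[OF continuous_on_circ[of UNIV]]) auto
  then show ?thesis
    unfolding split_beta using assms(2,3) norm_circ[OF assms(2)]
    by (intro continuous_on_compose2[OF assms(1)]) auto
qed

text \<open>\<open>holo_fun\<close> asks for a derivative at every point, not for its continuity.
  That comes from the integral in \<open>cauchy_line\<close>, which depends continuously on
  z.\<close>

lemma continuous_on_holo_derivative:
  assumes V: "open V" and f: "holo_fun V f"
  shows "continuous_on V (\<lambda>z. frechet_derivative f (at z) v)"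
proof -
  have "isCont (\<lambda>z. frechet_derivative f (at z) v) z0" if z0: "z0 \<in> V" for z0
  proof -
    obtain \<rho> r where \<rho>: "0 < \<rho>" "0 < r" "ball z0 \<rho> \<subseteq> V"
      "\<And>z \<zeta>. z \<in> ball z0 \<rho> \<Longrightarrow> norm \<zeta> \<le> r \<Longrightarrow> z + \<zeta> *s v \<in> V"
      using line_in_open[OF V z0, of v] by blast
    have "continuous_on (ball z0 \<rho> \<times> cbox 0 1) (\<lambda>(z, t). f (z + circ r t *s v))"
      by (rule continuous_on_line_integrand[OF holo_fun_continuous[OF f] \<rho>(2,4)])
    then have "continuous_on (ball z0 \<rho> \<times> cbox 0 1) (\<lambda>(z, t). f (z + circ r t *s v) / circ r t)"
      unfolding split_beta using circ_nonzero[OF \<rho>(2)]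
      by (intro continuous_on_divide continuous_on_compose2[OF continuous_on_circ[of UNIV]] continuous_intros) auto
    then have "continuous_on (ball z0 \<rho>) (\<lambda>z. integral (cbox 0 1) (\<lambda>t. f (z + circ r t *s v) / circ r t))"
      by (rule integral_continuous_on_param)
    then have "continuous_on (ball z0 \<rho>) (\<lambda>z. frechet_derivative f (at z) v)"
      by (rule continuous_on_eq) (simp add: cauchy_line[OF f \<rho>(2,4)])
    then show ?thesis using \<rho>(1) by (simp add: continuous_on_eq_continuous_at)
  qed
  then show ?thesis by (simp add: continuous_at_imp_continuous_on)
qed

text \<open>Differentiation under the integral of \<open>cauchy_line\<close>. It needs the
  derivative of the integrand as a continuous family of bounded linear maps; its continuity is
  tested on basis vectors, where the previous lemma applies.\<close>

lemma holo_fun_derivative_leibniz: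
  fixes f :: "complex^'m \<Rightarrow> complex"
  assumes V: "open V" and f: "holo_fun V f" and z0: "z0 \<in> V"
  obtains r where "0 < r" "\<And>\<zeta>. norm \<zeta> \<le> r \<Longrightarrow> z0 + \<zeta> *s v \<in> V"
    "((\<lambda>z. frechet_derivative f (at z) v) has_derivative
      (\<lambda>w. integral {0..1} (\<lambda>t. frechet_derivative f (at (z0 + circ r t *s v)) w / circ r t))) (at z0)"
proof -
  obtain \<rho> r where \<rho>: "0 < \<rho>" "0 < r" "ball z0 \<rho> \<subseteq> V"
    "\<And>z \<zeta>. z \<in> ball z0 \<rho> \<Longrightarrow> norm \<zeta> \<le> r \<Longrightarrow> z + \<zeta> *s v \<in> V"
    using line_in_open[OF V z0, of v] by blast
  define B where "B z = Blinfun (frechet_derivative f (at z))" for z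
  have B: "blinfun_apply (B z) = frechet_derivative f (at z)" if "z \<in> V" for z
    unfolding B_def using holo_fun_derivative(1)[OF f that]
    by (intro bounded_linear_Blinfun_apply has_derivative_bounded_linear)
  have contB: "continuous_on V B"
  proof (rule continuous_on_blinfun_componentwise)
    fix i :: "complex^'m" assume "i \<in> Basis"
    show "continuous_on V (\<lambda>x. blinfun_apply (B x) i)"
      using continuous_on_holo_derivative[OF V f, of i] by (rule continuous_on_eq) (simp add: B)
  qed
  define G where "G z t = blinfun_mult_right (1 / circ r t) o\<^sub>L B (z + circ r t *s v)" for z t
  have inV: "z + circ r t *s v \<in> V" if "z \<in> ball z0 \<rho>" for z t
    using \<rho>(4)[OF that] norm_circ[OF \<rho>(2)] by simp
  have G: "blinfun_apply (G z t) w = frechet_derivative f (at (z + circ r t *s v)) w / circ r t"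
    if "z \<in> ball z0 \<rho>" for z t w
    using inV[OF that, of t] by (simp add: G_def B)
  have contG: "continuous_on (ball z0 \<rho> \<times> cbox 0 1) (\<lambda>(z, t). G z t)"
  proof -
    have 1: "continuous_on (ball z0 \<rho> \<times> cbox 0 1) (\<lambda>p. B (fst p + circ r (snd p) *s v))"
      using continuous_on_line_integrand[OF contB \<rho>(2,4)] unfolding split_beta .
    have 2: "continuous_on (ball z0 \<rho> \<times> cbox 0 1) (\<lambda>p. blinfun_mult_right (1 / circ r (snd p)))"
      using circ_nonzero[OF \<rho>(2)]
      by (intro bounded_linear.continuous_on[OF bounded_linear_blinfun_mult_right] continuous_intros
          continuous_on_compose2[OF continuous_on_circ[of UNIV]]) auto
    show ?thesis
      unfolding split_beta G_def
      by (rule bounded_bilinear.continuous_on[OF bounded_bilinear_blinfun_compose 2 1])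
  qed
  have contf: "continuous_on (cbox 0 1) (\<lambda>t. f (z + circ r t *s v) / circ r t)" if "z \<in> ball z0 \<rho>" for z
    using inV[OF that] circ_nonzero[OF \<rho>(2)]
    by (intro continuous_on_divide continuous_on_circ continuous_on_compose2[OF holo_fun_continuous[OF f]]
        continuous_intros bounded_linear.continuous_on[OF bounded_linear_line]) auto
  have "((\<lambda>z. integral (cbox 0 1) (\<lambda>t. f (z + circ r t *s v) / circ r t)) has_derivative
      integral (cbox 0 1) (G z0)) (at z0 within ball z0 \<rho>)"
  proof (rule leibniz_rule[where fx = G])
    fix z t assume z: "z \<in> ball z0 \<rho>"
    have "((\<lambda>z. f (z + circ r t *s v)) has_derivative frechet_derivative f (at (z + circ r t *s v))) (at z)"
      using has_derivative_compose[OF has_derivative_add[OF has_derivative_ident has_derivative_const]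
          holo_fun_derivative(1)[OF f inV[OF z, of t]]] by simp
    then have "((\<lambda>z. f (z + circ r t *s v) * (1 / circ r t)) has_derivative
        (\<lambda>w. frechet_derivative f (at (z + circ r t *s v)) w * (1 / circ r t))) (at z)"
      by (rule has_derivative_mult_left)
    moreover have "blinfun_apply (G z t) = (\<lambda>w. frechet_derivative f (at (z + circ r t *s v)) w * (1 / circ r t))"
      using G[OF z] by (simp add: fun_eq_iff)
    ultimately show "((\<lambda>z. f (z + circ r t *s v) / circ r t) has_derivative blinfun_apply (G z t)) (at z within ball z0 \<rho>)"
      by (simp add: has_derivative_at_withinI)
  next
    show "(\<lambda>t. f (z + circ r t *s v) / circ r t) integrable_on cbox 0 1" if "z \<in> ball z0 \<rho>" for z
      using contf[OF that] by (rule integrable_continuous)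
  qed (use contG \<rho>(1) in auto)
  then have "((\<lambda>z. integral (cbox 0 1) (\<lambda>t. f (z + circ r t *s v) / circ r t)) has_derivative
      integral (cbox 0 1) (G z0)) (at z0)"
    using \<rho>(1) by (simp add: at_within_open[of z0 "ball z0 \<rho>"])
  then have D: "((\<lambda>z. frechet_derivative f (at z) v) has_derivative integral (cbox 0 1) (G z0)) (at z0)"
    by (rule has_derivative_transform_within_open[where s = "ball z0 \<rho>"])
      (use \<rho>(1) in \<open>simp_all add: cauchy_line[OF f \<rho>(2,4)]\<close>)
  have "G z0 integrable_on cbox 0 1"
  proof (rule integrable_continuous)
    show "continuous_on (cbox 0 1) (G z0)"
      using continuous_on_compose2[OF contG, of "cbox 0 1" "\<lambda>t. (z0, t)"] \<rho>(1)
      by (simp add: continuous_on_Pair image_subset_iff)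
  qed
  then have "blinfun_apply (integral (cbox 0 1) (G z0)) w =
      integral (cbox 0 1) (\<lambda>t. frechet_derivative f (at (z0 + circ r t *s v)) w / circ r t)" for w
    using \<rho>(1) by (simp add: blinfun_apply_integral G)
  then have "blinfun_apply (integral (cbox 0 1) (G z0)) =
      (\<lambda>w. integral {0..1} (\<lambda>t. frechet_derivative f (at (z0 + circ r t *s v)) w / circ r t))"
    by (simp add: fun_eq_iff)
  with D have "((\<lambda>z. frechet_derivative f (at z) v) has_derivative
      (\<lambda>w. integral {0..1} (\<lambda>t. frechet_derivative f (at (z0 + circ r t *s v)) w / circ r t))) (at z0)"
    by (simp only:)
  then show ?thesis using \<rho>(4)[of z0] \<rho>(1) by (intro that[OF \<rho>(2)]) auto
qed

lemma holo_fun_frechet_derivative: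
  assumes V: "open V" and f: "holo_fun V f"
  shows "holo_fun V (\<lambda>z. frechet_derivative f (at z) v)"
  unfolding holo_fun_def
proof
  fix z0 assume z0: "z0 \<in> V"
  obtain r where r: "0 < r" "\<And>\<zeta>. norm \<zeta> \<le> r \<Longrightarrow> z0 + \<zeta> *s v \<in> V"
    "((\<lambda>z. frechet_derivative f (at z) v) has_derivative
      (\<lambda>w. integral {0..1} (\<lambda>t. frechet_derivative f (at (z0 + circ r t *s v)) w / circ r t))) (at z0)"
    by (rule holo_fun_derivative_leibniz[OF V f z0, of v]) (rule that, assumption+)
  have "integral {0..1} (\<lambda>t. frechet_derivative f (at (z0 + circ r t *s v)) (c *s w) / circ r t) =
      c * integral {0..1} (\<lambda>t. frechet_derivative f (at (z0 + circ r t *s v)) w / circ r t)" for c w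
    using r(2) norm_circ[OF r(1)] by (simp add: holo_fun_derivative(2)[OF f] flip: integral_mult_right)
  then show "\<exists>f'. ((\<lambda>z. frechet_derivative f (at z) v) has_derivative f') (at z0) \<and> (\<forall>c v. f' (c *s v) = c * f' v)"
    using r(3) by blast
qed

text \<open>By the Leibniz rule, the derivative in direction w of the v-derivative of f is the
  integral of the w-derivative over a circle in direction v. Read backwards,
  \<open>cauchy_line\<close> identifies this with the v-derivative of the w-derivative.\<close>

lemma holo_fun_symmetric_derivative:
  assumes V: "open V" and f: "holo_fun V f" and z0: "z0 \<in> V"
  shows "frechet_derivative (\<lambda>z. frechet_derivative f (at z) v) (at z0) w =
    frechet_derivative (\<lambda>z. frechet_derivative f (at z) w) (at z0) v"
proof -
  obtain r where r: "0 < r" "\<And>\<zeta>. norm \<zeta> \<le> r \<Longrightarrow> z0 + \<zeta> *s v \<in> V"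
    "((\<lambda>z. frechet_derivative f (at z) v) has_derivative
      (\<lambda>w. integral {0..1} (\<lambda>t. frechet_derivative f (at (z0 + circ r t *s v)) w / circ r t))) (at z0)"
    by (rule holo_fun_derivative_leibniz[OF V f z0, of v]) (rule that, assumption+)
  have "frechet_derivative (\<lambda>z. frechet_derivative f (at z) v) (at z0) w =
      integral {0..1} (\<lambda>t. frechet_derivative f (at (z0 + circ r t *s v)) w / circ r t)"
    by (subst frechet_derivative_at[OF r(3), symmetric]) (rule refl)
  also have "\<dots> = frechet_derivative (\<lambda>z. frechet_derivative f (at z) w) (at z0) v"
    by (rule cauchy_line[OF holo_fun_frechet_derivative[OF V f, of w] r(1,2), symmetric])
  finally show ?thesis .
qed

lemma Ck_on_holo_fun:
  fixes f :: "complex^'m \<Rightarrow> complex"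
  assumes V: "open V"
  shows "holo_fun V f \<Longrightarrow> Ck_on k V f"
proof (induction k arbitrary: f)
  case 0
  then show ?case by (simp add: holo_fun_continuous)
next
  case (Suc k)
  have "f differentiable (at z)" if "z \<in> V" for z
    using holo_fun_derivative(1)[OF Suc.prems that] by (rule differentiableI)
  moreover have "Ck_on k V (\<lambda>z. frechet_derivative f (at z) v)" for v
    by (rule Suc.IH[OF holo_fun_frechet_derivative[OF V Suc.prems]])
  ultimately show ?case using Ck_on_Suc_frechet[OF V] by blast
qed

section \<open>Maps with holomorphic components\<close>

lemma holo_map_derivative_components:
  fixes F :: "complex^'m \<Rightarrow> complex^'k"
  assumes F: "holo_map V F" and z: "z \<in> V"
  shows "(F has_derivative frechet_derivative F (at z)) (at z)"
    and "vec_nth (frechet_derivative F (at z) v) k = frechet_derivative (\<lambda>z. vec_nth (F z) k) (at z) v"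
proof -
  define F' where "F' v = (\<chi> k. frechet_derivative (\<lambda>z. vec_nth (F z) k) (at z) v)" for v
  have *: "((\<lambda>z. vec_nth (F z) k) has_derivative frechet_derivative (\<lambda>z. vec_nth (F z) k) (at z)) (at z)" for k
    using F z unfolding holo_map_def by (blast intro: holo_fun_derivative(1))
  have "((\<lambda>z. F z \<bullet> b) has_derivative (\<lambda>v. F' v \<bullet> b)) (at z)" if b: "b \<in> Basis" for b
  proof -
    obtain k u where b: "b = axis k u" using b by (auto simp: Basis_vec_def)
    show ?thesis unfolding b inner_axis F'_def vec_lambda_beta by (intro derivative_intros *)
  qed
  then have D: "(F has_derivative F') (at z)"
    using has_derivative_componentwise_within[of F F' z UNIV] by blast
  have F': "F' = frechet_derivative F (at z)" by (rule frechet_derivative_at[OF D])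
  show "(F has_derivative frechet_derivative F (at z)) (at z)" using D unfolding F' .
  show "vec_nth (frechet_derivative F (at z) v) k = frechet_derivative (\<lambda>z. vec_nth (F z) k) (at z) v"
    unfolding F'[symmetric] by (simp add: F'_def)
qed

lemma holo_map_derivative_cmul:
  assumes F: "holo_map V F" and z: "z \<in> V"
  shows "frechet_derivative F (at z) (c *s v) = c *s frechet_derivative F (at z) v"
proof -
  have "holo_fun V (\<lambda>z. vec_nth (F z) k)" for k using F by (simp add: holo_map_def)
  from holo_fun_derivative(2)[OF this z] show ?thesis
    by (simp add: Finite_Cartesian_Product.vec_eq_iff holo_map_derivative_components(2)[OF F z])
qed

lemma Ck_on_holo_map:
  fixes F :: "complex^'m \<Rightarrow> complex^'k"
  assumes V: "open V" and F: "holo_map V F"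
  shows "Ck_on k V F"
proof (rule Ck_on_euclidean_componentwise)
  fix b :: "complex^'k" assume "b \<in> Basis"
  then obtain j u where b: "b = axis j u" by (auto simp: Basis_vec_def)
  have "Ck_on k V (\<lambda>z. vec_nth (F z) j)" using Ck_on_holo_fun[OF V] F by (simp add: holo_map_def)
  then show "Ck_on k V (\<lambda>z. F z \<bullet> b)"
    unfolding b inner_axis by (rule Ck_on_linear_comp[OF bounded_linear_inner_left])
qed

lemma holo_fun_cong:
  assumes V: "open V" and eq: "\<And>z. z \<in> V \<Longrightarrow> f z = g z" and f: "holo_fun V f"
  shows "holo_fun V g"
  unfolding holo_fun_def
proof
  fix z assume z: "z \<in> V"
  obtain f' where f': "(f has_derivative f') (at z)" "\<forall>c v. f' (c *s v) = c * f' v"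
    using f z unfolding holo_fun_def by blast
  from has_derivative_transform_within_open[OF f'(1) V z eq] f'(2)
  show "\<exists>f'. (g has_derivative f') (at z) \<and> (\<forall>c v. f' (c *s v) = c * f' v)" by blast
qed

lemma holo_map_frechet_derivative:
  assumes V: "open V" and F: "holo_map V F"
  shows "holo_map V (\<lambda>z. frechet_derivative F (at z) v)"
  unfolding holo_map_def
proof
  fix k
  have "holo_fun V (\<lambda>z. vec_nth (F z) k)" using F by (simp add: holo_map_def)
  from holo_fun_frechet_derivative[OF V this]
  show "holo_fun V (\<lambda>z. vec_nth (frechet_derivative F (at z) v) k)"
    by (rule holo_fun_cong[OF V, rotated]) (simp add: holo_map_derivative_components(2)[OF F])
qed

lemma frechet_derivative_cong:
  assumes "open V" "z \<in> V" "\<And>x. x \<in> V \<Longrightarrow> f x = g x"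
  shows "frechet_derivative f (at z) = frechet_derivative g (at z)"
proof -
  have "(f has_derivative D) (at z) = (g has_derivative D) (at z)" for D
    using has_derivative_transform_within_open[OF _ assms(1,2), of f D UNIV g]
      has_derivative_transform_within_open[OF _ assms(1,2), of g D UNIV f] assms(3) by auto
  then show ?thesis by (simp add: frechet_derivative_def)
qed

lemma holo_map_symmetric_derivative:
  assumes V: "open V" and F: "holo_map V F" and z: "z \<in> V"
  shows "frechet_derivative (\<lambda>z. frechet_derivative F (at z) v) (at z) w =
    frechet_derivative (\<lambda>z. frechet_derivative F (at z) w) (at z) v"
proof -
  have k: "holo_fun V (\<lambda>z. vec_nth (F z) k)" for k using F by (simp add: holo_map_def)
  have "vec_nth (frechet_derivative (\<lambda>z. frechet_derivative F (at z) v) (at z) w) k =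
      frechet_derivative (\<lambda>z. frechet_derivative (\<lambda>z. vec_nth (F z) k) (at z) v) (at z) w" for k v w
    unfolding holo_map_derivative_components(2)[OF holo_map_frechet_derivative[OF V F] z]
    by (subst frechet_derivative_cong[OF V z]) (simp_all add: holo_map_derivative_components(2)[OF F])
  then show ?thesis
    by (simp add: Finite_Cartesian_Product.vec_eq_iff holo_fun_symmetric_derivative[OF V k z, of _ v w])
qed

section \<open>Charts\<close>

text \<open>The expression of f in a pair of charts. For f the identity it is a change of charts, so
  coordinate changes and the automorphism are treated alike.\<close>

definition transition :: "('a \<Rightarrow> 'b) \<Rightarrow> ('a, 'm) chart \<Rightarrow> ('b, 'k) chart \<Rightarrow> complex^'m \<Rightarrow> complex^'k" where
  "transition f c d = snd d \<circ> f \<circ> inv_into (fst c) (snd c)"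

lemma chart_at:
  assumes "complex_manifold X" "x \<in> points X"
  obtains c where "c \<in> atlas X" "x \<in> fst c"
proof -
  have "x \<in> (\<Union>(D, \<phi>)\<in>atlas X. D)" using assms by (simp add: complex_manifold_def)
  then show ?thesis using that by force
qed

locale charts =
  fixes X :: "('a, 'm::finite) cmanifold"
  assumes complex_manifold: "complex_manifold X"
begin

context
  fixes c :: "('a, 'm) chart"
  assumes c: "c \<in> atlas X"
begin

lemma chart_openin: "openin (mtop X) (fst c)"
  and chart_open: "open (snd c ` fst c)"
  and chart_homeomorphic: "homeomorphic_map (subtopology (mtop X) (fst c)) (top_of_set (snd c ` fst c)) (snd c)"
proof -
  have "\<forall>(D, \<phi>)\<in>atlas X. openin (mtop X) D \<and> open (\<phi> ` D) \<and>
      homeomorphic_map (subtopology (mtop X) D) (top_of_set (\<phi> ` D)) \<phi>"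
    using complex_manifold by (simp add: complex_manifold_def)
  from bspec[OF this c] show "openin (mtop X) (fst c)" "open (snd c ` fst c)"
    "homeomorphic_map (subtopology (mtop X) (fst c)) (top_of_set (snd c ` fst c)) (snd c)"
    by (simp_all add: split_beta)
qed

lemma chart_subset: "fst c \<subseteq> points X"
  using openin_subset[OF chart_openin] by (simp add: points_def)

lemma chart_inj: "inj_on (snd c) (fst c)"
  using homeomorphic_imp_injective_map[OF chart_homeomorphic] chart_subset
  by (simp add: points_def Int_absorb1)

lemma chart_inverse: "x \<in> fst c \<Longrightarrow> inv_into (fst c) (snd c) (snd c x) = x"
  using chart_inj by (rule inv_into_f_f)

lemma open_chart_image:
  assumes "openin (mtop X) W"
  shows "open (snd c ` (fst c \<inter> W))"
proof -
  have "openin (subtopology (mtop X) (fst c)) (fst c \<inter> W)"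
    using assms by (auto simp: openin_subtopology)
  then have "openin (top_of_set (snd c ` fst c)) (snd c ` (fst c \<inter> W))"
    using homeomorphic_imp_open_map[OF chart_homeomorphic] unfolding open_map_def by blast
  then show ?thesis by (rule openin_open_trans) (rule chart_open)
qed

end

text \<open>The compatibility of the charts of the atlas, in the form that makes all facts on
  holomorphic self-maps available for changes of charts.\<close>

lemma holo_between_id: "holo_between X X (\<lambda>x. x)"
proof -
  have "\<forall>(D, \<phi>)\<in>atlas X. \<forall>(E, \<psi>)\<in>atlas X. holo_map (\<phi> ` (D \<inter> E)) (\<psi> \<circ> inv_into D \<phi>)"
    using complex_manifold by (simp add: complex_manifold_def)
  then show ?thesis unfolding holo_between_def Int_def by (simp add: o_def)
qed

lemma
  assumes f: "holo_between X X f" and c: "c \<in> atlas X" and d: "d \<in> atlas X"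
  shows transition_open: "open (snd c ` {x \<in> fst c. f x \<in> fst d})"
    and transition_holo: "holo_map (snd c ` {x \<in> fst c. f x \<in> fst d}) (transition f c d)"
proof -
  have cont: "continuous_map (mtop X) (mtop X) f" using f by (simp add: holo_between_def)
  have "openin (mtop X) {x \<in> topspace (mtop X). f x \<in> fst d}"
    using openin_continuous_map_preimage[OF cont chart_openin[OF d]] .
  moreover have "{x \<in> fst c. f x \<in> fst d} = fst c \<inter> {x \<in> topspace (mtop X). f x \<in> fst d}"
    using chart_subset[OF c] by (auto simp: points_def)
  ultimately show "open (snd c ` {x \<in> fst c. f x \<in> fst d})"
    using open_chart_image[OF c] by simp
  show "holo_map (snd c ` {x \<in> fst c. f x \<in> fst d}) (transition f c d)"
  proof -
    have "\<forall>(D, \<phi>)\<in>atlas X. \<forall>(E, \<psi>)\<in>atlas X. holo_map (\<phi> ` {x \<in> D. f x \<in> E}) (\<psi> \<circ> f \<circ> inv_into D \<phi>)"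
      using f by (simp add: holo_between_def)
    from bspec[OF this c] d show ?thesis by (auto simp: transition_def split_beta)
  qed
qed

lemma transition_apply: "c \<in> atlas X \<Longrightarrow> x \<in> fst c \<Longrightarrow> transition f c d (snd c x) = snd d (f x)"
  by (simp add: transition_def chart_inverse)

lemma transition_compose:
  assumes f: "holo_between X X f" and h: "holo_between X X h"
    and charts: "c \<in> atlas X" "d \<in> atlas X" "e \<in> atlas X"
    and x: "x \<in> fst c" "f x \<in> fst d" "h (f x) \<in> fst e"
  shows "frechet_derivative (transition (h \<circ> f) c e) (at (snd c x)) v =
    frechet_derivative (transition h d e) (at (snd d (f x))) (frechet_derivative (transition f c d) (at (snd c x)) v)"
proof -
  let ?V = "snd c ` {x \<in> fst c. f x \<in> fst d}"
  have V: "open ?V" "snd c x \<in> ?V" using transition_open[OF f] charts x by auto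
  have Df: "(transition f c d has_derivative frechet_derivative (transition f c d) (at (snd c x))) (at (snd c x))"
    using holo_map_derivative_components(1)[OF transition_holo[OF f charts(1,2)] V(2)] .
  have "snd d (f x) \<in> snd d ` {x \<in> fst d. h x \<in> fst e}" using x by blast
  from holo_map_derivative_components(1)[OF transition_holo[OF h charts(2,3)] this]
  have Dh: "(transition h d e has_derivative frechet_derivative (transition h d e) (at (snd d (f x))))
      (at (transition f c d (snd c x)))"
    by (simp add: transition_apply[OF charts(1) x(1)])
  have "((\<lambda>z. transition h d e (transition f c d z)) has_derivative
      (\<lambda>v. frechet_derivative (transition h d e) (at (snd d (f x)))
        (frechet_derivative (transition f c d) (at (snd c x)) v))) (at (snd c x))"
    by (rule has_derivative_compose[OF Df Dh])
  moreover have "transition h d e (transition f c d z) = transition (h \<circ> f) c e z" if "z \<in> ?V" for z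
    using that charts by (auto simp: transition_apply)
  ultimately have "(transition (h \<circ> f) c e has_derivative
      (\<lambda>v. frechet_derivative (transition h d e) (at (snd d (f x)))
        (frechet_derivative (transition f c d) (at (snd c x)) v))) (at (snd c x))"
    by (rule has_derivative_transform_within_open[OF _ V])
  from frechet_derivative_at[OF this] show ?thesis by (simp add: fun_eq_iff)
qed

lemma transition_id_derivative:
  assumes c: "c \<in> atlas X" and x: "x \<in> fst c" and f: "\<And>y. y \<in> points X \<Longrightarrow> f y = y"
  shows "frechet_derivative (transition f c c) (at (snd c x)) v = v"
proof -
  have "transition f c c z = z" if "z \<in> snd c ` fst c" for z
    using that chart_subset[OF c] f by (auto simp: transition_apply[OF c])
  then have "frechet_derivative (\<lambda>z. z) (at (snd c x)) = frechet_derivative (transition f c c) (at (snd c x))"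
    using x by (intro frechet_derivative_cong[OF chart_open[OF c]]) auto
  then show ?thesis by (metis frechet_derivative_at has_derivative_ident)
qed

lemma is_pullback_iff:
  "is_pullback X f \<eta> \<theta> \<longleftrightarrow> (\<forall>c\<in>atlas X. \<forall>d\<in>atlas X. \<forall>x\<in>fst c. f x \<in> fst d \<longrightarrow>
    (\<forall>v w. \<theta> c (snd c x) v w = \<eta> d (snd d (f x))
      (frechet_derivative (transition f c d) (at (snd c x)) v)
      (frechet_derivative (transition f c d) (at (snd c x)) w)))"
  unfolding is_pullback_def transition_def Let_def split_beta by simp

end

section \<open>Periods of differential forms\<close>

lemma bilinear_basis_sum:
  fixes B :: "'e::euclidean_space \<Rightarrow> 'e \<Rightarrow> real"
  assumes "bilinear B"
  shows "B v w = (\<Sum>a\<in>Basis. \<Sum>b\<in>Basis. (v \<bullet> a) * (w \<bullet> b) * B a b)"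
proof -
  have 1: "linear (\<lambda>v. B v w)" and 2: "linear (B v)" for v w using assms by (simp_all add: bilinear_def)
  have "B v w = (\<Sum>a\<in>Basis. (v \<bullet> a) *\<^sub>R B a w)" by (rule linear_euclidean_sum[OF 1])
  also have "\<dots> = (\<Sum>a\<in>Basis. (v \<bullet> a) * (\<Sum>b\<in>Basis. (w \<bullet> b) * B a b))"
    by (rule sum.cong[OF refl]) (simp add: linear_euclidean_sum[OF 2, of _ w])
  finally show ?thesis by (simp add: sum_distrib_left mult.assoc)
qed

text \<open>The smooth extension to an open set W that \<open>smooth_simplex\<close> demands of a
  2-simplex, considered without the simplex.\<close>

definition surface :: "('a, 'm::finite) cmanifold \<Rightarrow> (real \<times> real) set \<Rightarrow> (real \<times> real \<Rightarrow> 'a) \<Rightarrow> bool" where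
  "surface X W g \<longleftrightarrow> open W \<and> g ` W \<subseteq> points X \<and>
     (\<forall>c\<in>atlas X. open {p \<in> W. g p \<in> fst c} \<and> smooth_on {p \<in> W. g p \<in> fst c} (snd c \<circ> g))"

text \<open>The integrand of \<open>simplex_integral\<close> with the parametrised surface as an
  argument, so that it makes sense for the extension beyond the triangle.\<close>

definition integrand ::
  "('a, 'm::finite) cmanifold \<Rightarrow> ('a, 'm, real) tensor2 \<Rightarrow> (real \<times> real \<Rightarrow> 'a) \<Rightarrow> real \<times> real \<Rightarrow> real" where
  "integrand X \<eta> g p = (let c = (SOME c. c \<in> atlas X \<and> g p \<in> fst c);
     \<gamma>' = frechet_derivative (snd c \<circ> g) (at p) in \<eta> c (snd c (g p)) (\<gamma>' (1, 0)) (\<gamma>' (0, 1)))"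

abbreviation triangle :: "(real \<times> real) set" where
  "triangle \<equiv> {(s, t). 0 < s \<and> 0 < t \<and> s + t < 1}"

abbreviation closed_triangle :: "(real \<times> real) set" where
  "closed_triangle \<equiv> {(s, t). 0 \<le> s \<and> 0 \<le> t \<and> s + t \<le> 1}"

lemma triangle_eqs:
  "triangle = {p. 0 < fst p} \<inter> {p. 0 < snd p} \<inter> {p. fst p + snd p < 1}"
  "closed_triangle = {p. 0 \<le> fst p} \<inter> {p. 0 \<le> snd p} \<inter> {p. fst p + snd p \<le> 1}"
  by auto

lemma open_triangle: "open triangle"
  unfolding triangle_eqs by (intro open_Int open_Collect_less continuous_intros)

lemma compact_closed_triangle: "compact closed_triangle"
proof -
  have "closed closed_triangle"
    unfolding triangle_eqs by (intro closed_Int closed_Collect_le continuous_intros)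
  moreover have "closed_triangle \<subseteq> cbox (0, 0) (1, 1)" by (auto simp: cbox_Pair_eq)
  then have "bounded closed_triangle" by (rule bounded_subset[OF bounded_cbox])
  ultimately show ?thesis unfolding compact_eq_bounded_closed by (rule conjI[rotated])
qed

lemma triangle_subset: "triangle \<subseteq> closed_triangle" by auto

lemma simplex_integral_eq: "simplex_integral X \<eta> \<sigma> = integral triangle (integrand X \<eta> (\<sigma> \<circ> bary))"
  unfolding simplex_integral_def integrand_def Let_def by (simp add: o_assoc)

lemma integrand_cong:
  assumes "open U" "p \<in> U" "\<And>p. p \<in> U \<Longrightarrow> g p = h p"
  shows "integrand X \<eta> g p = integrand X \<eta> h p"
proof -
  have "frechet_derivative (snd c \<circ> g) (at p) = frechet_derivative (snd c \<circ> h) (at p)" for c :: "('a, 'b) chart"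
    by (rule frechet_derivative_cong[OF assms(1,2)]) (simp add: assms(3))
  then show ?thesis unfolding integrand_def Let_def assms(3)[OF assms(2)] by simp
qed

lemma smooth_simplex_iff:
  "smooth_simplex X \<sigma> \<longleftrightarrow> singular_simplex 2 (mtop X) \<sigma> \<and>
    (\<exists>W g. surface X W g \<and> closed_triangle \<subseteq> W \<and> (\<forall>p\<in>closed_triangle. g p = \<sigma> (bary p)))"
  unfolding smooth_simplex_def surface_def split_beta by auto

text \<open>The integral runs over the open triangle, where agreement of the simplex with its
  extension includes agreement of the derivatives.\<close>

lemma simplex_integral_surface:
  assumes "\<forall>p\<in>closed_triangle. g p = \<sigma> (bary p)"
  shows "simplex_integral X \<eta> \<sigma> = integral triangle (integrand X \<eta> g)"
  unfolding simplex_integral_eq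
proof (rule integral_cong)
  fix p assume p: "p \<in> triangle"
  show "integrand X \<eta> (\<sigma> \<circ> bary) p = integrand X \<eta> g p"
    by (rule integrand_cong[OF open_triangle p]) (use assms in auto)
qed

lemma
  assumes "smooth_2form X \<eta>"
  shows smooth_2form_pullback_id: "is_pullback X (\<lambda>x. x) \<eta> \<eta>"
    and smooth_2form_bilinear: "c \<in> atlas X \<Longrightarrow> z \<in> snd c ` fst c \<Longrightarrow> bilinear (\<eta> c z)"
    and smooth_2form_alternating: "c \<in> atlas X \<Longrightarrow> z \<in> snd c ` fst c \<Longrightarrow> \<eta> c z v v = 0"
    and smooth_2form_Ck_on: "c \<in> atlas X \<Longrightarrow> Ck_on k (snd c ` fst c) (\<lambda>z. \<eta> c z v w)"
proof -
  have 1: "\<forall>(D, \<phi>)\<in>atlas X. (\<forall>z\<in>\<phi> ` D. bilinear (\<eta> (D, \<phi>) z) \<and> (\<forall>v. \<eta> (D, \<phi>) z v v = 0)) \<and>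
      (\<forall>v w. smooth_on (\<phi> ` D) (\<lambda>z. \<eta> (D, \<phi>) z v w))"
    using assms unfolding smooth_2form_def by (rule conjunct1)
  show "is_pullback X (\<lambda>x. x) \<eta> \<eta>" using assms by (simp add: smooth_2form_def)
  assume "c \<in> atlas X"
  from bspec[OF 1 this]
  have 2: "\<forall>z\<in>snd c ` fst c. bilinear (\<eta> c z) \<and> (\<forall>v. \<eta> c z v v = 0)"
    and 3: "\<forall>v w. smooth_on (snd c ` fst c) (\<lambda>z. \<eta> c z v w)" by (simp_all add: split_beta)
  show "Ck_on k (snd c ` fst c) (\<lambda>z. \<eta> c z v w)" using 3 by (simp add: smooth_on_def)
  assume "z \<in> snd c ` fst c"
  with 2 show "bilinear (\<eta> c z)" "\<eta> c z v v = 0" by blast+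
qed

section \<open>Integration of forms over smooth simplices\<close>

context charts
begin

lemma surface_derivative:
  assumes g: "surface X W g" and c: "c \<in> atlas X" and p: "p \<in> W" "g p \<in> fst c"
  shows "((snd c \<circ> g) has_derivative frechet_derivative (snd c \<circ> g) (at p)) (at p)"
proof -
  have "Ck_on (Suc 0) {p \<in> W. g p \<in> fst c} (snd c \<circ> g)" "open {p \<in> W. g p \<in> fst c}"
    using g c unfolding surface_def smooth_on_def by blast+
  then have "(snd c \<circ> g) differentiable (at p)" using Ck_on_Suc_frechet p by blast
  then show ?thesis by (simp add: frechet_derivative_works)
qed

text \<open>The chain rule, with arbitrary charts around the point and its image. For f the identity
  it says that the integrand does not depend on the chart, for other f that integrands pull
  back.\<close>

lemma pullback_surface:
  assumes \<eta>: "is_pullback X f \<eta> \<theta>" and f: "holo_between X X f" and g: "surface X W g" and p: "p \<in> W"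
    and c: "c \<in> atlas X" "g p \<in> fst c" and d: "d \<in> atlas X" "f (g p) \<in> fst d"
  shows "\<theta> c (snd c (g p)) (frechet_derivative (snd c \<circ> g) (at p) v) (frechet_derivative (snd c \<circ> g) (at p) w) =
    \<eta> d (snd d (f (g p))) (frechet_derivative (snd d \<circ> (f \<circ> g)) (at p) v)
      (frechet_derivative (snd d \<circ> (f \<circ> g)) (at p) w)"
proof -
  let ?U = "{p \<in> W. g p \<in> fst c}" and ?F = "transition f c d"
  have U: "open ?U" "p \<in> ?U" using g c p by (auto simp: surface_def)
  have "snd c (g p) \<in> snd c ` {x \<in> fst c. f x \<in> fst d}" using c d by blast
  from holo_map_derivative_components(1)[OF transition_holo[OF f c(1) d(1)] this]
  have F: "(?F has_derivative frechet_derivative ?F (at (snd c (g p)))) (at ((snd c \<circ> g) p))" by simp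
  have "((\<lambda>q. ?F ((snd c \<circ> g) q)) has_derivative
      (\<lambda>v. frechet_derivative ?F (at (snd c (g p))) (frechet_derivative (snd c \<circ> g) (at p) v))) (at p)"
    by (rule has_derivative_compose[OF surface_derivative[OF g c(1) p c(2)] F])
  then have "((snd d \<circ> (f \<circ> g)) has_derivative
      (\<lambda>v. frechet_derivative ?F (at (snd c (g p))) (frechet_derivative (snd c \<circ> g) (at p) v))) (at p)"
    by (rule has_derivative_transform_within_open[OF _ U]) (simp add: transition_apply[OF c(1)])
  from frechet_derivative_at[OF this, symmetric] \<eta> c d show ?thesis
    unfolding is_pullback_iff by simp
qed

lemma integrand_pullback:
  assumes "is_pullback X f \<eta> \<theta>" "holo_between X X f" "surface X W g" "p \<in> W"
  shows "integrand X \<eta> (f \<circ> g) p = integrand X \<theta> g p"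
proof -
  have g: "g p \<in> points X" using assms(3,4) by (auto simp: surface_def)
  have "f (g p) \<in> points X"
    using assms(2) g continuous_map_image_subset_topspace unfolding holo_between_def points_def by fastforce
  with g obtain c d where c: "c \<in> atlas X \<and> g p \<in> fst c" and d: "d \<in> atlas X \<and> (f \<circ> g) p \<in> fst d"
    by (metis chart_at complex_manifold comp_apply)
  have c': "(SOME c. c \<in> atlas X \<and> g p \<in> fst c) \<in> atlas X" "g p \<in> fst (SOME c. c \<in> atlas X \<and> g p \<in> fst c)"
    using someI[of "\<lambda>c. c \<in> atlas X \<and> g p \<in> fst c", OF c] by blast+
  have d': "(SOME d. d \<in> atlas X \<and> (f \<circ> g) p \<in> fst d) \<in> atlas X"
    "f (g p) \<in> fst (SOME d. d \<in> atlas X \<and> (f \<circ> g) p \<in> fst d)"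
    using someI[of "\<lambda>d. d \<in> atlas X \<and> (f \<circ> g) p \<in> fst d", OF d] by auto
  show ?thesis
    unfolding integrand_def Let_def using pullback_surface[OF assms c' d', of "(1, 0)" "(0, 1)"] by simp
qed

lemma integrand_chart:
  assumes \<eta>: "is_pullback X (\<lambda>x. x) \<eta> \<eta>" and g: "surface X W g" and p: "p \<in> W"
    and c: "c \<in> atlas X" "g p \<in> fst c"
  shows "integrand X \<eta> g p = \<eta> c (snd c (g p)) (frechet_derivative (snd c \<circ> g) (at p) (1, 0))
    (frechet_derivative (snd c \<circ> g) (at p) (0, 1))"
proof -
  have d: "(SOME d. d \<in> atlas X \<and> g p \<in> fst d) \<in> atlas X" "g p \<in> fst (SOME d. d \<in> atlas X \<and> g p \<in> fst d)"
    using someI[of "\<lambda>d. d \<in> atlas X \<and> g p \<in> fst d" c] c by blast+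
  show ?thesis
    unfolding integrand_def Let_def
    using pullback_surface[OF \<eta> holo_between_id g p d c, of "(1, 0)" "(0, 1)"] by (simp add: o_def)
qed

text \<open>The chart chosen in \<open>integrand\<close> may jump from point to point. Near a given
  point it can be replaced by one fixed chart, in which the integrand is visibly continuous.\<close>

lemma continuous_on_integrand:
  assumes \<eta>: "smooth_2form X \<eta>" and g: "surface X W g"
  shows "continuous_on W (integrand X \<eta> g)"
proof -
  have "isCont (integrand X \<eta> g) p" if p: "p \<in> W" for p
  proof -
    obtain c where c: "c \<in> atlas X" "g p \<in> fst c"
      using chart_at[OF complex_manifold, of "g p"] g p unfolding surface_def by blast
    let ?U = "{p \<in> W. g p \<in> fst c}"
    have U: "open ?U" "Ck_on (Suc 0) ?U (snd c \<circ> g)" using g c unfolding surface_def smooth_on_def by blast+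
    have D: "continuous_on ?U (\<lambda>q. frechet_derivative (snd c \<circ> g) (at q) v)" for v
      using Ck_on_Suc_frechet[OF U(1), of 0] U(2) unfolding Ck_on.simps(1) by blast
    have G: "continuous_on ?U (snd c \<circ> g)" using Ck_on_SucD[OF U(2)] by simp
    have "continuous_on (snd c ` fst c) (\<lambda>z. \<eta> c z v w)" for v w
      using smooth_2form_Ck_on[OF \<eta> c(1), of 0] by simp
    then have E: "continuous_on ?U (\<lambda>q. \<eta> c (snd c (g q)) v w)" for v w
      using continuous_on_compose2[of "snd c ` fst c" "\<lambda>z. \<eta> c z v w" ?U "snd c \<circ> g"] G by auto
    have "continuous_on ?U (\<lambda>q. \<Sum>a\<in>Basis. \<Sum>b\<in>Basis. (frechet_derivative (snd c \<circ> g) (at q) (1, 0) \<bullet> a) *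
        (frechet_derivative (snd c \<circ> g) (at q) (0, 1) \<bullet> b) * \<eta> c (snd c (g q)) a b)"
      by (intro continuous_on_sum continuous_on_mult continuous_on_inner continuous_on_const D E)
    moreover have "(\<Sum>a\<in>Basis. \<Sum>b\<in>Basis. (frechet_derivative (snd c \<circ> g) (at q) (1, 0) \<bullet> a) *
        (frechet_derivative (snd c \<circ> g) (at q) (0, 1) \<bullet> b) * \<eta> c (snd c (g q)) a b) = integrand X \<eta> g q"
      if "q \<in> ?U" for q
    proof -
      have q: "q \<in> W" "g q \<in> fst c" using that by auto
      show ?thesis
        unfolding integrand_chart[OF smooth_2form_pullback_id[OF \<eta>] g q(1) c(1) q(2)]
        by (rule bilinear_basis_sum[symmetric], rule smooth_2form_bilinear[OF \<eta> c(1)]) (use q(2) in blast)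
    qed
    ultimately have "continuous_on ?U (integrand X \<eta> g)" by (rule continuous_on_eq)
    then have "\<forall>q\<in>?U. isCont (integrand X \<eta> g) q" unfolding continuous_on_eq_continuous_at[OF U(1)] .
    then show ?thesis using p c(2) by blast
  qed
  then show ?thesis by (simp add: continuous_at_imp_continuous_on)
qed

text \<open>The extension makes the integrand continuous on the compact closed triangle;
  integrability is then inherited by the open one.\<close>

lemma integrand_integrable:
  assumes "smooth_2form X \<eta>" "surface X W g" "closed_triangle \<subseteq> W"
  shows "integrand X \<eta> g integrable_on triangle"
proof -
  have "continuous_on closed_triangle (integrand X \<eta> g)"
    using continuous_on_subset[OF continuous_on_integrand] assms by blast
  then have "set_integrable lborel closed_triangle (integrand X \<eta> g)"
    unfolding set_integrable_def by (rule borel_integrable_compact[OF compact_closed_triangle])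
  then have "set_integrable lborel triangle (integrand X \<eta> g)"
    by (rule set_integrable_subset) (use open_triangle triangle_subset in auto)
  then show ?thesis by (rule set_borel_integral_eq_integral(1))
qed

lemma simplex_integral_add_scale:
  assumes "smooth_2form X \<eta>" "smooth_2form X \<theta>" "smooth_simplex X \<sigma>"
  shows "simplex_integral X (\<lambda>c z v w. a * \<eta> c z v w + b * \<theta> c z v w) \<sigma> =
    a * simplex_integral X \<eta> \<sigma> + b * simplex_integral X \<theta> \<sigma>"
proof -
  obtain W g where g: "surface X W g" "closed_triangle \<subseteq> W" "\<forall>p\<in>closed_triangle. g p = \<sigma> (bary p)"
    using assms(3) unfolding smooth_simplex_iff by blast
  have "integrand X (\<lambda>c z v w. a * \<eta> c z v w + b * \<theta> c z v w) g = (\<lambda>p. a * integrand X \<eta> g p + b * integrand X \<theta> g p)"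
    by (simp add: integrand_def Let_def fun_eq_iff)
  then show ?thesis
    unfolding simplex_integral_surface[OF g(3)]
    using integrand_integrable[OF assms(1) g(1,2)] integrand_integrable[OF assms(2) g(1,2)]
    by (simp add: integral_add integrable_on_mult_right)
qed

text \<open>Smoothness is a local matter: near a parameter p the composite is read through a chart
  around g p, followed by the holomorphic expression of f.\<close>

lemma surface_compose:
  assumes f: "holo_between X X f" and g: "surface X W g"
  shows "surface X W (f \<circ> g)"
  unfolding surface_def
proof (intro conjI ballI)
  have cont: "continuous_map (mtop X) (mtop X) f" using f by (simp add: holo_between_def)
  show W: "open W" using g by (simp add: surface_def)
  show "(f \<circ> g) ` W \<subseteq> points X"
    using g continuous_map_image_subset_topspace[OF cont] unfolding surface_def points_def by auto
  fix d assume d: "d \<in> atlas X"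
  have loc: "\<exists>U. open U \<and> p \<in> U \<and> U \<subseteq> {p \<in> W. (f \<circ> g) p \<in> fst d} \<and> (\<forall>k. Ck_on k U (snd d \<circ> (f \<circ> g)))"
    if p: "p \<in> {p \<in> W. (f \<circ> g) p \<in> fst d}" for p
  proof -
    obtain c where c: "c \<in> atlas X" "g p \<in> fst c"
      using chart_at[OF complex_manifold, of "g p"] g p unfolding surface_def by blast
    let ?U = "{p \<in> W. g p \<in> fst c}" and ?V = "snd c ` {x \<in> fst c. f x \<in> fst d}"
    have U: "open ?U" "\<And>k. Ck_on k ?U (snd c \<circ> g)" using g c by (simp_all add: surface_def smooth_on_def)
    have V: "open ?V" by (rule transition_open[OF f c(1) d])
    define N where "N = ?U \<inter> (snd c \<circ> g) -` ?V"
    have N: "open N" unfolding N_def Int_commute[of ?U]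
      using U(2)[of 0] by (intro continuous_open_preimage[OF _ U(1) V, unfolded Int_commute[of ?U]]) simp
    have "f (g q) \<in> fst d" if "q \<in> N" for q
    proof -
      obtain x where x: "x \<in> fst c" "f x \<in> fst d" "snd c (g q) = snd c x" using \<open>q \<in> N\<close> by (auto simp: N_def)
      then have "g q = x" using chart_inj[OF c(1)] \<open>q \<in> N\<close> by (auto simp: N_def inj_on_def)
      then show ?thesis using x by simp
    qed
    then have sub: "N \<subseteq> {p \<in> W. (f \<circ> g) p \<in> fst d}" by (auto simp: N_def)
    have "Ck_on k N (snd d \<circ> (f \<circ> g))" for k
    proof (rule Ck_on_cong[OF N])
      show "Ck_on k N (\<lambda>q. transition f c d ((snd c \<circ> g) q))"
        by (rule Ck_on_compose[OF Ck_on_subset[OF U(2)] Ck_on_holo_map[OF V transition_holo[OF f c(1) d]]])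
          (auto simp: N_def)
    qed (simp add: N_def transition_apply[OF c(1)])
    moreover have "p \<in> N" using p c by (auto simp: N_def)
    ultimately show ?thesis using N sub by blast
  qed
  show O: "open {p \<in> W. (f \<circ> g) p \<in> fst d}"
    using loc by (subst open_subopen) blast
  show "smooth_on {p \<in> W. (f \<circ> g) p \<in> fst d} (snd d \<circ> (f \<circ> g))"
    unfolding smooth_on_def using loc by (intro allI Ck_on_local[OF O]) blast
qed

lemma
  assumes f: "holo_between X X f" and \<sigma>: "smooth_simplex X \<sigma>"
  shows smooth_simplex_map: "smooth_simplex X (simplex_map 2 f \<sigma>)"
    and simplex_integral_map: "is_pullback X f \<eta> \<theta> \<Longrightarrow>
      simplex_integral X \<eta> (simplex_map 2 f \<sigma>) = simplex_integral X \<theta> \<sigma>"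
proof -
  obtain W g where g: "surface X W g" "closed_triangle \<subseteq> W" "\<forall>p\<in>closed_triangle. g p = \<sigma> (bary p)"
    using \<sigma> unfolding smooth_simplex_iff by blast
  have "bary p \<in> standard_simplex 2" if "p \<in> closed_triangle" for p
    using that by (auto simp: standard_simplex_def bary_def numeral_2_eq_2)
  then have fg: "\<forall>p\<in>closed_triangle. (f \<circ> g) p = simplex_map 2 f \<sigma> (bary p)"
    using g(3) by (simp add: simplex_map_def)
  have "singular_simplex 2 (mtop X) (simplex_map 2 f \<sigma>)"
    using f \<sigma> by (intro singular_simplex_simplex_map[where X = "mtop X"])
      (auto simp: holo_between_def smooth_simplex_def)
  then show "smooth_simplex X (simplex_map 2 f \<sigma>)"
    unfolding smooth_simplex_iff using surface_compose[OF f g(1)] g(2) fg by blast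
  assume "is_pullback X f \<eta> \<theta>"
  then show "simplex_integral X \<eta> (simplex_map 2 f \<sigma>) = simplex_integral X \<theta> \<sigma>"
    unfolding simplex_integral_surface[OF fg] simplex_integral_surface[OF g(3)]
    by (intro integral_cong integrand_pullback[OF _ f g(1)]) (use g(2) in auto)
qed

end

section \<open>Pullbacks of Kaehler forms\<close>

text \<open>The product rule for a form whose coefficients vary with the base point.
  Differentiability is known only for fixed arguments, so the arguments are expanded in a basis
  before differentiating.\<close>

lemma has_derivative_form:
  fixes B :: "'e::euclidean_space \<Rightarrow> 'e \<Rightarrow> 'e \<Rightarrow> real" and F p s :: "'d::real_normed_vector \<Rightarrow> 'e"
  assumes V: "open V" "\<And>y. y \<in> V \<Longrightarrow> bilinear (B y)"
    and U: "open U" "z0 \<in> U" "\<And>z. z \<in> U \<Longrightarrow> F z \<in> V"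
    and B: "\<And>v w. (\<lambda>y. B y v w) differentiable (at (F z0))"
    and F: "(F has_derivative F') (at z0)"
    and p: "(p has_derivative p') (at z0)" and s: "(s has_derivative s') (at z0)"
  shows "((\<lambda>z. B (F z) (p z) (s z)) has_derivative
    (\<lambda>u. frechet_derivative (\<lambda>y. B y (p z0) (s z0)) (at (F z0)) (F' u) +
      B (F z0) (p' u) (s z0) + B (F z0) (p z0) (s' u))) (at z0)"
proof -
  define D where "D a b = frechet_derivative (\<lambda>y. B y a b) (at (F z0))" for a b
  have D: "((\<lambda>y. B y a b) has_derivative D a b) (at (F z0))" for a b
    unfolding D_def using B by (simp add: frechet_derivative_works)
  have "((\<lambda>y. \<Sum>a\<in>Basis. \<Sum>b\<in>Basis. (v \<bullet> a) * (w \<bullet> b) * B y a b) has_derivative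
      (\<lambda>h. \<Sum>a\<in>Basis. \<Sum>b\<in>Basis. (v \<bullet> a) * (w \<bullet> b) * D a b h)) (at (F z0))" for v w
    by (intro has_derivative_sum has_derivative_mult_right D)
  then have "((\<lambda>y. B y v w) has_derivative
      (\<lambda>h. \<Sum>a\<in>Basis. \<Sum>b\<in>Basis. (v \<bullet> a) * (w \<bullet> b) * D a b h)) (at (F z0))" for v w
    by (rule has_derivative_transform_within_open[OF _ V(1) U(3)[OF U(2)]])
      (rule bilinear_basis_sum[OF V(2), symmetric])
  then have Dvw: "D v w = (\<lambda>h. \<Sum>a\<in>Basis. \<Sum>b\<in>Basis. (v \<bullet> a) * (w \<bullet> b) * D a b h)" for v w
    using has_derivative_unique[OF D] by blast
  have "((\<lambda>z. \<Sum>a\<in>Basis. \<Sum>b\<in>Basis. (p z \<bullet> a) * (s z \<bullet> b) * B (F z) a b) has_derivative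
      (\<lambda>u. \<Sum>a\<in>Basis. \<Sum>b\<in>Basis. ((p z0 \<bullet> a) * (s z0 \<bullet> b)) * D a b (F' u) +
        ((p z0 \<bullet> a) * (s' u \<bullet> b) + (p' u \<bullet> a) * (s z0 \<bullet> b)) * B (F z0) a b)) (at z0)"
    by (intro has_derivative_sum has_derivative_mult has_derivative_inner_left p s
        has_derivative_compose[OF F D])
  then have "((\<lambda>z. B (F z) (p z) (s z)) has_derivative
      (\<lambda>u. \<Sum>a\<in>Basis. \<Sum>b\<in>Basis. ((p z0 \<bullet> a) * (s z0 \<bullet> b)) * D a b (F' u) +
        ((p z0 \<bullet> a) * (s' u \<bullet> b) + (p' u \<bullet> a) * (s z0 \<bullet> b)) * B (F z0) a b)) (at z0)"
    by (rule has_derivative_transform_within_open[OF _ U(1,2)])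
      (rule bilinear_basis_sum[OF V(2)[OF U(3)], symmetric])
  moreover have "(\<Sum>a\<in>Basis. \<Sum>b\<in>Basis. ((p z0 \<bullet> a) * (s z0 \<bullet> b)) * D a b (F' u) +
        ((p z0 \<bullet> a) * (s' u \<bullet> b) + (p' u \<bullet> a) * (s z0 \<bullet> b)) * B (F z0) a b) =
      D (p z0) (s z0) (F' u) + B (F z0) (p' u) (s z0) + B (F z0) (p z0) (s' u)" for u
  proof -
    note bil = bilinear_basis_sum[OF V(2)[OF U(3)[OF U(2)]]]
    have "D (p z0) (s z0) (F' u) + B (F z0) (p' u) (s z0) + B (F z0) (p z0) (s' u) =
      (\<Sum>a\<in>Basis. \<Sum>b\<in>Basis. (p z0 \<bullet> a) * (s z0 \<bullet> b) * D a b (F' u)) +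
      (\<Sum>a\<in>Basis. \<Sum>b\<in>Basis. (p' u \<bullet> a) * (s z0 \<bullet> b) * B (F z0) a b) +
      (\<Sum>a\<in>Basis. \<Sum>b\<in>Basis. (p z0 \<bullet> a) * (s' u \<bullet> b) * B (F z0) a b)"
      using fun_cong[OF Dvw[of "p z0" "s z0"], of "F' u"] bil[of "p' u" "s z0"] bil[of "p z0" "s' u"]
      by (rule arg_cong2[where f = "(+)", OF arg_cong2[where f = "(+)"]])
    then show ?thesis by (simp add: sum.distrib ring_distribs)
  qed
  ultimately show ?thesis unfolding D_def[symmetric] by (simp only:)
qed

lemma smooth_2formI:
  assumes "\<And>c z. c \<in> atlas X \<Longrightarrow> z \<in> snd c ` fst c \<Longrightarrow> bilinear (\<eta> c z)"
    and "\<And>c z v. c \<in> atlas X \<Longrightarrow> z \<in> snd c ` fst c \<Longrightarrow> \<eta> c z v v = 0"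
    and "\<And>c k v w. c \<in> atlas X \<Longrightarrow> Ck_on k (snd c ` fst c) (\<lambda>z. \<eta> c z v w)"
    and "is_pullback X (\<lambda>x. x) \<eta> \<eta>"
  shows "smooth_2form X \<eta>"
  unfolding smooth_2form_def split_beta smooth_on_def using assms by simp

lemma closed_2form_iff:
  "closed_2form X \<eta> \<longleftrightarrow> (\<forall>c\<in>atlas X. \<forall>z\<in>snd c ` fst c. \<forall>u v w.
    frechet_derivative (\<lambda>z. \<eta> c z v w) (at z) u + frechet_derivative (\<lambda>z. \<eta> c z w u) (at z) v +
    frechet_derivative (\<lambda>z. \<eta> c z u v) (at z) w = 0)"
  unfolding closed_2form_def split_beta by simp

lemma kaehler_form_iff:
  "kaehler_form X \<omega> \<longleftrightarrow> smooth_2form X \<omega> \<and> closed_2form X \<omega> \<and>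
    (\<forall>c\<in>atlas X. \<forall>z\<in>snd c ` fst c. (\<forall>v w. \<omega> c z (\<i> *s v) (\<i> *s w) = \<omega> c z v w) \<and>
      (\<forall>v. v \<noteq> 0 \<longrightarrow> 0 < \<omega> c z v (\<i> *s v)))"
  unfolding kaehler_form_def split_beta by simp

lemma (in charts) smooth_2form_differentiable:
  assumes "smooth_2form X \<eta>" "c \<in> atlas X" "z \<in> snd c ` fst c"
  shows "(\<lambda>z. \<eta> c z v w) differentiable (at z)"
  using smooth_2form_Ck_on[OF assms(1,2), of "Suc 0" v w] assms(3)
  unfolding Ck_on_Suc_frechet[OF chart_open[OF assms(2)]] by blast

lemma (in charts) kaehler_form_add:
  assumes "kaehler_form X \<omega>" "kaehler_form X \<theta>"
  shows "kaehler_form X (\<lambda>c z v w. \<omega> c z v w + \<theta> c z v w)"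
proof -
  have s: "smooth_2form X \<omega>" "smooth_2form X \<theta>" using assms by (simp_all add: kaehler_form_def)
  have "smooth_2form X (\<lambda>c z v w. \<omega> c z v w + \<theta> c z v w)"
  proof (rule smooth_2formI)
    fix c z assume "c \<in> atlas X" "z \<in> snd c ` fst c"
    then have "bilinear (\<omega> c z)" "bilinear (\<theta> c z)" using smooth_2form_bilinear s by blast+
    then show "bilinear (\<lambda>v w. \<omega> c z v w + \<theta> c z v w)"
      unfolding bilinear_def by (simp add: linear_compose_add)
  next
    show "is_pullback X (\<lambda>x. x) (\<lambda>c z v w. \<omega> c z v w + \<theta> c z v w) (\<lambda>c z v w. \<omega> c z v w + \<theta> c z v w)"
      using smooth_2form_pullback_id[OF s(1)] smooth_2form_pullback_id[OF s(2)]
      unfolding is_pullback_iff by (intro ballI allI impI arg_cong2[where f = "(+)"]) blast+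
  next
    show "Ck_on k (snd c ` fst c) (\<lambda>z. \<omega> c z v w + \<theta> c z v w)" if "c \<in> atlas X" for c k v w
      by (intro Ck_on_add smooth_2form_Ck_on[OF s(1) that] smooth_2form_Ck_on[OF s(2) that])
  next
    fix c z v assume "c \<in> atlas X" "z \<in> snd c ` fst c"
    from smooth_2form_alternating[OF s(1) this, of v] smooth_2form_alternating[OF s(2) this, of v]
    show "\<omega> c z v v + \<theta> c z v v = 0" by linarith
  qed
  moreover have "closed_2form X (\<lambda>c z v w. \<omega> c z v w + \<theta> c z v w)"
    unfolding closed_2form_iff
  proof (intro ballI allI)
    fix c z u v w assume c: "c \<in> atlas X" and z: "z \<in> snd c ` fst c"
    have "((\<lambda>z. \<omega> c z v w + \<theta> c z v w) has_derivative (\<lambda>u. frechet_derivative (\<lambda>z. \<omega> c z v w) (at z) u +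
        frechet_derivative (\<lambda>z. \<theta> c z v w) (at z) u)) (at z)" for v w
      using smooth_2form_differentiable[OF s(1) c z] smooth_2form_differentiable[OF s(2) c z]
      by (intro has_derivative_add) (simp_all add: frechet_derivative_works)
    note D = frechet_derivative_at[OF this]
    have *: "frechet_derivative (\<lambda>z. \<omega> c z v w + \<theta> c z v w) (at z) u =
        frechet_derivative (\<lambda>z. \<omega> c z v w) (at z) u + frechet_derivative (\<lambda>z. \<theta> c z v w) (at z) u" for u v w
      using fun_cong[OF D, of v w u] by (rule sym)
    have "closed_2form X \<omega>" "closed_2form X \<theta>" using assms by (simp_all add: kaehler_form_def)
    from this(1)[unfolded closed_2form_iff, rule_format, OF c z, of v w u]
      this(2)[unfolded closed_2form_iff, rule_format, OF c z, of v w u]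
    show "frechet_derivative (\<lambda>z. \<omega> c z v w + \<theta> c z v w) (at z) u +
      frechet_derivative (\<lambda>z. \<omega> c z w u + \<theta> c z w u) (at z) v +
      frechet_derivative (\<lambda>z. \<omega> c z u v + \<theta> c z u v) (at z) w = 0"
      unfolding * by linarith
  qed
  ultimately show ?thesis using assms unfolding kaehler_form_iff by (simp add: add_pos_pos)
qed

text \<open>A tensor is a family of components in all charts of its argument, so at each point a
  chart around the image has to be chosen. \<open>pullback_form_chart\<close> shows independence of
  that choice.\<close>

definition pullback_form ::
  "('a, 'm::finite) cmanifold \<Rightarrow> ('a \<Rightarrow> 'a) \<Rightarrow> ('a, 'm, real) tensor2 \<Rightarrow> ('a, 'm, real) tensor2" where
  "pullback_form X f \<eta> c z v w = (let x = inv_into (fst c) (snd c) z; d = (SOME d. d \<in> atlas X \<and> f x \<in> fst d);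
     F' = frechet_derivative (transition f c d) (at z) in \<eta> d (snd d (f x)) (F' v) (F' w))"

locale holomorphic_self_map = charts X for X :: "('a, 'm::finite) cmanifold" +
  fixes f :: "'a \<Rightarrow> 'a"
  assumes holo: "holo_between X X f"
begin

lemma map_points: "x \<in> points X \<Longrightarrow> f x \<in> points X"
  using holo continuous_map_image_subset_topspace unfolding holo_between_def points_def by fastforce

lemma target_chart:
  assumes "c \<in> atlas X" "x \<in> fst c"
  obtains d where "d \<in> atlas X" "f x \<in> fst d"
  using chart_at[OF complex_manifold map_points] chart_subset[OF assms(1)] assms(2) by blast

lemma pullback_form_chart:
  assumes \<eta>: "is_pullback X (\<lambda>x. x) \<eta> \<eta>"
    and c: "c \<in> atlas X" "x \<in> fst c" and d: "d \<in> atlas X" "f x \<in> fst d"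
  shows "pullback_form X f \<eta> c (snd c x) v w = \<eta> d (snd d (f x))
    (frechet_derivative (transition f c d) (at (snd c x)) v)
    (frechet_derivative (transition f c d) (at (snd c x)) w)"
proof -
  define e where "e = (SOME d. d \<in> atlas X \<and> f x \<in> fst d)"
  have e: "e \<in> atlas X" "f x \<in> fst e"
    using someI[of "\<lambda>d. d \<in> atlas X \<and> f x \<in> fst d" d] d unfolding e_def by blast+
  have "frechet_derivative (transition f c d) (at (snd c x)) v =
      frechet_derivative (transition (\<lambda>x. x) e d) (at (snd e (f x)))
        (frechet_derivative (transition f c e) (at (snd c x)) v)" for v
    using transition_compose[OF holo holo_between_id c(1) e(1) d(1) c(2) e(2) d(2)] by (simp add: o_def)
  then show ?thesis
    unfolding pullback_form_def Let_def chart_inverse[OF c] e_def[symmetric]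
    using \<eta>[unfolded is_pullback_iff, rule_format, OF e(1) d(1) e(2) d(2)] by presburger
qed

lemma is_pullback_pullback_form:
  assumes "is_pullback X (\<lambda>x. x) \<eta> \<eta>"
  shows "is_pullback X f \<eta> (pullback_form X f \<eta>)"
  unfolding is_pullback_iff by (intro ballI allI impI pullback_form_chart[OF assms])

lemma pullback_form_local:
  assumes \<eta>: "is_pullback X (\<lambda>x. x) \<eta> \<eta>" and c: "c \<in> atlas X" and d: "d \<in> atlas X"
    and z: "z \<in> snd c ` {x \<in> fst c. f x \<in> fst d}"
  shows "pullback_form X f \<eta> c z v w = \<eta> d (transition f c d z)
    (frechet_derivative (transition f c d) (at z) v) (frechet_derivative (transition f c d) (at z) w)"
    and "transition f c d z \<in> snd d ` fst d"
proof -
  obtain x where x: "x \<in> fst c" "f x \<in> fst d" "z = snd c x" using z by blast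
  show "pullback_form X f \<eta> c z v w = \<eta> d (transition f c d z)
    (frechet_derivative (transition f c d) (at z) v) (frechet_derivative (transition f c d) (at z) w)"
    unfolding x(3) pullback_form_chart[OF \<eta> c x(1) d x(2)] by (simp add: transition_apply[OF c x(1)])
  show "transition f c d z \<in> snd d ` fst d" using x by (simp add: transition_apply[OF c x(1)])
qed

lemma local_chart:
  assumes "c \<in> atlas X" "z \<in> snd c ` fst c"
  obtains d where "d \<in> atlas X" "z \<in> snd c ` {x \<in> fst c. f x \<in> fst d}"
proof -
  obtain x where x: "x \<in> fst c" "z = snd c x" using assms(2) by blast
  obtain d where "d \<in> atlas X" "f x \<in> fst d" using target_chart[OF assms(1) x(1)] .
  then show ?thesis using x by (intro that[of d]) auto
qed

lemma pullback_form_smooth: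
  assumes \<eta>: "smooth_2form X \<eta>"
  shows "smooth_2form X (pullback_form X f \<eta>)"
proof (rule smooth_2formI)
  note id = smooth_2form_pullback_id[OF \<eta>]
  fix c assume c: "c \<in> atlas X"
  have *: "bilinear (pullback_form X f \<eta> c z) \<and> pullback_form X f \<eta> c z v v = 0"
    if z: "z \<in> snd c ` fst c" for z v
  proof -
    obtain d where d: "d \<in> atlas X" "z \<in> snd c ` {x \<in> fst c. f x \<in> fst d}"
      using local_chart[OF c z] .
    let ?F' = "frechet_derivative (transition f c d) (at z)"
    have lin: "linear ?F'"
      using has_derivative_linear[OF holo_map_derivative_components(1)[OF transition_holo[OF holo c d(1)] d(2)]] .
    note y = pullback_form_local(2)[OF id c d]
    have bil: "bilinear (\<eta> d (transition f c d z))" using smooth_2form_bilinear[OF \<eta> d(1) y] .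
    have "bilinear (\<lambda>v w. \<eta> d (transition f c d z) (?F' v) (?F' w))"
      using bil linear_compose[OF lin] unfolding bilinear_def o_def by blast
    then show ?thesis
      using smooth_2form_alternating[OF \<eta> d(1) y] unfolding pullback_form_local(1)[OF id c d] by blast
  qed
  show "bilinear (pullback_form X f \<eta> c z)" if "z \<in> snd c ` fst c" for z using *[OF that] by blast
  show "pullback_form X f \<eta> c z v v = 0" if "z \<in> snd c ` fst c" for z v using *[OF that] by blast
  show "Ck_on k (snd c ` fst c) (\<lambda>z. pullback_form X f \<eta> c z v w)" for k v w
  proof (rule Ck_on_local[OF chart_open[OF c]])
    fix z assume z: "z \<in> snd c ` fst c"
    obtain d where d: "d \<in> atlas X" "z \<in> snd c ` {x \<in> fst c. f x \<in> fst d}"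
      using local_chart[OF c z] .
    let ?V = "snd c ` {x \<in> fst c. f x \<in> fst d}" and ?F = "transition f c d"
    have V: "open ?V" "holo_map ?V ?F" using transition_open[OF holo c d(1)] transition_holo[OF holo c d(1)] .
    have F: "Ck_on k ?V ?F" "\<And>v. Ck_on k ?V (\<lambda>z. frechet_derivative ?F (at z) v)"
      using Ck_on_holo_map V holo_map_frechet_derivative by blast+
    have "Ck_on k ?V (\<lambda>z. \<Sum>a\<in>Basis. \<Sum>b\<in>Basis. (frechet_derivative ?F (at z) v \<bullet> a) *
        (frechet_derivative ?F (at z) w \<bullet> b) * \<eta> d (?F z) a b)"
      by (intro Ck_on_sum Ck_on_bilinear[OF bounded_bilinear_mult] Ck_on_linear_comp[OF bounded_linear_inner_left]
          F Ck_on_compose[OF F(1) smooth_2form_Ck_on[OF \<eta> d(1)]] pullback_form_local(2)[OF id c d(1)])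
    then have "Ck_on k ?V (\<lambda>z. pullback_form X f \<eta> c z v w)"
    proof (rule Ck_on_cong[OF V(1), rotated])
      fix z assume z: "z \<in> ?V"
      show "(\<Sum>a\<in>Basis. \<Sum>b\<in>Basis. (frechet_derivative ?F (at z) v \<bullet> a) *
        (frechet_derivative ?F (at z) w \<bullet> b) * \<eta> d (?F z) a b) = pullback_form X f \<eta> c z v w"
        unfolding pullback_form_local(1)[OF id c d(1) z]
        by (rule bilinear_basis_sum[symmetric], rule smooth_2form_bilinear[OF \<eta> d(1)])
          (rule pullback_form_local(2)[OF id c d(1) z])
    qed
    then show "\<exists>U. open U \<and> z \<in> U \<and> U \<subseteq> snd c ` fst c \<and> Ck_on k U (\<lambda>z. pullback_form X f \<eta> c z v w)"
      using V(1) d(2) by (intro exI[of _ ?V]) auto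
  qed
next
  note id = smooth_2form_pullback_id[OF \<eta>]
  show "is_pullback X (\<lambda>x. x) (pullback_form X f \<eta>) (pullback_form X f \<eta>)"
    unfolding is_pullback_iff
  proof (intro ballI allI impI)
    fix c c' x v w assume c: "c \<in> atlas X" "x \<in> fst c" and c': "c' \<in> atlas X" "x \<in> fst c'"
    obtain d where d: "d \<in> atlas X" "f x \<in> fst d" using target_chart[OF c] .
    have "frechet_derivative (transition f c d) (at (snd c x)) v =
        frechet_derivative (transition f c' d) (at (snd c' x))
          (frechet_derivative (transition (\<lambda>x. x) c c') (at (snd c x)) v)" for v
      using transition_compose[OF holo_between_id holo c(1) c'(1) d(1) c(2) c'(2) d(2)] by (simp add: o_def)
    then show "pullback_form X f \<eta> c (snd c x) v w = pullback_form X f \<eta> c' (snd c' x)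
        (frechet_derivative (transition (\<lambda>x. x) c c') (at (snd c x)) v)
        (frechet_derivative (transition (\<lambda>x. x) c c') (at (snd c x)) w)"
      unfolding pullback_form_chart[OF id c d] pullback_form_chart[OF id c' d] by simp
  qed
qed

text \<open>Differentiating a component gives the derivative of the coefficients, whose cyclic sum
  vanishes because the form is closed, and two terms with second derivatives of f. These are
  symmetric while the form is alternating, so they cancel in pairs in the cyclic sum.\<close>

lemma pullback_form_closed:
  assumes \<eta>: "smooth_2form X \<eta>" and closed: "closed_2form X \<eta>"
  shows "closed_2form X (pullback_form X f \<eta>)"
  unfolding closed_2form_iff
proof (intro ballI allI)
  note id = smooth_2form_pullback_id[OF \<eta>]
  fix c z u v w assume c: "c \<in> atlas X" and z: "z \<in> snd c ` fst c"
  obtain d where d: "d \<in> atlas X" "z \<in> snd c ` {x \<in> fst c. f x \<in> fst d}"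
    using local_chart[OF c z] .
  let ?V = "snd c ` {x \<in> fst c. f x \<in> fst d}" and ?F = "transition f c d"
  have V: "open ?V" "holo_map ?V ?F" using transition_open[OF holo c d(1)] transition_holo[OF holo c d(1)] .
  define P where "P v z = frechet_derivative ?F (at z) v" for v z
  define H where "H v u = frechet_derivative (P v) (at z) u" for v u
  have sym: "H v u = H u v" for u v
    unfolding H_def P_def using holo_map_symmetric_derivative[OF V d(2)] .
  have P: "(P v has_derivative H v) (at z)" for v
    unfolding H_def P_def
    using holo_map_derivative_components(1)[OF holo_map_frechet_derivative[OF V] d(2)] by simp
  have F: "(?F has_derivative (\<lambda>u. P u z)) (at z)"
    unfolding P_def using holo_map_derivative_components(1)[OF V(2) d(2)] by simp
  have y: "?F z \<in> snd d ` fst d" using pullback_form_local(2)[OF id c d] .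
  have "((\<lambda>z. \<eta> d (?F z) (P v z) (P w z)) has_derivative
      (\<lambda>u. frechet_derivative (\<lambda>y. \<eta> d y (P v z) (P w z)) (at (?F z)) (P u z) +
        \<eta> d (?F z) (H v u) (P w z) + \<eta> d (?F z) (P v z) (H w u))) (at z)" for v w
    using smooth_2form_differentiable[OF \<eta> d(1) y]
    by (intro has_derivative_form[OF chart_open[OF d(1)] smooth_2form_bilinear[OF \<eta> d(1)] V(1) d(2) _ _ F P P]
        pullback_form_local(2)[OF id c d(1)]) auto
  then have "((\<lambda>z. pullback_form X f \<eta> c z v w) has_derivative
      (\<lambda>u. frechet_derivative (\<lambda>y. \<eta> d y (P v z) (P w z)) (at (?F z)) (P u z) +
        \<eta> d (?F z) (H v u) (P w z) + \<eta> d (?F z) (P v z) (H w u))) (at z)" for v w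
    by (rule has_derivative_transform_within_open[OF _ V(1) d(2)])
      (simp add: pullback_form_local(1)[OF id c d(1)] P_def)
  from frechet_derivative_at[OF this, symmetric]
  have *: "frechet_derivative (\<lambda>z. pullback_form X f \<eta> c z v w) (at z) u =
      frechet_derivative (\<lambda>y. \<eta> d y (P v z) (P w z)) (at (?F z)) (P u z) +
        \<eta> d (?F z) (H v u) (P w z) + \<eta> d (?F z) (P v z) (H w u)" for u v w
    by (simp add: fun_eq_iff)
  have bil: "bilinear (\<eta> d (?F z))" using smooth_2form_bilinear[OF \<eta> d(1) y] .
  have anti: "\<eta> d (?F z) v w = - \<eta> d (?F z) w v" for v w
  proof -
    have "\<eta> d (?F z) (v + w) (v + w) = 0" "\<eta> d (?F z) v v = 0" "\<eta> d (?F z) w w = 0"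
      using smooth_2form_alternating[OF \<eta> d(1) y] by blast+
    then show ?thesis by (simp add: bilinear_ladd[OF bil] bilinear_radd[OF bil])
  qed
  have "frechet_derivative (\<lambda>y. \<eta> d y (P v z) (P w z)) (at (?F z)) (P u z) +
      frechet_derivative (\<lambda>y. \<eta> d y (P w z) (P u z)) (at (?F z)) (P v z) +
      frechet_derivative (\<lambda>y. \<eta> d y (P u z) (P v z)) (at (?F z)) (P w z) = 0"
    using closed d(1) y unfolding closed_2form_iff by blast
  moreover have "\<eta> d (?F z) (H v u) (P w z) = - \<eta> d (?F z) (P w z) (H u v)"
    "\<eta> d (?F z) (H w v) (P u z) = - \<eta> d (?F z) (P u z) (H v w)"
    "\<eta> d (?F z) (H u w) (P v z) = - \<eta> d (?F z) (P v z) (H w u)"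
    unfolding sym[of v u] sym[of w v] sym[of u w] by (rule anti)+
  ultimately show "frechet_derivative (\<lambda>z. pullback_form X f \<eta> c z v w) (at z) u +
    frechet_derivative (\<lambda>z. pullback_form X f \<eta> c z w u) (at z) v +
    frechet_derivative (\<lambda>z. pullback_form X f \<eta> c z u v) (at z) w = 0"
    unfolding * by linarith
qed

text \<open>Positivity survives because the derivative of f is complex linear and injective;
  injectivity is the chain rule for the identity f o f.\<close>

lemma pullback_form_kaehler:
  assumes inv: "\<And>x. x \<in> points X \<Longrightarrow> f (f x) = x" and \<omega>: "kaehler_form X \<omega>"
  shows "kaehler_form X (pullback_form X f \<omega>)"
proof -
  have s: "smooth_2form X \<omega>" "closed_2form X \<omega>" using \<omega> by (simp_all add: kaehler_form_def)
  note id = smooth_2form_pullback_id[OF s(1)]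
  have "(\<forall>v w. pullback_form X f \<omega> c z (\<i> *s v) (\<i> *s w) = pullback_form X f \<omega> c z v w) \<and>
      (\<forall>v. v \<noteq> 0 \<longrightarrow> 0 < pullback_form X f \<omega> c z v (\<i> *s v))"
    if c: "c \<in> atlas X" and z: "z \<in> snd c ` fst c" for c z
  proof -
    obtain x where x: "x \<in> fst c" "z = snd c x" using z by blast
    obtain d where d: "d \<in> atlas X" "f x \<in> fst d" using target_chart[OF c x(1)] .
    let ?F' = "frechet_derivative (transition f c d) (at (snd c x))"
    have ffx: "f (f x) \<in> fst c" using inv x(1) chart_subset[OF c] by auto
    have zV: "snd c x \<in> snd c ` {x \<in> fst c. f x \<in> fst d}" using x d by blast
    have cmul: "?F' (\<i> *s v) = \<i> *s ?F' v" for v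
      by (rule holo_map_derivative_cmul[OF transition_holo[OF holo c d(1)] zV])
    have "?F' v \<noteq> 0" if "v \<noteq> 0" for v
    proof
      assume 0: "?F' v = 0"
      have "v = frechet_derivative (transition (f \<circ> f) c c) (at (snd c x)) v"
        using transition_id_derivative[OF c x(1), of "f \<circ> f"] inv by simp
      also have "\<dots> = frechet_derivative (transition f d c) (at (snd d (f x))) 0"
        unfolding transition_compose[OF holo holo c d(1) c x(1) d(2) ffx] 0 ..
      also have "\<dots> = 0"
      proof -
        have "snd d (f x) \<in> snd d ` {x \<in> fst d. f x \<in> fst c}" using d ffx by blast
        from holo_map_derivative_components(1)[OF transition_holo[OF holo d(1) c] this]
        show ?thesis by (intro linear_0 has_derivative_linear)
      qed
      finally show False using that by simp
    qed
    moreover have "snd d (f x) \<in> snd d ` fst d" using d by blast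
    moreover have "\<forall>y\<in>snd d ` fst d. (\<forall>v w. \<omega> d y (\<i> *s v) (\<i> *s w) = \<omega> d y v w) \<and>
        (\<forall>v. v \<noteq> 0 \<longrightarrow> 0 < \<omega> d y v (\<i> *s v))"
      using \<omega> d(1) unfolding kaehler_form_iff by blast
    ultimately show ?thesis
      unfolding x(2) pullback_form_chart[OF id c x(1) d] cmul by blast
  qed
  then show ?thesis
    unfolding kaehler_form_iff using pullback_form_smooth[OF s(1)] pullback_form_closed[OF s] by blast
qed

end

section \<open>Classes represented by forms\<close>

lemma sum_support:
  fixes r :: "'b \<Rightarrow> real"
  assumes "finite F" "{A. r A \<noteq> 0} \<subseteq> F"
  shows "(\<Sum>A | r A \<noteq> 0. r A * h A) = (\<Sum>A\<in>F. r A * h A)"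
  by (rule sum.mono_neutral_left[OF assms]) auto

lemma real_square_support:
  assumes F: "finite F" "{A. r A \<noteq> 0} \<subseteq> F"
  shows "real_square q r = (\<Sum>A\<in>F. \<Sum>B\<in>F. r A * r B * of_int (q A B))"
proof -
  have "real_square q r = (\<Sum>A | r A \<noteq> 0. r A * (\<Sum>B | r B \<noteq> 0. r B * of_int (q A B)))"
    by (simp add: real_square_def sum_distrib_left mult.assoc)
  also have "\<dots> = (\<Sum>A\<in>F. r A * (\<Sum>B\<in>F. r B * of_int (q A B)))"
    by (simp only: sum_support[OF F])
  finally show ?thesis by (simp add: sum_distrib_left mult.assoc)
qed

text \<open>Reindexing along the involution moves g from the coefficients to the classes:
  coefficients r + e r(g) on the A amount to coefficients r on the A + e gA. It is applied with e =
  1 and e = -1.\<close>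

lemma sum_symmetrize:
  fixes r :: "'b \<Rightarrow> real"
  assumes g: "\<And>A. A \<in> F \<Longrightarrow> g A \<in> F" "\<And>A. A \<in> F \<Longrightarrow> g (g A) = A"
  shows "(\<Sum>A\<in>F. \<Sum>B\<in>F. (r A + e * r (g A)) * (r B + e * r (g B)) * h A B) =
    (\<Sum>A\<in>F. \<Sum>B\<in>F. r A * r B * (h A B + e * h A (g B) + e * h (g A) B + e * e * h (g A) (g B)))"
proof -
  have bij: "bij_betw g F F" by (rule bij_betwI[of g F F g]) (use g in auto)
  have 1: "(\<Sum>A\<in>F. (r A + e * r (g A)) * k A) = (\<Sum>A\<in>F. r A * (k A + e * k (g A)))" for k
  proof -
    have "(\<Sum>A\<in>F. e * r (g A) * k A) = (\<Sum>A\<in>F. e * r (g (g A)) * k (g A))"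
      by (rule sum.reindex_bij_betw[OF bij, symmetric])
    also have "\<dots> = (\<Sum>A\<in>F. r A * (e * k (g A)))" by (rule sum.cong) (simp_all add: g)
    finally show ?thesis by (simp add: ring_distribs sum.distrib)
  qed
  have "(\<Sum>A\<in>F. \<Sum>B\<in>F. (r A + e * r (g A)) * (r B + e * r (g B)) * h A B) =
      (\<Sum>A\<in>F. (r A + e * r (g A)) * (\<Sum>B\<in>F. (r B + e * r (g B)) * h A B))"
    by (simp add: sum_distrib_left mult.assoc)
  also have "\<dots> = (\<Sum>A\<in>F. r A * ((\<Sum>B\<in>F. r B * (h A B + e * h A (g B))) +
      e * (\<Sum>B\<in>F. r B * (h (g A) B + e * h (g A) (g B)))))"
    unfolding 1 ..
  also have "\<dots> = (\<Sum>A\<in>F. \<Sum>B\<in>F. r A * r B * (h A B + e * h A (g B) + e * h (g A) B + e * e * h (g A) (g B)))"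
    by (simp add: sum_distrib_left sum.distrib[symmetric] ring_distribs mult_ac add_ac)
  finally show ?thesis .
qed

lemma (in charts) represents_form_lincomb:
  assumes s: "smooth_2form X \<eta>" "smooth_2form X \<theta>"
    and r: "represents_form X \<eta> r" and t: "represents_form X \<theta> t"
  shows "represents_form X (\<lambda>c z v w. a * \<eta> c z v w + b * \<theta> c z v w) (\<lambda>A. a * r A + b * t A)"
  unfolding represents_form_def
proof (intro conjI allI impI)
  let ?u = "\<lambda>A. a * r A + b * t A" and ?F = "{A. r A \<noteq> 0} \<union> {A. t A \<noteq> 0}"
  have F: "finite ?F" "?F \<subseteq> carrier (H2 (mtop X))" using r t by (auto simp: represents_form_def)
  have sub: "{A. r A \<noteq> 0} \<subseteq> ?F" "{A. t A \<noteq> 0} \<subseteq> ?F" "{A. ?u A \<noteq> 0} \<subseteq> ?F" by auto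
  show "finite {A. ?u A \<noteq> 0}" using finite_subset[OF sub(3) F(1)] .
  show "{A. ?u A \<noteq> 0} \<subseteq> carrier (H2 (mtop X))" using sub(3) F(2) by (rule order_trans)
  fix z assume z: "singular_relcycle 2 (mtop X) {} z \<and> (\<forall>\<sigma>\<in>Poly_Mapping.keys z. smooth_simplex X \<sigma>)"
  have "cochain_eval (simplex_integral X (\<lambda>c z v w. a * \<eta> c z v w + b * \<theta> c z v w)) z =
      cochain_eval (\<lambda>\<sigma>. a * simplex_integral X \<eta> \<sigma> + b * simplex_integral X \<theta> \<sigma>) z"
    using z by (intro cochain_eval_cong simplex_integral_add_scale s) blast
  also have "\<dots> = a * cochain_eval (simplex_integral X \<eta>) z + b * cochain_eval (simplex_integral X \<theta>) z"
    by (simp add: cochain_eval_def sum.distrib sum_distrib_left ring_distribs mult_ac)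
  also have "cochain_eval (simplex_integral X \<eta>) z = (\<Sum>A\<in>?F. r A * of_int (H2_pairing A z))"
    using r z unfolding represents_form_def sum_support[OF F(1) sub(1), symmetric] by simp
  also have "cochain_eval (simplex_integral X \<theta>) z = (\<Sum>A\<in>?F. t A * of_int (H2_pairing A z))"
    using t z unfolding represents_form_def sum_support[OF F(1) sub(2), symmetric] by simp
  finally show "(\<Sum>A | ?u A \<noteq> 0. ?u A * of_int (H2_pairing A z)) =
      cochain_eval (simplex_integral X (\<lambda>c z v w. a * \<eta> c z v w + b * \<theta> c z v w)) z"
    unfolding sum_support[OF F(1) sub(3)] by (simp add: sum.distrib sum_distrib_left ring_distribs mult_ac)
qed

section \<open>The action of an involution on classes of forms\<close>

locale holomorphic_involution = holomorphic_self_map X f for X :: "('a, 'm::finite) cmanifold" and f +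
  assumes involutive: "\<And>x. x \<in> points X \<Longrightarrow> f (f x) = x"
begin

abbreviation H where "H \<equiv> H2 (mtop X)"
abbreviation g where "g \<equiv> H2_pullback (mtop X) f"

lemma continuous: "continuous_map (mtop X) (mtop X) f"
  using holo by (simp add: holo_between_def)

lemma pullback_involution:
  shows "A \<in> carrier H \<Longrightarrow> g A \<in> carrier H"
    and "A \<in> carrier H \<Longrightarrow> g (g A) = A"
    and "A \<in> carrier H \<Longrightarrow> B \<in> carrier H \<Longrightarrow> g (A \<otimes>\<^bsub>H\<^esub> B) = g A \<otimes>\<^bsub>H\<^esub> g B"
proof -
  have *: "f (f x) = x" if "x \<in> topspace (mtop X)" for x using involutive that by (simp add: points_def)
  show "A \<in> carrier H \<Longrightarrow> g A \<in> carrier H" by (rule H2_pullback_involution(1)[OF continuous *])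
  show "A \<in> carrier H \<Longrightarrow> g (g A) = A" by (rule H2_pullback_involution(2)[OF continuous *])
  show "A \<in> carrier H \<Longrightarrow> B \<in> carrier H \<Longrightarrow> g (A \<otimes>\<^bsub>H\<^esub> B) = g A \<otimes>\<^bsub>H\<^esub> g B"
    by (rule H2_pullback_involution(3)[OF continuous *])
qed

text \<open>The image of the formal combination r under g. As g is its own inverse on the carrier,
  pushing forward along g is composing with g; outside the carrier the coefficient is 0, as
  \<open>represents_form\<close> requires.\<close>

definition pulled_back where "pulled_back r A = (if A \<in> carrier H then r (g A) else (0 :: real))"

lemma pulled_back_support:
  assumes "{A. r A \<noteq> 0} \<subseteq> carrier H"
  shows "{A. pulled_back r A \<noteq> 0} = g ` {A. r A \<noteq> 0}"
proof
  show "{A. pulled_back r A \<noteq> 0} \<subseteq> g ` {A. r A \<noteq> 0}"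
  proof
    fix A assume "A \<in> {A. pulled_back r A \<noteq> 0}"
    then have A: "A \<in> carrier H" "r (g A) \<noteq> 0" by (auto simp: pulled_back_def split: if_splits)
    then have "A = g (g A)" using pullback_involution(2) by simp
    with A(2) show "A \<in> g ` {A. r A \<noteq> 0}" by blast
  qed
  show "g ` {A. r A \<noteq> 0} \<subseteq> {A. pulled_back r A \<noteq> 0}"
  proof
    fix A assume "A \<in> g ` {A. r A \<noteq> 0}"
    then obtain B where B: "r B \<noteq> 0" "A = g B" by blast
    then have "B \<in> carrier H" using assms by blast
    then show "A \<in> {A. pulled_back r A \<noteq> 0}" using B pullback_involution(1,2) by (simp add: pulled_back_def)
  qed
qed

text \<open>Both sides are moved to the image cycle: periods of the pulled back form over z are
  periods over f(z), and the pairing of gB with z is that of B with f(z).\<close>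

lemma represents_form_pullback:
  assumes r: "represents_form X \<eta> r" and \<eta>: "is_pullback X f \<eta> \<theta>"
  shows "represents_form X \<theta> (pulled_back r)"
  unfolding represents_form_def
proof (intro conjI allI impI)
  have F: "finite {A. r A \<noteq> 0}" "{A. r A \<noteq> 0} \<subseteq> carrier H" using r by (auto simp: represents_form_def)
  note supp = pulled_back_support[OF F(2)]
  show "finite {A. pulled_back r A \<noteq> 0}" unfolding supp using F(1) by (rule finite_imageI)
  show "{A. pulled_back r A \<noteq> 0} \<subseteq> carrier H" by (auto simp: pulled_back_def)
  fix z assume "singular_relcycle 2 (mtop X) {} z \<and> (\<forall>\<sigma>\<in>Poly_Mapping.keys z. smooth_simplex X \<sigma>)"
  then have z: "singular_relcycle 2 (mtop X) {} z" "\<And>\<sigma>. \<sigma> \<in> Poly_Mapping.keys z \<Longrightarrow> smooth_simplex X \<sigma>"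
    by blast+
  have inj: "inj_on g {A. r A \<noteq> 0}"
  proof (rule inj_onI)
    fix A B assume AB: "A \<in> {A. r A \<noteq> 0}" "B \<in> {A. r A \<noteq> 0}" "g A = g B"
    then have "A \<in> carrier H" "B \<in> carrier H" using F(2) by blast+
    then show "A = B" using pullback_involution(2) AB(3) by metis
  qed
  have fz: "singular_relcycle 2 (mtop X) {} (chain_map 2 f z)"
    by (rule singular_relcycle_chain_map[OF z(1) continuous]) simp
  have smooth: "smooth_simplex X \<sigma>" if "\<sigma> \<in> Poly_Mapping.keys (chain_map 2 f z)" for \<sigma>
  proof -
    obtain \<tau> where "\<tau> \<in> Poly_Mapping.keys z" "\<sigma> \<in> Poly_Mapping.keys (frag_of (simplex_map 2 f \<tau>))"
      using keys_frag_extend[of "frag_of \<circ> simplex_map 2 f" z] \<open>\<sigma> \<in> _\<close> unfolding chain_map_def by auto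
    then show ?thesis using smooth_simplex_map[OF holo z(2)] by auto
  qed
  have "(\<Sum>A | pulled_back r A \<noteq> 0. pulled_back r A * of_int (H2_pairing A z)) =
      (\<Sum>B | r B \<noteq> 0. pulled_back r (g B) * of_int (H2_pairing (g B) z))"
    unfolding supp by (subst sum.reindex[OF inj]) (simp add: o_def)
  also have "\<dots> = (\<Sum>B | r B \<noteq> 0. r B * of_int (H2_pairing B (chain_map 2 f z)))"
  proof (rule sum.cong[OF refl])
    fix B assume "B \<in> {B. r B \<noteq> 0}"
    then have B: "B \<in> carrier H" using F(2) by blast
    show "pulled_back r (g B) * of_int (H2_pairing (g B) z) = r B * of_int (H2_pairing B (chain_map 2 f z))"
      unfolding H2_pairing_pullback[OF continuous B z(1)] using pullback_involution(1,2)[OF B] by (simp add: pulled_back_def)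
  qed
  also have "\<dots> = cochain_eval (simplex_integral X \<eta>) (chain_map 2 f z)"
    using r fz smooth unfolding represents_form_def by blast
  also have "\<dots> = cochain_eval (simplex_integral X \<theta>) z"
    unfolding cochain_eval_chain_map
    by (rule cochain_eval_cong) (rule simplex_integral_map[OF holo z(2) \<eta>])
  finally show "(\<Sum>A | pulled_back r A \<noteq> 0. pulled_back r A * of_int (H2_pairing A z)) =
    cochain_eval (simplex_integral X \<theta>) z" .
qed

lemma symmetric_square:
  assumes F: "finite F" "F \<subseteq> carrier H" "\<And>A. A \<in> F \<Longrightarrow> g A \<in> F" "{A. r A \<noteq> 0} \<subseteq> F"
  shows "real_square q (\<lambda>A. a * r A + b * pulled_back r A) =
    (\<Sum>A\<in>F. \<Sum>B\<in>F. (a * r A + b * r (g A)) * (a * r B + b * r (g B)) * of_int (q A B))"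
proof -
  have pulled_back: "pulled_back r A = r (g A)" if "A \<in> F" for A using F(2) that by (auto simp: pulled_back_def)
  have "{A. a * r A + b * pulled_back r A \<noteq> 0} \<subseteq> F"
  proof
    fix A assume "A \<in> {A. a * r A + b * pulled_back r A \<noteq> 0}"
    then have "r A \<noteq> 0 \<or> pulled_back r A \<noteq> 0" by auto
    moreover have "A \<in> F" if "pulled_back r A \<noteq> 0"
    proof -
      have "A \<in> g ` {A. r A \<noteq> 0}" using that pulled_back_support[OF order_trans[OF F(4,2)]] by blast
      then obtain B where "A = g B" "r B \<noteq> 0" by blast
      then show ?thesis using F(3)[of B] F(4) by blast
    qed
    ultimately show "A \<in> F" using F(4) by blast
  qed
  from real_square_support[OF F(1) this] show ?thesis by (simp add: pulled_back)
qed

end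

section \<open>Positivity of the holomorphic symplectic form\<close>

lemma holomorphic_2form_iff:
  "holomorphic_2form X \<sigma> \<longleftrightarrow> (\<forall>c\<in>atlas X.
    (\<forall>z\<in>snd c ` fst c. bilinear (\<sigma> c z) \<and> (\<forall>v. \<sigma> c z v v = 0) \<and>
      (\<forall>v w. \<sigma> c z (\<i> *s v) w = \<i> * \<sigma> c z v w)) \<and>
    (\<forall>v w. holo_fun (snd c ` fst c) (\<lambda>z. \<sigma> c z v w))) \<and> is_pullback X (\<lambda>x. x) \<sigma> \<sigma>"
  unfolding holomorphic_2form_def split_beta by simp

lemma linear_cmult: "linear (\<lambda>v. L v :: complex) \<Longrightarrow> linear (\<lambda>v. k * L v)"
  by (rule linear_compose[unfolded o_def]) (auto intro: bounded_linear.linear bounded_linear_mult_right)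

lemma linear_Re: "linear L \<Longrightarrow> linear (\<lambda>v. Re (L v))"
  by (rule linear_compose[unfolded o_def]) (auto intro: bounded_linear.linear bounded_linear_Re)

context charts
begin

lemma holomorphic_2form_scale:
  assumes \<sigma>: "holomorphic_2form X \<sigma>"
  shows "holomorphic_2form X (\<lambda>c z v w. k * \<sigma> c z v w)"
  unfolding holomorphic_2form_iff
proof (intro conjI ballI allI)
  fix c assume c: "c \<in> atlas X"
  have \<sigma>c: "(\<forall>z\<in>snd c ` fst c. bilinear (\<sigma> c z) \<and> (\<forall>v. \<sigma> c z v v = 0) \<and>
      (\<forall>v w. \<sigma> c z (\<i> *s v) w = \<i> * \<sigma> c z v w))" "(\<forall>v w. holo_fun (snd c ` fst c) (\<lambda>z. \<sigma> c z v w))"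
    using \<sigma> c unfolding holomorphic_2form_iff by blast+
  show "bilinear (\<lambda>v w. k * \<sigma> c z v w)" if "z \<in> snd c ` fst c" for z
  proof -
    have "bilinear (\<sigma> c z)" using \<sigma>c(1) that by blast
    then show ?thesis unfolding bilinear_def by (intro conjI allI linear_cmult) blast+
  qed
  show "k * \<sigma> c z v v = 0" if "z \<in> snd c ` fst c" for z v
  proof -
    have "\<sigma> c z v v = 0" using \<sigma>c(1) that by blast
    then show ?thesis by simp
  qed
  show "k * \<sigma> c z (\<i> *s v) w = \<i> * (k * \<sigma> c z v w)" if "z \<in> snd c ` fst c" for z v w
  proof -
    have "\<sigma> c z (\<i> *s v) w = \<i> * \<sigma> c z v w" using \<sigma>c(1) that by blast
    then show ?thesis by (simp only: mult.left_commute)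
  qed
  show "holo_fun (snd c ` fst c) (\<lambda>z. k * \<sigma> c z v w)" for v w
    unfolding holo_fun_def
  proof
    fix z assume "z \<in> snd c ` fst c"
    then obtain f' where f': "((\<lambda>z. \<sigma> c z v w) has_derivative f') (at z)" "\<forall>c v. f' (c *s v) = c * f' v"
      using \<sigma>c(2) unfolding holo_fun_def by blast
    show "\<exists>f'. ((\<lambda>z. k * \<sigma> c z v w) has_derivative f') (at z) \<and> (\<forall>c v. f' (c *s v) = c * f' v)"
      using has_derivative_mult_right[OF f'(1), of k] f'(2) by (intro exI[of _ "\<lambda>v. k * f' v"]) simp
  qed
next
  show "is_pullback X (\<lambda>x. x) (\<lambda>c z v w. k * \<sigma> c z v w) (\<lambda>c z v w. k * \<sigma> c z v w)"
    using \<sigma> unfolding holomorphic_2form_iff is_pullback_iff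
    by (intro ballI allI impI arg_cong2[where f = "(*)"] refl) blast
qed

lemma is_pullback_Re:
  assumes "is_pullback X f \<sigma> \<tau>"
  shows "is_pullback X f (\<lambda>c z v w. Re (\<sigma> c z v w)) (\<lambda>c z v w. Re (\<tau> c z v w))"
  using assms unfolding is_pullback_iff by (intro ballI allI impI arg_cong[where f = Re]) blast

lemma smooth_2form_Re:
  assumes \<sigma>: "holomorphic_2form X \<sigma>"
  shows "smooth_2form X (\<lambda>c z v w. Re (\<sigma> c z v w))"
proof (rule smooth_2formI)
  show "is_pullback X (\<lambda>x. x) (\<lambda>c z v w. Re (\<sigma> c z v w)) (\<lambda>c z v w. Re (\<sigma> c z v w))"
    using \<sigma> unfolding holomorphic_2form_def by (intro is_pullback_Re) blast
next
  fix c k v w assume c: "c \<in> atlas X"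
  then have "holo_fun (snd c ` fst c) (\<lambda>z. \<sigma> c z v w)" using \<sigma> unfolding holomorphic_2form_iff by blast
  then show "Ck_on k (snd c ` fst c) (\<lambda>z. Re (\<sigma> c z v w))"
    by (intro Ck_on_linear_comp[OF bounded_linear_Re] Ck_on_holo_fun chart_open[OF c])
next
  fix c z assume "c \<in> atlas X" "z \<in> snd c ` fst c"
  then have *: "bilinear (\<sigma> c z)" "\<And>v. \<sigma> c z v v = 0" using \<sigma> unfolding holomorphic_2form_iff by blast+
  show "bilinear (\<lambda>v w. Re (\<sigma> c z v w))" using *(1) unfolding bilinear_def by (intro conjI allI linear_Re) blast+
  show "Re (\<sigma> c z v v) = 0" for v using *(2) by simp
qed

end

lemma group_H2_lattice: "Group.group (H2_lattice X q)"
  and carrier_H2_lattice: "carrier (H2_lattice X q) = carrier (H2 (mtop X))"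
  and mult_H2_lattice: "A \<otimes>\<^bsub>H2_lattice X q\<^esub> B = A \<otimes>\<^bsub>H2 (mtop X)\<^esub> B"
  and form_H2_lattice: "form (H2_lattice X q) = q"
  and inv_H2_lattice: "inv\<^bsub>H2_lattice X q\<^esub> A = inv\<^bsub>H2 (mtop X)\<^esub> A"
proof -
  show c: "carrier (H2_lattice X q) = carrier (H2 (mtop X))"
    and m: "\<And>A B. A \<otimes>\<^bsub>H2_lattice X q\<^esub> B = A \<otimes>\<^bsub>H2 (mtop X)\<^esub> B"
    and "form (H2_lattice X q) = q"
    by (simp_all add: H2_lattice_def)
  have o: "\<one>\<^bsub>H2_lattice X q\<^esub> = \<one>\<^bsub>H2 (mtop X)\<^esub>"
    by (simp add: H2_lattice_def)
  show "inv\<^bsub>H2_lattice X q\<^esub> A = inv\<^bsub>H2 (mtop X)\<^esub> A" by (simp add: m_inv_def c m o)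
  interpret comm_group "H2 (mtop X)" by (rule comm_group_H2)
  show "Group.group (H2_lattice X q)"
    by (rule groupI) (auto simp: c m o m_assoc intro: l_inv_ex)
qed

text \<open>\<open>has_positive_class\<close> applies to every combination representing a form. It
  is used for the symmetrised combinations \<open>r + pulled_back r\<close> and
  \<open>s - pulled_back s\<close>, which \<open>sum_symmetrize\<close> rewrites in terms of the
  classes A + gA and A - gA.\<close>

theorem (in holomorphic_involution) isometry_and_positivity:
  assumes q: "BBF_form X q" and card: "CARD('m) = 2 * n" "0 < n"
    and \<omega>: "kaehler_form X \<omega>"
    and \<sigma>: "holomorphic_2form X \<sigma>" "nonzero_2form X \<sigma>"
    and anti: "is_pullback X f \<sigma> (\<lambda>c z v w. - \<sigma> c z v w)"
  shows "\<forall>A\<in>carrier H. \<forall>B\<in>carrier H. q (g A) (g B) = q A B"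
    and "\<exists>F r. finite F \<and> F \<subseteq> carrier H \<and> 0 < (\<Sum>A\<in>F. \<Sum>B\<in>F. r A * r B *
      real_of_int (q (A \<otimes>\<^bsub>H\<^esub> g A) (B \<otimes>\<^bsub>H\<^esub> g B)))"
    and "\<exists>F r1 r2. finite F \<and> F \<subseteq> carrier H \<and> (\<forall>a c. (a, c) \<noteq> (0, 0) \<longrightarrow>
      0 < (\<Sum>A\<in>F. \<Sum>B\<in>F. (a * r1 A + c * r2 A) * (a * r1 B + c * r2 B) *
        real_of_int (q (A \<otimes>\<^bsub>H\<^esub> inv\<^bsub>H\<^esub> g A) (B \<otimes>\<^bsub>H\<^esub> inv\<^bsub>H\<^esub> g B))))"
proof -
  interpret H: comm_group H by (rule comm_group_H2)
  have sym: "q A B = q B A" if "A \<in> carrier H" "B \<in> carrier H" for A B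
    using q that unfolding BBF_form_def by blast
  have addl: "q (A \<otimes>\<^bsub>H\<^esub> B) C = q A C + q B C"
    if "A \<in> carrier H" "B \<in> carrier H" "C \<in> carrier H" for A B C
    using q that unfolding BBF_form_def by blast
  have addr: "q C (A \<otimes>\<^bsub>H\<^esub> B) = q C A + q C B"
    if "A \<in> carrier H" "B \<in> carrier H" "C \<in> carrier H" for A B C
    using addl[OF that] sym that by simp
  have one: "q \<one>\<^bsub>H\<^esub> C = 0" if "C \<in> carrier H" for C
    using addl[OF H.one_closed H.one_closed that] by simp
  have invl: "q (inv\<^bsub>H\<^esub> A) C = - q A C" if "A \<in> carrier H" "C \<in> carrier H" for A C
    using addl[of "inv\<^bsub>H\<^esub> A" A C] one[of C] that by simp
  have invr: "q C (inv\<^bsub>H\<^esub> A) = - q C A" if "A \<in> carrier H" "C \<in> carrier H" for A C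
    using invl[OF that] sym that by simp
  \<comment> \<open>Sums are taken over a finite set that contains the support and is stable under
    g, so that they can be reindexed along g.\<close>
  have stable: "\<exists>F. finite F \<and> F \<subseteq> carrier H \<and> (\<forall>A\<in>F. g A \<in> F) \<and> E \<subseteq> F"
    if E: "finite E" "E \<subseteq> carrier H" for E
  proof (intro exI[of _ "E \<union> g ` E"] conjI ballI)
    fix A assume "A \<in> E \<union> g ` E"
    then show "g A \<in> E \<union> g ` E"
    proof
      assume "A \<in> g ` E"
      then obtain B where "A = g B" "B \<in> E" by blast
      then show ?thesis using pullback_involution(2)[of B] E(2) by auto
    qed simp
  next
    show "E \<union> g ` E \<subseteq> carrier H" using E(2) pullback_involution(1) by blast
  qed (use E(1) in auto)
  have kaehler_positive: "has_positive_class X q \<eta>" if "kaehler_form X \<eta>" for \<eta>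
    using q that unfolding BBF_form_def by blast
  have smooth: "smooth_2form X \<omega>" using \<omega> by (simp add: kaehler_form_def)
  define \<theta> where "\<theta> = pullback_form X f \<omega>"
  have \<theta>: "kaehler_form X \<theta>" unfolding \<theta>_def by (rule pullback_form_kaehler[OF involutive \<omega>])
  obtain r where r: "represents_form X \<omega> r" and r_pos: "0 < real_square q r"
    using kaehler_positive[OF \<omega>] unfolding has_positive_class_def by blast
  have r': "represents_form X \<theta> (pulled_back r)"
    unfolding \<theta>_def
    by (rule represents_form_pullback[OF r is_pullback_pullback_form[OF smooth_2form_pullback_id[OF smooth]]])
  have "finite {A. r A \<noteq> 0}" "{A. r A \<noteq> 0} \<subseteq> carrier H" using r by (auto simp: represents_form_def)
  from stable[OF this] obtain F where F: "finite F" "F \<subseteq> carrier H" "\<And>A. A \<in> F \<Longrightarrow> g A \<in> F" "{A. r A \<noteq> 0} \<subseteq> F"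
    by blast
  have gF: "g (g A) = A" if "A \<in> F" for A using pullback_involution(2) F(2) that by blast
  have "real_square q (pulled_back r) = (\<Sum>A\<in>F. \<Sum>B\<in>F. r (g A) * r (g B) * of_int (q A B))"
    using symmetric_square[OF F, of q 0 1] by simp
  also have "\<dots> = (\<Sum>A\<in>F. \<Sum>B\<in>F. r A * r B * of_int (q (g A) (g B)))"
  proof -
    have bij: "bij_betw g F F" by (rule bij_betwI[of g F F g]) (use F(3) gF in auto)
    have "(\<Sum>A\<in>F. \<Sum>B\<in>F. r A * r B * real_of_int (q (g A) (g B))) =
        (\<Sum>A\<in>F. \<Sum>B\<in>F. r (g A) * r (g B) * of_int (q (g (g A)) (g (g B))))"
      by (subst sum.reindex_bij_betw[OF bij, symmetric], rule sum.cong[OF refl])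
        (rule sum.reindex_bij_betw[OF bij, symmetric])
    also have "\<dots> = (\<Sum>A\<in>F. \<Sum>B\<in>F. r (g A) * r (g B) * of_int (q A B))"
      by (intro sum.cong refl) (simp add: gF)
    finally show ?thesis by (rule HOL.sym)
  qed
  finally have square': "real_square q (pulled_back r) = (\<Sum>A\<in>F. \<Sum>B\<in>F. r A * r B * of_int (q (g A) (g B)))" .
  have "\<not> (\<forall>A\<in>carrier H. \<forall>B\<in>carrier H. q (g A) (g B) = - q A B)"
  proof
    assume neg: "\<forall>A\<in>carrier H. \<forall>B\<in>carrier H. q (g A) (g B) = - q A B"
    have "real_square q (pulled_back r) = (\<Sum>A\<in>F. \<Sum>B\<in>F. - (r A * r B * of_int (q A B)))"
      unfolding square'
    proof (intro sum.cong refl)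
      fix A B assume "A \<in> F" "B \<in> F"
      then have "q (g A) (g B) = - q A B" using neg F(2) by blast
      then show "r A * r B * real_of_int (q (g A) (g B)) = - (r A * r B * real_of_int (q A B))" by simp
    qed
    also have "\<dots> = - real_square q r" unfolding real_square_support[OF F(1,4)] by (simp add: sum_negf)
    finally have "real_square q (pulled_back r) < 0" using r_pos by simp
    moreover have "0 < real_square q (pulled_back r)"
      using kaehler_positive[OF \<theta>] r' unfolding has_positive_class_def by blast
    ultimately show False by simp
  qed
  moreover have "f (f x) = x" if "x \<in> topspace (mtop X)" for x using involutive that by (simp add: points_def)
  ultimately show iso: "\<forall>A\<in>carrier H. \<forall>B\<in>carrier H. q (g A) (g B) = q A B"
    using BBF_pullback_up_to_sign[OF q card continuous] by blast

  have sum_rep: "represents_form X (\<lambda>c z v w. 1 * \<omega> c z v w + 1 * \<theta> c z v w) (\<lambda>A. 1 * r A + 1 * pulled_back r A)"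
    using \<theta> by (intro represents_form_lincomb[OF smooth _ r r']) (simp add: kaehler_form_def)
  have "has_positive_class X q (\<lambda>c z v w. 1 * \<omega> c z v w + 1 * \<theta> c z v w)"
    using kaehler_positive[OF kaehler_form_add[OF \<omega> \<theta>]] by simp
  with sum_rep have "0 < real_square q (\<lambda>A. 1 * r A + 1 * pulled_back r A)"
    unfolding has_positive_class_def by blast
  also have "\<dots> = (\<Sum>A\<in>F. \<Sum>B\<in>F. (r A + 1 * r (g A)) * (r B + 1 * r (g B)) * of_int (q A B))"
    using symmetric_square[OF F, of q 1 1] by simp
  also have "\<dots> = (\<Sum>A\<in>F. \<Sum>B\<in>F. r A * r B * (of_int (q A B) + 1 * of_int (q A (g B)) +
      1 * of_int (q (g A) B) + 1 * 1 * of_int (q (g A) (g B))))"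
    using F(3) gF by (rule sum_symmetrize)
  also have "\<dots> = (\<Sum>A\<in>F. \<Sum>B\<in>F. r A * r B * real_of_int (q (A \<otimes>\<^bsub>H\<^esub> g A) (B \<otimes>\<^bsub>H\<^esub> g B)))"
  proof (intro sum.cong refl)
    fix A B assume "A \<in> F" "B \<in> F"
    then have "A \<in> carrier H" "g A \<in> carrier H" "B \<in> carrier H" "g B \<in> carrier H" using F(2,3) by blast+
    then show "r A * r B * (of_int (q A B) + 1 * of_int (q A (g B)) + 1 * of_int (q (g A) B) +
        1 * 1 * of_int (q (g A) (g B))) = r A * r B * real_of_int (q (A \<otimes>\<^bsub>H\<^esub> g A) (B \<otimes>\<^bsub>H\<^esub> g B))"
      by (simp add: addl addr)
  qed
  finally show "\<exists>F r. finite F \<and> F \<subseteq> carrier H \<and> 0 < (\<Sum>A\<in>F. \<Sum>B\<in>F. r A * r B *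
      real_of_int (q (A \<otimes>\<^bsub>H\<^esub> g A) (B \<otimes>\<^bsub>H\<^esub> g B)))"
    using F(1,2) by blast

  \<comment> \<open>The real parts of the multiples of sigma. For k = a + ic the form
    \<open>\<rho> k\<close> is a \<open>\<rho> 1\<close> + c \<open>\<rho> \<i>\<close>, so two
    classes r1, r2 describe the whole plane.\<close>
  define \<rho> where "\<rho> k = (\<lambda>c z v w. Re (k * \<sigma> c z v w))" for k
  have scaled: "holomorphic_2form X (\<lambda>c z v w. k * \<sigma> c z v w)" for k
    by (rule holomorphic_2form_scale[OF \<sigma>(1)])
  have \<rho>_smooth: "smooth_2form X (\<rho> k)" for k
    unfolding \<rho>_def by (rule smooth_2form_Re[OF scaled])
  have \<rho>_positive: "has_positive_class X q (\<rho> k)" if "k \<noteq> 0" for k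
  proof -
    have "nonzero_2form X (\<lambda>c z v w. k * \<sigma> c z v w)"
      using \<sigma>(2) that unfolding nonzero_2form_def by auto
    then show ?thesis unfolding \<rho>_def using q scaled[of k] unfolding BBF_form_def by blast
  qed
  have \<rho>_pullback: "is_pullback X f (\<rho> k) (\<rho> (- k))" for k
  proof -
    have "is_pullback X f (\<lambda>c z v w. k * \<sigma> c z v w) (\<lambda>c z v w. - k * \<sigma> c z v w)"
      unfolding is_pullback_iff
    proof (intro ballI allI impI)
      fix c d x v w assume "c \<in> atlas X" "d \<in> atlas X" "x \<in> fst c" "f x \<in> fst d"
      then have "- \<sigma> c (snd c x) v w = \<sigma> d (snd d (f x)) (frechet_derivative (transition f c d) (at (snd c x)) v)
          (frechet_derivative (transition f c d) (at (snd c x)) w)"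
        using anti unfolding is_pullback_iff by blast
      then show "- k * \<sigma> c (snd c x) v w = k * \<sigma> d (snd d (f x))
          (frechet_derivative (transition f c d) (at (snd c x)) v)
          (frechet_derivative (transition f c d) (at (snd c x)) w)"
        by (metis mult_minus_left mult_minus_right)
    qed
    then show ?thesis unfolding \<rho>_def by (rule is_pullback_Re)
  qed
  obtain r1 r2 where r12: "represents_form X (\<rho> 1) r1" "represents_form X (\<rho> \<i>) r2"
    using \<rho>_positive[of 1] \<rho>_positive[of \<i>] unfolding has_positive_class_def by auto
  have "finite ({A. r1 A \<noteq> 0} \<union> {A. r2 A \<noteq> 0})" "{A. r1 A \<noteq> 0} \<union> {A. r2 A \<noteq> 0} \<subseteq> carrier H"
    using r12 by (auto simp: represents_form_def)
  from stable[OF this] obtain F' where F': "finite F'" "F' \<subseteq> carrier H" "\<And>A. A \<in> F' \<Longrightarrow> g A \<in> F'"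
    "{A. r1 A \<noteq> 0} \<union> {A. r2 A \<noteq> 0} \<subseteq> F'"
    by blast
  have gF': "g (g A) = A" if "A \<in> F'" for A using pullback_involution(2) F'(2) that by blast
  have pos: "0 < (\<Sum>A\<in>F'. \<Sum>B\<in>F'. (a * r1 A + c * r2 A) * (a * r1 B + c * r2 B) *
        real_of_int (q (A \<otimes>\<^bsub>H\<^esub> inv\<^bsub>H\<^esub> g A) (B \<otimes>\<^bsub>H\<^esub> inv\<^bsub>H\<^esub> g B)))"
    if ac: "(a, c) \<noteq> (0, 0)" for a c
  proof -
    define k where "k = Complex a c"
    define s where "s A = a * r1 A + c * r2 A" for A
    have "2 * k \<noteq> 0" using ac by (simp add: k_def complex_eq_iff)
    have "(\<lambda>ch z v w. a * \<rho> 1 ch z v w + c * \<rho> \<i> ch z v w) = \<rho> k"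
      by (simp add: \<rho>_def k_def fun_eq_iff)
    with represents_form_lincomb[OF \<rho>_smooth \<rho>_smooth r12, of a c]
    have s: "represents_form X (\<rho> k) s" unfolding s_def[abs_def] by simp
    \<comment> \<open>The pullback of \<open>\<rho> k\<close> is \<open>\<rho> (- k)\<close>. So
      antisymmetrising gives \<open>\<rho> (2 * k)\<close>, again the real part of a nonzero
      multiple of sigma and therefore positive.\<close>
    have "(\<lambda>ch z v w. 1 * \<rho> k ch z v w + - 1 * \<rho> (- k) ch z v w) = \<rho> (2 * k)"
      by (simp add: \<rho>_def fun_eq_iff algebra_simps)
    with represents_form_lincomb[OF \<rho>_smooth \<rho>_smooth s represents_form_pullback[OF s \<rho>_pullback], of 1 "- 1"]
    have "represents_form X (\<rho> (2 * k)) (\<lambda>A. 1 * s A + - 1 * pulled_back s A)" by (simp only:)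
    then have "0 < real_square q (\<lambda>A. 1 * s A + - 1 * pulled_back s A)"
      using \<rho>_positive[OF \<open>2 * k \<noteq> 0\<close>] unfolding has_positive_class_def by blast
    also have "\<dots> = (\<Sum>A\<in>F'. \<Sum>B\<in>F'. (s A + - 1 * s (g A)) * (s B + - 1 * s (g B)) * of_int (q A B))"
    proof -
      have "r1 A = 0" "r2 A = 0" if "A \<notin> F'" for A using F'(4) that by auto
      then have "s A = 0" if "A \<notin> F'" for A using that by (simp add: s_def)
      then have "{A. s A \<noteq> 0} \<subseteq> F'" by blast
      from symmetric_square[OF F'(1-3) this, of q 1 "- 1"] show ?thesis by simp
    qed
    also have "\<dots> = (\<Sum>A\<in>F'. \<Sum>B\<in>F'. s A * s B * (of_int (q A B) + - 1 * of_int (q A (g B)) +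
        - 1 * of_int (q (g A) B) + - 1 * - 1 * of_int (q (g A) (g B))))"
      using F'(3) gF' by (rule sum_symmetrize)
    also have "\<dots> = (\<Sum>A\<in>F'. \<Sum>B\<in>F'. s A * s B *
        real_of_int (q (A \<otimes>\<^bsub>H\<^esub> inv\<^bsub>H\<^esub> g A) (B \<otimes>\<^bsub>H\<^esub> inv\<^bsub>H\<^esub> g B)))"
    proof (intro sum.cong refl)
      fix A B assume "A \<in> F'" "B \<in> F'"
      then have "A \<in> carrier H" "g A \<in> carrier H" "B \<in> carrier H" "g B \<in> carrier H" using F'(2,3) by blast+
      then show "s A * s B * (of_int (q A B) + - 1 * of_int (q A (g B)) + - 1 * of_int (q (g A) B) +
          - 1 * - 1 * of_int (q (g A) (g B))) =
          s A * s B * real_of_int (q (A \<otimes>\<^bsub>H\<^esub> inv\<^bsub>H\<^esub> g A) (B \<otimes>\<^bsub>H\<^esub> inv\<^bsub>H\<^esub> g B))"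
        by (simp add: addl addr invl invr)
    qed
    finally show ?thesis unfolding s_def .
  qed
  show "\<exists>F r1 r2. finite F \<and> F \<subseteq> carrier H \<and> (\<forall>a c. (a, c) \<noteq> (0, 0) \<longrightarrow>
      0 < (\<Sum>A\<in>F. \<Sum>B\<in>F. (a * r1 A + c * r2 A) * (a * r1 B + c * r2 B) *
        real_of_int (q (A \<otimes>\<^bsub>H\<^esub> inv\<^bsub>H\<^esub> g A) (B \<otimes>\<^bsub>H\<^esub> inv\<^bsub>H\<^esub> g B))))"
    by (intro exI[of _ F'] exI[of _ r1] exI[of _ r2] conjI allI impI F'(1,2) pos)
qed

lemma (in charts) nondegenerate_2form_nonzero:
  assumes "points X \<noteq> {}" "nondegenerate_2form X \<sigma>"
  shows "nonzero_2form X \<sigma>"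
proof -
  obtain x where "x \<in> points X" using assms(1) by blast
  then obtain c where c: "c \<in> atlas X" "x \<in> fst c" using chart_at[OF complex_manifold] by blast
  \<comment> \<open>Some nonzero tangent vector: the index type has an element, so the dimension is
    positive.\<close>
  have "axis undefined 1 \<noteq> (0 :: complex^'m)" by (simp add: axis_eq_0_iff)
  then obtain w where "\<sigma> c (snd c x) (axis undefined 1) w \<noteq> 0"
    using assms(2) c unfolding nondegenerate_2form_def by fastforce
  moreover have "snd c x \<in> snd c ` fst c" using c(2) by (rule imageI)
  ultimately show ?thesis using c(1) unfolding nonzero_2form_def split_beta prod.collapse by blast
qed

theorem proposition3p4:
  fixes X :: "('a, 'm::finite) cmanifold"
    and i :: "'a \<Rightarrow> 'a"
    and n :: nat
    and q :: "'a cohomology_class \<Rightarrow> 'a cohomology_class \<Rightarrow> int"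
    and L T S :: "'a cohomology_class int_lattice"
  assumes n: "2 \<le> n" "n \<le> 5"
    and X: "K3n_type n X"
    and q: "BBF_form X q"
    and L: "L = H2_lattice X q"
    and L_iso: "isometric L (K3n_lattice n)"
    and i: "non_symplectic_involution X i"
    and T: "T = invariant_lattice L (H2_pullback (mtop X) i)"
    and S: "S = orthogonal_lattice L T"
    and rank_T: "has_rank T 2"
    and disc: "acts_as_minus_id_on_discriminant L (H2_pullback (mtop X) i)"
  shows
    "(isometric T (gram_lattice U_gram) \<and>
      isometric S (gram_lattice (diag_block_mat
        [U_gram, U_gram, E8_gram, E8_gram, rank1_gram (- 2 * (int n - 1))])))
   \<or> (isometric T (gram_lattice U2_gram) \<and>
      isometric S (gram_lattice (diag_block_mat
        [U_gram, U2_gram, E8_gram, E8_gram, rank1_gram (- 2 * (int n - 1))])))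
   \<or> (isometric T (gram_lattice (diag_block_mat [rank1_gram 2, rank1_gram (- 2)])) \<and>
      isometric S (gram_lattice (diag_block_mat
        [U_gram, E8_gram, E8_gram, rank1_gram 2, rank1_gram (- 2), rank1_gram (- 2 * (int n - 1))])))
   \<or> (n \<in> {3, 5} \<and>
      isometric T (gram_lattice U2_gram) \<and>
      isometric S (gram_lattice (diag_block_mat
        [U_gram, U_gram, E8_gram, E8_gram, rank1_gram (- 2 * (int n - 1))])))
   \<or> (n \<in> {2, 4} \<and>
      isometric T (gram_lattice (diag_block_mat [rank1_gram 2, rank1_gram (- 2)])) \<and>
      isometric S (gram_lattice (diag_block_mat
        [U_gram, U_gram, E8_gram, E8_gram, rank1_gram (- 2 * (int n - 1))])))
   \<or> (n = 5 \<and>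
      isometric T (gram_lattice (diag_block_mat [rank1_gram 2, rank1_gram (- 2)])) \<and>
      isometric S (gram_lattice (diag_block_mat
        [U_gram, E8_gram, E8_gram,
         mat_of_rows_list 3 [[- 2, 1, 0], [1, - 2, 1], [0, 1, 2]]])))"
proof -
  let ?H = "H2 (mtop X)" and ?g = "H2_pullback (mtop X) i"
  have card: "CARD('m) = 2 * n" and ihs: "IHS_manifold X" using X by (simp_all add: K3n_type_def)
  have manifold: "complex_manifold X" and points: "points X \<noteq> {}"
    using ihs by (simp_all add: IHS_manifold_def simply_connected_space_def points_def)
  obtain \<omega> where \<omega>: "kaehler_form X \<omega>" using ihs unfolding IHS_manifold_def by blast
  obtain \<sigma> where \<sigma>: "holomorphic_2form X \<sigma>" "nondegenerate_2form X \<sigma>"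
    using ihs unfolding IHS_manifold_def by blast
  have holo: "holo_between X X i" and inv: "\<And>x. x \<in> points X \<Longrightarrow> i (i x) = x"
    and anti: "is_pullback X i \<sigma> (\<lambda>c z v w. - \<sigma> c z v w)"
    using i \<sigma>(1)
    unfolding non_symplectic_involution_def automorphism_def biholomorphic_map_def non_symplectic_def
    by blast+
  interpret holomorphic_involution X i
    by unfold_locales (fact manifold holo inv)+
  have "0 < n" using n(1) by simp
  note geometry = isometry_and_positivity[OF q card this \<omega> \<sigma>(1) nondegenerate_2form_nonzero[OF points \<sigma>(2)] anti]
  obtain F r where F: "finite F \<and> F \<subseteq> carrier ?H \<and> 0 < (\<Sum>A\<in>F. \<Sum>B\<in>F. r A * r B *
      real_of_int (q (A \<otimes>\<^bsub>?H\<^esub> ?g A) (B \<otimes>\<^bsub>?H\<^esub> ?g B)))"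
    using geometry(2) by (elim exE) (rule that)
  obtain F' r1 r2 where F': "finite F' \<and> F' \<subseteq> carrier ?H \<and> (\<forall>a c. (a, c) \<noteq> (0, 0) \<longrightarrow>
      0 < (\<Sum>A\<in>F'. \<Sum>B\<in>F'. (a * r1 A + c * r2 A) * (a * r1 B + c * r2 B) *
        real_of_int (q (A \<otimes>\<^bsub>?H\<^esub> inv\<^bsub>?H\<^esub> ?g A) (B \<otimes>\<^bsub>?H\<^esub> inv\<^bsub>?H\<^esub> ?g B))))"
    using geometry(3) by (elim exE) (rule that)
  note H2_lattice = carrier_H2_lattice mult_H2_lattice form_H2_lattice inv_H2_lattice
  show ?thesis
  proof (rule lattice_involution_classification[OF n _ L_iso _ _ _ _ T S rank_T disc])
    show "Group.group L" unfolding L by (rule group_H2_lattice)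
    fix x assume "x \<in> carrier L"
    then have x: "x \<in> carrier ?H" unfolding L H2_lattice .
    show "?g x \<in> carrier L" unfolding L H2_lattice by (rule pullback_involution(1)[OF x])
    show "?g (?g x) = x" by (rule pullback_involution(2)[OF x])
    fix y assume "y \<in> carrier L"
    then have y: "y \<in> carrier ?H" unfolding L H2_lattice .
    show "?g (x \<otimes>\<^bsub>L\<^esub> y) = ?g x \<otimes>\<^bsub>L\<^esub> ?g y" unfolding L H2_lattice by (rule pullback_involution(3)[OF x y])
    show "form L (?g x) (?g y) = form L x y"
      unfolding L H2_lattice by (rule bspec[OF bspec[OF geometry(1) x] y])
  next
    show "finite F" using F by (rule conjunct1)
    show "F \<subseteq> carrier L" unfolding L H2_lattice by (rule F[THEN conjunct2, THEN conjunct1])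
    show "finite F'" using F' by (rule conjunct1)
    show "F' \<subseteq> carrier L" unfolding L H2_lattice by (rule F'[THEN conjunct2, THEN conjunct1])
    show "0 < (\<Sum>A\<in>F. \<Sum>B\<in>F. r A * r B * real_of_int (form L (A \<otimes>\<^bsub>L\<^esub> ?g A) (B \<otimes>\<^bsub>L\<^esub> ?g B)))"
      unfolding L H2_lattice by (rule F[THEN conjunct2, THEN conjunct2])
    show "0 < (\<Sum>A\<in>F'. \<Sum>B\<in>F'. (a * r1 A + c * r2 A) * (a * r1 B + c * r2 B) *
        real_of_int (form L (A \<otimes>\<^bsub>L\<^esub> inv\<^bsub>L\<^esub> ?g A) (B \<otimes>\<^bsub>L\<^esub> inv\<^bsub>L\<^esub> ?g B)))"
      if "(a, c) \<noteq> (0, 0)" for a c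
      using F'[THEN conjunct2, THEN conjunct2, rule_format, OF that] unfolding L H2_lattice .
  qed
qed

end
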